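(* For every $m \geq 2$, every $m$-decorated graph $(G, \Phi, \Gamma)$ is Reeb realizable.
   Context: Smooth means of class $C^\infty$; $\cong$ denotes diffeomorphism. A manifold is closed if it is compact and has no boundary (not assumed connected unless stated). A graph means a finite multigraph (multi-edges allowed), regarded as a topological space as a compact CW complex of dimension at most $1$. Here $G$ is a graph without loops. Reeb space: for a continuous map $f : X \to Y$ and $x_0, x_1 \in X$, write $x_0 \sim x_1$ if $f(x_0) = f(x_1)$ and $x_0, x_1$ lie on the same connected component of $f^{-1}(f(x_0))$. The Reeb space $W_f = X/\!\sim$ carries the quotient topology, and $q_f : X \to W_f$ is the quotient map. For a smooth function $f$ with finitely many critical values on a closed manifold of dimension $m \geq 2$, $W_f$ has the structure of a graph whose vertices are exactly the $q_f$-images of the connected components of level sets of $f$ that contain critical points. That $G$ is identified with $W_f$ means that there is a homeomorphism $G \to W_f$ carrying vertices to vertices and edges to edges. $m$-decorated graph ($m \geq 2$): a triple $(G, \Phi, \Gamma)$, where $G$ is a graph without loops, $\Phi$ is a map assigning to each edge of $G$ a diffeomorphism type of closed connected $(m-1)$-dimensional manifolds, and $\Gamma$ is a map assigning to each vertex of $G$ a diffeomorphism type of compact connected $m$-dimensional manifolds (possibly with boundary), such that for each vertex $v$ of $G$, $$\partial(\Gamma(v)) \cong \bigsqcup_{v \in e} \Phi(e),$$ i.e. the boundary of $\Gamma(v)$ is diffeomorphic to the disjoint union of the finitely many manifolds $\Phi(e)$, where $e$ runs over all edges incident to $v$. Reeb realizable: an $m$-decorated graph $(G, \Phi, \Gamma)$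 is Reeb realizable if there exists a smooth function $f : M \to \mathbb{R}$ on a closed $m$-dimensional manifold $M$ with finitely many critical values such that (1) $G$ is identified with the Reeb space $W_f$; (2) for each edge $e$ of $G = W_f$, $q_f^{-1}(x) \cong \Phi(e)$ for all $x$ in the interior of $e$; (3) for each vertex $v$ of $G = W_f$, $q_f^{-1}(N(v)) \cong \Gamma(v)$, where $N(v)$ is a small (closed) regular neighborhood of $v$ in $G$. *)

theory Defs
  imports "HOL-Analysis.Analysis"
begin

section \<open>Smooth functions on subsets of Euclidean space\<close>

text \<open>
  The space \<open>\<real>\<^sup>n\<close> is the library's \<^const>\<open>Euclidean_space\<close> \<open>n\<close>, whose points are the
  functions on \<open>nat\<close> that vanish from \<open>n\<close> on. Thus \<open>\<real>\<^sup>k\<close> is literally the subspace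
  of \<open>\<real>\<^sup>n\<close> on which the last \<open>n - k\<close> coordinates are zero.
\<close>

definition partial :: "nat \<Rightarrow> ((nat \<Rightarrow> real) \<Rightarrow> real) \<Rightarrow> (nat \<Rightarrow> real) \<Rightarrow> real" where
  "partial i F x = deriv (\<lambda>t. F (x(i := t))) (x i)"

definition partials :: "nat list \<Rightarrow> ((nat \<Rightarrow> real) \<Rightarrow> real) \<Rightarrow> (nat \<Rightarrow> real) \<Rightarrow> real" where
  "partials is F = foldr partial is F"

text \<open>Class \<open>C\<^sup>\<infinity>\<close> on an open set: all iterated partial derivatives exist and are continuous.\<close>

definition smooth_on_open :: "nat \<Rightarrow> (nat \<Rightarrow> real) set \<Rightarrow> ((nat \<Rightarrow> real) \<Rightarrow> real) \<Rightarrow> bool" where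
  "smooth_on_open n W F \<longleftrightarrow>
     openin (Euclidean_space n) W \<and>
     (\<forall>is. set is \<subseteq> {..<n} \<longrightarrow>
        continuous_map (subtopology (Euclidean_space n) W) euclideanreal (partials is F) \<and>
        (\<forall>i<n. \<forall>x\<in>W. (\<lambda>t. partials is F (x(i := t))) differentiable at (x i)))"

text \<open>On an arbitrary subset, smoothness means the existence of local smooth extensions.\<close>

definition smooth_on :: "nat \<Rightarrow> (nat \<Rightarrow> real) set \<Rightarrow> ((nat \<Rightarrow> real) \<Rightarrow> real) \<Rightarrow> bool" where
  "smooth_on n S F \<longleftrightarrow>
     (\<forall>x\<in>S. \<exists>W F'. x \<in> W \<and> smooth_on_open n W F' \<and> (\<forall>y\<in>W \<inter> S. F' y = F y))"

definition smooth_map_on ::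
    "nat \<Rightarrow> nat \<Rightarrow> (nat \<Rightarrow> real) set \<Rightarrow> ((nat \<Rightarrow> real) \<Rightarrow> (nat \<Rightarrow> real)) \<Rightarrow> bool" where
  "smooth_map_on n k S g \<longleftrightarrow> (\<forall>j<k. smooth_on n S (\<lambda>x. g x j))"


section \<open>Smooth manifolds, possibly with boundary\<close>

text \<open>For \<open>n > 0\<close>, the half space is cut out by the last coordinate, so that its boundary
  hyperplane is literally \<open>\<real>\<^sup>n\<^sup>-\<^sup>1\<close>.\<close>

definition half_space :: "nat \<Rightarrow> (nat \<Rightarrow> real) topology" where
  "half_space n = subtopology (Euclidean_space n) {x. 0 \<le> x (n - 1)}"

type_synonym 'a chart = "'a set \<times> ('a \<Rightarrow> nat \<Rightarrow> real)"

record 'a mfd =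
  mtop :: "'a topology"
  atlas :: "'a chart set"

abbreviation points :: "'a mfd \<Rightarrow> 'a set" where
  "points M \<equiv> topspace (mtop M)"

definition is_chart :: "nat \<Rightarrow> 'a topology \<Rightarrow> 'a chart \<Rightarrow> bool" where
  "is_chart n X c \<longleftrightarrow> (case c of (U, \<phi>) \<Rightarrow>
     openin X U \<and>
     (openin (Euclidean_space n) (\<phi> ` U) \<or> openin (half_space n) (\<phi> ` U)) \<and>
     homeomorphic_map (subtopology X U) (subtopology (Euclidean_space n) (\<phi> ` U)) \<phi>)"

definition smooth_transition :: "nat \<Rightarrow> 'a chart \<Rightarrow> 'a chart \<Rightarrow> bool" where
  "smooth_transition n c d \<longleftrightarrow> (case c of (U, \<phi>) \<Rightarrow> case d of (V, \<psi>) \<Rightarrow>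
     smooth_map_on n n (\<phi> ` (U \<inter> V)) (\<psi> \<circ> inv_into U \<phi>))"

text \<open>The atlas need not be maximal; it determines the smooth structure.\<close>

definition smooth_manifold :: "nat \<Rightarrow> 'a mfd \<Rightarrow> bool" where
  "smooth_manifold n M \<longleftrightarrow>
     Hausdorff_space (mtop M) \<and> second_countable (mtop M) \<and>
     (\<forall>c\<in>atlas M. is_chart n (mtop M) c) \<and>
     \<Union> (fst ` atlas M) = points M \<and>
     (\<forall>c\<in>atlas M. \<forall>d\<in>atlas M. smooth_transition n c d)"

definition maximal_atlas :: "nat \<Rightarrow> 'a mfd \<Rightarrow> 'a chart set" where
  "maximal_atlas n M =
     {c. is_chart n (mtop M) c \<and>
         (\<forall>d\<in>atlas M. smooth_transition n c d \<and> smooth_transition n d c)}"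

definition boundary_points :: "nat \<Rightarrow> 'a mfd \<Rightarrow> 'a set" where
  "boundary_points n M =
     {p. 0 < n \<and> (\<exists>(U, \<phi>)\<in>atlas M. p \<in> U \<and> openin (half_space n) (\<phi> ` U) \<and> \<phi> p (n - 1) = 0)}"

text \<open>The boundary as an \<open>(n - 1)\<close>-dimensional manifold. A chart \<open>\<phi>\<close> into the half space maps
  boundary points into \<open>\<real>\<^sup>n\<^sup>-\<^sup>1\<close>, so it only has to be restricted (charts without boundary points
  restrict to empty charts).\<close>

definition boundary_mfd :: "nat \<Rightarrow> 'a mfd \<Rightarrow> 'a mfd" where
  "boundary_mfd n M =
     \<lparr> mtop = subtopology (mtop M) (boundary_points n M),
       atlas = (\<lambda>(U, \<phi>). (U \<inter> boundary_points n M, \<phi>)) ` atlas M \<rparr>"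

definition compact_manifold :: "nat \<Rightarrow> 'a mfd \<Rightarrow> bool" where
  "compact_manifold n M \<longleftrightarrow> smooth_manifold n M \<and> compact_space (mtop M)"

definition closed_manifold :: "nat \<Rightarrow> 'a mfd \<Rightarrow> bool" where
  "closed_manifold n M \<longleftrightarrow> compact_manifold n M \<and> boundary_points n M = {}"

text \<open>Connected manifolds are nonempty, whereas \<^const>\<open>connected_space\<close> admits the empty space.\<close>

definition connected_manifold :: "'a mfd \<Rightarrow> bool" where
  "connected_manifold M \<longleftrightarrow> connected_space (mtop M) \<and> points M \<noteq> {}"

definition disjoint_union_mfd :: "('i \<Rightarrow> 'a mfd) \<Rightarrow> 'i set \<Rightarrow> ('i \<times> 'a) mfd" where
  "disjoint_union_mfd M I =
     \<lparr> mtop = sum_topology (\<lambda>i. mtop (M i)) I,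
       atlas = (\<Union>i\<in>I. (\<lambda>(U, \<phi>). ({i} \<times> U, \<phi> \<circ> snd)) ` atlas (M i)) \<rparr>"

definition smooth_map :: "nat \<Rightarrow> nat \<Rightarrow> 'a mfd \<Rightarrow> 'b mfd \<Rightarrow> ('a \<Rightarrow> 'b) \<Rightarrow> bool" where
  "smooth_map n k M N g \<longleftrightarrow>
     continuous_map (mtop M) (mtop N) g \<and>
     (\<forall>(U, \<phi>)\<in>atlas M. \<forall>(V, \<psi>)\<in>atlas N.
        smooth_map_on n k (\<phi> ` {p \<in> U. g p \<in> V}) (\<psi> \<circ> g \<circ> inv_into U \<phi>))"

definition diffeomorphic :: "nat \<Rightarrow> 'a mfd \<Rightarrow> 'b mfd \<Rightarrow> bool" where
  "diffeomorphic n M N \<longleftrightarrow>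
     (\<exists>g g'. homeomorphic_maps (mtop M) (mtop N) g g' \<and>
             smooth_map n n M N g \<and> smooth_map n n N M g')"

definition smooth_function :: "nat \<Rightarrow> 'a mfd \<Rightarrow> ('a \<Rightarrow> real) \<Rightarrow> bool" where
  "smooth_function n M f \<longleftrightarrow> (\<forall>(U, \<phi>)\<in>atlas M. smooth_on n (\<phi> ` U) (f \<circ> inv_into U \<phi>))"

text \<open>Critical points are only used on manifolds without boundary, where chart images are open
  in \<open>\<real>\<^sup>n\<close> and hence the partial derivatives are meaningful.\<close>

definition critical_point :: "nat \<Rightarrow> 'a mfd \<Rightarrow> ('a \<Rightarrow> real) \<Rightarrow> 'a \<Rightarrow> bool" where
  "critical_point n M f p \<longleftrightarrow>
     (\<exists>(U, \<phi>)\<in>atlas M. p \<in> U \<and> (\<forall>i<n. partial i (f \<circ> inv_into U \<phi>) (\<phi> p) = 0))"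

definition critical_values :: "nat \<Rightarrow> 'a mfd \<Rightarrow> ('a \<Rightarrow> real) \<Rightarrow> real set" where
  "critical_values n M f = f ` {p. critical_point n M f p}"

text \<open>Slice charts: near its points, a \<open>k\<close>-dimensional submanifold \<open>S\<close> of an \<open>n\<close>-dimensional
  manifold without boundary looks like \<open>\<real>\<^sup>k\<close> or like a half space of \<open>\<real>\<^sup>k\<close> inside \<open>\<real>\<^sup>n\<close>. For
  \<open>k < n\<close> this describes level sets, for \<open>k = n\<close> domains with smooth boundary.\<close>

definition slice_charts :: "nat \<Rightarrow> nat \<Rightarrow> 'a mfd \<Rightarrow> 'a set \<Rightarrow> 'a chart set" where
  "slice_charts k n M S =
     {(U, \<phi>) \<in> maximal_atlas n M.
        openin (Euclidean_space n) (\<phi> ` U) \<and>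
        (\<phi> ` (U \<inter> S) = \<phi> ` U \<inter> topspace (Euclidean_space k) \<or>
         \<phi> ` (U \<inter> S) = \<phi> ` U \<inter> topspace (half_space k))}"

definition embedded_submanifold :: "nat \<Rightarrow> nat \<Rightarrow> 'a mfd \<Rightarrow> 'a set \<Rightarrow> bool" where
  "embedded_submanifold k n M S \<longleftrightarrow>
     k \<le> n \<and> S \<subseteq> points M \<and> S \<subseteq> \<Union> (fst ` slice_charts k n M S)"

definition submanifold :: "nat \<Rightarrow> nat \<Rightarrow> 'a mfd \<Rightarrow> 'a set \<Rightarrow> 'a mfd" where
  "submanifold k n M S =
     \<lparr> mtop = subtopology (mtop M) S,
       atlas = (\<lambda>(U, \<phi>). (U \<inter> S, \<phi>)) ` slice_charts k n M S \<rparr>"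

definition submanifold_diffeomorphic ::
    "nat \<Rightarrow> nat \<Rightarrow> 'a mfd \<Rightarrow> 'a set \<Rightarrow> 'b mfd \<Rightarrow> bool" where
  "submanifold_diffeomorphic k n M S N \<longleftrightarrow>
     embedded_submanifold k n M S \<and> diffeomorphic k (submanifold k n M S) N"


section \<open>Finite graphs as CW complexes\<close>

text \<open>A finite multigraph is a topological space with a finite set of vertices (the 0-cells) and
  a finite set of edges. An edge is represented by the corresponding open 1-cell, a subset of the
  space, so the points of an edge are the points of its interior.\<close>

record 'g graph =
  gtop :: "'g topology"
  verts :: "'g set"
  edges :: "'g set set"

definition characteristic_map :: "'g graph \<Rightarrow> 'g set \<Rightarrow> (real \<Rightarrow> 'g) \<Rightarrow> bool" where
  "characteristic_map G e \<gamma> \<longleftrightarrow>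
     continuous_map (top_of_set {0..1}) (gtop G) \<gamma> \<and>
     homeomorphic_map (top_of_set {0<..<1}) (subtopology (gtop G) e) \<gamma> \<and>
     \<gamma> 0 \<in> verts G \<and> \<gamma> 1 \<in> verts G"

definition finite_graph :: "'g graph \<Rightarrow> bool" where
  "finite_graph G \<longleftrightarrow>
     Hausdorff_space (gtop G) \<and>
     finite (verts G) \<and> verts G \<subseteq> topspace (gtop G) \<and>
     finite (edges G) \<and> pairwise disjnt (edges G) \<and>
     \<Union> (edges G) = topspace (gtop G) - verts G \<and>
     (\<forall>e\<in>edges G. \<exists>\<gamma>. characteristic_map G e \<gamma>)"

definition loopless :: "'g graph \<Rightarrow> bool" where
  "loopless G \<longleftrightarrow> (\<forall>e\<in>edges G. \<forall>\<gamma>. characteristic_map G e \<gamma> \<longrightarrow> \<gamma> 0 \<noteq> \<gamma> 1)"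

definition incident_edges :: "'g graph \<Rightarrow> 'g \<Rightarrow> 'g set set" where
  "incident_edges G v = {e \<in> edges G. \<exists>\<gamma>. characteristic_map G e \<gamma> \<and> (\<gamma> 0 = v \<or> \<gamma> 1 = v)}"

text \<open>Closed regular neighborhoods of a vertex of a loopless graph: the vertex together with an
  initial closed arc of each incident edge, the arc not reaching the other end of the edge.\<close>

definition regular_neighborhood :: "'g graph \<Rightarrow> 'g \<Rightarrow> 'g set \<Rightarrow> bool" where
  "regular_neighborhood G v N \<longleftrightarrow>
     v \<in> N \<and> N \<subseteq> insert v (\<Union> (incident_edges G v)) \<and>
     (\<forall>e\<in>incident_edges G v. \<exists>\<gamma> s. characteristic_map G e \<gamma> \<and> \<gamma> 0 = v \<and>
        0 < s \<and> s < 1 \<and> N \<inter> insert v e = \<gamma> ` {0..s})"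

definition graph_isomorphism :: "'g graph \<Rightarrow> 'h graph \<Rightarrow> ('g \<Rightarrow> 'h) \<Rightarrow> bool" where
  "graph_isomorphism G H h \<longleftrightarrow>
     homeomorphic_map (gtop G) (gtop H) h \<and>
     h ` verts G = verts H \<and> (`) h ` edges G = edges H"


section \<open>Reeb spaces\<close>

definition reeb_related :: "'a topology \<Rightarrow> ('a \<Rightarrow> 'y) \<Rightarrow> 'a \<Rightarrow> 'a \<Rightarrow> bool" where
  "reeb_related X f x y \<longleftrightarrow>
     x \<in> topspace X \<and> y \<in> topspace X \<and> f x = f y \<and>
     connected_component_of (subtopology X {z \<in> topspace X. f z = f x}) x y"

text \<open>A point of the Reeb space is an equivalence class, i.e. a connected component of a
  level set.\<close>

definition reeb_map :: "'a topology \<Rightarrow> ('a \<Rightarrow> 'y) \<Rightarrow> 'a \<Rightarrow> 'a set" where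
  "reeb_map X f x = {y. reeb_related X f x y}"

definition quotient_topology :: "'a topology \<Rightarrow> ('a \<Rightarrow> 'b) \<Rightarrow> 'b topology" where
  "quotient_topology X q =
     topology (\<lambda>U. U \<subseteq> q ` topspace X \<and> openin X {x \<in> topspace X. q x \<in> U})"

lemma openin_quotient_topology:
  "openin (quotient_topology X q) U \<longleftrightarrow>
     U \<subseteq> q ` topspace X \<and> openin X {x \<in> topspace X. q x \<in> U}"
proof -
  have 1: "{x \<in> topspace X. q x \<in> S \<inter> T} = {x \<in> topspace X. q x \<in> S} \<inter> {x \<in> topspace X. q x \<in> T}"
    for S T by auto
  have 2: "{x \<in> topspace X. q x \<in> \<Union>\<K>} = (\<Union>K\<in>\<K>. {x \<in> topspace X. q x \<in> K})" for \<K>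
    by auto
  have "istopology (\<lambda>U. U \<subseteq> q ` topspace X \<and> openin X {x \<in> topspace X. q x \<in> U})"
    unfolding istopology_def 1 2 by blast
  then show ?thesis
    by (simp add: quotient_topology_def)
qed

lemma topspace_quotient_topology [simp]: "topspace (quotient_topology X q) = q ` topspace X"
proof
  show "topspace (quotient_topology X q) \<subseteq> q ` topspace X"
    by (metis openin_quotient_topology openin_topspace)
  have "{x \<in> topspace X. q x \<in> q ` topspace X} = topspace X"
    by auto
  then have "openin (quotient_topology X q) (q ` topspace X)"
    by (simp add: openin_quotient_topology)
  then show "q ` topspace X \<subseteq> topspace (quotient_topology X q)"
    by (rule openin_subset)
qed

lemma quotient_map_quotient_topology: "quotient_map X (quotient_topology X q) q"
  by (simp add: quotient_map_def openin_quotient_topology)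

definition reeb_space :: "'a topology \<Rightarrow> ('a \<Rightarrow> 'y) \<Rightarrow> 'a set topology" where
  "reeb_space X f = quotient_topology X (reeb_map X f)"

text \<open>The graph structure of the Reeb space: the vertices are the components of level sets that
  contain critical points, and the open edges are the connected components of their complement.\<close>

definition reeb_verts :: "nat \<Rightarrow> 'a mfd \<Rightarrow> ('a \<Rightarrow> real) \<Rightarrow> 'a set set" where
  "reeb_verts m M f = {w \<in> topspace (reeb_space (mtop M) f). \<exists>p\<in>w. critical_point m M f p}"

definition reeb_graph :: "nat \<Rightarrow> 'a mfd \<Rightarrow> ('a \<Rightarrow> real) \<Rightarrow> 'a set graph" where
  "reeb_graph m M f =
     \<lparr> gtop = reeb_space (mtop M) f,
       verts = reeb_verts m M f,
       edges = connected_components_of (subtopology (reeb_space (mtop M) f)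
                 (topspace (reeb_space (mtop M) f) - reeb_verts m M f)) \<rparr>"

definition reeb_preimage :: "'a topology \<Rightarrow> ('a \<Rightarrow> 'y) \<Rightarrow> 'a set set \<Rightarrow> 'a set" where
  "reeb_preimage X f A = {p \<in> topspace X. reeb_map X f p \<in> A}"


section \<open>Decorated graphs and their realizations\<close>

text \<open>Diffeomorphism types are given by representatives; all conditions below are invariant under
  changing a representative by a diffeomorphism.\<close>

definition decorated_graph ::
    "nat \<Rightarrow> 'g graph \<Rightarrow> ('g set \<Rightarrow> 'a mfd) \<Rightarrow> ('g \<Rightarrow> 'b mfd) \<Rightarrow> bool" where
  "decorated_graph m G \<Phi> \<Gamma> \<longleftrightarrow>
     finite_graph G \<and> loopless G \<and>
     (\<forall>e\<in>edges G. closed_manifold (m - 1) (\<Phi> e) \<and> connected_manifold (\<Phi> e)) \<and>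
     (\<forall>v\<in>verts G. compact_manifold m (\<Gamma> v) \<and> connected_manifold (\<Gamma> v) \<and>
        diffeomorphic (m - 1) (boundary_mfd m (\<Gamma> v)) (disjoint_union_mfd \<Phi> (incident_edges G v)))"

text \<open>The realizing manifold lives on a subset of the type \<open>nat \<Rightarrow> real\<close>. This is no restriction,
  since by second countability every manifold has at most continuum many points and can be
  transported to such a subset.\<close>

definition reeb_realizable ::
    "nat \<Rightarrow> 'g graph \<Rightarrow> ('g set \<Rightarrow> 'a mfd) \<Rightarrow> ('g \<Rightarrow> 'b mfd) \<Rightarrow> bool" where
  "reeb_realizable m G \<Phi> \<Gamma> \<longleftrightarrow>
     (\<exists>(M :: (nat \<Rightarrow> real) mfd) f h.
        closed_manifold m M \<and> smooth_function m M f \<and> finite (critical_values m M f) \<and>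
        graph_isomorphism G (reeb_graph m M f) h \<and>
        (\<forall>e\<in>edges G. \<forall>x\<in>e.
           submanifold_diffeomorphic (m - 1) m M (reeb_preimage (mtop M) f {h x}) (\<Phi> e)) \<and>
        (\<forall>v\<in>verts G. \<forall>N. regular_neighborhood G v N \<longrightarrow>
           submanifold_diffeomorphic m m M (reeb_preimage (mtop M) f (h ` N)) (\<Gamma> v)))"

end

theory Submission
  imports Defs "HOL-Homology.Invariance_of_Domain" "HOL-Computational_Algebra.Polynomial"
begin

text \<open>
  The interiors of the manifolds \<open>\<Gamma> v\<close> are glued along collars of their boundaries: for an edge \<open>e\<close>
  from \<open>v\<close> to \<open>w\<close>, the collar \<open>\<Phi> e \<times> (0, 1)\<close> in \<open>\<Gamma> v\<close> is identified with the one in \<open>\<Gamma> w\<close> with the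
  second factor reversed. The result is a closed manifold with a projection to \<open>G\<close> that collapses the
  rest of each \<open>\<Gamma> v\<close> to \<open>v\<close> and maps each tube to its edge along the second factor. The fibres of this
  projection are connected.

  Choose distinct real numbers for the vertices. The height is constant on the part over each vertex, and
  along a tube it runs from one value to the other through a smooth step function that is flat at both
  ends and has no critical point in between. It factors through the projection, and every level
  consists of finitely many fibres. Hence the components of the levels are the fibres and the Reeb
  space is \<open>G\<close>. Morse theory is not needed, because every point over a vertex may be critical. The
  preimage of a regular neighborhood of \<open>v\<close> is \<open>\<Gamma> v\<close> with a thinner collar removed, and sliding along
  the collars identifies it with \<open>\<Gamma> v\<close>.
\<close>

section \<open>Calculus on Euclidean space\<close>

text \<open>The main obstacle is the collar theorem for manifolds with boundary, where smoothness on
  a half space means having local smooth extensions. Instead of following an inward vector field,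
  the proof inverts the pair of a smooth retraction onto the boundary and a boundary defining
  function. In a chart this pair extends to a map that is the identity on the boundary hyperplane,
  so that its inversion rests on one nonzero partial derivative and on changes of single
  coordinates. Collars have length 2 although only the parameters in (0, 1) are glued. The value 1,
  where a tube meets the rest of \<open>\<Gamma> v\<close>, is then an inner parameter of the
  collar: formulas can be written across it, every core has interior points at which the height is
  locally constant, and slides can be the identity beyond it. Absence of loops puts the two ends of
  an edge into different pieces, so each piece embeds into the glued space. Smoothness is formulated
  on arbitrary subsets, so that boundaries, half-open collars and thinned pieces are treated within
  the charts of the surrounding manifold.\<close>

abbreviation ES :: "nat \<Rightarrow> (nat \<Rightarrow> real) set" where
  "ES n \<equiv> topspace (Euclidean_space n)"

lemma mem_ES: "x \<in> ES n \<longleftrightarrow> (\<forall>i\<ge>n. x i = 0)"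
  by (simp add: topspace_Euclidean_space)

lemma ES_mono: "k \<le> n \<Longrightarrow> x \<in> ES k \<Longrightarrow> x \<in> ES n"
  by (simp add: mem_ES)

lemma ES_upd: "x \<in> ES n \<Longrightarrow> i < n \<Longrightarrow> x(i := t) \<in> ES n"
  by (simp add: mem_ES)

lemma ES_eqI: "x \<in> ES n \<Longrightarrow> y \<in> ES n \<Longrightarrow> (\<And>i. i < n \<Longrightarrow> x i = y i) \<Longrightarrow> x = y"
  by (metis ext mem_ES not_le)

lemma Euclidean_space_eq_top_of_set: "Euclidean_space n = top_of_set {x. \<forall>i\<ge>n. x i = 0}"
  by (simp add: Euclidean_space_def euclidean_product_topology)

lemma subtopology_Euclidean_space:
  "W \<subseteq> ES n \<Longrightarrow> subtopology (Euclidean_space n) W = top_of_set W"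
  unfolding Euclidean_space_eq_top_of_set by (simp add: subtopology_subtopology Int_absorb1)

lemma openin_Euclidean_space: "openin (Euclidean_space n) W \<longleftrightarrow> (\<exists>T. open T \<and> W = ES n \<inter> T)"
  unfolding Euclidean_space_eq_top_of_set by (simp add: openin_open)

lemma continuous_map_subtopology_Euclidean_space:
  "W \<subseteq> ES n \<Longrightarrow> continuous_map (subtopology (Euclidean_space n) W) euclidean F \<longleftrightarrow> continuous_on W F"
  by (simp add: subtopology_Euclidean_space)

text \<open>Cubes serve as basic neighbourhoods because they are products: any mixture of the
  coordinates of two points of a cube lies in the cube, as changing the coordinates one at a time
  requires.\<close>

definition cube :: "nat \<Rightarrow> (nat \<Rightarrow> real) \<Rightarrow> real \<Rightarrow> (nat \<Rightarrow> real) set" where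
  "cube n x e = {y \<in> ES n. \<forall>i<n. \<bar>y i - x i\<bar> < e}"

lemma cube_mono: "d \<le> e \<Longrightarrow> cube n x d \<subseteq> cube n x e"
  by (fastforce simp: cube_def)

lemma continuous_on_coord [continuous_intros]: "continuous_on S (\<lambda>x :: nat \<Rightarrow> real. x i)"
  by (rule continuous_on_product_then_coordinatewise[OF continuous_on_id])

lemma openin_cube: "openin (Euclidean_space n) (cube n x e)"
proof -
  have 1: "open (\<Inter>i\<in>{..<n}. {y::nat\<Rightarrow>real. \<bar>y i - x i\<bar> < e})"
    by (intro open_INT finite_lessThan ballI open_Collect_less continuous_on_coord continuous_intros)
  have "cube n x e = ES n \<inter> (\<Inter>i\<in>{..<n}. {y. \<bar>y i - x i\<bar> < e})"
    by (auto simp: cube_def)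
  with 1 show ?thesis
    using openin_Euclidean_space by blast
qed

text \<open>A product-open set gives a radius for each coordinate. Points of \<open>ES n\<close>
  agree in the coordinates from \<open>n\<close> on, so the least of the first \<open>n\<close>
  radii is a common one.\<close>

lemma openin_Euclidean_space_cube:
  assumes "openin (Euclidean_space n) W" "x \<in> W"
  obtains e where "e > 0" "cube n x e \<subseteq> W"
proof -
  obtain T where T: "open T" "W = ES n \<inter> T"
    using assms openin_Euclidean_space by blast
  then have "openin (product_topology (\<lambda>i::nat. euclideanreal) UNIV) T"
    by (simp add: euclidean_product_topology)
  then obtain X where X: "x \<in> (\<Pi>\<^sub>E i\<in>UNIV. X i)" "\<And>i. open (X i)" "(\<Pi>\<^sub>E i\<in>UNIV. X i) \<subseteq> T"
    using product_topology_open_contains_basis[of "\<lambda>i. euclideanreal" UNIV T x] assms T by (auto)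
  have xX: "x i \<in> X i" for i using X(1) by auto
  have "\<exists>e>0. \<forall>t. \<bar>t - x i\<bar> < e \<longrightarrow> t \<in> X i" for i
    using X(2)[of i] xX[of i] unfolding open_dist dist_real_def by auto
  then obtain e where e: "\<And>i. e i > 0" "\<And>i t. \<bar>t - x i\<bar> < e i \<Longrightarrow> t \<in> X i" by metis
  \<comment> \<open>The inserted 1 keeps the set nonempty if \<open>n\<close> is 0.\<close>
  define d where "d = Min (insert 1 (e ` {..<n}))"
  have d: "d > 0" "\<And>i. i < n \<Longrightarrow> d \<le> e i"
    unfolding d_def using e(1) by (auto simp: Min_gr_iff)
  have "cube n x d \<subseteq> W"
  proof
    fix y assume y: "y \<in> cube n x d"
    have "y i \<in> X i" for i
    proof (cases "i < n")
      case True
      then show ?thesis using y d(2)[of i] e(2)[of "y i" i] by (force simp: cube_def)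
    next
      case False
      moreover have "x \<in> ES n" using assms T by auto
      ultimately have "y i = x i" using y by (simp add: cube_def mem_ES)
      then show ?thesis using xX by simp
    qed
    then have "y \<in> T" using X(3) by auto
    then show "y \<in> W" using T y by (auto simp: cube_def)
  qed
  with d(1) show ?thesis using that by blast
qed

lemma in_cube_self: "x \<in> ES n \<Longrightarrow> e > 0 \<Longrightarrow> x \<in> cube n x e"
  by (simp add: cube_def)

lemma continuous_on_cubeD:
  assumes "W \<subseteq> ES n" "continuous_on W (F :: _ \<Rightarrow> real)" "y \<in> W" "e > 0"
  obtains d where "d > 0" "\<And>z. z \<in> W \<Longrightarrow> z \<in> cube n y d \<Longrightarrow> \<bar>F z - F y\<bar> < e"
proof -
  have "openin (top_of_set W) (W \<inter> F -` {F y - e<..<F y + e})"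
    using assms(2) by (simp add: continuous_openin_preimage_gen)
  then obtain T where T: "open T" "W \<inter> F -` {F y - e<..<F y + e} = W \<inter> T"
    by (auto simp: openin_open)
  then have "openin (Euclidean_space n) (ES n \<inter> T)"
    using openin_Euclidean_space by blast
  moreover have "y \<in> ES n \<inter> T" using T assms by auto
  ultimately obtain d where d: "d > 0" "cube n y d \<subseteq> ES n \<inter> T"
    using openin_Euclidean_space_cube by blast
  have "\<bar>F z - F y\<bar> < e" if "z \<in> W" "z \<in> cube n y d" for z
  proof -
    have "z \<in> W \<inter> F -` {F y - e<..<F y + e}" using that d(2) T(2) by auto
    then show ?thesis by auto
  qed
  then show ?thesis using that d(1) by blast
qed

section \<open>Iterated partial derivatives and smoothness on open sets\<close>

lemma eventually_upd_in:
  assumes "openin (Euclidean_space n) W" "x \<in> W" "i < n"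
  shows "\<forall>\<^sub>F t in nhds (x i). x(i := t) \<in> W"
proof -
  obtain e where e: "e > 0" "cube n x e \<subseteq> W"
    using assms openin_Euclidean_space_cube by blast
  have "x \<in> ES n" using assms openin_subset by blast
  then have "x(i := t) \<in> W" if "dist t (x i) < e" for t
    using e that assms(3) by (auto simp: cube_def dist_real_def mem_ES subset_iff)
  then show ?thesis using e(1) unfolding eventually_nhds_metric by blast
qed

lemma partial_cong:
  assumes "openin (Euclidean_space n) W" "x \<in> W" "i < n" "\<And>y. y \<in> W \<Longrightarrow> F y = G y"
  shows "partial i F x = partial i G x"
  unfolding partial_def
  by (intro deriv_cong_ev eventually_mono[OF eventually_upd_in[OF assms(1-3)]]) (auto intro: assms)

lemma partials_cong:
  assumes "openin (Euclidean_space n) W" "\<And>y. y \<in> W \<Longrightarrow> F y = G y" "set is \<subseteq> {..<n}" "x \<in> W"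
  shows "partials is F x = partials is G x"
  using assms(3,4)
proof (induction "is" arbitrary: x)
  case (Cons i "is")
  then show ?case
    using partial_cong[OF assms(1), of x i "partials is F" "partials is G"]
    by (simp add: partials_def)
qed (simp add: partials_def assms)

text \<open>Coinduction: by induction on the list of indices, every iterated partial derivative of
  \<open>F\<close> agrees on \<open>W\<close> with a member of \<open>C\<close>. A smoothness proof
  thereby reduces to exhibiting a class of continuous functions that is closed under
  differentiation. Agreement on the open set \<open>W\<close> is enough, since partial derivatives
  at a point depend only on nearby values.\<close>

lemma smooth_on_open_coinduct:
  assumes W: "openin (Euclidean_space n) W" and "F \<in> C"
    and cont: "\<And>G. G \<in> C \<Longrightarrow> continuous_on W G"
    and der: "\<And>G i. G \<in> C \<Longrightarrow> i < n \<Longrightarrow> \<exists>G'\<in>C. \<forall>x\<in>W.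
       ((\<lambda>t. G (x(i := t))) has_real_derivative G' x) (at (x i))"
  shows "smooth_on_open n W F"
proof -
  have WE: "W \<subseteq> ES n" using W openin_subset by blast
  have *: "\<exists>G\<in>C. \<forall>x\<in>W. partials is F x = G x" if "set is \<subseteq> {..<n}" for "is"
    using that
  proof (induction "is")
    case Nil
    then show ?case using assms(2) by (auto simp: partials_def)
  next
    case (Cons i "is")
    then obtain G where G: "G \<in> C" "\<forall>x\<in>W. partials is F x = G x" by auto
    obtain G' where G': "G' \<in> C" "\<forall>x\<in>W. ((\<lambda>t. G (x(i := t))) has_real_derivative G' x) (at (x i))"
      using der[OF G(1), of i] Cons by auto
    have "partials (i # is) F x = G' x" if "x \<in> W" for x
    proof -
      have "partials (i # is) F x = partial i G x"
        using partial_cong[OF W that, of i "partials is F" G] Cons G by (simp add: partials_def)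
      then show ?thesis using G' that by (simp add: partial_def DERIV_imp_deriv)
    qed
    with G' show ?case by blast
  qed
  show ?thesis
    unfolding smooth_on_open_def
  proof (intro conjI W allI impI ballI)
    fix "is" assume "set is \<subseteq> {..<n}"
    then obtain G where G: "G \<in> C" "\<forall>x\<in>W. partials is F x = G x" using * by blast
    show "continuous_map (subtopology (Euclidean_space n) W) euclideanreal (partials is F)"
      using cont[OF G(1)] G(2) WE
      by (metis (no_types, lifting) continuous_map_subtopology_Euclidean_space continuous_on_cong)
    fix i x assume "i < n" "x \<in> W"
    then obtain D where "((\<lambda>t. G (x(i := t))) has_real_derivative D) (at (x i))"
      using der[OF G(1)] by blast
    then have "((\<lambda>t. partials is F (x(i := t))) has_real_derivative D) (at (x i))"
      using eventually_upd_in[OF W \<open>x \<in> W\<close> \<open>i < n\<close>] G(2)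
      by (subst DERIV_cong_ev[OF refl _ refl, where g = "\<lambda>t. G (x(i := t))"])
         (auto elim: eventually_mono)
    then show "(\<lambda>t. partials is F (x(i := t))) differentiable at (x i)"
      using real_differentiable_def by blast
  qed
qed

lemma smooth_on_openD:
  assumes "smooth_on_open n W F"
  shows smooth_on_open_imp_openin: "openin (Euclidean_space n) W"
    and smooth_on_open_imp_continuous: "continuous_on W F"
    and smooth_on_open_imp_partial: "i < n \<Longrightarrow> smooth_on_open n W (partial i F)"
    and smooth_on_open_imp_DERIV: "i < n \<Longrightarrow> x \<in> W \<Longrightarrow>
      ((\<lambda>t. F (x(i := t))) has_real_derivative partial i F x) (at (x i))"
proof -
  show W: "openin (Euclidean_space n) W" using assms by (simp add: smooth_on_open_def)
  have WE: "W \<subseteq> ES n" using W openin_subset by blast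
  have *: "\<And>is. set is \<subseteq> {..<n} \<Longrightarrow> continuous_map (subtopology (Euclidean_space n) W) euclideanreal (partials is F)"
    "\<And>is i x. set is \<subseteq> {..<n} \<Longrightarrow> i < n \<Longrightarrow> x \<in> W \<Longrightarrow> (\<lambda>t. partials is F (x(i := t))) differentiable at (x i)"
    using assms unfolding smooth_on_open_def by auto
  show "continuous_on W F"
    using *(1)[of "[]"] WE by (simp add: partials_def continuous_map_subtopology_Euclidean_space)
  show "((\<lambda>t. F (x(i := t))) has_real_derivative partial i F x) (at (x i))" if "i < n" "x \<in> W"
    using *(2)[of "[]" i x] that
    by (simp add: partials_def partial_def DERIV_deriv_iff_real_differentiable)
  show "smooth_on_open n W (partial i F)" if "i < n"
    unfolding smooth_on_open_def
  proof (intro conjI W allI impI ballI)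
    fix "is" assume "set is \<subseteq> {..<n}"
    \<comment> \<open>\<open>foldr\<close> differentiates first with respect to the last index of
      the list.\<close>
    have eq: "partials is (partial i F) = partials (is @ [i]) F"
      by (simp add: partials_def)
    show "continuous_map (subtopology (Euclidean_space n) W) euclideanreal (partials is (partial i F))"
      unfolding eq by (rule *) (use \<open>set is \<subseteq> {..<n}\<close> that in auto)
    show "(\<lambda>t. partials is (partial i F) (x(j := t))) differentiable at (x j)" if "j < n" "x \<in> W" for j x
      unfolding eq by (rule *) (use \<open>set is \<subseteq> {..<n}\<close> that \<open>i < n\<close> in auto)
  qed
qed

lemma smooth_on_open_subset:
  assumes "smooth_on_open n W F" "openin (Euclidean_space n) V" "V \<subseteq> W"
  shows "smooth_on_open n V F"
proof (rule smooth_on_open_coinduct[where C = "{F. smooth_on_open n W F}"])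
  fix F i assume F: "F \<in> {F. smooth_on_open n W F}"
  then show "continuous_on V F"
    using assms(3) continuous_on_subset smooth_on_open_imp_continuous by blast
  assume "i < n"
  then show "\<exists>G'\<in>{F. smooth_on_open n W F}. \<forall>x\<in>V. ((\<lambda>t. F (x(i := t))) has_real_derivative G' x) (at (x i))"
    using F assms(3)
    by (intro bexI[of _ "partial i F"]) (auto intro: smooth_on_open_imp_partial smooth_on_open_imp_DERIV)
qed (use assms in auto)

lemma smooth_on_open_const:
  assumes "openin (Euclidean_space n) W" shows "smooth_on_open n W (\<lambda>_. c)"
proof (rule smooth_on_open_coinduct[where C = "range (\<lambda>c _. c)", OF assms])
  fix G :: "(nat \<Rightarrow> real) \<Rightarrow> real" and i assume "G \<in> range (\<lambda>c _. c)"
  then show "\<exists>G'\<in>range (\<lambda>c _. c). \<forall>x\<in>W. ((\<lambda>t. G (x(i := t))) has_real_derivative G' x) (at (x i))"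
    by (intro bexI[of _ "\<lambda>_. 0"]) auto
qed auto

lemma smooth_on_open_coord:
  assumes "openin (Euclidean_space n) W" shows "smooth_on_open n W (\<lambda>x. x i)"
proof (rule smooth_on_open_coinduct[where C = "insert (\<lambda>x. x i) (range (\<lambda>c _. c))", OF assms])
  fix G :: "(nat \<Rightarrow> real) \<Rightarrow> real" and j assume G: "G \<in> insert (\<lambda>x. x i) (range (\<lambda>c _. c))"
  then show "continuous_on W G"
    by (auto intro!: continuous_intros continuous_on_product_then_coordinatewise[OF continuous_on_id])
  show "\<exists>G'\<in>insert (\<lambda>x. x i) (range (\<lambda>c _. c)). \<forall>x\<in>W. ((\<lambda>t. G (x(j := t))) has_real_derivative G' x) (at (x j))"
  proof (cases "G = (\<lambda>x. x i) \<and> i = j")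
    case True
    then show ?thesis by (intro bexI[of _ "\<lambda>_. 1"]) (auto intro!: derivative_eq_intros)
  next
    case False
    then show ?thesis using G by (intro bexI[of _ "\<lambda>_. 0"]) (auto intro!: derivative_eq_intros)
  qed
qed auto

section \<open>Mean values, the chain rule along curves, and composition\<close>

lemma mvt_between:
  fixes g :: "real \<Rightarrow> real"
  assumes "\<And>t. \<bar>t - a\<bar> \<le> \<bar>b - a\<bar> \<Longrightarrow> (g has_real_derivative g' t) (at t)"
  obtains \<xi> where "\<bar>\<xi> - a\<bar> \<le> \<bar>b - a\<bar>" "g b - g a = (b - a) * g' \<xi>"
proof -
  consider "a < b" | "b < a" | "a = b" by linarith
  then show ?thesis
  proof cases
    case 1
    then obtain \<xi> where "a < \<xi>" "\<xi> < b" "g b - g a = (b - a) * g' \<xi>"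
      using MVT2[of a b g g'] assms by auto
    then show ?thesis using that[of \<xi>] 1 by auto
  next
    case 2
    then obtain \<xi> where "b < \<xi>" "\<xi> < a" "g a - g b = (a - b) * g' \<xi>"
      using MVT2[of b a g g'] assms by auto
    then show ?thesis using that[of \<xi>] 2 by (auto simp: algebra_simps)
  next
    case 3
    then show ?thesis using that[of a] by auto
  qed
qed

text \<open>A mean value theorem with one intermediate point for each coordinate, obtained by
  changing the coordinates one at a time.\<close>

lemma smooth_increment:
  assumes H: "smooth_on_open k W H" and y: "y \<in> W"
  obtains d u where "d > 0" "cube k y d \<subseteq> W"
    "\<And>z. z \<in> cube k y d \<Longrightarrow> H z - H y = (\<Sum>j<k. partial j H (u j z) * (z j - y j))"
    "\<And>j z. z \<in> cube k y d \<Longrightarrow> j < k \<Longrightarrow> u j z \<in> cube k y d \<and> (\<forall>i. \<bar>u j z i - y i\<bar> \<le> \<bar>z i - y i\<bar>)"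
proof -
  have yE: "y \<in> ES k" using y smooth_on_open_imp_openin[OF H] openin_subset by blast
  obtain d where d: "d > 0" "cube k y d \<subseteq> W"
    using openin_Euclidean_space_cube[OF smooth_on_open_imp_openin[OF H] y] by blast
  have "\<exists>v. (\<forall>j<k. v j \<in> cube k y d \<and> (\<forall>i. \<bar>v j i - y i\<bar> \<le> \<bar>z i - y i\<bar>)) \<and>
      H z - H y = (\<Sum>j<k. partial j H (v j) * (z j - y j))" if z: "z \<in> cube k y d" for z
  proof -
    define w where "w j = (\<lambda>i. if i < j then z i else y i)" for j :: nat
    have w0: "w 0 = y" by (simp add: w_def)
    have zE: "z \<in> ES k" using z by (simp add: cube_def)
    have wk: "w k = z" using yE zE by (auto simp: w_def mem_ES)
    have "\<exists>v. v \<in> cube k y d \<and> (\<forall>i. \<bar>v i - y i\<bar> \<le> \<bar>z i - y i\<bar>) \<and>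
       H (w (Suc j)) - H (w j) = partial j H v * (z j - y j)" if j: "j < k" for j
    proof -
      have in_cube: "(w j)(j := t) \<in> cube k y d" if "\<bar>t - y j\<bar> \<le> \<bar>z j - y j\<bar>" for t
        using that z j d(1) zE yE by (auto simp: cube_def w_def mem_ES)
      have "((\<lambda>t. H ((w j)(j := t))) has_real_derivative partial j H ((w j)(j := t))) (at t)"
        if "\<bar>t - y j\<bar> \<le> \<bar>z j - y j\<bar>" for t
        using smooth_on_open_imp_DERIV[OF H j, of "(w j)(j := t)"] in_cube[OF that] d by auto
      from mvt_between[of "y j" "z j", OF this] obtain \<xi> where
        \<xi>: "\<bar>\<xi> - y j\<bar> \<le> \<bar>z j - y j\<bar>"
          "H ((w j)(j := z j)) - H ((w j)(j := y j)) = (z j - y j) * partial j H ((w j)(j := \<xi>))"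
        by blast
      have "(w j)(j := z j) = w (Suc j)" "(w j)(j := y j) = w j"
        by (auto simp: w_def)
      then show ?thesis
        using \<xi> in_cube[OF \<xi>(1)] by (intro exI[of _ "(w j)(j := \<xi>)"]) (auto simp: w_def mult.commute)
    qed
    then obtain v where v: "\<And>j. j < k \<Longrightarrow> v j \<in> cube k y d \<and> (\<forall>i. \<bar>v j i - y i\<bar> \<le> \<bar>z i - y i\<bar>) \<and>
       H (w (Suc j)) - H (w j) = partial j H (v j) * (z j - y j)" by metis
    have "H z - H y = (\<Sum>j<k. H (w (Suc j)) - H (w j))"
      by (simp add: sum_lessThan_telescope[where f = "\<lambda>j. H (w j)"] w0 wk)
    also have "\<dots> = (\<Sum>j<k. partial j H (v j) * (z j - y j))"
      using v by (intro sum.cong) auto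
    finally show ?thesis using v by blast
  qed
  then have "\<forall>z\<in>cube k y d. \<exists>v. (\<forall>j<k. v j \<in> cube k y d \<and> (\<forall>i. \<bar>v j i - y i\<bar> \<le> \<bar>z i - y i\<bar>)) \<and>
      H z - H y = (\<Sum>j<k. partial j H (v j) * (z j - y j))" by blast
  from bchoice[OF this] obtain u where "\<forall>z\<in>cube k y d. (\<forall>j<k. u z j \<in> cube k y d \<and> (\<forall>i. \<bar>u z j i - y i\<bar> \<le> \<bar>z i - y i\<bar>)) \<and>
      H z - H y = (\<Sum>j<k. partial j H (u z j) * (z j - y j))" by blast
  then show ?thesis using d by (intro that[of d "\<lambda>j z. u z j"]; blast)
qed

lemma tendsto_cube:
  assumes "continuous_on W (F :: _ \<Rightarrow> real)" "W \<subseteq> ES k" "y \<in> W"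
    and "\<And>j. j < k \<Longrightarrow> ((\<lambda>t. \<gamma> t j) \<longlongrightarrow> y j) A"
    and "\<forall>\<^sub>F t in A. \<gamma> t \<in> W"
  shows "((\<lambda>t. F (\<gamma> t)) \<longlongrightarrow> F y) A"
proof (rule tendstoI)
  fix e :: real assume "e > 0"
  then obtain d where d: "d > 0" "\<And>z. z \<in> W \<Longrightarrow> z \<in> cube k y d \<Longrightarrow> \<bar>F z - F y\<bar> < e"
    using continuous_on_cubeD[OF assms(2,1,3)] by metis
  have "\<forall>\<^sub>F t in A. \<forall>j\<in>{..<k}. \<bar>\<gamma> t j - y j\<bar> < d"
    using assms(4) d(1) by (intro eventually_ball_finite ballI finite_lessThan)
      (auto simp: tendsto_iff dist_real_def)
  then show "\<forall>\<^sub>F t in A. dist (F (\<gamma> t)) (F y) < e"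
    using assms(5)
  proof eventually_elim
    case (elim t)
    then have "\<gamma> t \<in> cube k y d" using assms(2) by (auto simp: cube_def)
    then show ?case using d elim by (simp add: dist_real_def)
  qed
qed

text \<open>Partial derivatives see only one-variable restrictions, so a chain rule for curves
  covers all composites. By \<open>smooth_increment\<close>, the increment of \<open>H\<close> is a
  sum of intermediate partial derivatives times the increments of the coordinates. The intermediate
  points are coordinatewise at least as close to \<open>\<gamma> t0\<close> as
  \<open>\<gamma> t\<close> is, hence converge to it, and the difference quotient converges term by
  term.\<close>

lemma smooth_chain_curve:
  assumes H: "smooth_on_open k W H" and y: "\<gamma> t0 \<in> W"
    and d: "\<And>j. j < k \<Longrightarrow> ((\<lambda>t. \<gamma> t j) has_real_derivative D j) (at t0)"
    and ev: "\<forall>\<^sub>F t in at t0. \<gamma> t \<in> ES k"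
  shows "((\<lambda>t. H (\<gamma> t)) has_real_derivative (\<Sum>j<k. partial j H (\<gamma> t0) * D j)) (at t0)"
proof -
  define y where "y = \<gamma> t0"
  obtain e u where e: "e > 0" "cube k y e \<subseteq> W"
    "\<And>z. z \<in> cube k y e \<Longrightarrow> H z - H y = (\<Sum>j<k. partial j H (u j z) * (z j - y j))"
    "\<And>j z. z \<in> cube k y e \<Longrightarrow> j < k \<Longrightarrow> u j z \<in> cube k y e \<and> (\<forall>i. \<bar>u j z i - y i\<bar> \<le> \<bar>z i - y i\<bar>)"
    using smooth_increment[OF H y[folded y_def]] by blast
  have \<gamma>: "((\<lambda>t. \<gamma> t j) \<longlongrightarrow> y j) (at t0)" if "j < k" for j
    unfolding y_def using DERIV_isCont[OF d[OF that]] by (simp add: isCont_def)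
  have "\<forall>\<^sub>F t in at t0. \<forall>j\<in>{..<k}. \<bar>\<gamma> t j - y j\<bar> < e"
    using \<gamma> e(1) by (intro eventually_ball_finite ballI finite_lessThan)
      (auto simp: tendsto_iff dist_real_def)
  then have ev2: "\<forall>\<^sub>F t in at t0. \<gamma> t \<in> cube k y e"
    using ev by eventually_elim (auto simp: cube_def)
  have lim: "((\<lambda>t. partial j H (u j (\<gamma> t))) \<longlongrightarrow> partial j H y) (at t0)" if j: "j < k" for j
  proof (rule tendsto_cube[where W = W and F = "partial j H" and \<gamma> = "\<lambda>t. u j (\<gamma> t)" and k = k])
    show "continuous_on W (partial j H)"
      by (rule smooth_on_open_imp_continuous[OF smooth_on_open_imp_partial[OF H j]])
    show "W \<subseteq> ES k" using smooth_on_open_imp_openin[OF H] openin_subset by blast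
    show "y \<in> W" using y y_def by simp
    show "\<forall>\<^sub>F t in at t0. u j (\<gamma> t) \<in> W"
      using ev2 by eventually_elim (use e j in auto)
    fix i assume "i < k"
    have "((\<lambda>t. u j (\<gamma> t) i - y i) \<longlongrightarrow> 0) (at t0)"
    proof (rule Lim_null_comparison)
      show "((\<lambda>t. \<bar>\<gamma> t i - y i\<bar>) \<longlongrightarrow> 0) (at t0)"
        using \<gamma>[OF \<open>i < k\<close>] LIM_zero tendsto_rabs_zero by blast
      show "\<forall>\<^sub>F t in at t0. norm (u j (\<gamma> t) i - y i) \<le> \<bar>\<gamma> t i - y i\<bar>"
        using ev2 by eventually_elim (use e j in auto)
    qed
    then show "((\<lambda>t. u j (\<gamma> t) i) \<longlongrightarrow> y i) (at t0)" by (rule LIM_zero_cancel)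
  qed
  have "((\<lambda>t. \<Sum>j<k. partial j H (u j (\<gamma> t)) * ((\<gamma> t j - \<gamma> t0 j) / (t - t0)))
      \<longlongrightarrow> (\<Sum>j<k. partial j H y * D j)) (at t0)"
    using lim d unfolding has_field_derivative_iff by (intro tendsto_sum tendsto_mult) auto
  then have "((\<lambda>t. (H (\<gamma> t) - H (\<gamma> t0)) / (t - t0)) \<longlongrightarrow> (\<Sum>j<k. partial j H y * D j)) (at t0)"
  proof (rule Lim_transform_eventually)
    show "\<forall>\<^sub>F t in at t0. (\<Sum>j<k. partial j H (u j (\<gamma> t)) * ((\<gamma> t j - \<gamma> t0 j) / (t - t0)))
       = (H (\<gamma> t) - H (\<gamma> t0)) / (t - t0)"
      using ev2 by eventually_elim (simp add: e(3)[unfolded y_def] y_def sum_divide_distrib)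
  qed
  then show ?thesis by (simp add: has_field_derivative_iff y_def)
qed

lemma continuous_on_into_ES:
  assumes "\<And>j. j < k \<Longrightarrow> continuous_on W (\<lambda>x. g x j)" "g ` W \<subseteq> ES k"
  shows "continuous_on W (g :: (nat \<Rightarrow> real) \<Rightarrow> nat \<Rightarrow> real)"
proof (rule continuous_on_coordinatewise_then_product)
  fix j
  show "continuous_on W (\<lambda>x. g x j)"
  proof (cases "j < k")
    case False
    then have "g x j = 0" if "x \<in> W" for x using assms(2) that by (auto simp: mem_ES)
    then show ?thesis by (metis (no_types, lifting) continuous_on_cong continuous_on_const)
  qed (rule assms)
qed

text \<open>The functions generated from the smooth functions and the composites by sums and products
  form a class that is closed under partial derivatives.\<close>

inductive_set alg_closure :: "nat \<Rightarrow> (nat \<Rightarrow> real) set \<Rightarrow> nat \<Rightarrow> (nat \<Rightarrow> real) set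
    \<Rightarrow> ((nat \<Rightarrow> real) \<Rightarrow> nat \<Rightarrow> real) \<Rightarrow> ((nat \<Rightarrow> real) \<Rightarrow> real) set"
  for n W k V g where
  base: "smooth_on_open n W F \<Longrightarrow> F \<in> alg_closure n W k V g"
| comp: "smooth_on_open k V H \<Longrightarrow> (\<lambda>x. H (g x)) \<in> alg_closure n W k V g"
| add: "F \<in> alg_closure n W k V g \<Longrightarrow> G \<in> alg_closure n W k V g \<Longrightarrow> (\<lambda>x. F x + G x) \<in> alg_closure n W k V g"
| mult: "F \<in> alg_closure n W k V g \<Longrightarrow> G \<in> alg_closure n W k V g \<Longrightarrow> (\<lambda>x. F x * G x) \<in> alg_closure n W k V g"

lemma alg_closure_sum:
  assumes "openin (Euclidean_space n) W" "\<And>j. j < (l::nat) \<Longrightarrow> F j \<in> alg_closure n W k V g"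
  shows "(\<lambda>x. \<Sum>j<l. F j x) \<in> alg_closure n W k V g"
  using assms(2)
proof (induction l)
  case 0
  then show ?case using alg_closure.base[OF smooth_on_open_const[OF assms(1), of 0]] by simp
next
  case (Suc l)
  then show ?case using alg_closure.add[of "\<lambda>x. \<Sum>j<l. F j x" n W k V g "F l"] by simp
qed

lemma alg_closure_smooth:
  assumes W: "openin (Euclidean_space n) W"
    and g: "\<And>j. j < k \<Longrightarrow> smooth_on_open n W (\<lambda>x. g x j)" "g ` W \<subseteq> ES k" "g ` W \<subseteq> V"
    and F: "F \<in> alg_closure n W k V g"
  shows "smooth_on_open n W F"
proof (rule smooth_on_open_coinduct[OF W F])
  have gcont: "continuous_on W g"
    using continuous_on_into_ES[OF _ g(2)] smooth_on_open_imp_continuous[OF g(1)] by blast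
  fix G assume "G \<in> alg_closure n W k V g"
  then show "continuous_on W G"
  proof induction
    case (base F)
    then show ?case by (rule smooth_on_open_imp_continuous)
  next
    case (comp H)
    then show ?case
      using continuous_on_compose2[OF smooth_on_open_imp_continuous[OF comp] gcont] g(3) by auto
  qed (auto intro: continuous_intros)
next
  fix G i assume G: "G \<in> alg_closure n W k V g" and i: "i < n"
  from G show "\<exists>G'\<in>alg_closure n W k V g. \<forall>x\<in>W. ((\<lambda>t. G (x(i := t))) has_real_derivative G' x) (at (x i))"
  proof induction
    case (base F)
    then show ?case
      by (intro bexI[of _ "partial i F"] ballI smooth_on_open_imp_DERIV[OF base i] alg_closure.base
           smooth_on_open_imp_partial[OF base i])
  next
    case (comp H)
    show ?case
    proof (intro bexI ballI)
      \<comment> \<open>The chain rule yields a sum of products of a composite and a smooth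
        function; this is why the class is closed under sums and products.\<close>
      show "(\<lambda>x. \<Sum>j<k. partial j H (g x) * partial i (\<lambda>x. g x j) x) \<in> alg_closure n W k V g"
        using smooth_on_open_imp_partial[OF comp] smooth_on_open_imp_partial[OF g(1) i]
        by (intro alg_closure_sum[OF W] alg_closure.mult alg_closure.base alg_closure.comp)
      fix x assume x: "x \<in> W"
      have "((\<lambda>t. H ((\<lambda>t. g (x(i := t))) t)) has_real_derivative
         (\<Sum>j<k. partial j H ((\<lambda>t. g (x(i := t))) (x i)) * partial i (\<lambda>x. g x j) x)) (at (x i))"
      proof (rule smooth_chain_curve[OF comp])
        have "\<forall>\<^sub>F t in at (x i). x(i := t) \<in> W"
          using eventually_upd_in[OF W x i] by (simp add: eventually_at_filter eventually_mono)
        then show "\<forall>\<^sub>F t in at (x i). g (x(i := t)) \<in> ES k"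
          by eventually_elim (use g in auto)
      qed (use x g smooth_on_open_imp_DERIV[OF g(1) _ x] i in auto)
      then show "((\<lambda>t. H (g (x(i := t)))) has_real_derivative
         (\<Sum>j<k. partial j H (g x) * partial i (\<lambda>x. g x j) x)) (at (x i))" by simp
    qed
  next
    case (add F G)
    then obtain F' G' where "F' \<in> alg_closure n W k V g" "G' \<in> alg_closure n W k V g"
      "\<forall>x\<in>W. ((\<lambda>t. F (x(i := t))) has_real_derivative F' x) (at (x i))"
      "\<forall>x\<in>W. ((\<lambda>t. G (x(i := t))) has_real_derivative G' x) (at (x i))" by blast
    then show ?case
      by (intro bexI[of _ "\<lambda>x. F' x + G' x"]) (auto simp: fun_upd_def intro!: DERIV_add alg_closure.add)
  next
    case (mult F G)
    then obtain F' G' where *: "F' \<in> alg_closure n W k V g" "G' \<in> alg_closure n W k V g"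
      "\<forall>x\<in>W. ((\<lambda>t. F (x(i := t))) has_real_derivative F' x) (at (x i))"
      "\<forall>x\<in>W. ((\<lambda>t. G (x(i := t))) has_real_derivative G' x) (at (x i))" by blast
    have "((\<lambda>t. F (x(i := t)) * G (x(i := t))) has_real_derivative F' x * G x + G' x * F x) (at (x i))"
      if "x \<in> W" for x
      using DERIV_mult[of "\<lambda>t. F (x(i := t))" "F' x" "x i" UNIV "\<lambda>t. G (x(i := t))" "G' x"] * that by simp
    then show ?case using * mult.hyps
      by (intro bexI[of _ "\<lambda>x. F' x * G x + G' x * F x"]) (auto simp: fun_upd_def intro!: alg_closure.add alg_closure.mult)
  qed
qed

lemma smooth_on_open_compose:
  assumes "openin (Euclidean_space n) W" "smooth_on_open k V H"
    and "\<And>j. j < k \<Longrightarrow> smooth_on_open n W (\<lambda>x. g x j)" "g ` W \<subseteq> V"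
  shows "smooth_on_open n W (\<lambda>x. H (g x))"
  using alg_closure_smooth[OF assms(1,3) _ assms(4) alg_closure.comp[OF assms(2)]]
    openin_subset[OF smooth_on_open_imp_openin[OF assms(2)]] assms(4) by blast

lemma smooth_on_open_add:
  assumes "smooth_on_open n W F" "smooth_on_open n W G"
  shows "smooth_on_open n W (\<lambda>x. F x + G x)"
proof -
  note W = smooth_on_open_imp_openin[OF assms(1)]
  show ?thesis
    \<comment> \<open>The composites are trivialised by the constant map into the one-point space of
      dimension 0, so that only the closure under sums and products is exploited.\<close>
    using alg_closure_smooth[where k = 0 and g = "\<lambda>_ _. 0" and V = UNIV,
        OF W _ _ _ alg_closure.add[OF alg_closure.base[OF assms(1)] alg_closure.base[OF assms(2)]]]
    by (simp add: mem_ES image_subset_iff)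
qed

lemma smooth_on_open_mult:
  assumes "smooth_on_open n W F" "smooth_on_open n W G"
  shows "smooth_on_open n W (\<lambda>x. F x * G x)"
proof -
  note W = smooth_on_open_imp_openin[OF assms(1)]
  show ?thesis
    using alg_closure_smooth[where k = 0 and g = "\<lambda>_ _. 0" and V = UNIV,
        OF W _ _ _ alg_closure.mult[OF alg_closure.base[OF assms(1)] alg_closure.base[OF assms(2)]]]
    by (simp add: mem_ES image_subset_iff)
qed

lemma DERIV_smooth_curve:
  assumes "smooth_on_open n W F" "i < n" "x(i := t) \<in> W"
  shows "((\<lambda>s. F (x(i := s))) has_real_derivative partial i F (x(i := t))) (at t)"
  using smooth_on_open_imp_DERIV[OF assms] by simp

section \<open>Smooth functions of one real variable and the smooth step\<close>

definition smooth_real :: "(real \<Rightarrow> real) \<Rightarrow> real set \<Rightarrow> bool" where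
  "smooth_real f T \<longleftrightarrow> open T \<and>
     (\<exists>C. f \<in> C \<and> (\<forall>g\<in>C. \<exists>g'\<in>C. \<forall>t\<in>T. (g has_real_derivative g' t) (at t)))"

text \<open>A one-variable function is read as a function of coordinate 0 on the line
  \<open>ES 1\<close>. The class of derivatives in \<open>smooth_real\<close> has just the form that
  the coinduction rule asks for there, and composition of smooth functions does the rest.\<close>

lemma smooth_real_compose:
  assumes f: "smooth_real f T" and F: "smooth_on_open n W F" "F ` W \<subseteq> T"
  shows "smooth_on_open n W (\<lambda>x. f (F x))"
proof -
  obtain C where T: "open T" and C: "f \<in> C" "\<forall>g\<in>C. \<exists>g'\<in>C. \<forall>t\<in>T. (g has_real_derivative g' t) (at t)"
    using f by (auto simp: smooth_real_def)
  let ?V = "{y \<in> ES 1. y 0 \<in> T}"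
  have "?V = ES 1 \<inter> (\<lambda>y. y 0) -` T" by auto
  moreover have "open ((\<lambda>y :: nat \<Rightarrow> real. y 0) -` T)"
    using T continuous_on_coord[of UNIV 0] open_vimage by blast
  ultimately have V: "openin (Euclidean_space 1) ?V"
    using openin_Euclidean_space by blast
  have "smooth_on_open 1 ?V (\<lambda>y. f (y 0))"
  proof (rule smooth_on_open_coinduct[where C = "(\<lambda>g y. g (y 0)) ` C", OF V])
    fix G assume "G \<in> (\<lambda>g (y :: nat \<Rightarrow> real). g (y 0)) ` C"
    then obtain g g' where g: "G = (\<lambda>y. g (y 0))" "g' \<in> C" "\<forall>t\<in>T. (g has_real_derivative g' t) (at t)"
      using C by blast
    then have "continuous_on T g"
      by (meson DERIV_continuous continuous_at_imp_continuous_on)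
    then show "continuous_on ?V G"
      unfolding g by (rule continuous_on_compose2[OF _ continuous_on_coord]) auto
    fix i assume "i < (1 :: nat)"
    then show "\<exists>G'\<in>(\<lambda>g y. g (y 0)) ` C. \<forall>x\<in>?V. ((\<lambda>t. G (x(i := t))) has_real_derivative G' x) (at (x i))"
      using g by (intro bexI[of _ "\<lambda>y. g' (y 0)"]) auto
  qed (use C in auto)
  from smooth_on_open_compose[OF smooth_on_open_imp_openin[OF F(1)] this, of "\<lambda>x j. if j = 0 then F x else 0"]
  show ?thesis using F by (auto simp: mem_ES image_subset_iff)
qed

lemma smooth_real_inverse: "smooth_real inverse (- {0})"
proof -
  \<comment> \<open>Multiples of powers of 1 / t are closed under differentiation.\<close>
  let ?C = "{g :: real \<Rightarrow> real. \<exists>c k. g = (\<lambda>t. c * inverse t ^ k)}"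
  have "\<exists>g'\<in>?C. \<forall>t\<in>-{0}. (g has_real_derivative g' t) (at t)" if "g \<in> ?C" for g
  proof -
    from that obtain c k where g: "g = (\<lambda>t. c * inverse t ^ k)" by blast
    have "(g has_real_derivative (- (c * real k) * inverse t ^ Suc k)) (at t)" if "t \<noteq> 0" for t
      using DERIV_cmult[OF DERIV_power[OF DERIV_inverse[OF that], of k], of c] unfolding g
      by (cases k) (simp_all add: mult_ac)
    moreover have "(\<lambda>t. - (c * real k) * inverse t ^ Suc k) \<in> ?C"
      by blast
    ultimately show ?thesis by (intro bexI) auto
  qed
  moreover have "inverse \<in> ?C" by (auto intro!: exI[of _ 1])
  ultimately show ?thesis unfolding smooth_real_def by (intro conjI exI[of _ ?C]) auto
qed

definition flat :: "real \<Rightarrow> real" where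
  "flat t = (if t \<le> 0 then 0 else exp (- inverse t))"

lemma poly_exp_tendsto_0: "((\<lambda>u. poly p u * exp (- u)) \<longlongrightarrow> 0) (at_top :: real filter)"
proof -
  have "((\<lambda>u. \<Sum>i\<le>Polynomial.degree p. Polynomial.coeff p i * (u ^ i / exp u)) \<longlongrightarrow> (\<Sum>i\<le>Polynomial.degree p. Polynomial.coeff p i * 0)) (at_top :: real filter)"
    by (intro tendsto_sum tendsto_mult tendsto_const tendsto_power_div_exp_0)
  then show ?thesis
    by (simp add: poly_altdef sum_distrib_right sum_divide_distrib exp_minus field_simps)
qed

text \<open>With s = 1 / t, the functions p(s) exp(-s), extended by 0 to t \<le> 0, are closed under
  differentiation: the derivative for t > 0 belongs to the polynomial s^2 (p - p'). At 0 the
  difference quotient has the same form with s p in place of p and therefore tends to 0.\<close>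

lemma smooth_real_flat: "smooth_real flat UNIV"
proof -
  define h where "h p t = (if t \<le> 0 then 0 else poly p (inverse t) * exp (- inverse t))" for p and t :: real
  have lim: "((\<lambda>t. h p t / t) \<longlongrightarrow> 0) (at 0)" for p
  proof -
    have "((\<lambda>t. poly (pCons 0 p) (inverse t) * exp (- inverse t)) \<longlongrightarrow> 0) (at_right 0)"
      by (rule filterlim_compose[OF poly_exp_tendsto_0 filterlim_inverse_at_top_right])
    then have "((\<lambda>t. h p t / t) \<longlongrightarrow> 0) (at_right 0)"
      by (rule Lim_transform_eventually)
         (auto simp: eventually_at_right_field h_def divide_inverse mult_ac intro!: exI[of _ 1])
    moreover have "((\<lambda>t. h p t / t) \<longlongrightarrow> 0) (at_left 0)"
      by (rule tendsto_eventually) (auto simp: eventually_at_left_field h_def intro!: exI[of _ "-1"])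
    ultimately show ?thesis by (simp add: filterlim_at_split)
  qed
  have "(h p has_real_derivative h ([:0, 0, 1:] * (p - pderiv p)) t) (at t)" for p t
  proof -
    consider "t < 0" | "t = 0" | "t > 0" by linarith
    then show ?thesis
    proof cases
      case 1
      have "\<forall>\<^sub>F s in nhds t. h p s = 0"
        using eventually_nhds_in_open[of "{..<0}" t] 1 by (auto simp: h_def elim: eventually_mono)
      then show ?thesis using 1 by (subst DERIV_cong_ev[OF refl _ refl]) (auto simp: h_def)
    next
      case 2
      then show ?thesis using lim[of p] by (simp add: has_field_derivative_iff h_def)
    next
      case 3
      have "\<forall>\<^sub>F s in nhds t. h p s = poly p (inverse s) * exp (- inverse s)"
        using eventually_nhds_in_open[of "{0<..}" t] 3 by (auto simp: h_def elim: eventually_mono)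
      then show ?thesis using 3
        by (subst DERIV_cong_ev[OF refl _ refl])
          (auto intro!: derivative_eq_intros DERIV_chain2[OF poly_DERIV] simp: h_def field_simps power2_eq_square)
    qed
  qed
  moreover have "flat = h 1" by (auto simp: flat_def h_def)
  ultimately show ?thesis unfolding smooth_real_def by (intro conjI exI[of _ "range h"]) auto
qed

lemma flat_pos: "t > 0 \<Longrightarrow> flat t > 0" and flat_nonneg: "flat t \<ge> 0" and flat_0: "t \<le> 0 \<Longrightarrow> flat t = 0"
  by (auto simp: flat_def)

lemma DERIV_flat: "t > 0 \<Longrightarrow> (flat has_real_derivative flat t / t\<^sup>2) (at t)"
proof -
  assume t: "t > 0"
  have "\<forall>\<^sub>F s in nhds t. flat s = exp (- inverse s)"
    using eventually_nhds_in_open[of "{0<..}" t] t by (auto simp: flat_def elim: eventually_mono)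
  then show ?thesis using t
    by (subst DERIV_cong_ev[OF refl _ refl])
       (auto intro!: derivative_eq_intros simp: flat_def field_simps power2_eq_square)
qed

text \<open>Returns from \<open>ES 1\<close> to the line: the functions that lift to smooth
  functions on \<open>ES 1\<close> form a class closed under derivatives, via
  \<open>partial 0\<close>. One-variable functions can then be assembled with the sums, products and
  composites available on Euclidean space.\<close>

lemma smooth_on_open_real:
  assumes "smooth_on_open 1 (ES 1) (\<lambda>y. f (y 0))"
  shows "smooth_real f UNIV"
proof -
  let ?e = "\<lambda>t i. if i = (0::nat) then t else (0::real)"
  let ?C = "{g. \<exists>F. smooth_on_open 1 (ES 1) F \<and> (\<forall>t. F (?e t) = g t)}"
  have E: "?e t \<in> ES 1" "(?e t)(0 := s) = ?e s" for t s by (auto simp: mem_ES)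
  have "\<exists>g'\<in>?C. \<forall>t\<in>UNIV. (g has_real_derivative g' t) (at t)" if g: "g \<in> ?C" for g
  proof -
    obtain F where F: "smooth_on_open 1 (ES 1) F" "\<And>t. F (?e t) = g t" using g by blast
    have "((\<lambda>s. F ((?e t)(0 := s))) has_real_derivative partial 0 F (?e t)) (at t)" for t
      using smooth_on_open_imp_DERIV[OF F(1), of 0 "?e t"] E by simp
    then have "(g has_real_derivative partial 0 F (?e t)) (at t)" for t
      unfolding E F(2) .
    then show ?thesis using smooth_on_open_imp_partial[OF F(1), of 0]
      by (intro bexI[of _ "\<lambda>t. partial 0 F (?e t)"]) auto
  qed
  moreover have "f \<in> ?C" using assms by (intro CollectI exI[of _ "\<lambda>y. f (y 0)"]) simp
  ultimately show ?thesis unfolding smooth_real_def by (intro conjI exI[of _ ?C]) auto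
qed

text \<open>The usual smooth transition from 0 to 1, written with \<open>inverse\<close> so that the
  closure lemmas apply. The denominator never vanishes because \<open>t\<close> and
  \<open>1 - t\<close> are not both nonpositive.\<close>

definition step :: "real \<Rightarrow> real" where
  "step t = flat t * inverse (flat t + flat (1 - t))"

lemma step_denominator: "flat t + flat (1 - t) > 0"
  using flat_pos[of t] flat_pos[of "1 - t"] flat_nonneg[of t] flat_nonneg[of "1 - t"]
  by (cases "t > 0") linarith+

lemma smooth_real_step: "smooth_real step UNIV"
proof (rule smooth_on_open_real)
  have o: "openin (Euclidean_space 1) (ES 1)" by simp
  have 1: "smooth_on_open 1 (ES 1) (\<lambda>y. flat (y 0))"
    by (rule smooth_real_compose[OF smooth_real_flat smooth_on_open_coord[OF o]]) auto
  have "smooth_on_open 1 (ES 1) (\<lambda>y. 1 + (- 1) * y 0)"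
    by (intro smooth_on_open_add smooth_on_open_mult smooth_on_open_const smooth_on_open_coord o)
  then have 2: "smooth_on_open 1 (ES 1) (\<lambda>y. flat (1 + (- 1) * y 0))"
    by (rule smooth_real_compose[OF smooth_real_flat]) auto
  have "smooth_on_open 1 (ES 1) (\<lambda>y. inverse (flat (y 0) + flat (1 + (- 1) * y 0)))"
    by (rule smooth_real_compose[OF smooth_real_inverse smooth_on_open_add[OF 1 2]])
       (use step_denominator in \<open>force simp: less_le\<close>)
  from smooth_on_open_mult[OF 1 this]
  show "smooth_on_open 1 (ES 1) (\<lambda>y. step (y 0))" by (simp add: step_def)
qed

lemma step_0: "t \<le> 0 \<Longrightarrow> step t = 0"
  by (simp add: step_def flat_0)

lemma step_1: "t \<ge> 1 \<Longrightarrow> step t = 1"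
  using step_denominator[of t] by (simp add: step_def flat_0)

lemma step_nonneg: "step t \<ge> 0" and step_le_1: "step t \<le> 1"
  using step_denominator[of t] flat_nonneg[of t] flat_nonneg[of "1 - t"]
  by (auto simp: step_def field_simps)

text \<open>In the numerator of the quotient rule the terms with the square of \<open>flat t\<close>
  cancel, which leaves a sum of two positive terms. The strict sign is what later rules out critical
  points in the tubes.\<close>

lemma DERIV_step:
  assumes "0 < t" "t < 1"
  obtains d where "d > 0" "(step has_real_derivative d) (at t)"
proof -
  let ?s = "flat t + flat (1 - t)"
  have 1: "(flat has_real_derivative flat t / t\<^sup>2) (at t)" by (rule DERIV_flat[OF assms(1)])
  have "((\<lambda>u. flat (1 - u)) has_real_derivative (flat (1 - t) / (1 - t)\<^sup>2) * (- 1)) (at t)"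
    by (rule DERIV_chain2[OF DERIV_flat]) (use assms in \<open>auto intro!: derivative_eq_intros\<close>)
  then have 2: "((\<lambda>u. flat (1 - u)) has_real_derivative - (flat (1 - t) / (1 - t)\<^sup>2)) (at t)" by simp
  have "((\<lambda>u. flat u / (flat u + flat (1 - u))) has_real_derivative
     (flat t / t\<^sup>2 * ?s - flat t * (flat t / t\<^sup>2 + - (flat (1 - t) / (1 - t)\<^sup>2))) / (?s * ?s)) (at t)"
    by (intro DERIV_divide DERIV_add 1 2) (use step_denominator[of t] in auto)
  moreover have "flat t / t\<^sup>2 * ?s - flat t * (flat t / t\<^sup>2 + - (flat (1 - t) / (1 - t)\<^sup>2))
     = flat t / t\<^sup>2 * flat (1 - t) + flat t * (flat (1 - t) / (1 - t)\<^sup>2)"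
    by (simp add: algebra_simps add_divide_distrib)
  moreover have "\<dots> / (?s * ?s) > 0"
    using assms flat_pos[of t] flat_pos[of "1 - t"] step_denominator[of t]
    by (intro divide_pos_pos add_pos_pos mult_pos_pos) auto
  ultimately show ?thesis
    using that by (auto simp: step_def[abs_def] divide_inverse)
qed

lemma step_strict_mono:
  assumes "0 \<le> s" "s < t" "t \<le> 1" shows "step s < step t"
proof (rule DERIV_pos_imp_increasing_open[OF assms(2)])
  show "\<exists>d. (step has_real_derivative d) (at u) \<and> d > 0" if "s < u" "u < t" for u
    using DERIV_step[of u] that assms by (metis less_le_trans le_less_trans)
  show "continuous_on {s..t} step"
    using smooth_real_step unfolding smooth_real_def
    by (metis DERIV_isCont UNIV_I continuous_at_imp_continuous_on)
qed

section \<open>Local inverses\<close>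

lemma smooth_on_open_sum:
  assumes "openin (Euclidean_space n) W" "\<And>j. j < (l::nat) \<Longrightarrow> smooth_on_open n W (F j)"
  shows "smooth_on_open n W (\<lambda>x. \<Sum>j<l. F j x)"
  using assms(2)
proof (induction l)
  case (Suc l)
  then show ?case using smooth_on_open_add[of n W "\<lambda>x. \<Sum>j<l. F j x" "F l"] by simp
qed (simp add: smooth_on_open_const assms)

lemma smooth_on_open_inverse:
  assumes "smooth_on_open n W F" "\<And>x. x \<in> W \<Longrightarrow> F x \<noteq> 0"
  shows "smooth_on_open n W (\<lambda>x. inverse (F x))"
  by (rule smooth_real_compose[OF smooth_real_inverse assms(1)]) (use assms(2) in auto)

lemma continuous_map_into_ES:
  assumes "openin (Euclidean_space n) W" "\<And>j. j < k \<Longrightarrow> smooth_on_open n W (\<lambda>x. g x j)" "g ` W \<subseteq> ES k"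
  shows "continuous_map (subtopology (Euclidean_space n) W) (Euclidean_space k) g"
proof -
  have "continuous_on W g"
    using continuous_on_into_ES[OF smooth_on_open_imp_continuous[OF assms(2)] assms(3)] .
  moreover have "W \<subseteq> ES n" using assms(1) openin_subset by blast
  ultimately show ?thesis
    using assms(3) by (simp add: cm_Euclidean_space_iff_continuous_on Int_absorb1 image_subset_iff_funcset)
qed

text \<open>Invariance of domain supplies the topological half of the inverse function theorem,
  openness of the image and continuity of the inverse, without any derivative. Only the
  differentiation of the inverse is left to calculus.\<close>

lemma invariance_of_domain_inverse:
  assumes W: "openin (Euclidean_space n) W"
    and F: "continuous_map (subtopology (Euclidean_space n) W) (Euclidean_space n) F"
    and G: "\<And>x. x \<in> W \<Longrightarrow> G (F x) = x"
  shows "openin (Euclidean_space n) (F ` W)" "continuous_on (F ` W) G"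
proof -
  have inj: "inj_on F W" by (rule inj_on_inverseI[of W G]) (rule G)
  show V: "openin (Euclidean_space n) (F ` W)"
    by (rule invariance_of_domain_Euclidean_space[OF W F inj])
  have WE: "W \<subseteq> ES n" "F ` W \<subseteq> ES n" using W V openin_subset by blast+
  have "embedding_map (subtopology (Euclidean_space n) W) (Euclidean_space n) F"
    by (rule invariance_of_domain_Euclidean_space_embedding_map[OF W F inj])
  then have "homeomorphic_map (top_of_set W) (top_of_set (F ` W)) F"
    using WE by (simp add: embedding_map_def subtopology_Euclidean_space)
  then obtain G' where "homeomorphic_maps (top_of_set W) (top_of_set (F ` W)) F G'"
    using homeomorphic_map_maps by blast
  then have "continuous_on (F ` W) G'" "\<And>x. x \<in> W \<Longrightarrow> G' (F x) = x"
    by (auto simp: homeomorphic_maps_def)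
  then show "continuous_on (F ` W) G"
    using G by (subst continuous_on_cong[OF refl, of _ _ G']) auto
qed

text \<open>The inverse of a map that changes only the coordinate \<open>i\<close>.\<close>

lemma smooth_inverse_coordinate:
  assumes g: "smooth_on_open n W g" and i: "i < n"
    and G: "\<And>x. x \<in> W \<Longrightarrow> G (x(i := g x)) = x"
    and nz: "\<And>x. x \<in> W \<Longrightarrow> partial i g x \<noteq> 0"
    and V: "V = (\<lambda>x. x(i := g x)) ` W"
  shows "openin (Euclidean_space n) V"
    and "\<And>H. smooth_on_open n W H \<Longrightarrow> smooth_on_open n V (\<lambda>y. H (G y))"
proof -
  let ?F = "\<lambda>x. x(i := g x)"
  note W = smooth_on_open_imp_openin[OF g]
  have WE: "W \<subseteq> ES n" using W openin_subset by blast
  have "smooth_on_open n W (\<lambda>x. ?F x j)" for j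
    by (cases "j = i") (auto simp: smooth_on_open_coord[OF W] g)
  then have "continuous_map (subtopology (Euclidean_space n) W) (Euclidean_space n) ?F"
    using WE i by (intro continuous_map_into_ES[OF W]) (auto intro!: ES_upd)
  from invariance_of_domain_inverse[OF W this, of G]
  have Vo: "openin (Euclidean_space n) V" and Gc: "continuous_on V G"
    using G by (auto simp: V)
  show "openin (Euclidean_space n) V" by (rule Vo)
  have VE: "V \<subseteq> ES n" using Vo openin_subset by blast
  have GV: "G y \<in> W" "?F (G y) = y" if "y \<in> V" for y
    using that G by (auto simp: V)
  define \<delta> where "\<delta> a b = (if a = b then 1 else 0 :: real)" for a b :: nat
  \<comment> \<open>\<open>D l j (G y)\<close> is the partial derivative of coordinate
    \<open>j\<close> of \<open>G\<close> in direction \<open>l\<close>. For \<open>j = i\<close> it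
    comes from differentiating \<open>g (G y) = y i\<close> implicitly; the other coordinates of
    \<open>G y\<close> are those of \<open>y\<close>. It is stated as a smooth function on
    \<open>W\<close>, before composition with \<open>G\<close>.\<close>
  define D where "D l j x = (if j = i then (\<delta> i l + (\<delta> i l - 1) * partial l g x) * inverse (partial i g x) else \<delta> j l)"
    for l j x
  have D: "smooth_on_open n W (D l j)" if "l < n" for l j
  proof (cases "j = i")
    case True
    have "smooth_on_open n W (\<lambda>x. (\<delta> i l + (\<delta> i l - 1) * partial l g x) * inverse (partial i g x))"
      by (intro smooth_on_open_mult smooth_on_open_add smooth_on_open_const[OF W] smooth_on_open_inverse
         smooth_on_open_imp_partial[OF g] that i nz)
    with True show ?thesis by (simp add: D_def[abs_def])
  qed (simp add: D_def[abs_def] smooth_on_open_const[OF W])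
  have DG: "((\<lambda>s. G (y(l := s)) j) has_real_derivative D l j (G y)) (at (y l))"
    if y: "y \<in> V" and l: "l < n" for y l j
  proof -
    define x where "x = G y"
    have x: "x \<in> W" "?F x = y" using GV[OF y] by (auto simp: x_def)
    have evV: "\<forall>\<^sub>F s in nhds (y l). y(l := s) \<in> V" by (rule eventually_upd_in[OF Vo y l])
    show ?thesis
    proof (cases "j = i")
      case False
      have "G (y(l := s)) j = (y(l := s)) j" if "y(l := s) \<in> V" for s
        using GV(2)[OF that] False by (metis fun_upd_apply)
      then have ev: "\<forall>\<^sub>F s in nhds (y l). G (y(l := s)) j = (y(l := s)) j"
        using evV by (auto elim: eventually_mono)
      show ?thesis
        unfolding DERIV_cong_ev[OF refl ev refl]
        by (cases "j = l") (use False in \<open>auto simp: D_def \<delta>_def\<close>)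
    next
      case True
      \<comment> \<open>Coordinate \<open>i\<close> is the only one with a nontrivial inverse. The
        increment of \<open>g\<close> between \<open>x\<close> and the perturbed preimage is
        expanded by the mean value theorem and then solved for the increment of coordinate
        \<open>i\<close>.\<close>
      obtain d u where u: "d > 0" "cube n x d \<subseteq> W"
        "\<And>z. z \<in> cube n x d \<Longrightarrow> g z - g x = (\<Sum>j<n. partial j g (u j z) * (z j - x j))"
        "\<And>j z. z \<in> cube n x d \<Longrightarrow> j < n \<Longrightarrow> u j z \<in> cube n x d \<and> (\<forall>i. \<bar>u j z i - x i\<bar> \<le> \<bar>z i - x i\<bar>)"
        using smooth_increment[OF g x(1)] by blast
      have evV': "\<forall>\<^sub>F s in at (y l). y(l := s) \<in> V"
        using evV by (simp add: eventually_at_filter eventually_mono)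
      have Glim: "((\<lambda>s. G (y(l := s)) j) \<longlongrightarrow> x j) (at (y l))" for j
      proof -
        have "continuous_on V (\<lambda>z. G z j)"
          by (rule continuous_on_product_then_coordinatewise[OF Gc])
        moreover have "((\<lambda>t. (y(l := t)) j) \<longlongrightarrow> y j) (at (y l))" for j by (cases "j = l") auto
        ultimately have "((\<lambda>s. G (y(l := s)) j) \<longlongrightarrow> G y j) (at (y l))"
          using tendsto_cube[where F = "\<lambda>z. G z j" and \<gamma> = "\<lambda>s. y(l := s)", OF _ VE y _ evV'] by blast
        then show ?thesis by (simp add: x_def)
      qed
      have "\<forall>\<^sub>F s in at (y l). \<forall>j\<in>{..<n}. \<bar>G (y(l := s)) j - x j\<bar> < d"
        using Glim u(1) by (intro eventually_ball_finite ballI finite_lessThan)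
          (auto simp: tendsto_iff dist_real_def)
      then have evc: "\<forall>\<^sub>F s in at (y l). y(l := s) \<in> V \<and> G (y(l := s)) \<in> cube n x d"
        using evV' by eventually_elim (use GV WE in \<open>auto simp: cube_def\<close>)
      have lim: "((\<lambda>s. partial j g (u j (G (y(l := s))))) \<longlongrightarrow> partial j g x) (at (y l))" if j: "j < n" for j
      proof (rule tendsto_cube[where W = W and F = "partial j g" and \<gamma> = "\<lambda>s. u j (G (y(l := s)))" and k = n])
        show "continuous_on W (partial j g)"
          by (rule smooth_on_open_imp_continuous[OF smooth_on_open_imp_partial[OF g j]])
        show "W \<subseteq> ES n" "x \<in> W" by fact+
        show "\<forall>\<^sub>F s in at (y l). u j (G (y(l := s))) \<in> W"
          using evc by eventually_elim (use u j in auto)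
        fix k assume "k < n"
        have "((\<lambda>s. u j (G (y(l := s))) k - x k) \<longlongrightarrow> 0) (at (y l))"
        proof (rule Lim_null_comparison)
          show "((\<lambda>s. \<bar>G (y(l := s)) k - x k\<bar>) \<longlongrightarrow> 0) (at (y l))"
            using Glim LIM_zero tendsto_rabs_zero by blast
          show "\<forall>\<^sub>F s in at (y l). norm (u j (G (y(l := s))) k - x k) \<le> \<bar>G (y(l := s)) k - x k\<bar>"
            using evc by eventually_elim (use u j in auto)
        qed
        then show "((\<lambda>s. u j (G (y(l := s))) k) \<longlongrightarrow> x k) (at (y l))" by (rule LIM_zero_cancel)
      qed
      \<comment> \<open>This is the difference quotient of coordinate \<open>i\<close> itself,
        expressed by partial derivatives of \<open>g\<close> at intermediate points. The continuity
        of \<open>G\<close> makes these points converge to \<open>x\<close>.\<close>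
      let ?q = "\<lambda>s. (\<delta> i l + (\<delta> i l - 1) * partial l g (u l (G (y(l := s))))) * inverse (partial i g (u i (G (y(l := s)))))"
      have "(?q \<longlongrightarrow> D l i x) (at (y l))"
        unfolding D_def using lim[OF l] lim[OF i] nz[OF x(1)] by (auto intro!: tendsto_intros)
      moreover have ne: "\<forall>\<^sub>F s in at (y l). s \<noteq> y l" by (simp add: eventually_at_filter)
      have "\<forall>\<^sub>F s in at (y l). ?q s = (G (y(l := s)) i - G (y(l := y l)) i) / (s - y l)"
        using evc ne
      proof eventually_elim
        case (elim s)
        define x' where x'_eq: "x' = G (y(l := s))"
        note elim = elim[folded x'_eq]
        have x': "x' \<in> W" "?F x' = y(l := s)" using GV elim by (auto simp: x'_eq)
        have dj: "x' j - x j = \<delta> j l * (s - y l)" if "j \<noteq> i" for j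
          using fun_cong[OF x'(2), of j] fun_cong[OF x(2), of j] that by (auto simp: \<delta>_def)
        have gd: "g x' - g x = \<delta> i l * (s - y l)"
          using fun_cong[OF x'(2), of i] fun_cong[OF x(2), of i] by (auto simp: \<delta>_def)
        have *: "partial i g (u i x') \<noteq> 0" using u(2) u(4)[of x' i] elim i nz by auto
        have "g x' - g x = (\<Sum>j<n. partial j g (u j x') * (x' j - x j))" using u(3) elim by blast
        also have "\<dots> = partial i g (u i x') * (x' i - x i)
            + (\<Sum>j\<in>{..<n} - {i}. partial j g (u j x') * (x' j - x j))"
          using i by (subst sum.remove[of _ i]) auto
        also have "(\<Sum>j\<in>{..<n} - {i}. partial j g (u j x') * (x' j - x j))
            = (\<Sum>j\<in>{..<n} - {i}. if j = l then partial l g (u l x') * (s - y l) else 0)"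
          using dj by (intro sum.cong) (auto simp: \<delta>_def)
        also have "\<dots> = (1 - \<delta> i l) * (partial l g (u l x') * (s - y l))"
          using l by (auto simp: \<delta>_def)
        finally have "partial i g (u i x') * (x' i - x i)
            = (\<delta> i l + (\<delta> i l - 1) * partial l g (u l x')) * (s - y l)"
          using gd by (simp add: algebra_simps)
        then have "(\<delta> i l + (\<delta> i l - 1) * partial l g (u l x')) * inverse (partial i g (u i x')) = (x' i - x i) / (s - y l)"
            using * elim by (simp add: field_simps)
          then show ?case by (simp add: x'_eq x_def)
      qed
      ultimately have "((\<lambda>s. G (y(l := s)) i) has_real_derivative D l i x) (at (y l))"
        unfolding has_field_derivative_iff by (rule Lim_transform_eventually)
      then show ?thesis using True by (simp add: x_def)
    qed
  qed
  fix H assume H: "smooth_on_open n W H"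
  show "smooth_on_open n V (\<lambda>y. H (G y))"
  \<comment> \<open>A partial derivative of \<open>K\<close> composed with \<open>G\<close> is again
    a smooth function on \<open>W\<close> composed with \<open>G\<close>, because the entries
    \<open>D l j\<close> are smooth on \<open>W\<close>. The smoothness of \<open>G\<close> comes
    out without circularity.\<close>
  proof (rule smooth_on_open_coinduct[where C = "(\<lambda>K y. K (G y)) ` {K. smooth_on_open n W K}", OF Vo])
    fix K' l assume "K' \<in> (\<lambda>K y. K (G y)) ` {K. smooth_on_open n W K}"
    then obtain K where K: "smooth_on_open n W K" "K' = (\<lambda>y. K (G y))" by auto
    show "continuous_on V K'"
      unfolding K(2) using continuous_on_compose2[OF smooth_on_open_imp_continuous[OF K(1)] Gc] GV by auto
    assume l: "l < n"
    have K': "smooth_on_open n W (\<lambda>x. \<Sum>j<n. partial j K x * D l j x)"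
      by (intro smooth_on_open_sum[OF W] smooth_on_open_mult smooth_on_open_imp_partial[OF K(1)] D l)
    have DK: "((\<lambda>s. K (G (y(l := s)))) has_real_derivative (\<Sum>j<n. partial j K (G y) * D l j (G y))) (at (y l))"
      if y: "y \<in> V" for y
    proof -
      have "\<forall>\<^sub>F s in at (y l). y(l := s) \<in> V"
        using eventually_upd_in[OF Vo y l] by (simp add: eventually_at_filter eventually_mono)
      then have "\<forall>\<^sub>F s in at (y l). G (y(l := s)) \<in> ES n"
        by eventually_elim (use GV WE in blast)
      from smooth_chain_curve[OF K(1), of "\<lambda>s. G (y(l := s))" "y l" "\<lambda>j. D l j (G y)", OF _ _ this]
      show ?thesis using GV[OF y] DG[OF y l] by simp
    qed
    show "\<exists>G'\<in>(\<lambda>K y. K (G y)) ` {K. smooth_on_open n W K}.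
        \<forall>x\<in>V. ((\<lambda>t. K' (x(l := t))) has_real_derivative G' x) (at (x l))"
      unfolding K(2)
    proof (intro bexI ballI)
      show "(\<lambda>y. \<Sum>j<n. partial j K (G y) * D l j (G y)) \<in> (\<lambda>K y. K (G y)) ` {K. smooth_on_open n W K}"
        by (rule image_eqI[OF refl]) (simp add: K')
    qed (rule DK)
  qed (use H in auto)
qed

definition smooth_inverse_on ::
    "nat \<Rightarrow> (nat \<Rightarrow> real) set \<Rightarrow> ((nat \<Rightarrow> real) \<Rightarrow> nat \<Rightarrow> real) \<Rightarrow> ((nat \<Rightarrow> real) \<Rightarrow> nat \<Rightarrow> real) \<Rightarrow> bool" where
  "smooth_inverse_on n W F G \<longleftrightarrow> openin (Euclidean_space n) W \<and> openin (Euclidean_space n) (F ` W) \<and>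
     (\<forall>x\<in>W. G (F x) = x) \<and> (\<forall>j<n. smooth_on_open n (F ` W) (\<lambda>y. G y j))"

lemma smooth_inverse_on_subset:
  assumes "smooth_inverse_on n W F G" "openin (Euclidean_space n) W'" "W' \<subseteq> W"
  shows "smooth_inverse_on n W' F G"
proof -
  have F: "openin (Euclidean_space n) (F ` W)" "\<And>x. x \<in> W \<Longrightarrow> G (F x) = x"
    "\<And>j. j < n \<Longrightarrow> smooth_on_open n (F ` W) (\<lambda>y. G y j)" "W \<subseteq> ES n"
    using assms(1) openin_subset unfolding smooth_inverse_on_def by blast+
  have "G ` F ` W \<subseteq> ES n" using F by force
  from continuous_map_into_ES[OF F(1,3) this]
  have "openin (subtopology (Euclidean_space n) (F ` W)) {y \<in> topspace (subtopology (Euclidean_space n) (F ` W)). G y \<in> W'}"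
    using assms(2) openin_continuous_map_preimage by blast
  moreover have "{y \<in> topspace (subtopology (Euclidean_space n) (F ` W)). G y \<in> W'} = F ` W'"
    using openin_subset[OF F(1)] assms(3) F(2) by force
  ultimately have "openin (Euclidean_space n) (F ` W')"
    using F(1) openin_trans_full by metis
  then show ?thesis
    unfolding smooth_inverse_on_def using assms F smooth_on_open_subset[OF F(3)]
    by (auto simp: image_mono)
qed

lemma partial_eqI:
  assumes "openin (Euclidean_space n) W" "x \<in> W" "i < n"
    "\<And>t. x(i := t) \<in> W \<Longrightarrow> F (x(i := t)) = t"
  shows "partial i F x = 1"
proof -
  have "\<forall>\<^sub>F t in nhds (x i). F (x(i := t)) = t"
    by (rule eventually_mono[OF eventually_upd_in[OF assms(1-3)] assms(4)])
  then show ?thesis unfolding partial_def by (subst deriv_cong_ev[OF _ refl]) auto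
qed

text \<open>One step of elimination. \<open>A\<close> replaces coordinate \<open>k\<close> by
  \<open>F x k\<close> and is inverted near \<open>p\<close> by some \<open>B\<close>; then
  \<open>F\<close> after \<open>B\<close> also fixes coordinate \<open>k\<close> and is still the
  identity on the hyperplane, so \<open>IH\<close> applies to it. The continuation is passed as a
  hypothesis because the first step, for the last coordinate, and the later steps obtain the nonzero
  derivative from different sources.\<close>

lemma smooth_inverse_step:
  assumes F: "\<And>j. j < n \<Longrightarrow> smooth_on_open n W (\<lambda>x. F x j)" "F ` W \<subseteq> ES n" and p: "p \<in> W"
    and hyp: "\<And>x. x \<in> W \<Longrightarrow> x (n - 1) = 0 \<Longrightarrow> F x = x" "p (n - 1) = 0"
    and k: "k < n" and fix_F: "\<And>x i. x \<in> W \<Longrightarrow> Suc k \<le> i \<Longrightarrow> i < n \<Longrightarrow> F x i = x i"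
    and nz: "partial k (\<lambda>x. F x k) p \<noteq> 0"
    and IH: "\<And>F W. (\<And>j. j < n \<Longrightarrow> smooth_on_open n W (\<lambda>x. F x j)) \<Longrightarrow> F ` W \<subseteq> ES n \<Longrightarrow> p \<in> W \<Longrightarrow>
      (\<And>x. x \<in> W \<Longrightarrow> x (n - 1) = 0 \<Longrightarrow> F x = x) \<Longrightarrow>
      (\<And>x i. x \<in> W \<Longrightarrow> k \<le> i \<Longrightarrow> i < n \<Longrightarrow> F x i = x i) \<Longrightarrow>
      \<exists>W' G. p \<in> W' \<and> W' \<subseteq> W \<and> smooth_inverse_on n W' F G"
  shows "\<exists>W' G. p \<in> W' \<and> W' \<subseteq> W \<and> smooth_inverse_on n W' F G"
proof -
  note W = smooth_on_open_imp_openin[OF F(1)[OF k]]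
  have WE: "W \<subseteq> ES n" using W openin_subset by blast
  let ?P = "partial k (\<lambda>x. F x k)"
  have P: "smooth_on_open n W ?P" by (rule smooth_on_open_imp_partial[OF F(1) k]) (rule k)
  obtain d where d: "d > 0" "\<And>z. z \<in> W \<Longrightarrow> z \<in> cube n p d \<Longrightarrow> \<bar>?P z - ?P p\<bar> < \<bar>?P p\<bar>"
    using continuous_on_cubeD[OF WE smooth_on_open_imp_continuous[OF P] p, of "\<bar>?P p\<bar>"] nz by auto
  obtain d' where d': "d' > 0" "cube n p d' \<subseteq> W" using openin_Euclidean_space_cube[OF W p] by blast
  define C where "C = cube n p (min d d')"
  have C: "openin (Euclidean_space n) C" "p \<in> C" "C \<subseteq> W"
    using d(1) d' p WE cube_mono[of "min d d'" d' n p] by (auto simp: C_def openin_cube intro!: in_cube_self)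
  have CP: "?P x \<noteq> 0" if "x \<in> C" for x
    using d(2)[of x] that C cube_mono[of "min d d'" d] by (force simp: C_def)
  define A where "A x = x(k := F x k)" for x
  \<comment> \<open>Two points with the same image under \<open>A\<close> differ at most in
    coordinate \<open>k\<close>. If they did differ, Rolle's argument would give a zero of the
    nonvanishing partial derivative between them, inside the cube.\<close>
  have inj: "inj_on A C"
  proof (rule inj_onI)
    fix x y assume xy: "x \<in> C" "y \<in> C" "A x = A y"
    have y: "y = x(k := y k)"
    proof
      fix j show "y j = (x(k := y k)) j" using fun_cong[OF xy(3), of j] by (auto simp: A_def)
    qed
    have inC: "x(k := t) \<in> C" if "\<bar>t - x k\<bar> \<le> \<bar>y k - x k\<bar>" "t \<in> closed_segment (x k) (y k)" for t
    proof -
      have "\<bar>x k - p k\<bar> < min d d'" "\<bar>y k - p k\<bar> < min d d'"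
        using xy(1,2) k by (auto simp: C_def cube_def)
      then have "\<bar>t - p k\<bar> < min d d'"
        using that(2) by (simp add: closed_segment_eq_real_ivl split: if_splits) linarith+
      then show ?thesis using xy(1) k by (auto simp: C_def cube_def mem_ES)
    qed
    have Fxy: "F x k = F y k" using fun_cong[OF xy(3), of k] by (simp add: A_def)
    show "x = y"
    proof (rule ccontr)
      assume "x \<noteq> y"
      then have ne: "x k \<noteq> y k" using y by (metis fun_upd_triv)
      have der: "((\<lambda>s. F (x(k := s)) k) has_real_derivative ?P (x(k := t))) (at t)"
        if "t \<in> closed_segment (x k) (y k)" for t
      proof (rule DERIV_smooth_curve[OF F(1)[OF k] k])
        show "x(k := t) \<in> W"
          using inC[OF _ that] that C by (auto simp: closed_segment_eq_real_ivl split: if_splits)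
      qed
      obtain t where t: "t \<in> closed_segment (x k) (y k)" "?P (x(k := t)) = 0"
      proof -
        have eq: "F (x(k := x k)) k = F (x(k := y k)) k" using Fxy y by (metis fun_upd_triv)
        consider "x k < y k" | "y k < x k" using ne by linarith
        then show ?thesis
        proof cases
          case 1
          then obtain t where "x k < t" "t < y k"
             "F (x(k := y k)) k - F (x(k := x k)) k = (y k - x k) * ?P (x(k := t))"
            using MVT2[OF 1, of "\<lambda>s. F (x(k := s)) k" "\<lambda>t. ?P (x(k := t))"] der
            by (auto simp: closed_segment_eq_real_ivl)
          then show ?thesis using that[of t] eq 1 by (auto simp: closed_segment_eq_real_ivl)
        next
          case 2
          then obtain t where "y k < t" "t < x k"
             "F (x(k := x k)) k - F (x(k := y k)) k = (x k - y k) * ?P (x(k := t))"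
            using MVT2[OF 2, of "\<lambda>s. F (x(k := s)) k" "\<lambda>t. ?P (x(k := t))"] der
            by (auto simp: closed_segment_eq_real_ivl)
          then show ?thesis using that[of t] eq 2 by (auto simp: closed_segment_eq_real_ivl)
        qed
      qed
      have "x(k := t) \<in> C" using inC[OF _ t(1)] t(1) by (auto simp: closed_segment_eq_real_ivl split: if_splits)
      with CP t(2) show False by blast
    qed
  qed
  define B where "B = inv_into C A"
  have BA: "B (A x) = x" if "x \<in> C" for x using inj that by (simp add: B_def)
  define V where "V = A ` C"
  have Fk: "smooth_on_open n C (\<lambda>x. F x k)" by (rule smooth_on_open_subset[OF F(1)[OF k] C(1,3)])
  have V: "openin (Euclidean_space n) V"
    and Bsm: "\<And>H. smooth_on_open n C H \<Longrightarrow> smooth_on_open n V (\<lambda>y. H (B y))"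
    using smooth_inverse_coordinate[OF Fk k, of B V] BA CP by (auto simp: V_def A_def)
  have BV: "B y \<in> C" "A (B y) = y" if "y \<in> V" for y
    using that BA by (auto simp: V_def)
  have Bi: "B y i = y i" if "y \<in> V" "i \<noteq> k" for y i
    using fun_cong[OF BV(2)[OF that(1)], of i] that(2) by (simp add: A_def)
  have Ap: "A p = p" using hyp(1)[OF p hyp(2)] by (simp add: A_def)
  have "\<exists>W' G. p \<in> W' \<and> W' \<subseteq> V \<and> smooth_inverse_on n W' (\<lambda>y. F (B y)) G"
  proof (rule IH)
    show "smooth_on_open n V (\<lambda>y. F (B y) j)" if "j < n" for j
      by (rule Bsm) (rule smooth_on_open_subset[OF F(1)[OF that] C(1,3)])
    show "(\<lambda>y. F (B y)) ` V \<subseteq> ES n" using F(2) BV C by blast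
    show "p \<in> V" using Ap C(2) by (metis V_def image_eqI)
    show "F (B y) i = y i" if "y \<in> V" "k \<le> i" "i < n" for y i
    proof (cases "i = k")
      case True
      then show ?thesis using fun_cong[OF BV(2)[OF that(1)], of k] by (simp add: A_def)
    next
      case False
      then show ?thesis using fix_F[of "B y" i] BV that C Bi by auto
    qed
    show "F (B y) = y" if y: "y \<in> V" "y (n - 1) = 0" for y
    proof -
      \<comment> \<open>Clearing the last coordinate of \<open>B y\<close> stays in the cube, whose
        centre lies on the hyperplane. \<open>A\<close> fixes the resulting point, and a comparison
        of coordinates shows that this point is \<open>y\<close>.\<close>
      let ?z = "(B y)(n - 1 := 0)"
      have zC: "?z \<in> C" using BV(1)[OF y(1)] hyp(2) d d' k
        by (auto simp: C_def cube_def mem_ES)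
      then have "F ?z = ?z" using hyp(1)[of ?z] C by auto
      then have Az: "A ?z = ?z" unfolding A_def by (metis fun_upd_triv)
      have "?z = y"
      proof
        fix j show "?z j = y j"
        proof (cases "j = n - 1 \<or> j \<noteq> k")
          case True then show ?thesis using y Bi by auto
        next
          case False
          then have jk: "j = k" "k \<noteq> n - 1" by auto
          then have "B y (n - 1) = 0" using Bi[OF y(1), of "n - 1"] y by simp
          then have "F (B y) = B y" using hyp(1) BV[OF y(1)] C by blast
          then have "A (B y) = B y" by (simp add: A_def)
          then show ?thesis using BV(2)[OF y(1)] jk by simp
        qed
      qed
      then have "B y = y" "y \<in> W" using BA[OF zC] Az zC C by auto
      then show ?thesis using hyp(1) y(2) by simp
    qed
  qed
  then obtain W2 G where W2: "p \<in> W2" "W2 \<subseteq> V" "smooth_inverse_on n W2 (\<lambda>y. F (B y)) G" by blast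
  \<comment> \<open>\<open>B\<close> carries \<open>W2\<close> back to the original coordinates. The
    image is open because \<open>A\<close> is a smooth inverse of \<open>B\<close>.\<close>
  define W' where "W' = B ` W2"
  have "smooth_inverse_on n V B A"
    unfolding smooth_inverse_on_def
  proof (intro conjI V ballI allI impI BV(2))
    have BVC: "B ` V = C" using BA BV by (force simp: V_def)
    show "openin (Euclidean_space n) (B ` V)" using C BVC by simp
    fix j assume "j < n"
    then show "smooth_on_open n (B ` V) (\<lambda>y. A y j)"
      unfolding BVC by (cases "j = k") (auto simp: A_def Fk smooth_on_open_coord[OF C(1)])
  qed
  moreover have "openin (Euclidean_space n) W2" using W2 by (simp add: smooth_inverse_on_def)
  ultimately have W'o: "openin (Euclidean_space n) W'"
    using smooth_inverse_on_subset W2(2) unfolding W'_def smooth_inverse_on_def by blast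
  have FW': "F ` W' = (\<lambda>y. F (B y)) ` W2" by (auto simp: W'_def)
  have "smooth_inverse_on n W' F (\<lambda>y. B (G y))"
    unfolding smooth_inverse_on_def
  proof (intro conjI W'o ballI allI impI)
    show "openin (Euclidean_space n) (F ` W')" using W2(3) by (simp add: FW' smooth_inverse_on_def)
    show "B (G (F x)) = x" if "x \<in> W'" for x
      using that W2(3) by (auto simp: W'_def smooth_inverse_on_def)
    fix j assume "j < n"
    have "smooth_on_open n V (\<lambda>y. B y j)" by (rule Bsm[OF smooth_on_open_coord[OF C(1)]])
    moreover have "G ` F ` W' \<subseteq> V"
      using W2 unfolding FW' smooth_inverse_on_def by auto
    moreover have "openin (Euclidean_space n) (F ` W')" "\<And>j. j < n \<Longrightarrow> smooth_on_open n (F ` W') (\<lambda>y. G y j)"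
      using W2(3) by (simp_all add: FW' smooth_inverse_on_def)
    ultimately show "smooth_on_open n (F ` W') (\<lambda>y. B (G y) j)"
      using smooth_on_open_compose[where g = G] by blast
  qed
  moreover have "p \<in> W'" using W2(1) Ap BA[OF C(2)] by (metis W'_def image_eqI)
  moreover have "W' \<subseteq> W" using W2 BV C by (auto simp: W'_def)
  ultimately show ?thesis by blast
qed

text \<open>The map is inverted by straightening one coordinate at a time.\<close>

lemma smooth_inverse_fixing_hyperplane:
  assumes n: "0 < n" and F: "\<And>j. j < n \<Longrightarrow> smooth_on_open n W (\<lambda>x. F x j)" "F ` W \<subseteq> ES n" and p: "p \<in> W"
    and hyp: "\<And>x. x \<in> W \<Longrightarrow> x (n - 1) = 0 \<Longrightarrow> F x = x" "p (n - 1) = 0"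
    and nz: "partial (n - 1) (\<lambda>x. F x (n - 1)) p \<noteq> 0"
  shows "\<exists>W' G. p \<in> W' \<and> W' \<subseteq> W \<and> smooth_inverse_on n W' F G"
proof -
  have *: "\<exists>W' G. p \<in> W' \<and> W' \<subseteq> W \<and> smooth_inverse_on n W' F G"
    if "k \<le> n - 1" "\<And>j. j < n \<Longrightarrow> smooth_on_open n W (\<lambda>x. F x j)" "F ` W \<subseteq> ES n" "p \<in> W"
      "\<And>x. x \<in> W \<Longrightarrow> x (n - 1) = 0 \<Longrightarrow> F x = x"
      "\<And>x i. x \<in> W \<Longrightarrow> k \<le> i \<Longrightarrow> i < n \<Longrightarrow> F x i = x i" for k F W
    using that
  proof (induction k arbitrary: F W)
    case 0
    have W: "openin (Euclidean_space n) W" using 0(2)[OF n] smooth_on_open_imp_openin by blast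
    have id: "F x = x" if "x \<in> W" for x
      by (rule ES_eqI[of _ n]) (use that 0(3,6) openin_subset[OF W] in auto)
    then have "F ` W = W" by auto
    then have "smooth_inverse_on n W F (\<lambda>x. x)"
      unfolding smooth_inverse_on_def using W id smooth_on_open_coord[OF W] by auto
    then show ?case using 0 by blast
  next
    case (Suc k)
    have W: "openin (Euclidean_space n) W" using Suc.prems(2)[OF n] smooth_on_open_imp_openin by blast
    \<comment> \<open>Here \<open>k < n - 1\<close>, so varying coordinate \<open>k\<close> of
      \<open>p\<close> does not leave the hyperplane, on which \<open>F\<close> is the identity. The
      hypothesis on the derivative is thus spent on the last coordinate alone.\<close>
    have "partial k (\<lambda>x. F x k) p = 1"
    proof (rule partial_eqI[OF W Suc.prems(4)])
      show "F (p(k := t)) k = t" if "p(k := t) \<in> W" for t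
        using fun_cong[OF Suc.prems(5)[OF that], of k] hyp(2) Suc.prems(1) by (simp add: fun_upd_def)
    qed (use Suc.prems in auto)
    then show ?case
      using Suc.prems Suc.IH hyp(2) by (intro smooth_inverse_step[where k = k and n = n and W = W and F = F]) auto
  qed
  show ?thesis
  proof (rule smooth_inverse_step[where k = "n - 1", OF F p hyp])
    show "\<exists>W' G. p \<in> W' \<and> W' \<subseteq> W \<and> smooth_inverse_on n W' F G"
      if "\<And>j. j < n \<Longrightarrow> smooth_on_open n W (\<lambda>x. F x j)" "F ` W \<subseteq> ES n" "p \<in> W"
        "\<And>x. x \<in> W \<Longrightarrow> x (n - 1) = 0 \<Longrightarrow> F x = x"
        "\<And>x i. x \<in> W \<Longrightarrow> n - 1 \<le> i \<Longrightarrow> i < n \<Longrightarrow> F x i = x i" for F W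
      by (rule *[OF order_refl that])
  qed (use n nz in auto)
qed

section \<open>Smooth functions on arbitrary subsets\<close>

lemma smooth_on_subset:
  assumes "smooth_on n S F" "T \<subseteq> S" shows "smooth_on n T F"
  unfolding smooth_on_def
proof
  fix x assume "x \<in> T"
  then obtain W F' where "x \<in> W" "smooth_on_open n W F'" "\<forall>y\<in>W \<inter> S. F' y = F y"
    using assms unfolding smooth_on_def by blast
  then show "\<exists>W F'. x \<in> W \<and> smooth_on_open n W F' \<and> (\<forall>y\<in>W \<inter> T. F' y = F y)"
    using assms(2) by (intro exI[of _ W] exI[of _ F']) auto
qed

lemma smooth_on_cong:
  assumes "smooth_on n S F" "\<And>x. x \<in> S \<Longrightarrow> F x = G x" shows "smooth_on n S G"
  using assms unfolding smooth_on_def by (metis Int_iff)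

lemma smooth_on_openI: "smooth_on_open n W F \<Longrightarrow> smooth_on n W F"
  unfolding smooth_on_def by blast

lemma smooth_on_local:
  assumes "\<And>x. x \<in> S \<Longrightarrow> \<exists>T. open T \<and> x \<in> T \<and> smooth_on n (S \<inter> T) F"
  shows "smooth_on n S F"
  unfolding smooth_on_def
proof
  fix x assume "x \<in> S"
  then obtain T where T: "open T" "x \<in> T" "smooth_on n (S \<inter> T) F" using assms by blast
  then obtain W F' where W: "x \<in> W" "smooth_on_open n W F'" "\<forall>y\<in>W \<inter> (S \<inter> T). F' y = F y"
    using \<open>x \<in> S\<close> unfolding smooth_on_def by blast
  note Wo = smooth_on_open_imp_openin[OF W(2)]
  have "openin (Euclidean_space n) (W \<inter> (ES n \<inter> T))"
    using T(1) openin_Euclidean_space by (intro openin_Int[OF Wo]) blast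
  moreover have "W \<inter> (ES n \<inter> T) = W \<inter> T" using openin_subset[OF Wo] by blast
  ultimately have "smooth_on_open n (W \<inter> T) F'"
    using smooth_on_open_subset[OF W(2)] by auto
  then show "\<exists>W F'. x \<in> W \<and> smooth_on_open n W F' \<and> (\<forall>y\<in>W \<inter> S. F' y = F y)"
    using W T by (intro exI[of _ "W \<inter> T"] exI[of _ F']) auto
qed

lemma smooth_on_subset_ES: "smooth_on n S F \<Longrightarrow> S \<subseteq> ES n"
  unfolding smooth_on_def using smooth_on_open_imp_openin openin_subset by (metis subsetD subsetI)

lemma smooth_on_imp_continuous:
  assumes "smooth_on n S F" shows "continuous_on S F"
  unfolding continuous_on_eq_continuous_within
proof
  fix x assume x: "x \<in> S"
  then obtain W F' where W: "x \<in> W" "smooth_on_open n W F'" "\<forall>y\<in>W \<inter> S. F' y = F y"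
    using assms unfolding smooth_on_def by blast
  obtain T where T: "open T" "W = ES n \<inter> T"
    using smooth_on_open_imp_openin[OF W(2)] openin_Euclidean_space by blast
  have WS: "W \<inter> S = S \<inter> T" using T smooth_on_subset_ES[OF assms] by blast
  have "continuous_on (S \<inter> T) F'"
    using continuous_on_subset[OF smooth_on_open_imp_continuous[OF W(2)]] WS by (metis Int_lower1)
  then have "continuous_on (S \<inter> T) F"
    by (rule continuous_on_eq) (use W WS in auto)
  then have "continuous (at x within S \<inter> T) F"
    using x W T by (simp add: continuous_on_eq_continuous_within)
  then show "continuous (at x within S) F"
    using at_within_nhd[of x T "S \<inter> T" S] T W x by auto
qed

text \<open>The components of \<open>g\<close> have separate local extensions; on a common
  neighbourhood they form a map \<open>g'\<close>, padded by zeros. The extension of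
  \<open>H\<close> can be composed with \<open>g'\<close> where \<open>g'\<close> takes values in
  its domain, which is an open set by continuity.\<close>

lemma smooth_on_compose:
  assumes H: "smooth_on k T H" and g: "\<And>j. j < k \<Longrightarrow> smooth_on n S (\<lambda>x. g x j)"
    and S: "S \<subseteq> ES n" and gT: "g ` S \<subseteq> T"
  shows "smooth_on n S (\<lambda>x. H (g x))"
  unfolding smooth_on_def
proof
  fix x assume x: "x \<in> S"
  have TE: "T \<subseteq> ES k" by (rule smooth_on_subset_ES[OF H])
  obtain V H' where V: "g x \<in> V" "smooth_on_open k V H'" "\<forall>y\<in>V \<inter> T. H' y = H y"
    using H x gT unfolding smooth_on_def by blast
  have "\<exists>W G. x \<in> W \<and> smooth_on_open n W G \<and> (\<forall>y\<in>W \<inter> S. G y = g y j)" if "j < k" for j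
    using g[OF that] x unfolding smooth_on_def by blast
  then obtain W G where W: "\<And>j. j < k \<Longrightarrow> x \<in> W j" "\<And>j. j < k \<Longrightarrow> smooth_on_open n (W j) (G j)"
    "\<And>j y. j < k \<Longrightarrow> y \<in> W j \<Longrightarrow> y \<in> S \<Longrightarrow> G j y = g y j" by (metis IntI)
  \<comment> \<open>The factor \<open>ES n\<close> matters if \<open>k\<close> is 0, when the
    intersection is the whole type.\<close>
  define W0 where "W0 = ES n \<inter> (\<Inter>j\<in>{..<k}. W j)"
  have W0: "openin (Euclidean_space n) W0"
  proof (cases "k = 0")
    case False
    then have "openin (Euclidean_space n) (\<Inter>j\<in>{..<k}. W j)"
      by (intro openin_INT2) (auto intro: smooth_on_open_imp_openin[OF W(2)])
    then show ?thesis unfolding W0_def by (intro openin_Int) simp_all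
  qed (simp add: W0_def)
  define g' where "g' y = (\<lambda>j. if j < k then G j y else 0)" for y
  have g': "smooth_on_open n W0 (\<lambda>y. g' y j)" if "j < k" for j
    using smooth_on_open_subset[OF W(2)[OF that] W0] that by (auto simp: W0_def g'_def)
  have g'E: "g' ` W0 \<subseteq> ES k" by (auto simp: g'_def mem_ES)
  have g'_eq: "g' y = g y" if "y \<in> W0" "y \<in> S" for y
  proof (rule ES_eqI[of _ k])
    show "g y \<in> ES k" using that gT TE by blast
  qed (use that W(3) in \<open>auto simp: g'_def mem_ES W0_def\<close>)
  define W1 where "W1 = {y \<in> topspace (subtopology (Euclidean_space n) W0). g' y \<in> V}"
  have "openin (subtopology (Euclidean_space n) W0) W1"
    unfolding W1_def
    by (rule openin_continuous_map_preimage[OF continuous_map_into_ES[OF W0 g' g'E] smooth_on_open_imp_openin[OF V(2)]])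
  then have W1: "openin (Euclidean_space n) W1" using W0 openin_trans_full by blast
  have W1': "W1 \<subseteq> W0" "g' ` W1 \<subseteq> V" by (auto simp: W1_def)
  have "smooth_on_open n W1 (\<lambda>y. H' (g' y))"
    by (rule smooth_on_open_compose[OF W1 V(2) smooth_on_open_subset[OF g' W1 W1'(1)] W1'(2)])
  moreover have xW0: "x \<in> W0" using W x S by (auto simp: W0_def)
  moreover have "x \<in> W1" using xW0 g'_eq[OF xW0 x] V x S by (auto simp: W1_def)
  moreover have "H' (g' y) = H (g y)" if "y \<in> W1 \<inter> S" for y
    using that g'_eq[of y] W1' V(3) gT by (metis IntD1 IntD2 IntI image_subset_iff subsetD)
  ultimately show "\<exists>W F'. x \<in> W \<and> smooth_on_open n W F' \<and> (\<forall>y\<in>W \<inter> S. F' y = H (g y))"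
    by (intro exI[of _ W1] exI[of _ "\<lambda>y. H' (g' y)"]) blast
qed

text \<open>Downwards, an extension is restricted to the smaller space. Upwards, it is composed with
  the first \<open>k\<close> coordinates, hence extended independently of the others. The lemma
  passes between charts of a manifold and charts of its boundary, its levels and other
  slices.\<close>

lemma smooth_on_dim:
  assumes "k \<le> n" "S \<subseteq> ES k" shows "smooth_on n S F \<longleftrightarrow> smooth_on k S F"
proof
  assume F: "smooth_on n S F"
  show "smooth_on k S F"
    unfolding smooth_on_def
  proof
    fix x assume x: "x \<in> S"
    then obtain W F' where W: "x \<in> W" "smooth_on_open n W F'" "\<forall>y\<in>W \<inter> S. F' y = F y"
      using F unfolding smooth_on_def by blast
    obtain T where T: "open T" "W = ES n \<inter> T"
      using smooth_on_open_imp_openin[OF W(2)] openin_Euclidean_space by blast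
    have "W \<inter> ES k = ES k \<inter> T" using T assms(1) ES_mono by blast
    then have Wo: "openin (Euclidean_space k) (W \<inter> ES k)"
      using T openin_Euclidean_space by auto
    have "smooth_on_open k (W \<inter> ES k) F'"
    proof (rule smooth_on_open_coinduct[where C = "{F. smooth_on_open n W F}", OF Wo])
      fix G i assume G: "G \<in> {F. smooth_on_open n W F}"
      then show "continuous_on (W \<inter> ES k) G"
        using continuous_on_subset smooth_on_open_imp_continuous by blast
      assume "i < k"
      then show "\<exists>G'\<in>{F. smooth_on_open n W F}. \<forall>x\<in>W \<inter> ES k. ((\<lambda>t. G (x(i := t))) has_real_derivative G' x) (at (x i))"
        using G assms(1)
        by (intro bexI[of _ "partial i G"]) (auto intro: smooth_on_open_imp_partial smooth_on_open_imp_DERIV)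
    qed (use W in auto)
    then show "\<exists>W F'. x \<in> W \<and> smooth_on_open k W F' \<and> (\<forall>y\<in>W \<inter> S. F' y = F y)"
      using W x assms by (intro exI[of _ "W \<inter> ES k"] exI[of _ F']) auto
  qed
next
  assume F: "smooth_on k S F"
  have S: "S \<subseteq> ES n" using assms ES_mono by blast
  have "smooth_on n S (\<lambda>x. x j)" for j
    by (rule smooth_on_subset[OF smooth_on_openI[OF smooth_on_open_coord[of n "ES n"]] S]) simp
  from smooth_on_compose[OF F this S, of "\<lambda>x. x"] show "smooth_on n S F" by simp
qed

lemma smooth_on_coord: "S \<subseteq> ES n \<Longrightarrow> smooth_on n S (\<lambda>x. x i)"
  by (rule smooth_on_subset[OF smooth_on_openI[OF smooth_on_open_coord[of n "ES n"]]]) auto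

section \<open>Spaces locally modelled on subsets of Euclidean space\<close>

text \<open>Charts onto arbitrary subsets of Euclidean space cover manifolds with boundary, their subsets
  and their cylinders at once.\<close>

definition premanifold :: "nat \<Rightarrow> 'a mfd \<Rightarrow> bool" where
  "premanifold n M \<longleftrightarrow>
     (\<forall>(U, \<phi>)\<in>atlas M. openin (mtop M) U \<and> \<phi> ` U \<subseteq> ES n \<and>
        homeomorphic_map (subtopology (mtop M) U) (top_of_set (\<phi> ` U)) \<phi>) \<and>
     \<Union> (fst ` atlas M) = points M \<and>
     (\<forall>c\<in>atlas M. \<forall>d\<in>atlas M. smooth_transition n c d)"

text \<open>Only the values on \<open>S\<close> enter, while the charts remain those of
  \<open>M\<close>. Thus boundaries and half-open collars can be domains of smooth functions without
  carrying atlases of their own.\<close>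

definition msmooth :: "nat \<Rightarrow> 'a mfd \<Rightarrow> 'a set \<Rightarrow> ('a \<Rightarrow> real) \<Rightarrow> bool" where
  "msmooth n M S f \<longleftrightarrow> (\<forall>(U, \<phi>)\<in>atlas M. smooth_on n (\<phi> ` (U \<inter> S)) (f \<circ> inv_into U \<phi>))"

definition smap :: "nat \<Rightarrow> nat \<Rightarrow> 'a mfd \<Rightarrow> 'a set \<Rightarrow> 'b mfd \<Rightarrow> ('a \<Rightarrow> 'b) \<Rightarrow> bool" where
  "smap n k M S N g \<longleftrightarrow> continuous_map (subtopology (mtop M) S) (mtop N) g \<and>
     (\<forall>(V, \<psi>)\<in>atlas N. \<forall>j<k. msmooth n M {p \<in> S. g p \<in> V} (\<lambda>p. \<psi> (g p) j))"

lemma premanifold_chart: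
  assumes "premanifold n M" "(U, \<phi>) \<in> atlas M"
  shows chart_openin: "openin (mtop M) U"
    and chart_image: "\<phi> ` U \<subseteq> ES n"
    and chart_homeomorphic: "homeomorphic_map (subtopology (mtop M) U) (top_of_set (\<phi> ` U)) \<phi>"
    and chart_subset: "U \<subseteq> points M"
    and chart_inj: "inj_on \<phi> U"
proof -
  have "case (U, \<phi>) of (U, \<phi>) \<Rightarrow> openin (mtop M) U \<and> \<phi> ` U \<subseteq> ES n \<and>
        homeomorphic_map (subtopology (mtop M) U) (top_of_set (\<phi> ` U)) \<phi>"
    using assms(1)[unfolded premanifold_def, THEN conjunct1] assms(2) by (rule bspec)
  then show *: "openin (mtop M) U" "\<phi> ` U \<subseteq> ES n"
    "homeomorphic_map (subtopology (mtop M) U) (top_of_set (\<phi> ` U)) \<phi>"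
    by simp_all
  show "U \<subseteq> points M" using *(1) openin_subset by blast
  then show "inj_on \<phi> U"
    using homeomorphic_imp_injective_map[OF *(3)] by (simp add: Int_absorb1)
qed

lemma premanifold_cover:
  assumes "premanifold n M" "p \<in> points M"
  obtains U \<phi> where "(U, \<phi>) \<in> atlas M" "p \<in> U"
proof -
  have "p \<in> \<Union> (fst ` atlas M)" using assms unfolding premanifold_def by blast
  then show ?thesis using that by force
qed

lemma premanifold_transition:
  assumes "premanifold n M" "(U, \<phi>) \<in> atlas M" "(V, \<psi>) \<in> atlas M" "j < n"
  shows "smooth_on n (\<phi> ` (U \<inter> V)) (\<lambda>x. \<psi> (inv_into U \<phi> x) j)"
proof -
  have "smooth_transition n (U, \<phi>) (V, \<psi>)" using assms(1-3) unfolding premanifold_def by blast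
  then show ?thesis using assms(4) by (simp add: smooth_transition_def smooth_map_on_def)
qed

lemma chart_image_Int_open:
  assumes "premanifold n M" "(U, \<phi>) \<in> atlas M" "openin (mtop M) W"
  obtains T where "open T" "\<phi> ` (U \<inter> W) = \<phi> ` U \<inter> T"
proof -
  note U = premanifold_chart[OF assms(1,2)]
  have "openin (subtopology (mtop M) U) (U \<inter> W)"
    using assms(3) by (simp add: openin_subtopology_Int2)
  then have "openin (top_of_set (\<phi> ` U)) (\<phi> ` (U \<inter> W))"
    using homeomorphic_map_openness[OF U(3), of "U \<inter> W"] U(4) by auto
  then show ?thesis using that by (auto simp: openin_open)
qed

lemma chart_continuous:
  assumes "premanifold n M" "(U, \<phi>) \<in> atlas M"
  shows "continuous_map (subtopology (mtop M) U) euclidean \<phi>"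
  using homeomorphic_imp_continuous_map[OF chart_homeomorphic[OF assms]]
  by (simp add: continuous_map_in_subtopology)

lemma chart_inverse_continuous:
  assumes "premanifold n M" "(U, \<phi>) \<in> atlas M"
  shows "continuous_map (top_of_set (\<phi> ` U)) (mtop M) (inv_into U \<phi>)"
proof -
  note U = premanifold_chart[OF assms]
  obtain g where g: "homeomorphic_maps (subtopology (mtop M) U) (top_of_set (\<phi> ` U)) \<phi> g"
    using U(3) homeomorphic_map_maps by blast
  then have "continuous_map (top_of_set (\<phi> ` U)) (mtop M) g" "\<And>p. p \<in> U \<Longrightarrow> g (\<phi> p) = p"
    using U(4) by (auto simp: homeomorphic_maps_def continuous_map_in_subtopology)
  then show ?thesis
    by (elim continuous_map_eq) (auto simp: inv_into_f_f[OF U(5)])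
qed

section \<open>Smooth functions on subsets of a premanifold\<close>

lemma msmooth_subset:
  assumes "msmooth n M S f" "T \<subseteq> S" shows "msmooth n M T f"
  unfolding msmooth_def
proof clarify
  fix U \<phi> assume "(U, \<phi>) \<in> atlas M"
  then have "smooth_on n (\<phi> ` (U \<inter> S)) (f \<circ> inv_into U \<phi>)" using assms by (auto simp: msmooth_def)
  then show "smooth_on n (\<phi> ` (U \<inter> T)) (f \<circ> inv_into U \<phi>)"
    by (rule smooth_on_subset) (use assms(2) in blast)
qed

lemma msmooth_cong:
  assumes "premanifold n M" "msmooth n M S f" "\<And>p. p \<in> S \<Longrightarrow> p \<in> points M \<Longrightarrow> f p = g p"
  shows "msmooth n M S g"
  unfolding msmooth_def
proof clarify
  fix U \<phi> assume U: "(U, \<phi>) \<in> atlas M"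
  then have "smooth_on n (\<phi> ` (U \<inter> S)) (f \<circ> inv_into U \<phi>)" using assms by (auto simp: msmooth_def)
  then show "smooth_on n (\<phi> ` (U \<inter> S)) (g \<circ> inv_into U \<phi>)"
    by (rule smooth_on_cong)
       (use chart_subset[OF assms(1) U] assms(3) in \<open>auto simp: inv_into_f_f[OF chart_inj[OF assms(1) U]]\<close>)
qed

text \<open>One chart around each point suffices: any other chart differs from it by a smooth
  transition, and \<open>smooth_on_local\<close> puts the neighbourhoods together.\<close>

lemma msmoothI_chart:
  assumes M: "premanifold n M"
    and *: "\<And>p. p \<in> S \<Longrightarrow> p \<in> points M \<Longrightarrow> \<exists>U \<phi> W. (U, \<phi>) \<in> atlas M \<and> p \<in> U \<and> openin (mtop M) W \<and> p \<in> W \<and>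
       smooth_on n (\<phi> ` (U \<inter> S \<inter> W)) (f \<circ> inv_into U \<phi>)"
  shows "msmooth n M S f"
  unfolding msmooth_def
proof clarify
  fix U' \<phi>' assume U': "(U', \<phi>') \<in> atlas M"
  note cU' = premanifold_chart[OF M U']
  show "smooth_on n (\<phi>' ` (U' \<inter> S)) (f \<circ> inv_into U' \<phi>')"
  proof (rule smooth_on_local)
    fix x assume "x \<in> \<phi>' ` (U' \<inter> S)"
    then obtain p where p: "p \<in> U'" "p \<in> S" "x = \<phi>' p" by blast
    then obtain U \<phi> W where U: "(U, \<phi>) \<in> atlas M" "p \<in> U" "openin (mtop M) W" "p \<in> W"
      "smooth_on n (\<phi> ` (U \<inter> S \<inter> W)) (f \<circ> inv_into U \<phi>)" using *[of p] cU'(4) by blast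
    note cU = premanifold_chart[OF M U(1)]
    have "openin (mtop M) (U \<inter> W)" using cU(1) U(3) by blast
    from chart_image_Int_open[OF M U' this] obtain T where
      T: "open T" "\<phi>' ` (U' \<inter> (U \<inter> W)) = \<phi>' ` U' \<inter> T" by blast
    have inv': "inv_into U' \<phi>' (\<phi>' q) = q" if "q \<in> U'" for q using cU'(5) that by simp
    have inv: "inv_into U \<phi> (\<phi> q) = q" if "q \<in> U" for q using cU(5) that by simp
    have eq: "\<phi>' ` (U' \<inter> S) \<inter> T = \<phi>' ` (U' \<inter> S \<inter> U \<inter> W)"
    proof (intro equalityI subsetI)
      fix y assume "y \<in> \<phi>' ` (U' \<inter> S) \<inter> T"
      then obtain q where q: "q \<in> U'" "q \<in> S" "y = \<phi>' q" "y \<in> T" by blast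
      then have "y \<in> \<phi>' ` (U' \<inter> (U \<inter> W))" using T(2) by blast
      then have "q \<in> U \<inter> W" using q cU'(5) by (auto dest: inj_onD)
      then show "y \<in> \<phi>' ` (U' \<inter> S \<inter> U \<inter> W)" using q by blast
    next
      fix y assume "y \<in> \<phi>' ` (U' \<inter> S \<inter> U \<inter> W)"
      moreover from this have "y \<in> \<phi>' ` U' \<inter> T" unfolding T(2)[symmetric] by blast
      ultimately show "y \<in> \<phi>' ` (U' \<inter> S) \<inter> T" by blast
    qed
    have "smooth_on n (\<phi>' ` (U' \<inter> S) \<inter> T) (\<lambda>x. (f \<circ> inv_into U \<phi>) (\<phi> (inv_into U' \<phi>' x)))"
      unfolding eq
    proof (rule smooth_on_compose[OF U(5)])
      show "smooth_on n (\<phi>' ` (U' \<inter> S \<inter> U \<inter> W)) (\<lambda>x. \<phi> (inv_into U' \<phi>' x) j)" if "j < n" for j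
        by (rule smooth_on_subset[OF premanifold_transition[OF M U' U(1) that]]) blast
      show "\<phi>' ` (U' \<inter> S \<inter> U \<inter> W) \<subseteq> ES n" using cU'(2) by blast
      show "(\<lambda>x. \<phi> (inv_into U' \<phi>' x)) ` \<phi>' ` (U' \<inter> S \<inter> U \<inter> W) \<subseteq> \<phi> ` (U \<inter> S \<inter> W)"
        using inv' by auto
    qed
    then have "smooth_on n (\<phi>' ` (U' \<inter> S) \<inter> T) (f \<circ> inv_into U' \<phi>')"
      by (rule smooth_on_cong) (unfold eq, use inv inv' in auto)
    moreover have "x \<in> T" using T(2) p U by blast
    ultimately show "\<exists>T. open T \<and> x \<in> T \<and> smooth_on n (\<phi>' ` (U' \<inter> S) \<inter> T) (f \<circ> inv_into U' \<phi>')"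
      using T(1) by blast
  qed
qed

lemma msmooth_local:
  assumes M: "premanifold n M"
    and *: "\<And>p. p \<in> S \<Longrightarrow> p \<in> points M \<Longrightarrow> \<exists>W. openin (mtop M) W \<and> p \<in> W \<and> msmooth n M (S \<inter> W) f"
  shows "msmooth n M S f"
proof (rule msmoothI_chart[OF M])
  fix p assume p: "p \<in> S" "p \<in> points M"
  obtain U \<phi> where U: "(U, \<phi>) \<in> atlas M" "p \<in> U" by (rule premanifold_cover[OF M p(2)])
  obtain W where W: "openin (mtop M) W" "p \<in> W" "msmooth n M (S \<inter> W) f" using * p by blast
  then have "smooth_on n (\<phi> ` (U \<inter> S \<inter> W)) (f \<circ> inv_into U \<phi>)"
    using U(1) by (auto simp: msmooth_def Int_assoc)
  then show "\<exists>U \<phi> W. (U, \<phi>) \<in> atlas M \<and> p \<in> U \<and> openin (mtop M) W \<and> p \<in> W \<and>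
       smooth_on n (\<phi> ` (U \<inter> S \<inter> W)) (f \<circ> inv_into U \<phi>)" using U W by blast
qed

lemma msmooth_chart:
  assumes "premanifold n M" "(V, \<psi>) \<in> atlas M" "j < n"
  shows "msmooth n M V (\<lambda>p. \<psi> p j)"
  unfolding msmooth_def using premanifold_transition[OF assms(1) _ assms(2,3)] by (auto simp: o_def)

text \<open>The source of all algebra with smooth functions on \<open>M\<close>: sums, products,
  constants and one-variable composites are smooth functions of finitely many real variables applied
  to smooth functions.\<close>

lemma msmooth_lift:
  assumes M: "premanifold n M" and H: "smooth_on k T H"
    and g: "\<And>j. j < k \<Longrightarrow> msmooth n M S (\<lambda>p. g p j)" "\<And>p. p \<in> S \<Longrightarrow> p \<in> points M \<Longrightarrow> g p \<in> T"
  shows "msmooth n M S (\<lambda>p. H (g p))"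
  unfolding msmooth_def
proof clarify
  fix U \<phi> assume U: "(U, \<phi>) \<in> atlas M"
  note cU = premanifold_chart[OF M U]
  have "smooth_on n (\<phi> ` (U \<inter> S)) (\<lambda>x. H (g (inv_into U \<phi> x)))"
  proof (rule smooth_on_compose[OF H])
    show "smooth_on n (\<phi> ` (U \<inter> S)) (\<lambda>x. g (inv_into U \<phi> x) j)" if "j < k" for j
      using g(1)[OF that] U unfolding msmooth_def by (auto simp: o_def)
    show "(\<lambda>x. g (inv_into U \<phi> x)) ` \<phi> ` (U \<inter> S) \<subseteq> T"
      using g(2) cU(4) by (auto simp: inv_into_f_f[OF cU(5)])
  qed (use cU(2) in blast)
  then show "smooth_on n (\<phi> ` (U \<inter> S)) ((\<lambda>p. H (g p)) \<circ> inv_into U \<phi>)"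
    by (simp add: o_def)
qed

lemma openin_ES [simp]: "openin (Euclidean_space n) (ES n)" by simp

lemma msmooth_add:
  assumes M: "premanifold n M" and "msmooth n M S f" "msmooth n M S g"
  shows "msmooth n M S (\<lambda>p. f p + g p)"
proof -
  have "smooth_on 2 (ES 2) (\<lambda>y. y 0 + y 1)"
    by (intro smooth_on_openI smooth_on_open_add smooth_on_open_coord) simp_all
  from msmooth_lift[OF M this, of S "\<lambda>p j. if j = 0 then f p else if j = 1 then g p else 0"] assms
  show ?thesis by (fastforce simp: mem_ES less_2_cases_iff)
qed

lemma msmooth_mult:
  assumes M: "premanifold n M" and "msmooth n M S f" "msmooth n M S g"
  shows "msmooth n M S (\<lambda>p. f p * g p)"
proof -
  have "smooth_on 2 (ES 2) (\<lambda>y. y 0 * y 1)"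
    by (intro smooth_on_openI smooth_on_open_mult smooth_on_open_coord) simp_all
  from msmooth_lift[OF M this, of S "\<lambda>p j. if j = 0 then f p else if j = 1 then g p else 0"] assms
  show ?thesis by (fastforce simp: mem_ES less_2_cases_iff)
qed

lemma msmooth_const: 
  assumes M: "premanifold n M" shows "msmooth n M S (\<lambda>_. c)"
proof -
  have "smooth_on 0 (ES 0) (\<lambda>y. c)" by (intro smooth_on_openI smooth_on_open_const) simp
  from msmooth_lift[OF M this, of S "\<lambda>_ _. 0"] show ?thesis by (simp add: mem_ES)
qed

lemma msmooth_real:
  assumes M: "premanifold n M" and f: "smooth_real f UNIV" and g: "msmooth n M S g"
  shows "msmooth n M S (\<lambda>p. f (g p))"
proof -
  have "smooth_on 1 (ES 1) (\<lambda>y. f (y 0))"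
    by (intro smooth_on_openI smooth_real_compose[OF f] smooth_on_open_coord) simp_all
  from msmooth_lift[OF M this, of S "\<lambda>p j. if j = 0 then g p else 0"] g
  show ?thesis by (simp add: mem_ES)
qed

lemma continuous_map_local:
  assumes "\<And>p. p \<in> topspace X \<Longrightarrow> \<exists>W. openin X W \<and> p \<in> W \<and> continuous_map (subtopology X W) Y f"
  shows "continuous_map X Y f"
proof -
  have fY: "f p \<in> topspace Y" if "p \<in> topspace X" for p
    using assms[OF that] openin_subset by (fastforce simp: continuous_map_def)
  show ?thesis
    unfolding continuous_map_def
  proof (intro conjI allI impI)
    fix V assume V: "openin Y V"
    show "openin X {p \<in> topspace X. f p \<in> V}"
    proof (subst openin_subopen, clarify)
      fix p assume p: "p \<in> topspace X" "f p \<in> V"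
      then obtain W where W: "openin X W" "p \<in> W" "continuous_map (subtopology X W) Y f"
        using assms by blast
      have "openin (subtopology X W) {q \<in> topspace (subtopology X W). f q \<in> V}"
        using W(3) V openin_continuous_map_preimage by blast
      then have "openin X {q \<in> topspace (subtopology X W). f q \<in> V}"
        using W(1) openin_trans_full by blast
      then show "\<exists>T. openin X T \<and> p \<in> T \<and> T \<subseteq> {p \<in> topspace X. f p \<in> V}"
        using p W by (intro exI[of _ "{q \<in> topspace (subtopology X W). f q \<in> V}"]) auto
    qed
  qed (use fY in auto)
qed

lemma msmooth_continuous:
  assumes M: "premanifold n M" and f: "msmooth n M S f"
  shows "continuous_map (subtopology (mtop M) S) euclideanreal f"
proof (rule continuous_map_local)
  fix p assume "p \<in> topspace (subtopology (mtop M) S)"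
  then have p: "p \<in> S" "p \<in> points M" by auto
  obtain U \<phi> where U: "(U, \<phi>) \<in> atlas M" "p \<in> U" by (rule premanifold_cover[OF M p(2)])
  note cU = premanifold_chart[OF M U(1)]
  have "continuous_on (\<phi> ` (U \<inter> S)) (f \<circ> inv_into U \<phi>)"
    using f U(1) smooth_on_imp_continuous unfolding msmooth_def by blast
  then have 1: "continuous_map (top_of_set (\<phi> ` (U \<inter> S))) euclideanreal (f \<circ> inv_into U \<phi>)"
    by simp
  have 2: "continuous_map (subtopology (mtop M) (U \<inter> S)) (top_of_set (\<phi> ` (U \<inter> S))) \<phi>"
    using continuous_map_from_subtopology_mono[OF chart_continuous[OF M U(1)], of "U \<inter> S"]
    by (auto simp: continuous_map_in_subtopology)
  have "continuous_map (subtopology (mtop M) (U \<inter> S)) euclideanreal ((f \<circ> inv_into U \<phi>) \<circ> \<phi>)"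
    by (rule continuous_map_compose[OF 2 1])
  then have "continuous_map (subtopology (mtop M) (U \<inter> S)) euclideanreal f"
    by (rule continuous_map_eq) (use cU(5) in auto)
  then have *: "continuous_map (subtopology (subtopology (mtop M) S) (U \<inter> S)) euclideanreal f"
    by (simp add: subtopology_subtopology Int_commute Int_left_commute)
  have "openin (subtopology (mtop M) S) (U \<inter> S)"
    using cU(1) by (simp add: openin_subtopology_Int)
  then show "\<exists>W. openin (subtopology (mtop M) S) W \<and> p \<in> W \<and>
      continuous_map (subtopology (subtopology (mtop M) S) W) euclideanreal f"
    using * p U(2) by blast
qed

section \<open>Smooth maps on subsets\<close>

lemma smapD:
  assumes "smap n k M S N g"
  shows smap_continuous: "continuous_map (subtopology (mtop M) S) (mtop N) g"
    and smap_msmooth: "(V, \<psi>) \<in> atlas N \<Longrightarrow> j < k \<Longrightarrow> msmooth n M {p \<in> S. g p \<in> V} (\<lambda>p. \<psi> (g p) j)"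
  using assms by (auto simp: smap_def)

lemma smap_subset:
  assumes "smap n k M S N g" "T \<subseteq> S" shows "smap n k M T N g"
  unfolding smap_def
proof (intro conjI)
  show "continuous_map (subtopology (mtop M) T) (mtop N) g"
    using continuous_map_from_subtopology_mono[OF smap_continuous[OF assms(1)] assms(2)] .
  show "\<forall>(V, \<psi>)\<in>atlas N. \<forall>j<k. msmooth n M {p \<in> T. g p \<in> V} (\<lambda>p. \<psi> (g p) j)"
  proof clarify
    fix V \<psi> j assume "(V, \<psi>) \<in> atlas N" "j < k"
    then show "msmooth n M {p \<in> T. g p \<in> V} (\<lambda>p. \<psi> (g p) j)"
      by (rule msmooth_subset[OF smap_msmooth[OF assms(1)]]) (use assms(2) in blast)
  qed
qed

lemma smap_cong:
  assumes "premanifold n M" "smap n k M S N g" "\<And>p. p \<in> S \<Longrightarrow> p \<in> points M \<Longrightarrow> g p = h p"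
  shows "smap n k M S N h"
  unfolding smap_def
proof (intro conjI)
  show "continuous_map (subtopology (mtop M) S) (mtop N) h"
    using assms(3) by (intro continuous_map_eq[OF smap_continuous[OF assms(2)]]) auto
  show "\<forall>(V, \<psi>)\<in>atlas N. \<forall>j<k. msmooth n M {p \<in> S. h p \<in> V} (\<lambda>p. \<psi> (h p) j)"
  proof clarify
    fix V \<psi> j assume V: "(V, \<psi>) \<in> atlas N" and j: "j < k"
    have "msmooth n M ({p \<in> S. g p \<in> V}) (\<lambda>p. \<psi> (h p) j)"
      by (rule msmooth_cong[OF assms(1) smap_msmooth[OF assms(2) V j]]) (use assms(3) in auto)
    \<comment> \<open>\<open>g\<close> and \<open>h\<close> are compared only within
      \<open>points M\<close>, so the two index sets have to be intersected with it before one
      replaces the other.\<close>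
    then show "msmooth n M {p \<in> S. h p \<in> V} (\<lambda>p. \<psi> (h p) j)"
      by (rule_tac msmooth_local[OF assms(1)])
         (use assms(3) in \<open>auto intro!: exI[of _ "points M"] elim!: msmooth_subset\<close>)
  qed
qed

lemma smap_local:
  assumes M: "premanifold n M"
    and *: "\<And>p. p \<in> S \<Longrightarrow> p \<in> points M \<Longrightarrow> \<exists>W. openin (mtop M) W \<and> p \<in> W \<and> smap n k M (S \<inter> W) N g"
  shows "smap n k M S N g"
  unfolding smap_def
proof (intro conjI)
  show "continuous_map (subtopology (mtop M) S) (mtop N) g"
  proof (rule continuous_map_local)
    fix p assume "p \<in> topspace (subtopology (mtop M) S)"
    then obtain W where "openin (mtop M) W" "p \<in> W" "p \<in> S" "smap n k M (S \<inter> W) N g" using * by auto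
    then show "\<exists>W. openin (subtopology (mtop M) S) W \<and> p \<in> W \<and>
        continuous_map (subtopology (subtopology (mtop M) S) W) (mtop N) g"
      using smap_continuous by (intro exI[of _ "S \<inter> W"])
        (auto simp: openin_subtopology_Int2 subtopology_subtopology Int_commute Int_left_commute)
  qed
  show "\<forall>(V, \<psi>)\<in>atlas N. \<forall>j<k. msmooth n M {p \<in> S. g p \<in> V} (\<lambda>p. \<psi> (g p) j)"
  proof clarify
    fix V \<psi> j assume V: "(V, \<psi>) \<in> atlas N" "j < k"
    show "msmooth n M {p \<in> S. g p \<in> V} (\<lambda>p. \<psi> (g p) j)"
    proof (rule msmooth_local[OF M])
      fix p assume "p \<in> {p \<in> S. g p \<in> V}" "p \<in> points M"
      then obtain W where W: "openin (mtop M) W" "p \<in> W" "smap n k M (S \<inter> W) N g" using * by auto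
      then show "\<exists>W. openin (mtop M) W \<and> p \<in> W \<and> msmooth n M ({p \<in> S. g p \<in> V} \<inter> W) (\<lambda>p. \<psi> (g p) j)"
        using smap_msmooth[OF W(3) V] by (auto intro!: exI[of _ W] elim!: msmooth_subset)
    qed
  qed
qed

lemma msmooth_compose:
  assumes M: "premanifold n M" and N: "premanifold k N"
    and g: "smap n k M S N g" and f: "msmooth k N T f" and gT: "\<And>p. p \<in> S \<Longrightarrow> p \<in> points M \<Longrightarrow> g p \<in> T"
  shows "msmooth n M S (\<lambda>p. f (g p))"
proof (rule msmooth_local[OF M])
  fix p assume p: "p \<in> S" "p \<in> points M"
  note gc = smap_continuous[OF g]
  then have "g p \<in> points N" using p by (auto simp: continuous_map_def)
  then obtain V \<psi> where V: "(V, \<psi>) \<in> atlas N" "g p \<in> V" by (rule premanifold_cover[OF N])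
  note cV = premanifold_chart[OF N V(1)]
  have "openin (subtopology (mtop M) S) {q \<in> topspace (subtopology (mtop M) S). g q \<in> V}"
    by (rule openin_continuous_map_preimage[OF gc cV(1)])
  then obtain W where W: "openin (mtop M) W" "{q \<in> topspace (subtopology (mtop M) S). g q \<in> V} = W \<inter> S"
    by (auto simp: openin_subtopology)
  have "msmooth n M (S \<inter> W) (\<lambda>q. (f \<circ> inv_into V \<psi>) (\<psi> (g q)))"
  proof (rule msmooth_lift[OF M, where g = "\<lambda>q. \<psi> (g q)" and H = "f \<circ> inv_into V \<psi>"])
    show "smooth_on k (\<psi> ` (V \<inter> T)) (f \<circ> inv_into V \<psi>)" using f V by (auto simp: msmooth_def)
    show "msmooth n M (S \<inter> W) (\<lambda>q. \<psi> (g q) j)" if "j < k" for j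
      by (rule msmooth_subset[OF smap_msmooth[OF g V(1) that]]) (use W(2) in auto)
    show "\<psi> (g q) \<in> \<psi> ` (V \<inter> T)" if "q \<in> S \<inter> W" "q \<in> points M" for q
      using that W(2) gT by blast
  qed
  then have "msmooth n M (S \<inter> W) (\<lambda>q. f (g q))"
  proof (rule msmooth_cong[OF M])
    fix q assume "q \<in> S \<inter> W" "q \<in> points M"
    then have "g q \<in> V" using W(2) by auto
    then show "(f \<circ> inv_into V \<psi>) (\<psi> (g q)) = f (g q)" using cV(5) by simp
  qed
  moreover have "p \<in> W" using W(2) p V(2) by auto
  ultimately show "\<exists>W. openin (mtop M) W \<and> p \<in> W \<and> msmooth n M (S \<inter> W) (\<lambda>p. f (g p))"
    using W(1) by blast
qed

lemma smap_compose:
  assumes M: "premanifold n M" and N: "premanifold k N"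
    and g: "smap n k M S N g" and h: "smap k l N T P h" and gT: "\<And>p. p \<in> S \<Longrightarrow> p \<in> points M \<Longrightarrow> g p \<in> T"
  shows "smap n l M S P (\<lambda>p. h (g p))"
  unfolding smap_def
proof (intro conjI)
  have "continuous_map (subtopology (mtop M) S) (subtopology (mtop N) T) g"
    using smap_continuous[OF g] gT by (auto simp: continuous_map_in_subtopology)
  from continuous_map_compose[OF this smap_continuous[OF h]]
  show "continuous_map (subtopology (mtop M) S) (mtop P) (\<lambda>p. h (g p))" by (simp add: o_def)
  show "\<forall>(V, \<psi>)\<in>atlas P. \<forall>j<l. msmooth n M {p \<in> S. h (g p) \<in> V} (\<lambda>p. \<psi> (h (g p)) j)"
  proof clarify
    fix V \<psi> j assume V: "(V, \<psi>) \<in> atlas P" "j < l"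
    show "msmooth n M {p \<in> S. h (g p) \<in> V} (\<lambda>p. \<psi> (h (g p)) j)"
      by (rule msmooth_compose[OF M N smap_subset[OF g] smap_msmooth[OF h V]]) (use gT in auto)
  qed
qed

lemma smapI_chart:
  assumes M: "premanifold n M" and N: "premanifold k N"
    and gc: "continuous_map (subtopology (mtop M) S) (mtop N) g"
    and *: "\<And>p. p \<in> S \<Longrightarrow> p \<in> points M \<Longrightarrow> \<exists>V \<psi> W. (V, \<psi>) \<in> atlas N \<and> g p \<in> V \<and> openin (mtop M) W \<and> p \<in> W \<and>
      (\<forall>j<k. msmooth n M {p \<in> S \<inter> W. g p \<in> V} (\<lambda>p. \<psi> (g p) j))"
  shows "smap n k M S N g"
  unfolding smap_def
proof (intro conjI gc, clarify)
  fix V' \<psi>' j assume V': "(V', \<psi>') \<in> atlas N" "j < k"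
  show "msmooth n M {p \<in> S. g p \<in> V'} (\<lambda>p. \<psi>' (g p) j)"
  proof (rule msmooth_local[OF M])
    fix p assume p: "p \<in> {p \<in> S. g p \<in> V'}" "p \<in> points M"
    then obtain V \<psi> W where V: "(V, \<psi>) \<in> atlas N" "g p \<in> V" "openin (mtop M) W" "p \<in> W"
      "\<And>j. j < k \<Longrightarrow> msmooth n M {p \<in> S \<inter> W. g p \<in> V} (\<lambda>p. \<psi> (g p) j)" using * by blast
    note cV = premanifold_chart[OF N V(1)]
    have "openin (subtopology (mtop M) S) {q \<in> topspace (subtopology (mtop M) S). g q \<in> V}"
      by (rule openin_continuous_map_preimage[OF gc cV(1)])
    then obtain W' where W': "openin (mtop M) W'" "{q \<in> topspace (subtopology (mtop M) S). g q \<in> V} = W' \<inter> S"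
      by (auto simp: openin_subtopology)
    let ?S = "{p \<in> S. g p \<in> V'} \<inter> (W \<inter> W')"
    have "msmooth n M ?S (\<lambda>q. (\<lambda>x. \<psi>' (inv_into V \<psi> x) j) (\<psi> (g q)))"
    proof (rule msmooth_lift[OF M premanifold_transition[OF N V(1) V']])
      show "msmooth n M ?S (\<lambda>q. \<psi> (g q) i)" if "i < k" for i
      proof -
        have "msmooth n M ({p \<in> S \<inter> W. g p \<in> V}) (\<lambda>q. \<psi> (g q) i)" by (rule V(5)[OF that])
        moreover have "?S \<inter> points M \<subseteq> {p \<in> S \<inter> W. g p \<in> V}" using W'(2) by auto
        moreover have "?S \<subseteq> points M" using V(3) openin_subset by blast
        ultimately show ?thesis by (elim msmooth_subset) blast
      qed
      show "\<psi> (g q) \<in> \<psi> ` (V \<inter> V')" if "q \<in> ?S" "q \<in> points M" for q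
        using that W'(2) by auto
    qed
    then have "msmooth n M ?S (\<lambda>q. \<psi>' (g q) j)"
    proof (rule msmooth_cong[OF M])
      fix q assume "q \<in> ?S" "q \<in> points M"
      then have "g q \<in> V" using W'(2) by auto
      then show "\<psi>' (inv_into V \<psi> (\<psi> (g q))) j = \<psi>' (g q) j" using cV(5) by simp
    qed
    moreover have "p \<in> W \<inter> W'" "openin (mtop M) (W \<inter> W')" using W' V p by auto
    ultimately show "\<exists>W. openin (mtop M) W \<and> p \<in> W \<and> msmooth n M ({p \<in> S. g p \<in> V'} \<inter> W) (\<lambda>p. \<psi>' (g p) j)"
      by blast
  qed
qed

lemma smap_id:
  assumes "premanifold n M" shows "smap n n M S M (\<lambda>p. p)"
  unfolding smap_def
proof (intro conjI, simp add: continuous_map_from_subtopology, clarify)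
  fix V \<psi> j assume V: "(V, \<psi>) \<in> atlas M" and j: "j < n"
  show "msmooth n M {p \<in> S. p \<in> V} (\<lambda>p. \<psi> p j)"
    by (rule msmooth_subset[OF msmooth_chart[OF assms V j]]) auto
qed

text \<open>With Euclidean space as a premanifold, charts and their inverses become instances of
  \<open>smap\<close>, and coordinate computations turn into uses of
  \<open>smap_compose\<close>.\<close>

definition euclidean_mfd :: "nat \<Rightarrow> (nat \<Rightarrow> real) mfd" where
  "euclidean_mfd n = \<lparr>mtop = Euclidean_space n, atlas = {(ES n, \<lambda>x. x)}\<rparr>"

lemma euclidean_mfd_simps [simp]:
  "mtop (euclidean_mfd n) = Euclidean_space n" "atlas (euclidean_mfd n) = {(ES n, \<lambda>x. x)}"
  by (simp_all add: euclidean_mfd_def)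

lemma premanifold_euclidean: "premanifold n (euclidean_mfd n)"
proof -
  have "inv_into (ES n) (\<lambda>x. x) x = x" if "x \<in> ES n" for x
    using inv_into_f_f[of "\<lambda>x. x" "ES n" x] that by (simp add: inj_on_def)
  then have "smooth_on n (ES n) (\<lambda>x. inv_into (ES n) (\<lambda>x. x) x i)" for i
    by (intro smooth_on_cong[OF smooth_on_coord[of "ES n" n i]]) auto
  moreover have "homeomorphic_map (Euclidean_space n) (top_of_set (ES n)) (\<lambda>x. x)"
    using subtopology_Euclidean_space[of "ES n" n] by (simp add: homeomorphic_map_id[unfolded id_def])
  ultimately show ?thesis
    by (simp add: premanifold_def smooth_transition_def smooth_map_on_def o_def)
qed

lemma msmooth_euclidean:
  assumes "S \<subseteq> ES n" shows "msmooth n (euclidean_mfd n) S f \<longleftrightarrow> smooth_on n S f"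
proof -
  have inv: "inv_into (ES n) (\<lambda>x. x) x = x" if "x \<in> S" for x
    using inv_into_f_f[of "\<lambda>x. x" "ES n" x] that assms by (auto simp: inj_on_def)
  have "(\<lambda>x. x) ` (ES n \<inter> S) = S" using assms by auto
  then have "msmooth n (euclidean_mfd n) S f \<longleftrightarrow> smooth_on n S (f \<circ> inv_into (ES n) (\<lambda>x. x))"
    by (simp add: msmooth_def)
  also have "\<dots> \<longleftrightarrow> smooth_on n S f"
    using inv by (auto elim: smooth_on_cong)
  finally show ?thesis .
qed

lemma smap_into_euclidean:
  assumes M: "premanifold n M" and g: "\<And>j. j < k \<Longrightarrow> msmooth n M S (\<lambda>p. g p j)"
    "\<And>p. p \<in> S \<Longrightarrow> p \<in> points M \<Longrightarrow> g p \<in> ES k"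
  shows "smap n k M S (euclidean_mfd k) g"
  unfolding smap_def
proof (intro conjI)
  have "continuous_map (subtopology (mtop M) S) (Euclidean_space k) (\<lambda>p i. if i < k then g p i else 0)"
    using msmooth_continuous[OF M g(1)] by (simp add: continuous_map_componentwise_Euclidean_space)
  then have "continuous_map (subtopology (mtop M) S) (Euclidean_space k) g"
    by (rule continuous_map_eq) (use g(2) in \<open>auto simp: mem_ES\<close>)
  then show "continuous_map (subtopology (mtop M) S) (mtop (euclidean_mfd k)) g" by simp
  show "\<forall>(V, \<psi>)\<in>atlas (euclidean_mfd k). \<forall>j<k. msmooth n M {p \<in> S. g p \<in> V} (\<lambda>p. \<psi> (g p) j)"
    using g(1) by (auto intro: msmooth_subset)
qed

lemma smap_chart:
  assumes "premanifold n M" "(U, \<phi>) \<in> atlas M"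
  shows "smap n n M U (euclidean_mfd n) \<phi>"
proof (rule smap_into_euclidean[OF assms(1)])
  show "msmooth n M U (\<lambda>p. \<phi> p j)" if "j < n" for j by (rule msmooth_chart[OF assms that])
  show "\<phi> p \<in> ES n" if "p \<in> U" for p using chart_image[OF assms] that by auto
qed

lemma smap_chart_inverse:
  assumes M: "premanifold n M" and U: "(U, \<phi>) \<in> atlas M"
  shows "smap n n (euclidean_mfd n) (\<phi> ` U) M (inv_into U \<phi>)"
  unfolding smap_def
proof (intro conjI)
  note cU = premanifold_chart[OF M U]
  show "continuous_map (subtopology (mtop (euclidean_mfd n)) (\<phi> ` U)) (mtop M) (inv_into U \<phi>)"
    using chart_inverse_continuous[OF M U] cU(2) by (simp add: subtopology_Euclidean_space)
  show "\<forall>(V, \<psi>)\<in>atlas M. \<forall>j<n. msmooth n (euclidean_mfd n) {p \<in> \<phi> ` U. inv_into U \<phi> p \<in> V} (\<lambda>p. \<psi> (inv_into U \<phi> p) j)"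
  proof clarify
    fix V \<psi> j assume V: "(V, \<psi>) \<in> atlas M" "j < n"
    have "{p \<in> \<phi> ` U. inv_into U \<phi> p \<in> V} = \<phi> ` (U \<inter> V)" using cU(5) by auto
    then show "msmooth n (euclidean_mfd n) {p \<in> \<phi> ` U. inv_into U \<phi> p \<in> V} (\<lambda>p. \<psi> (inv_into U \<phi> p) j)"
      using premanifold_transition[OF M U V] cU(2) by (subst msmooth_euclidean) auto
  qed
qed

section \<open>Charts of the maximal atlas and submanifolds\<close>

lemma maximal_atlasI:
  assumes M: "premanifold n M" and U: "openin (mtop M) U" and \<phi>U: "openin (Euclidean_space n) (\<phi> ` U)"
    and \<phi>: "smap n n M U (euclidean_mfd n) \<phi>" and g: "smap n n (euclidean_mfd n) (\<phi> ` U) M g"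
    and inv: "\<And>p. p \<in> U \<Longrightarrow> g (\<phi> p) = p"
  shows "(U, \<phi>) \<in> maximal_atlas n M"
proof -
  have UM: "U \<subseteq> points M" using U openin_subset by blast
  have \<phi>E: "\<phi> ` U \<subseteq> ES n" using \<phi>U openin_subset by blast
  have inj: "inj_on \<phi> U" by (rule inj_on_inverseI[of U g]) (rule inv)
  have inv_eq: "inv_into U \<phi> y = g y" if "y \<in> \<phi> ` U" for y using that inj inv by auto
  have "homeomorphic_maps (subtopology (mtop M) U) (subtopology (Euclidean_space n) (\<phi> ` U)) \<phi> g"
    unfolding homeomorphic_maps_def
    using smap_continuous[OF \<phi>] smap_continuous[OF g] inv \<phi>E UM
    by (auto simp: continuous_map_in_subtopology)
  then have chart: "is_chart n (mtop M) (U, \<phi>)"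
    using U \<phi>U homeomorphic_map_maps by (auto simp: is_chart_def)
  have "smooth_transition n (U, \<phi>) d \<and> smooth_transition n d (U, \<phi>)" if d: "d \<in> atlas M" for d
  proof -
    obtain V \<psi> where V: "d = (V, \<psi>)" "(V, \<psi>) \<in> atlas M" using d by (cases d) auto
    have "smooth_on n (\<phi> ` (U \<inter> V)) (\<lambda>y. \<psi> (inv_into U \<phi> y) j)" if "j < n" for j
    proof -
      have "{p \<in> \<phi> ` U. g p \<in> V} = \<phi> ` (U \<inter> V)" using inv by auto
      then have "smooth_on n (\<phi> ` (U \<inter> V)) (\<lambda>y. \<psi> (g y) j)"
        using smap_msmooth[OF g V(2) that] \<phi>E by (subst (asm) msmooth_euclidean) auto
      then show ?thesis by (rule smooth_on_cong) (use inv_eq in auto)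
    qed
    moreover have "smooth_on n (\<psi> ` (V \<inter> U)) (\<lambda>y. \<phi> (inv_into V \<psi> y) j)" if "j < n" for j
    proof -
      have "msmooth n M {p \<in> U. \<phi> p \<in> ES n} (\<lambda>p. \<phi> p j)" using smap_msmooth[OF \<phi> _ that] by auto
      moreover have "{p \<in> U. \<phi> p \<in> ES n} = U" using \<phi>E by auto
      ultimately show ?thesis using V(2) by (auto simp: msmooth_def o_def)
    qed
    ultimately show ?thesis by (simp add: V smooth_transition_def smooth_map_on_def)
  qed
  then show ?thesis using chart by (simp add: maximal_atlas_def)
qed

lemma maximal_atlas_chart:
  assumes M: "premanifold n M" and U: "(U, \<phi>) \<in> maximal_atlas n M" and \<phi>E: "\<phi> ` U \<subseteq> ES n"
  shows maximal_openin: "openin (mtop M) U"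
    and maximal_inj: "inj_on \<phi> U"
    and smap_maximal: "smap n n M U (euclidean_mfd n) \<phi>"
    and smap_maximal_inverse: "smap n n (euclidean_mfd n) (\<phi> ` U) M (inv_into U \<phi>)"
proof -
  show Uo: "openin (mtop M) U"
    using U by (simp add: maximal_atlas_def is_chart_def)
  have hom: "homeomorphic_map (subtopology (mtop M) U) (top_of_set (\<phi> ` U)) \<phi>"
    using U \<phi>E by (simp add: maximal_atlas_def is_chart_def subtopology_Euclidean_space)
  have trans: "smooth_on n (\<phi> ` (U \<inter> V)) (\<lambda>y. \<psi> (inv_into U \<phi> y) j)"
    "smooth_on n (\<psi> ` (V \<inter> U)) (\<lambda>y. \<phi> (inv_into V \<psi> y) j)" if "(V, \<psi>) \<in> atlas M" "j < n" for V \<psi> j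
  proof -
    have "smooth_transition n (U, \<phi>) (V, \<psi>) \<and> smooth_transition n (V, \<psi>) (U, \<phi>)"
      using U that(1) by (simp add: maximal_atlas_def)
    then show "smooth_on n (\<phi> ` (U \<inter> V)) (\<lambda>y. \<psi> (inv_into U \<phi> y) j)"
      "smooth_on n (\<psi> ` (V \<inter> U)) (\<lambda>y. \<phi> (inv_into V \<psi> y) j)"
      using that(2) by (simp_all add: smooth_transition_def smooth_map_on_def)
  qed
  have UM: "U \<subseteq> points M" using Uo openin_subset by blast
  show inj: "inj_on \<phi> U" using homeomorphic_imp_injective_map[OF hom] UM by (simp add: Int_absorb1)
  show "smap n n M U (euclidean_mfd n) \<phi>"
  proof (rule smap_into_euclidean[OF M])
    show "msmooth n M U (\<lambda>p. \<phi> p j)" if "j < n" for j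
      unfolding msmooth_def using trans(2)[OF _ that] by (auto simp: o_def)
  qed (use \<phi>E in auto)
  show "smap n n (euclidean_mfd n) (\<phi> ` U) M (inv_into U \<phi>)"
    unfolding smap_def
  proof (intro conjI)
    obtain g where g: "homeomorphic_maps (subtopology (mtop M) U) (top_of_set (\<phi> ` U)) \<phi> g"
      using hom homeomorphic_map_maps by blast
    then have "continuous_map (top_of_set (\<phi> ` U)) (mtop M) g" "\<And>p. p \<in> U \<Longrightarrow> g (\<phi> p) = p"
      using UM by (auto simp: homeomorphic_maps_def continuous_map_in_subtopology)
    then have "continuous_map (top_of_set (\<phi> ` U)) (mtop M) (inv_into U \<phi>)"
      by (elim continuous_map_eq) (auto simp: inv_into_f_f[OF inj])
    then show "continuous_map (subtopology (mtop (euclidean_mfd n)) (\<phi> ` U)) (mtop M) (inv_into U \<phi>)"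
      using \<phi>E by (simp add: subtopology_Euclidean_space)
    show "\<forall>(V, \<psi>)\<in>atlas M. \<forall>j<n. msmooth n (euclidean_mfd n) {p \<in> \<phi> ` U. inv_into U \<phi> p \<in> V} (\<lambda>p. \<psi> (inv_into U \<phi> p) j)"
    proof clarify
      fix V \<psi> j assume V: "(V, \<psi>) \<in> atlas M" "j < n"
      have "{p \<in> \<phi> ` U. inv_into U \<phi> p \<in> V} = \<phi> ` (U \<inter> V)" using inj by auto
      then show "msmooth n (euclidean_mfd n) {p \<in> \<phi> ` U. inv_into U \<phi> p \<in> V} (\<lambda>p. \<psi> (inv_into U \<phi> p) j)"
        using trans(1)[OF V] \<phi>E by (subst msmooth_euclidean) auto
    qed
  qed
qed

text \<open>Slice charts send \<open>S\<close> into \<open>ES k\<close>, so by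
  \<open>smooth_on_dim\<close> smoothness with respect to the atlas of the submanifold is smoothness
  along \<open>S\<close> in the coordinates of \<open>M\<close>. A diffeomorphism can thus be given
  by maps of the ambient manifold, once \<open>S\<close> is covered by slice charts.\<close>

lemma submanifold_diffeomorphicI:
  assumes M: "premanifold n M" and N: "premanifold k N" and kn: "k \<le> n"
    and S: "S \<subseteq> points M" "S \<subseteq> \<Union> (fst ` slice_charts k n M S)"
    and g: "smap n k M S N g" and g': "smap k n N (points N) M g'" "g' ` points N \<subseteq> S"
    and inv: "\<And>p. p \<in> S \<Longrightarrow> g' (g p) = p" "\<And>x. x \<in> points N \<Longrightarrow> g (g' x) = x"
  shows "submanifold_diffeomorphic k n M S N"
proof -
  have slice: "(U, \<phi>) \<in> maximal_atlas n M \<and> \<phi> ` U \<subseteq> ES n \<and> \<phi> ` (U \<inter> S) \<subseteq> ES k"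
    if "(U, \<phi>) \<in> slice_charts k n M S" for U \<phi>
    using that openin_subset unfolding slice_charts_def half_space_def by fastforce
  have "diffeomorphic k (submanifold k n M S) N"
    unfolding diffeomorphic_def
  proof (intro exI[of _ g] exI[of _ g'] conjI)
    show "homeomorphic_maps (mtop (submanifold k n M S)) (mtop N) g g'"
      unfolding homeomorphic_maps_def submanifold_def
      using smap_continuous[OF g] smap_continuous[OF g'(1)] g'(2) inv
      by (auto simp: continuous_map_in_subtopology)
    show "smooth_map k k (submanifold k n M S) N g"
      unfolding smooth_map_def
    proof (intro conjI)
      show "continuous_map (mtop (submanifold k n M S)) (mtop N) g"
        using smap_continuous[OF g] by (simp add: submanifold_def)
      have "smooth_on k (\<phi> ` {p \<in> U \<inter> S. g p \<in> V}) (\<lambda>y. \<psi> (g (inv_into (U \<inter> S) \<phi> y)) j)"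
        if U: "(U, \<phi>) \<in> slice_charts k n M S" and V: "(V, \<psi>) \<in> atlas N" "j < k" for U \<phi> V \<psi> j
      proof -
        note * = maximal_atlas_chart[OF M, of U \<phi>]
        have inj: "inj_on \<phi> U" using *(2) slice[OF U] by blast
        let ?A = "\<phi> ` {p \<in> U \<inter> S. g p \<in> V}"
        have A: "?A \<subseteq> \<phi> ` U" "?A \<subseteq> ES k" using slice[OF U] by auto
        have "msmooth n (euclidean_mfd n) ?A (\<lambda>y. \<psi> (g (inv_into U \<phi> y)) j)"
        proof (rule msmooth_compose[OF premanifold_euclidean M _ smap_msmooth[OF g V]])
          show "smap n n (euclidean_mfd n) ?A M (inv_into U \<phi>)"
            by (rule smap_subset[OF *(4) A(1)]) (use slice[OF U] in auto)
          show "inv_into U \<phi> y \<in> {p \<in> S. g p \<in> V}" if "y \<in> ?A" for y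
            using that inj by auto
        qed
        then have "smooth_on k ?A (\<lambda>y. \<psi> (g (inv_into U \<phi> y)) j)"
          using A slice[OF U] by (subst (asm) msmooth_euclidean) (auto simp: smooth_on_dim[OF kn])
        then show ?thesis
          by (rule smooth_on_cong) (use inj in \<open>auto simp: inv_into_f_f inj_on_Int\<close>)
      qed
      then show "\<forall>(U, \<phi>)\<in>atlas (submanifold k n M S). \<forall>(V, \<psi>)\<in>atlas N.
          smooth_map_on k k (\<phi> ` {p \<in> U. g p \<in> V}) (\<psi> \<circ> g \<circ> inv_into U \<phi>)"
        by (auto simp: submanifold_def smooth_map_on_def o_def)
    qed
    show "smooth_map k k N (submanifold k n M S) g'"
      unfolding smooth_map_def
    proof (intro conjI)
      show "continuous_map (mtop N) (mtop (submanifold k n M S)) g'"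
        using smap_continuous[OF g'(1)] g'(2) by (simp add: submanifold_def continuous_map_in_subtopology image_subset_iff_funcset)
      have "smooth_on k (\<psi> ` {x \<in> V. g' x \<in> U \<inter> S}) (\<lambda>y. \<phi> (g' (inv_into V \<psi> y)) j)"
        if U: "(U, \<phi>) \<in> slice_charts k n M S" and V: "(V, \<psi>) \<in> atlas N" "j < k" for U \<phi> V \<psi> j
      proof -
        have "msmooth n M {p \<in> U. \<phi> p \<in> ES n} (\<lambda>p. \<phi> p j)"
          using smap_msmooth[OF smap_maximal[OF M, of U \<phi>], of "ES n" "\<lambda>x. x" j] slice[OF U] V(2) kn by auto
        moreover have "{p \<in> U. \<phi> p \<in> ES n} = U" using slice[OF U] by auto
        ultimately have "msmooth n M U (\<lambda>p. \<phi> p j)" by simp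
        have "msmooth k N {x \<in> points N. g' x \<in> U} (\<lambda>x. \<phi> (g' x) j)"
        proof (rule msmooth_compose[OF N M _ \<open>msmooth n M U (\<lambda>p. \<phi> p j)\<close>])
          show "smap k n N {x \<in> points N. g' x \<in> U} M g'" by (rule smap_subset[OF g'(1)]) blast
        qed blast
        then have "smooth_on k (\<psi> ` (V \<inter> {x \<in> points N. g' x \<in> U})) (\<lambda>y. \<phi> (g' (inv_into V \<psi> y)) j)"
          using V(1) by (auto simp: msmooth_def o_def)
        then show ?thesis
          by (rule smooth_on_subset) (use chart_subset[OF N V(1)] in auto)
      qed
      then show "\<forall>(V, \<psi>)\<in>atlas N. \<forall>(U, \<phi>)\<in>atlas (submanifold k n M S).
          smooth_map_on k k (\<psi> ` {p \<in> V. g' p \<in> U}) (\<phi> \<circ> g' \<circ> inv_into V \<psi>)"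
        by (auto simp: submanifold_def smooth_map_on_def o_def)
    qed
  qed
  then show ?thesis
    using S kn by (simp add: submanifold_diffeomorphic_def embedded_submanifold_def)
qed

text \<open>The coordinate of the factor \<open>\<real>\<close> comes last; it has index \<open>k\<close>.\<close>

definition cylinder :: "nat \<Rightarrow> 'a mfd \<Rightarrow> ('a \<times> real) mfd" where
  "cylinder k N = \<lparr>mtop = prod_topology (mtop N) euclideanreal,
     atlas = (\<lambda>(V, \<psi>). (V \<times> UNIV, \<lambda>z. (\<psi> (fst z))(k := snd z))) ` atlas N\<rparr>"

lemma mtop_cylinder [simp]: "mtop (cylinder k N) = prod_topology (mtop N) euclideanreal"
  by (simp add: cylinder_def)

lemma cylinder_chart:
  "(V, \<psi>) \<in> atlas N \<Longrightarrow> (V \<times> UNIV, \<lambda>z. (\<psi> (fst z))(k := snd z)) \<in> atlas (cylinder k N)"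
  by (force simp: cylinder_def)

lemma continuous_map_into_fun:
  "continuous_map X euclidean (f :: 'a \<Rightarrow> nat \<Rightarrow> real) \<longleftrightarrow> (\<forall>j. continuous_map X euclideanreal (\<lambda>x. f x j))"
  by (simp flip: euclidean_product_topology add: continuous_map_componentwise_UNIV)

lemma premanifold_cylinder:
  assumes N: "premanifold k N"
  shows "premanifold (Suc k) (cylinder k N)"
proof -
  let ?c = "\<lambda>\<psi> z. (\<psi> (fst z))(k := snd z) :: nat \<Rightarrow> real"
  have inj: "inj_on (?c \<psi>) (V \<times> UNIV)" and E: "?c \<psi> ` (V \<times> UNIV) \<subseteq> ES (Suc k)"
    and bwd: "\<And>z. z \<in> V \<times> UNIV \<Longrightarrow> (inv_into V \<psi> ((?c \<psi> z)(k := 0)), (?c \<psi> z) k) = z"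
    and low: "\<And>z. z \<in> V \<times> UNIV \<Longrightarrow> (?c \<psi> z)(k := 0) = \<psi> (fst z)"
    if V: "(V, \<psi>) \<in> atlas N" for V \<psi>
  proof -
    note cV = premanifold_chart[OF N V]
    \<comment> \<open>A chart of dimension \<open>k\<close> vanishes at index \<open>k\<close>,
      which is therefore free to carry the real factor; resetting it to 0 recovers the
      chart.\<close>
    have 0: "\<psi> x k = 0" if "x \<in> V" for x using cV(2) that by (auto simp: mem_ES)
    show low: "(?c \<psi> z)(k := 0) = \<psi> (fst z)" if "z \<in> V \<times> UNIV" for z
      using 0 that by (auto simp: fun_eq_iff)
    show bwd: "(inv_into V \<psi> ((?c \<psi> z)(k := 0)), (?c \<psi> z) k) = z" if "z \<in> V \<times> UNIV" for z
      unfolding low[OF that] using that cV(5) by auto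
    show "inj_on (?c \<psi>) (V \<times> UNIV)"
      by (rule inj_on_inverseI[of _ "\<lambda>y. (inv_into V \<psi> (y(k := 0)), y k)"]) (rule bwd)
    show "?c \<psi> ` (V \<times> UNIV) \<subseteq> ES (Suc k)" using cV(2) by (auto simp: mem_ES image_subset_iff)
  qed
  have hom: "homeomorphic_map (subtopology (mtop (cylinder k N)) (V \<times> UNIV)) (top_of_set (?c \<psi> ` (V \<times> UNIV))) (?c \<psi>)"
    if V: "(V, \<psi>) \<in> atlas N" for V \<psi>
  proof -
    note cV = premanifold_chart[OF N V]
    have top: "subtopology (mtop (cylinder k N)) (V \<times> UNIV) = prod_topology (subtopology (mtop N) V) euclideanreal"
      by (simp add: prod_topology_subtopology)
    have "homeomorphic_maps (prod_topology (subtopology (mtop N) V) euclideanreal) (top_of_set (?c \<psi> ` (V \<times> UNIV)))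
        (?c \<psi>) (\<lambda>y. (inv_into V \<psi> (y(k := 0)), y k))"
      unfolding homeomorphic_maps_def
    proof (intro conjI ballI)
      have "continuous_map (prod_topology (subtopology (mtop N) V) euclideanreal) euclideanreal (\<lambda>z. ?c \<psi> z j)" for j
      proof (cases "j = k")
        case False
        have "continuous_map (subtopology (mtop N) V) euclideanreal (\<lambda>x. \<psi> x j)"
          using chart_continuous[OF N V] continuous_map_into_fun by blast
        from continuous_map_compose[OF continuous_map_fst this] show ?thesis using False by (simp add: o_def)
      qed (simp add: continuous_map_snd)
      then have "continuous_map (prod_topology (subtopology (mtop N) V) euclideanreal) euclidean (?c \<psi>)"
        unfolding continuous_map_into_fun by blast
      then show "continuous_map (prod_topology (subtopology (mtop N) V) euclideanreal) (top_of_set (?c \<psi> ` (V \<times> UNIV))) (?c \<psi>)"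
        by (auto simp: continuous_map_in_subtopology)
      have 1: "continuous_map (top_of_set (?c \<psi> ` (V \<times> UNIV))) (top_of_set (\<psi> ` V)) (\<lambda>y. y(k := 0))"
      proof -
        have "continuous_map (top_of_set (?c \<psi> ` (V \<times> UNIV))) euclidean (\<lambda>y :: nat \<Rightarrow> real. y(k := 0))"
          unfolding continuous_map_into_fun
        proof
          fix j show "continuous_map (top_of_set (?c \<psi> ` (V \<times> UNIV))) euclideanreal (\<lambda>y. (y(k := 0)) j)"
            by (cases "j = k") (auto intro: continuous_on_coord)
        qed
        then show ?thesis using low[OF V] by (auto simp: continuous_map_in_subtopology)
      qed
      show "continuous_map (top_of_set (?c \<psi> ` (V \<times> UNIV))) (prod_topology (subtopology (mtop N) V) euclideanreal)
          (\<lambda>y. (inv_into V \<psi> (y(k := 0)), y k))"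
      proof (intro continuous_map_pairedI)
        have "continuous_map (top_of_set (\<psi> ` V)) (subtopology (mtop N) V) (inv_into V \<psi>)"
          using chart_inverse_continuous[OF N V] by (auto simp: continuous_map_in_subtopology inv_into_into)
        from continuous_map_compose[OF 1 this]
        show "continuous_map (top_of_set (?c \<psi> ` (V \<times> UNIV))) (subtopology (mtop N) V) (\<lambda>y. inv_into V \<psi> (y(k := 0)))"
          by (simp add: o_def)
      qed (simp add: continuous_on_coord)
    next
      fix z assume "z \<in> topspace (prod_topology (subtopology (mtop N) V) euclideanreal)"
      then show "(inv_into V \<psi> ((?c \<psi> z)(k := 0)), (?c \<psi> z) k) = z" using bwd[OF V, of z] by auto
    next
      fix y assume "y \<in> topspace (top_of_set (?c \<psi> ` (V \<times> UNIV)))"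
      then obtain z where "z \<in> V \<times> UNIV" "y = ?c \<psi> z" by auto
      then show "?c \<psi> (inv_into V \<psi> (y(k := 0)), y k) = y" using bwd[OF V, of z] by simp
    qed
    then show ?thesis unfolding top using homeomorphic_map_maps by blast
  qed
  have trans: "smooth_on (Suc k) (?c \<psi> ` (V \<times> UNIV \<inter> V' \<times> UNIV)) (\<lambda>y. ?c \<psi>' (inv_into (V \<times> UNIV) (?c \<psi>) y) j)"
    if V: "(V, \<psi>) \<in> atlas N" and V': "(V', \<psi>') \<in> atlas N" for V \<psi> V' \<psi>' j
  proof -
    let ?A = "?c \<psi> ` (V \<times> UNIV \<inter> V' \<times> UNIV)"
    have AE: "?A \<subseteq> ES (Suc k)" using E[OF V] by auto
    have eq: "inv_into (V \<times> UNIV) (?c \<psi>) (?c \<psi> z) = z" if "z \<in> V \<times> UNIV" for z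
      by (rule inv_into_f_f[OF inj[OF V] that])
    consider "j < k" | "j = k" | "j > k" by linarith
    then show ?thesis
    proof cases
      case 1
      have "smooth_on (Suc k) ?A (\<lambda>y. (\<lambda>w. \<psi>' (inv_into V \<psi> w) j) (y(k := 0)))"
      proof (rule smooth_on_compose[OF premanifold_transition[OF N V V' 1]])
        show "smooth_on (Suc k) ?A (\<lambda>y. (y(k := 0)) i)" if "i < k" for i
          using smooth_on_coord[OF AE, of i] that by simp
        show "(\<lambda>y. y(k := 0)) ` ?A \<subseteq> \<psi> ` (V \<inter> V')" using low[OF V] by auto
      qed (rule AE)
      then show ?thesis
      proof (rule smooth_on_cong)
        fix y assume "y \<in> ?A"
        then obtain z where z: "z \<in> V \<times> UNIV" "y = ?c \<psi> z" by auto
        then show "\<psi>' (inv_into V \<psi> (y(k := 0))) j = ?c \<psi>' (inv_into (V \<times> UNIV) (?c \<psi>) y) j"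
          using bwd[OF V z(1)] 1 unfolding z(2) eq[OF z(1)] by (auto simp: prod_eq_iff)
      qed
    next
      case 2
      show ?thesis by (rule smooth_on_cong[OF smooth_on_coord[OF AE, of k]]) (use 2 eq in auto)
    next
      case 3
      have "smooth_on (Suc k) ?A (\<lambda>_. 0)"
        by (rule smooth_on_subset[OF smooth_on_openI[OF smooth_on_open_const[OF openin_ES]] AE])
      then show ?thesis
      proof (rule smooth_on_cong)
        fix y assume "y \<in> ?A"
        then obtain z where z: "z \<in> V \<times> UNIV" "fst z \<in> V'" "y = ?c \<psi> z" by auto
        have "\<psi>' (fst z) \<in> ES k" using chart_image[OF N V'] z(2) by auto
        then show "0 = ?c \<psi>' (inv_into (V \<times> UNIV) (?c \<psi>) y) j"
          using 3 unfolding z(3) eq[OF z(1)] by (simp add: mem_ES)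
      qed
    qed
  qed
  show ?thesis
    unfolding premanifold_def
  proof (intro conjI)
    show "\<forall>(U, \<phi>)\<in>atlas (cylinder k N). openin (mtop (cylinder k N)) U \<and> \<phi> ` U \<subseteq> ES (Suc k) \<and>
        homeomorphic_map (subtopology (mtop (cylinder k N)) U) (top_of_set (\<phi> ` U)) \<phi>"
    proof clarify
      fix U \<phi> assume "(U, \<phi>) \<in> atlas (cylinder k N)"
      then obtain V \<psi> where V: "(V, \<psi>) \<in> atlas N" "U = V \<times> UNIV" "\<phi> = ?c \<psi>" by (auto simp: cylinder_def)
      show "openin (mtop (cylinder k N)) U \<and> \<phi> ` U \<subseteq> ES (Suc k) \<and>
        homeomorphic_map (subtopology (mtop (cylinder k N)) U) (top_of_set (\<phi> ` U)) \<phi>"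
        unfolding V(2,3)
      proof (intro conjI hom[OF V(1)] E[OF V(1)])
        show "openin (mtop (cylinder k N)) (V \<times> UNIV)"
          using chart_openin[OF N V(1)] by (simp add: openin_prod_Times_iff)
      qed
    qed
    have "\<Union> (fst ` atlas (cylinder k N)) = \<Union> (fst ` atlas N) \<times> UNIV"
      by (force simp: cylinder_def)
    also have "\<dots> = points (cylinder k N)" using N by (simp add: premanifold_def)
    finally show "\<Union> (fst ` atlas (cylinder k N)) = points (cylinder k N)" .
    show "\<forall>c\<in>atlas (cylinder k N). \<forall>d\<in>atlas (cylinder k N). smooth_transition (Suc k) c d"
      using trans by (auto simp: cylinder_def smooth_transition_def smooth_map_on_def o_def)
  qed
qed

lemma msmooth_snd:
  assumes N: "premanifold k N" shows "msmooth (Suc k) (cylinder k N) S snd"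
proof (rule msmooth_local[OF premanifold_cylinder[OF N]])
  fix z assume "z \<in> points (cylinder k N)"
  then have "fst z \<in> points N" by auto
  then obtain V \<psi> where V: "(V, \<psi>) \<in> atlas N" "fst z \<in> V" by (rule premanifold_cover[OF N])
  note c = cylinder_chart[OF V(1), of k]
  have "msmooth (Suc k) (cylinder k N) (V \<times> UNIV) snd"
    using msmooth_chart[OF premanifold_cylinder[OF N] c, of k] by simp
  then have "msmooth (Suc k) (cylinder k N) (S \<inter> (V \<times> UNIV)) snd" by (rule msmooth_subset) blast
  moreover have "z \<in> V \<times> UNIV" using V(2) by (cases z) auto
  ultimately show "\<exists>W. openin (mtop (cylinder k N)) W \<and> z \<in> W \<and> msmooth (Suc k) (cylinder k N) (S \<inter> W) snd"
    using chart_openin[OF premanifold_cylinder[OF N] c] by blast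
qed

lemma smap_fst:
  assumes N: "premanifold k N" shows "smap (Suc k) k (cylinder k N) S N fst"
  unfolding smap_def
proof (intro conjI)
  show "continuous_map (subtopology (mtop (cylinder k N)) S) (mtop N) fst"
    by (simp add: continuous_map_from_subtopology continuous_map_fst)
  show "\<forall>(V, \<psi>)\<in>atlas N. \<forall>j<k. msmooth (Suc k) (cylinder k N) {z \<in> S. fst z \<in> V} (\<lambda>z. \<psi> (fst z) j)"
  proof clarify
    fix V \<psi> j assume V: "(V, \<psi>) \<in> atlas N" "j < k"
    note c = cylinder_chart[OF V(1), of k]
    have "msmooth (Suc k) (cylinder k N) (V \<times> UNIV) (\<lambda>z. \<psi> (fst z) j)"
      using msmooth_chart[OF premanifold_cylinder[OF N] c, of j] V(2) by simp
    then show "msmooth (Suc k) (cylinder k N) {z \<in> S. fst z \<in> V} (\<lambda>z. \<psi> (fst z) j)"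
      by (rule msmooth_subset) auto
  qed
qed

lemma smap_Pair:
  assumes M: "premanifold n M" and N: "premanifold k N" and g: "smap n k M S N g" and h: "msmooth n M S h"
  shows "smap n (Suc k) M S (cylinder k N) (\<lambda>p. (g p, h p))"
  unfolding smap_def
proof (intro conjI)
  show "continuous_map (subtopology (mtop M) S) (mtop (cylinder k N)) (\<lambda>p. (g p, h p))"
    using smap_continuous[OF g] msmooth_continuous[OF M h] by (simp add: continuous_map_pairedI)
  show "\<forall>(V, \<psi>)\<in>atlas (cylinder k N). \<forall>j<Suc k. msmooth n M {p \<in> S. (g p, h p) \<in> V} (\<lambda>p. \<psi> (g p, h p) j)"
  proof clarify
    fix U \<phi> j assume "(U, \<phi>) \<in> atlas (cylinder k N)" and j: "j < Suc k"
    then obtain V \<psi> where V: "(V, \<psi>) \<in> atlas N" "U = V \<times> UNIV" "\<phi> = (\<lambda>z. (\<psi> (fst z))(k := snd z))"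
      by (auto simp: cylinder_def)
    show "msmooth n M {p \<in> S. (g p, h p) \<in> U} (\<lambda>p. \<phi> (g p, h p) j)"
    proof (cases "j = k")
      case True
      then show ?thesis unfolding V by (auto intro: msmooth_subset[OF h])
    next
      case False
      then show ?thesis using smap_msmooth[OF g V(1), of j] j unfolding V by simp
    qed
  qed
qed

section \<open>Collars\<close>

lemma topspace_half_space: "topspace (half_space n) = {x \<in> ES n. 0 \<le> x (n - 1)}"
  by (auto simp: half_space_def)

lemma openin_half_space:
  "openin (half_space n) A \<longleftrightarrow> (\<exists>T. open T \<and> A = {x \<in> ES n. 0 \<le> x (n - 1)} \<inter> T)"
proof -
  have "openin (half_space n) A \<longleftrightarrow> (\<exists>T. openin (Euclidean_space n) T \<and> A = T \<inter> {x. 0 \<le> x (n - 1)})"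
    by (simp add: half_space_def openin_subtopology)
  also have "\<dots> \<longleftrightarrow> (\<exists>T. open T \<and> A = {x \<in> ES n. 0 \<le> x (n - 1)} \<inter> T)"
    unfolding openin_Euclidean_space
  proof (intro iffI; elim exE conjE)
    fix T T' assume "A = T \<inter> {x. 0 \<le> x (n - 1)}" "open T'" "T = ES n \<inter> T'"
    then show "\<exists>T. open T \<and> A = {x \<in> ES n. 0 \<le> x (n - 1)} \<inter> T" by (intro exI[of _ T']) blast
  next
    fix T assume "open T" "A = {x \<in> ES n. 0 \<le> x (n - 1)} \<inter> T"
    then show "\<exists>S. (\<exists>T. open T \<and> S = ES n \<inter> T) \<and> A = S \<inter> {x. 0 \<le> x (n - 1)}"
      by (intro exI[of _ "ES n \<inter> T"] conjI exI[of _ T]) auto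
  qed
  finally show ?thesis .
qed

lemma smooth_manifold_chart_image:
  assumes "smooth_manifold n M" "(U, \<phi>) \<in> atlas M"
  shows "openin (Euclidean_space n) (\<phi> ` U) \<or> openin (half_space n) (\<phi> ` U)"
proof -
  have "is_chart n (mtop M) (U, \<phi>)" using assms unfolding smooth_manifold_def by blast
  then show ?thesis by (simp add: is_chart_def)
qed

lemma smooth_manifold_imp_premanifold:
  assumes M: "smooth_manifold n M" shows "premanifold n M"
  unfolding premanifold_def
proof (intro conjI)
  show "\<Union> (fst ` atlas M) = points M" "\<forall>c\<in>atlas M. \<forall>d\<in>atlas M. smooth_transition n c d"
    using M by (simp_all add: smooth_manifold_def)
  show "\<forall>(U, \<phi>)\<in>atlas M. openin (mtop M) U \<and> \<phi> ` U \<subseteq> ES n \<and>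
      homeomorphic_map (subtopology (mtop M) U) (top_of_set (\<phi> ` U)) \<phi>"
  proof clarify
    fix U \<phi> assume U: "(U, \<phi>) \<in> atlas M"
    have "is_chart n (mtop M) (U, \<phi>)" using M U unfolding smooth_manifold_def by blast
    then have *: "openin (mtop M) U"
      "homeomorphic_map (subtopology (mtop M) U) (subtopology (Euclidean_space n) (\<phi> ` U)) \<phi>"
      by (simp_all add: is_chart_def)
    have "\<phi> ` U \<subseteq> ES n"
      using smooth_manifold_chart_image[OF M U] openin_subset topspace_half_space by blast
    with * show "openin (mtop M) U \<and> \<phi> ` U \<subseteq> ES n \<and>
      homeomorphic_map (subtopology (mtop M) U) (top_of_set (\<phi> ` U)) \<phi>"
      by (simp add: subtopology_Euclidean_space)
  qed
qed

lemma boundary_pointE: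
  assumes "p \<in> boundary_points n M"
  obtains U \<phi> where "0 < n" "(U, \<phi>) \<in> atlas M" "p \<in> U" "openin (half_space n) (\<phi> ` U)" "\<phi> p (n - 1) = 0"
  using assms unfolding boundary_points_def by blast

text \<open>Independence of the chart rests on invariance of domain.\<close>

lemma boundary_point_chart:
  assumes M: "smooth_manifold n M" and p: "p \<in> boundary_points n M" and U: "(U, \<phi>) \<in> atlas M" "p \<in> U"
  shows "openin (half_space n) (\<phi> ` U)" "\<phi> p (n - 1) = 0"
proof -
  note PM = smooth_manifold_imp_premanifold[OF M]
  note cU = premanifold_chart[OF PM U(1)]
  obtain V \<psi> where V: "0 < n" "(V, \<psi>) \<in> atlas M" "p \<in> V" "openin (half_space n) (\<psi> ` V)" "\<psi> p (n - 1) = 0"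
    using boundary_pointE[OF p] by blast
  note cV = premanifold_chart[OF PM V(2)]
  \<comment> \<open>An open set around \<open>\<phi> p\<close> within the overlap would be mapped by
    the transition onto an open set around \<open>\<psi> p\<close>. As \<open>\<psi> p\<close> lies
    on the hyperplane, that image would contain points below it, outside the half space.\<close>
  have *: False if A: "openin (Euclidean_space n) A" "A \<subseteq> \<phi> ` (U \<inter> V)" "\<phi> p \<in> A" for A
  proof -
    let ?\<tau> = "\<lambda>y. \<psi> (inv_into U \<phi> y)"
    have inv: "inv_into U \<phi> (\<phi> q) = q" if "q \<in> U" for q using that cU(5) by simp
    have AE: "A \<subseteq> ES n" using A(1) openin_subset by blast
    have "smooth_on n A (\<lambda>y. ?\<tau> y j)" if "j < n" for j
      by (rule smooth_on_subset[OF premanifold_transition[OF PM U(1) V(2) that] A(2)])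
    moreover have "?\<tau> ` A \<subseteq> ES n" using A(2) cV(2) inv by force
    ultimately have "continuous_on A ?\<tau>"
      using continuous_on_into_ES[where g = ?\<tau> and k = n] smooth_on_imp_continuous by blast
    then have "continuous_map (subtopology (Euclidean_space n) A) (Euclidean_space n) ?\<tau>"
      using AE \<open>?\<tau> ` A \<subseteq> ES n\<close>
      by (simp add: cm_Euclidean_space_iff_continuous_on Int_absorb1 image_subset_iff_funcset)
    moreover have "inj_on ?\<tau> A"
    proof (rule inj_onI)
      fix x y assume xy: "x \<in> A" "y \<in> A" "?\<tau> x = ?\<tau> y"
      then obtain a b where ab: "a \<in> U \<inter> V" "b \<in> U \<inter> V" "x = \<phi> a" "y = \<phi> b" using A(2) by blast
      then have "\<psi> a = \<psi> b" using xy(3) inv by simp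
      then show "x = y" using ab cV(5) by (auto dest: inj_onD)
    qed
    ultimately have "openin (Euclidean_space n) (?\<tau> ` A)"
      using invariance_of_domain_Euclidean_space[OF A(1)] by blast
    moreover have "\<psi> p \<in> ?\<tau> ` A" using A(3) inv[OF U(2)] by force
    ultimately obtain e where e: "e > 0" "cube n (\<psi> p) e \<subseteq> ?\<tau> ` A" by (rule openin_Euclidean_space_cube)
    have "(\<psi> p)(n - 1 := - e / 2) \<in> cube n (\<psi> p) e"
      using e V cV(2) by (auto simp: cube_def mem_ES)
    then have "(\<psi> p)(n - 1 := - e / 2) \<in> ?\<tau> ` A" using e by blast
    then have "(\<psi> p)(n - 1 := - e / 2) \<in> \<psi> ` V" using A(2) inv by force
    then have "(\<psi> p)(n - 1 := - e / 2) \<in> topspace (half_space n)" using openin_subset[OF V(4)] by blast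
    then show False using e by (simp add: topspace_half_space)
  qed
  obtain T where T: "open T" "\<phi> ` (U \<inter> V) = \<phi> ` U \<inter> T"
    by (rule chart_image_Int_open[OF PM U(1) cV(1)])
  have pT: "\<phi> p \<in> \<phi> ` U \<inter> T" using U(2) V(3) T(2) by blast
  show half: "openin (half_space n) (\<phi> ` U)"
  proof (rule ccontr)
    assume "\<not> openin (half_space n) (\<phi> ` U)"
    then obtain T' where T': "open T'" "\<phi> ` U = ES n \<inter> T'"
      using smooth_manifold_chart_image[OF M U(1)] openin_Euclidean_space by blast
    then have "openin (Euclidean_space n) (\<phi> ` U \<inter> T)"
      using T(1) by (auto simp: openin_Euclidean_space Int_assoc)
    then show False using * T(2) pT by blast
  qed
  show "\<phi> p (n - 1) = 0"
  proof (rule ccontr)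
    assume "\<phi> p (n - 1) \<noteq> 0"
    obtain T' where T': "open T'" "\<phi> ` U = {x \<in> ES n. 0 \<le> x (n - 1)} \<inter> T'"
      using half openin_half_space by blast
    have o: "open {x :: nat \<Rightarrow> real. 0 < x (n - 1)}"
      by (intro open_Collect_less continuous_on_coord continuous_intros)
    let ?A = "ES n \<inter> (T' \<inter> T \<inter> {x. 0 < x (n - 1)})"
    have "openin (Euclidean_space n) ?A"
      unfolding openin_Euclidean_space using T' T(1) o by (intro exI[of _ "T' \<inter> T \<inter> {x. 0 < x (n - 1)}"]) auto
    moreover have "?A \<subseteq> \<phi> ` U \<inter> T" using T'(2) by auto
    moreover have "\<phi> p \<in> ?A" using pT T'(2) \<open>\<phi> p (n - 1) \<noteq> 0\<close> by auto
    ultimately show False using *[of ?A] T(2) by blast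
  qed
qed

lemma half_space_chart_nonneg:
  assumes "openin (half_space n) (\<phi> ` U)" "q \<in> U" shows "\<phi> q (n - 1) \<ge> 0"
  using openin_subset[OF assms(1)] assms(2) by (auto simp: topspace_half_space)

lemma boundary_pointI:
  assumes "0 < n" "(U, \<phi>) \<in> atlas M" "q \<in> U" "openin (half_space n) (\<phi> ` U)" "\<phi> q (n - 1) = 0"
  shows "q \<in> boundary_points n M"
  using assms unfolding boundary_points_def by blast

lemma boundary_points_subset:
  assumes "smooth_manifold n M" shows "boundary_points n M \<subseteq> points M"
  using boundary_pointE chart_subset[OF smooth_manifold_imp_premanifold[OF assms]] by (metis subsetD subsetI)

lemma closedin_boundary_points:
  assumes M: "smooth_manifold n M"
  shows "closedin (mtop M) (boundary_points n M)"
proof -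
  note PM = smooth_manifold_imp_premanifold[OF M]
  have "\<exists>W. openin (mtop M) W \<and> p \<in> W \<and> W \<subseteq> points M - boundary_points n M"
    if p: "p \<in> points M" "p \<notin> boundary_points n M" for p
  proof -
    obtain U \<phi> where U: "(U, \<phi>) \<in> atlas M" "p \<in> U" by (rule premanifold_cover[OF PM p(1)])
    note cU = premanifold_chart[OF PM U(1)]
    show ?thesis
    proof (cases "openin (half_space n) (\<phi> ` U)")
      case False
      then have "U \<subseteq> points M - boundary_points n M"
        using boundary_point_chart(1)[OF M _ U(1)] cU(4) by blast
      then show ?thesis using cU(1) U by blast
    next
      case True
      show ?thesis
      proof (cases "n = 0")
        case True
        then show ?thesis using p by (intro exI[of _ "points M"]) (auto simp: boundary_points_def)
      next
        case False
        let ?W = "{q \<in> U. \<phi> q (n - 1) \<in> - {0}}"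
        have "continuous_map (subtopology (mtop M) U) euclideanreal (\<lambda>q. \<phi> q (n - 1))"
          using chart_continuous[OF PM U(1)] by (simp add: continuous_map_into_fun)
        then have "openin (subtopology (mtop M) U) {q \<in> topspace (subtopology (mtop M) U). \<phi> q (n - 1) \<in> - {0}}"
          by (rule openin_continuous_map_preimage) auto
        moreover have "{q \<in> topspace (subtopology (mtop M) U). \<phi> q (n - 1) \<in> - {0}} = ?W"
          using cU(4) by auto
        ultimately have "openin (mtop M) ?W" using cU(1) openin_trans_full by metis
        moreover have "?W \<subseteq> points M - boundary_points n M"
          using boundary_point_chart(2)[OF M _ U(1)] cU(4) by auto
        moreover have "p \<in> ?W" using U p True False boundary_pointI[OF _ U(1) U(2) True] by auto
        ultimately show ?thesis by blast
      qed
    qed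
  qed
  then have "openin (mtop M) (points M - boundary_points n M)"
    by (subst openin_subopen) blast
  then show ?thesis
    using boundary_points_subset[OF M] by (simp add: closedin_def)
qed

subsection \<open>Bump functions\<close>

lemma compact_closed_cube: "compact {y \<in> ES n. \<forall>i<n. \<bar>y i - x i\<bar> \<le> e}"
proof -
  let ?X = "\<lambda>i. if i < n then {x i - e..x i + e} else {0}"
  have "compactin (product_topology (\<lambda>i. euclideanreal) UNIV) (\<Pi>\<^sub>E i\<in>UNIV. ?X i)"
    by (subst compactin_PiE) auto
  moreover have "(\<Pi>\<^sub>E i\<in>UNIV. ?X i) = {y \<in> ES n. \<forall>i<n. \<bar>y i - x i\<bar> \<le> e}"
  proof (intro equalityI subsetI)
    fix y assume y: "y \<in> (\<Pi>\<^sub>E i\<in>UNIV. ?X i)"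
    then have yi: "y i \<in> ?X i" for i by blast
    have "y i = 0" if "i \<ge> n" for i using yi[of i] that by simp
    moreover have "\<bar>y i - x i\<bar> \<le> e" if "i < n" for i using yi[of i] that by (auto simp: abs_le_iff)
    ultimately show "y \<in> {y \<in> ES n. \<forall>i<n. \<bar>y i - x i\<bar> \<le> e}" by (simp add: mem_ES)
  qed (auto simp: mem_ES abs_le_iff)
  ultimately show ?thesis by (simp add: euclidean_product_topology)
qed

lemma msmooth_prod:
  assumes "premanifold n M" "\<And>i. i < (k::nat) \<Longrightarrow> msmooth n M S (f i)"
  shows "msmooth n M S (\<lambda>p. \<Prod>i<k. f i p)"
  using assms(2)
proof (induction k)
  case (Suc k)
  then show ?case using msmooth_mult[OF assms(1), of S "\<lambda>p. \<Prod>i<k. f i p" "f k"] by simp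
qed (simp add: msmooth_const[OF assms(1)])

lemma msmooth_cutoff:
  assumes M: "premanifold n M" and U: "openin (mtop M) U" and f: "msmooth n M U f"
    and K: "closedin (mtop M) K" "K \<subseteq> U" and 0: "\<And>p. p \<in> points M \<Longrightarrow> p \<notin> K \<Longrightarrow> f p = 0"
  shows "msmooth n M UNIV f"
proof (rule msmooth_local[OF M])
  fix p assume "p \<in> points M"
  have "msmooth n M (points M - K) f"
    by (rule msmooth_cong[OF M msmooth_const[OF M, of _ 0]]) (use 0 in auto)
  moreover have "openin (mtop M) (points M - K)" using K(1) by (simp add: openin_diff)
  ultimately show "\<exists>W. openin (mtop M) W \<and> p \<in> W \<and> msmooth n M (UNIV \<inter> W) f"
    using U f K(2) \<open>p \<in> points M\<close> by (cases "p \<in> K") auto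
qed

text \<open>A product of one-variable bumps in the chart coordinates, extended by zero. The
  extension is smooth because \<open>K\<close> has compact image in the chart: it is compact in
  \<open>M\<close> and hence closed, as \<open>M\<close> is a Hausdorff space.\<close>

lemma bump_function:
  assumes M: "smooth_manifold n M" and U: "(U, \<phi>) \<in> atlas M" "p \<in> U"
  obtains b K W where "msmooth n M UNIV b" "\<And>q. 0 \<le> b q" "\<And>q. b q \<le> 1"
    "closedin (mtop M) K" "K \<subseteq> U" "\<And>q. q \<notin> K \<Longrightarrow> b q = 0"
    "openin (mtop M) W" "p \<in> W" "W \<subseteq> K" "\<And>q. q \<in> W \<Longrightarrow> b q = 1"
proof -
  note PM = smooth_manifold_imp_premanifold[OF M]
  note cU = premanifold_chart[OF PM U(1)]
  \<comment> \<open>\<open>Z\<close> is the whole space or the half space. Intersecting the closed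
    cube with the closed set \<open>Z\<close> gives a compact part of the chart image even at a
    boundary point.\<close>
  obtain Z where Z: "closed Z" and Zo: "\<exists>T. open T \<and> \<phi> ` U = ES n \<inter> Z \<inter> T"
  proof -
    consider "openin (Euclidean_space n) (\<phi> ` U)" | "openin (half_space n) (\<phi> ` U)"
      using smooth_manifold_chart_image[OF M U(1)] by blast
    then show ?thesis
    proof cases
      case 1
      then show ?thesis using that[of UNIV] by (auto simp: openin_Euclidean_space)
    next
      case 2
      have "closed {x :: nat \<Rightarrow> real. 0 \<le> x (n - 1)}"
        by (intro closed_Collect_le continuous_on_coord continuous_intros)
      moreover obtain T where "open T" "\<phi> ` U = {x \<in> ES n. 0 \<le> x (n - 1)} \<inter> T"
        using 2 openin_half_space by blast
      ultimately show ?thesis using that[of "{x. 0 \<le> x (n - 1)}"] by (auto intro!: exI[of _ T])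
    qed
  qed
  obtain T where T: "open T" "\<phi> ` U = ES n \<inter> Z \<inter> T" using Zo by blast
  have "openin (Euclidean_space n) (ES n \<inter> T)" using T(1) openin_Euclidean_space by blast
  moreover have "\<phi> p \<in> ES n \<inter> T" using T(2) U(2) by blast
  ultimately obtain e0 where e0: "e0 > 0" "cube n (\<phi> p) e0 \<subseteq> ES n \<inter> T" by (rule openin_Euclidean_space_cube)
  define e where "e = e0 / 2"
  have e: "e > 0" using e0 by (simp add: e_def)
  let ?C = "{y \<in> ES n. \<forall>i<n. \<bar>y i - \<phi> p i\<bar> \<le> e}"
  have CT: "?C \<subseteq> ES n \<inter> T"
  proof -
    have "?C \<subseteq> cube n (\<phi> p) e0" using e0(1) by (auto simp: cube_def e_def)
    then show ?thesis using e0 by blast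
  qed
  define K where "K = {q \<in> U. \<forall>i<n. \<bar>\<phi> q i - \<phi> p i\<bar> \<le> e}"
  have KC: "\<phi> ` K = ?C \<inter> Z"
  proof -
    have "\<phi> ` K = \<phi> ` U \<inter> ?C" using cU(2) by (auto simp: K_def)
    then show ?thesis using T(2) CT by blast
  qed
  have "compact (\<phi> ` K)" unfolding KC using compact_closed_cube Z by blast
  then have "compactin (top_of_set (\<phi> ` U)) (\<phi> ` K)"
    by (auto simp: compactin_subtopology K_def)
  then have "compactin (mtop M) (inv_into U \<phi> ` \<phi> ` K)"
    by (rule image_compactin[OF _ chart_inverse_continuous[OF PM U(1)]])
  moreover have "inv_into U \<phi> ` \<phi> ` K = K"
    by (rule inv_into_image_cancel[OF cU(5)]) (auto simp: K_def)
  ultimately have K: "closedin (mtop M) K"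
    using M compactin_imp_closedin by (auto simp: smooth_manifold_def)
  \<comment> \<open>The factor 4/3 brings the argument of \<open>step\<close> to 1 at half the
    radius, since (1 - 1/4) * (4/3) = 1. At the full radius the argument is 0. The formula avoids
    subtraction and division so that the rules for sums and products apply.\<close>
  define h where "h t = step ((1 + (- 1) * ((t * inverse e) * (t * inverse e))) * (4 / 3))" for t
  have h_eq: "h t = step ((1 - (t / e)\<^sup>2) * (4 / 3))" for t
  proof -
    have "(t * inverse e) * (t * inverse e) = (t / e)\<^sup>2"
      unfolding power2_eq_square by (simp only: divide_inverse)
    then show ?thesis unfolding h_def by simp
  qed
  have h1: "h t = 1" if "\<bar>t\<bar> \<le> e / 2" for t
  proof -
    have "(t / e)\<^sup>2 \<le> (1 / 2)\<^sup>2"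
      using that e by (intro abs_le_square_iff[THEN iffD1]) (auto simp: field_simps)
    then show ?thesis by (auto simp: h_eq power2_eq_square intro!: step_1)
  qed
  have h0: "h t = 0" if "\<not> \<bar>t\<bar> \<le> e" for t
  proof -
    have "1\<^sup>2 \<le> (t / e)\<^sup>2"
      using that e by (intro abs_le_square_iff[THEN iffD1]) (auto simp: field_simps)
    then show ?thesis by (auto simp: h_eq intro!: step_0)
  qed
  define b where "b q = (if q \<in> U then \<Prod>i<n. h (\<phi> q i - \<phi> p i) else 0)" for q
  have bK: "b q = 0" if "q \<notin> K" for q
  proof (cases "q \<in> U")
    case True
    then obtain i where "i < n" "\<not> \<bar>\<phi> q i - \<phi> p i\<bar> \<le> e" using \<open>q \<notin> K\<close> by (auto simp: K_def)
    then have "(\<Prod>i<n. h (\<phi> q i - \<phi> p i)) = 0" using h0 by (intro prod_zero) auto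
    then show ?thesis by (simp add: b_def)
  qed (simp add: b_def)
  have "msmooth n M U (\<lambda>q. \<Prod>i<n. h (\<phi> q i - \<phi> p i))"
  proof (rule msmooth_prod[OF PM])
    fix i assume "i < n"
    have 1: "msmooth n M U (\<lambda>q. (\<phi> q i + - \<phi> p i) * inverse e)"
      by (intro msmooth_mult[OF PM] msmooth_add[OF PM] msmooth_const[OF PM] msmooth_chart[OF PM U(1) \<open>i < n\<close>])
    have "msmooth n M U (\<lambda>q. (1 + (- 1) * (((\<phi> q i + - \<phi> p i) * inverse e) * ((\<phi> q i + - \<phi> p i) * inverse e))) * (4 / 3))"
      by (intro msmooth_mult[OF PM] msmooth_add[OF PM] msmooth_const[OF PM] 1)
    from msmooth_real[OF PM smooth_real_step this]
    show "msmooth n M U (\<lambda>q. h (\<phi> q i - \<phi> p i))"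
      by (simp only: h_def diff_conv_add_uminus)
  qed
  then have "msmooth n M U b" by (rule msmooth_cong[OF PM]) (simp add: b_def)
  then have 1: "msmooth n M UNIV b"
    by (rule msmooth_cutoff[OF PM cU(1) _ K]) (use bK in \<open>auto simp: K_def\<close>)
  have 2: "0 \<le> b q" "b q \<le> 1" for q
    by (auto simp: b_def h_def step_nonneg step_le_1 intro!: prod_nonneg prod_le_1)
  define W where "W = {q \<in> U. \<phi> q \<in> cube n (\<phi> p) (e / 2)}"
  have "openin (mtop M) W"
  proof -
    have "continuous_map (subtopology (mtop M) U) (Euclidean_space n) \<phi>"
      using smap_continuous[OF smap_chart[OF PM U(1)]] by simp
    from openin_continuous_map_preimage[OF this openin_cube]
    have "openin (subtopology (mtop M) U) {q \<in> topspace (subtopology (mtop M) U). \<phi> q \<in> cube n (\<phi> p) (e / 2)}" .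
    moreover have "{q \<in> topspace (subtopology (mtop M) U). \<phi> q \<in> cube n (\<phi> p) (e / 2)} = W"
      using cU(4) by (auto simp: W_def)
    ultimately show ?thesis using cU(1) openin_trans_full by metis
  qed
  moreover have "p \<in> W" using U(2) cU(2) e by (auto simp: W_def intro!: in_cube_self)
  moreover have "W \<subseteq> K" using e by (fastforce simp: W_def K_def cube_def)
  moreover have "b q = 1" if "q \<in> W" for q
  proof -
    have "h (\<phi> q i - \<phi> p i) = 1" if "i < n" for i
      using \<open>q \<in> W\<close> that by (intro h1) (auto simp: W_def cube_def)
    then show ?thesis using that by (simp add: b_def W_def)
  qed
  ultimately show ?thesis
    using that[of b K W] 1 2 K bK by (auto simp: K_def)
qed

subsection \<open>A boundary defining function and a retraction onto the boundary\<close>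

definition half_chart :: "nat \<Rightarrow> 'a mfd \<Rightarrow> 'a chart \<Rightarrow> bool" where
  "half_chart n M c \<longleftrightarrow> c \<in> atlas M \<and> openin (half_space n) (snd c ` fst c)"

lemma half_chart_image_boundary:
  assumes M: "smooth_manifold n M" and n: "0 < n" and U: "half_chart n M (U, \<phi>)" and q: "q \<in> U"
  shows "q \<in> boundary_points n M \<longleftrightarrow> \<phi> q (n - 1) = 0"
  using U q boundary_point_chart(2)[OF M, of q U \<phi>] boundary_pointI[OF n, of U \<phi> M q]
  by (auto simp: half_chart_def)

definition bump_chart ::
    "nat \<Rightarrow> 'a mfd \<Rightarrow> 'a set \<Rightarrow> ('a \<Rightarrow> nat \<Rightarrow> real) \<Rightarrow> ('a \<Rightarrow> real) \<Rightarrow> 'a set \<Rightarrow> 'a set \<Rightarrow> bool" where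
  "bump_chart n M U \<phi> b K W \<longleftrightarrow> half_chart n M (U, \<phi>) \<and> msmooth n M UNIV b \<and> (\<forall>q. 0 \<le> b q) \<and>
     closedin (mtop M) K \<and> K \<subseteq> U \<and> (\<forall>q. q \<notin> K \<longrightarrow> b q = 0) \<and>
     openin (mtop M) W \<and> W \<subseteq> K \<and> (\<forall>q\<in>W. b q = 1)"

lemma boundary_cover:
  fixes M :: "'a mfd"
  assumes M: "compact_manifold n M"
  obtains I :: "'a set" and U \<phi> b K W where "finite I"
    "\<And>i. i \<in> I \<Longrightarrow> bump_chart n M (U i) (\<phi> i) (b i) (K i) (W i)" "boundary_points n M \<subseteq> (\<Union>i\<in>I. W i)"
proof -
  have SM: "smooth_manifold n M" and cM: "compact_space (mtop M)" using M by (auto simp: compact_manifold_def)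
  have "\<exists>U \<phi> b K W. p \<in> W \<and> bump_chart n M U \<phi> b K W" if p: "p \<in> boundary_points n M" for p
  proof -
    obtain U \<phi> where U: "(U, \<phi>) \<in> atlas M" "p \<in> U" "openin (half_space n) (\<phi> ` U)"
      using boundary_pointE[OF p] by blast
    obtain b K W where "msmooth n M UNIV b" "\<And>q. 0 \<le> b q" "\<And>q. b q \<le> 1"
      "closedin (mtop M) K" "K \<subseteq> U" "\<And>q. q \<notin> K \<Longrightarrow> b q = 0"
      "openin (mtop M) W" "p \<in> W" "W \<subseteq> K" "\<And>q. q \<in> W \<Longrightarrow> b q = 1"
      using bump_function[OF SM U(1,2)] by blast
    then have "p \<in> W \<and> bump_chart n M U \<phi> b K W" using U by (simp add: half_chart_def bump_chart_def)
    then show ?thesis by blast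
  qed
  then obtain U \<phi> b K W where P: "\<And>p. p \<in> boundary_points n M \<Longrightarrow>
      p \<in> W p \<and> bump_chart n M (U p) (\<phi> p) (b p) (K p) (W p)"
    by metis
  have "compactin (mtop M) (boundary_points n M)"
    using closedin_compact_space[OF cM closedin_boundary_points[OF SM]] .
  then have "\<exists>\<F>. finite \<F> \<and> \<F> \<subseteq> W ` boundary_points n M \<and> boundary_points n M \<subseteq> \<Union> \<F>"
    by (rule compactinD) (use P in \<open>auto simp: bump_chart_def\<close>)
  then obtain \<F> where \<F>: "finite \<F>" "\<F> \<subseteq> W ` boundary_points n M" "boundary_points n M \<subseteq> \<Union> \<F>"
    by blast
  then obtain I where I: "I \<subseteq> boundary_points n M" "finite I" "\<F> = W ` I"
    by (meson finite_subset_image)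
  show ?thesis
    by (rule that[of I U \<phi> b K W]) (use I \<F> P in \<open>auto simp: subset_iff\<close>)
qed

text \<open>The function is the sum of the last chart coordinates weighted by bumps. All summands
  are nonnegative, so the sum dominates the last coordinate of any chart where the bump equals 1.
  This bound takes the place of a statement on the normal derivative: \<open>collar_local\<close>
  turns it into a derivative of at least 1.\<close>

lemma boundary_defining_function:
  fixes M :: "'a mfd"
  assumes M: "compact_manifold n M" and n: "0 < n"
  obtains \<rho> where "msmooth n M UNIV \<rho>" "\<And>q. q \<in> points M \<Longrightarrow> 0 \<le> \<rho> q"
    "\<And>q. q \<in> boundary_points n M \<Longrightarrow> \<rho> q = 0"
    "\<And>p. p \<in> boundary_points n M \<Longrightarrow> \<exists>U \<phi> W. half_chart n M (U, \<phi>) \<and> openin (mtop M) W \<and> p \<in> W \<and> W \<subseteq> U \<and>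
       (\<forall>q\<in>W. \<phi> q (n - 1) \<le> \<rho> q)"
proof -
  have SM: "smooth_manifold n M" using M by (simp add: compact_manifold_def)
  note PM = smooth_manifold_imp_premanifold[OF SM]
  obtain I :: "'a set" and U \<phi> b K W where I: "finite I" and
    I': "\<And>i. i \<in> I \<Longrightarrow> bump_chart n M (U i) (\<phi> i) (b i) (K i) (W i)" and
    cover: "boundary_points n M \<subseteq> (\<Union>i\<in>I. W i)"
    using boundary_cover[OF M] by blast
  note * = I'[unfolded bump_chart_def]
  let ?f = "\<lambda>i q. b i q * \<phi> i q (n - 1)"
  have f_nonneg: "0 \<le> ?f i q" if "i \<in> I" for i q
  proof (cases "q \<in> U i")
    case True
    then show ?thesis using *[OF that] half_space_chart_nonneg[of n "\<phi> i" "U i"] by (auto simp: half_chart_def)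
  next
    case False
    then have "b i q = 0" using *[OF that] by blast
    then show ?thesis by simp
  qed
  have f_smooth: "msmooth n M UNIV (?f i)" if i: "i \<in> I" for i
  proof -
    have U: "(U i, \<phi> i) \<in> atlas M" using *[OF i] by (simp add: half_chart_def)
    have "msmooth n M (U i) (?f i)"
    proof (rule msmooth_mult[OF PM])
      show "msmooth n M (U i) (b i)" by (rule msmooth_subset[of n M UNIV]) (use *[OF i] in auto)
      show "msmooth n M (U i) (\<lambda>q. \<phi> i q (n - 1))" by (rule msmooth_chart[OF PM U]) (use n in simp)
    qed
    then show ?thesis
      by (rule msmooth_cutoff[OF PM chart_openin[OF PM U], where K = "K i"]) (use *[OF i] in auto)
  qed
  have sum: "msmooth n M UNIV (\<lambda>q. \<Sum>i\<in>J. ?f i q)" if "finite J" "J \<subseteq> I" for J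
    using that
  proof induction
    case (insert i J)
    then show ?case using msmooth_add[OF PM f_smooth[of i]] by simp
  qed (simp add: msmooth_const[OF PM])
  show ?thesis
  proof
    show "msmooth n M UNIV (\<lambda>q. \<Sum>i\<in>I. ?f i q)" using sum I by blast
    show "0 \<le> (\<Sum>i\<in>I. ?f i q)" for q by (intro sum_nonneg f_nonneg)
    show "(\<Sum>i\<in>I. ?f i q) = 0" if "q \<in> boundary_points n M" for q
    proof (rule sum.neutral, rule ballI)
      fix i assume i: "i \<in> I"
      show "?f i q = 0"
      proof (cases "q \<in> U i")
        case True
        then show ?thesis using half_chart_image_boundary[OF SM n _ True] *[OF i] that by auto
      next
        case False
        then have "b i q = 0" using *[OF i] by blast
        then show ?thesis by simp
      qed
    qed
    fix p assume "p \<in> boundary_points n M"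
    then obtain i where i: "i \<in> I" "p \<in> W i" using cover by blast
    have "\<phi> i q (n - 1) \<le> (\<Sum>i\<in>I. ?f i q)" if "q \<in> W i" for q
    proof -
      have "\<phi> i q (n - 1) = ?f i q" using *[OF i(1)] that by simp
      also have "\<dots> \<le> (\<Sum>i\<in>I. ?f i q)" by (rule member_le_sum[OF i(1) _ I]) (use f_nonneg in auto)
      finally show ?thesis .
    qed
    moreover have "W i \<subseteq> U i" using *[OF i(1)] by blast
    ultimately show "\<exists>U \<phi> W. half_chart n M (U, \<phi>) \<and> openin (mtop M) W \<and> p \<in> W \<and> W \<subseteq> U \<and>
       (\<forall>q\<in>W. \<phi> q (n - 1) \<le> (\<Sum>i\<in>I. ?f i q))"
      using *[OF i(1)] i(2) by (intro exI[of _ "U i"] exI[of _ "\<phi> i"] exI[of _ "W i"]) simp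
  qed
qed

definition boundary_retraction :: "nat \<Rightarrow> 'a mfd \<Rightarrow> 'a set \<Rightarrow> ('a \<Rightarrow> 'a) \<Rightarrow> bool" where
  "boundary_retraction n M O' r \<longleftrightarrow> openin (mtop M) O' \<and> smap n n M O' M r \<and>
     r ` O' \<subseteq> boundary_points n M \<and> (\<forall>q\<in>O' \<inter> boundary_points n M. r q = q)"

text \<open>A retraction defined near a part of the boundary is extended across one more chart by
  interpolating, in the chart, between it and the vertical projection of the chart.\<close>

lemma boundary_retraction_extend:
  assumes M: "smooth_manifold n M" and n: "0 < n" and r: "boundary_retraction n M O' r"
    and U: "half_chart n M (U, \<phi>)" and b: "msmooth n M UNIV b"
    and K: "closedin (mtop M) K" "K \<subseteq> U" "\<And>q. q \<notin> K \<Longrightarrow> b q = 0"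
    and W: "openin (mtop M) W" "W \<subseteq> K" "\<And>q. q \<in> W \<Longrightarrow> b q = (1 :: real)"
  obtains O'' r' where "boundary_retraction n M O'' r'"
    "boundary_points n M \<inter> (O' \<union> W) \<subseteq> O''"
proof -
  note PM = smooth_manifold_imp_premanifold[OF M]
  let ?B = "boundary_points n M"
  have Ua: "(U, \<phi>) \<in> atlas M" using U by (simp add: half_chart_def)
  note cU = premanifold_chart[OF PM Ua]
  have r': "openin (mtop M) O'" "smap n n M O' M r" "\<And>q. q \<in> O' \<Longrightarrow> r q \<in> ?B"
    "\<And>q. q \<in> O' \<Longrightarrow> q \<in> ?B \<Longrightarrow> r q = q"
    using r by (auto simp: boundary_retraction_def)
  have OM: "O' \<subseteq> points M" using r'(1) openin_subset by blast
  obtain T where T: "open T" "\<phi> ` U = {x \<in> ES n. 0 \<le> x (n - 1)} \<inter> T"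
    using U openin_half_space by (auto simp: half_chart_def)
  have bd: "q \<in> ?B \<longleftrightarrow> \<phi> q (n - 1) = 0" if "q \<in> U" for q
    by (rule half_chart_image_boundary[OF M n U that])
  have inv: "inv_into U \<phi> (\<phi> q) = q" if "q \<in> U" for q using that cU(5) by simp
  define y where "y q = (\<phi> q)(n - 1 := 0)" for q
  \<comment> \<open>Weight 0 gives the old retraction read in the chart, weight 1 the vertical
    projection \<open>y\<close>. The last coordinate is 0 throughout, so that the interpolated
    points remain on the boundary.\<close>
  define z where "z q = (\<lambda>i. if i < n - 1 then (1 + (- 1) * b q) * \<phi> (r q) i + b q * \<phi> q i else 0)" for q
  have \<phi>0: "\<phi> q i = 0" if "q \<in> U" "i \<ge> n" for q i using cU(2) that by (auto simp: mem_ES)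
  define D where "D = {q \<in> O' \<inter> U. r q \<in> U}"
  have Do: "openin (mtop M) D"
  proof -
    have "openin (subtopology (mtop M) O') {q \<in> topspace (subtopology (mtop M) O'). r q \<in> U}"
      by (rule openin_continuous_map_preimage[OF smap_continuous[OF r'(2)] cU(1)])
    moreover have "{q \<in> topspace (subtopology (mtop M) O'). r q \<in> U} = {q \<in> O'. r q \<in> U}" using OM by auto
    ultimately have "openin (mtop M) {q \<in> O'. r q \<in> U}" using r'(1) openin_trans_full by metis
    moreover have "D = {q \<in> O'. r q \<in> U} \<inter> U" by (auto simp: D_def)
    ultimately show ?thesis using cU(1) by auto
  qed
  have sy: "smap n n M U (euclidean_mfd n) y"
  proof (rule smap_into_euclidean[OF PM])
    show "msmooth n M U (\<lambda>p. y p j)" if "j < n" for j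
      using msmooth_chart[OF PM Ua that] msmooth_const[OF PM] by (cases "j = n - 1") (simp_all add: y_def)
    show "y p \<in> ES n" if "p \<in> U" for p using \<phi>0[OF that] by (simp add: y_def mem_ES)
  qed
  have zE: "z p \<in> ES n" for p
    unfolding mem_ES
  proof (intro allI impI)
    fix i assume "n \<le> i"
    then have "\<not> i < n - 1" by linarith
    then show "z p i = 0" by (simp add: z_def)
  qed
  have sz: "smap n n M D (euclidean_mfd n) z"
  proof (rule smap_into_euclidean[OF PM])
    show "z p \<in> ES n" for p by (rule zE)
    fix j assume j: "j < n"
    have rj: "msmooth n M D (\<lambda>q. \<phi> (r q) j)"
      by (rule msmooth_subset[OF smap_msmooth[OF r'(2) Ua j]]) (auto simp: D_def)
    have "msmooth n M D (\<lambda>q. (1 + (- 1) * b q) * \<phi> (r q) j + b q * \<phi> q j)"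
      by (intro msmooth_add[OF PM] msmooth_mult[OF PM] msmooth_const[OF PM] rj
           msmooth_subset[OF b] msmooth_subset[OF msmooth_chart[OF PM Ua j]]) (auto simp: D_def)
    then show "msmooth n M D (\<lambda>p. z p j)"
      using msmooth_const[OF PM, of D 0] by (cases "j < n - 1") (simp_all add: z_def)
  qed
  have pre: "openin (mtop M) {q \<in> A. g q \<in> T}" if "openin (mtop M) A" "smap n n M A (euclidean_mfd n) g" for A g
  proof -
    have "continuous_map (subtopology (mtop M) A) euclidean g"
      using smap_continuous[OF that(2)]
      by (simp add: Euclidean_space_eq_top_of_set continuous_map_in_subtopology)
    from openin_continuous_map_preimage[OF this] T(1)
    have "openin (subtopology (mtop M) A) {q \<in> topspace (subtopology (mtop M) A). g q \<in> T}" by simp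
    moreover have "{q \<in> topspace (subtopology (mtop M) A). g q \<in> T} = {q \<in> A. g q \<in> T}"
      using openin_subset[OF that(1)] by auto
    ultimately show ?thesis using that(1) openin_trans_full by metis
  qed
  have z_bd: "z q = \<phi> q" if "q \<in> U" "q \<in> ?B" "r q = q" for q
  proof
    fix i
    consider "i < n - 1" | "i = n - 1" | "n \<le> i" by linarith
    then show "z q i = \<phi> q i"
      by cases (use that bd \<phi>0[of q] n in \<open>auto simp: z_def algebra_simps\<close>)
  qed
  \<comment> \<open>Away from \<open>K\<close> the old retraction is kept, on \<open>D\<close> it is
    interpolated, and on \<open>W\<close>, which may leave \<open>O'\<close>, the projection acts
    alone. The conditions with \<open>T\<close> say that the new values lie in the chart image. The
    definitions agree on overlaps because the weight is 0 off \<open>K\<close> and 1 on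
    \<open>W\<close>, while \<open>O1\<close> and \<open>O3\<close> are disjoint.\<close>
  define O1 where "O1 = O' - K"
  define O2 where "O2 = {q \<in> D. z q \<in> T}"
  define O3 where "O3 = {q \<in> W. y q \<in> T}"
  have o: "openin (mtop M) O1" "openin (mtop M) O2" "openin (mtop M) O3"
    using r'(1) K(1) pre[OF Do sz] pre[OF W(1) smap_subset[OF sy]] W(2) K(2)
    by (auto simp: O1_def O2_def O3_def openin_diff)
  have z_im: "z q \<in> \<phi> ` U \<and> z q (n - 1) = 0" if "q \<in> O2" for q
    using that zE[of q] n by (auto simp: T(2) O2_def z_def)
  have y_im: "y q \<in> \<phi> ` U \<and> y q (n - 1) = 0" if "q \<in> O3" for q
    using that W(2) K(2) \<phi>0[of q] by (auto simp: T(2) O3_def y_def mem_ES)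
  define s where "s q = (if q \<in> O1 then r q else if q \<in> O2 then inv_into U \<phi> (z q) else inv_into U \<phi> (y q))" for q
  have s1: "s q = r q" if "q \<in> O1" for q using that by (simp add: s_def)
  have s2: "s q = inv_into U \<phi> (z q)" if "q \<in> O2" for q
  proof (cases "q \<in> O1")
    case True
    then have "b q = 0" using K(3) by (simp add: O1_def)
    have rq: "r q \<in> U" "r q \<in> ?B" using that r'(3) by (auto simp: O2_def D_def)
    have "z q = \<phi> (r q)"
    proof
      fix i
      consider "i < n - 1" | "i = n - 1" | "n \<le> i" by linarith
      then show "z q i = \<phi> (r q) i"
        by cases (use \<open>b q = 0\<close> bd rq \<phi>0[of "r q"] n in \<open>auto simp: z_def\<close>)
    qed
    then show ?thesis using True inv[OF rq(1)] by (simp add: s_def)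
  qed (use that in \<open>simp add: s_def\<close>)
  have s3: "s q = inv_into U \<phi> (y q)" if "q \<in> O3" for q
  proof (cases "q \<in> O2")
    case True
    have "q \<in> W" using that by (simp add: O3_def)
    then have "q \<in> U" "b q = 1" using W K by auto
    have "z q = y q"
    proof
      fix i
      consider "i < n - 1" | "i = n - 1" | "n \<le> i" by linarith
      then show "z q i = y q i"
        by cases (use \<open>q \<in> U\<close> \<open>b q = 1\<close> \<phi>0[of q] n in \<open>auto simp: z_def y_def\<close>)
    qed
    then show ?thesis using s2[OF True] by simp
  qed (use that W(2) in \<open>auto simp: s_def O1_def O3_def\<close>)
  have "boundary_retraction n M (O1 \<union> O2 \<union> O3) s"
    unfolding boundary_retraction_def
  proof (intro conjI ballI)
    show "openin (mtop M) (O1 \<union> O2 \<union> O3)" using o by auto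
    show "smap n n M (O1 \<union> O2 \<union> O3) M s"
    proof (rule smap_local[OF PM])
      fix p assume "p \<in> O1 \<union> O2 \<union> O3"
      moreover have "smap n n M O1 M s"
        by (rule smap_cong[OF PM smap_subset[OF r'(2)]]) (auto simp: s1 O1_def)
      moreover have "smap n n M O2 M s"
      proof (rule smap_cong[OF PM])
        show "smap n n M O2 M (\<lambda>q. inv_into U \<phi> (z q))"
          by (rule smap_compose[OF PM premanifold_euclidean smap_subset[OF sz] smap_chart_inverse[OF PM Ua]])
             (use z_im in \<open>auto simp: O2_def\<close>)
      qed (simp add: s2)
      moreover have "smap n n M O3 M s"
      proof (rule smap_cong[OF PM])
        show "smap n n M O3 M (\<lambda>q. inv_into U \<phi> (y q))"
          by (rule smap_compose[OF PM premanifold_euclidean smap_subset[OF sy] smap_chart_inverse[OF PM Ua]])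
             (use y_im W K in \<open>auto simp: O3_def\<close>)
      qed (simp add: s3)
      moreover have "(O1 \<union> O2 \<union> O3) \<inter> O1 = O1" "(O1 \<union> O2 \<union> O3) \<inter> O2 = O2" "(O1 \<union> O2 \<union> O3) \<inter> O3 = O3"
        by blast+
      ultimately show "\<exists>W. openin (mtop M) W \<and> p \<in> W \<and> smap n n M ((O1 \<union> O2 \<union> O3) \<inter> W) M s"
        using o by (metis UnE)
    qed
    show "s ` (O1 \<union> O2 \<union> O3) \<subseteq> ?B"
    proof clarify
      fix q assume q: "q \<in> O1 \<union> O2 \<union> O3"
      have im: "inv_into U \<phi> w \<in> ?B" if "w \<in> \<phi> ` U \<and> w (n - 1) = 0" for w
        using that bd inv by auto
      show "s q \<in> ?B"
      proof (cases "q \<in> O1")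
        case True
        then show ?thesis using s1 r'(3) by (simp add: O1_def)
      next
        case False
        then show ?thesis using q s2 s3 im z_im y_im by (metis Un_iff)
      qed
    qed
  next
    fix q assume q: "q \<in> (O1 \<union> O2 \<union> O3) \<inter> ?B"
    have *: "y q = \<phi> q" if "q \<in> U" using that q bd by (auto simp: y_def)
    consider "q \<in> O1" | "q \<in> O2" | "q \<in> O3" using q by blast
    then show "s q = q"
    proof cases
      case 1
      then show ?thesis using q s1 r'(4) by (simp add: O1_def)
    next
      case 2
      then have "q \<in> U" "r q = q" using q r'(4) by (auto simp: O2_def D_def)
      then have "z q = \<phi> q" using z_bd q by blast
      then show ?thesis using s2[OF 2] inv[OF \<open>q \<in> U\<close>] by simp
    next
      case 3
      then have "q \<in> U" using W K by (auto simp: O3_def)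
      then show ?thesis using s3[OF 3] * inv by simp
    qed
  qed
  moreover have "?B \<inter> (O' \<union> W) \<subseteq> O1 \<union> O2 \<union> O3"
  proof
    fix q assume q: "q \<in> ?B \<inter> (O' \<union> W)"
    have *: "y q = \<phi> q" "\<phi> q \<in> T" if "q \<in> U" using that q bd T(2) by (auto simp: y_def)
    show "q \<in> O1 \<union> O2 \<union> O3"
    proof (cases "q \<in> W")
      case True
      then show ?thesis using * W K by (auto simp: O3_def)
    next
      case False
      then have qO: "q \<in> O'" "r q = q" using q r'(4) by auto
      show ?thesis
      proof (cases "q \<in> K")
        case True
        then have "q \<in> U" using K by blast
        then have "z q = \<phi> q" using z_bd q qO by blast
        then show ?thesis using * qO \<open>q \<in> U\<close> by (simp add: O2_def D_def)
      qed (use qO in \<open>simp add: O1_def\<close>)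
    qed
  qed
  ultimately show ?thesis using that by blast
qed

lemma boundary_retraction_exists:
  fixes M :: "'a mfd"
  assumes M: "compact_manifold n M" and n: "0 < n"
  obtains O' r where "boundary_retraction n M O' r" "boundary_points n M \<subseteq> O'"
proof -
  have SM: "smooth_manifold n M" using M by (simp add: compact_manifold_def)
  note PM = smooth_manifold_imp_premanifold[OF SM]
  obtain I :: "'a set" and U \<phi> b K W where I: "finite I" and
    I': "\<And>i. i \<in> I \<Longrightarrow> bump_chart n M (U i) (\<phi> i) (b i) (K i) (W i)" and
    cover: "boundary_points n M \<subseteq> (\<Union>i\<in>I. W i)"
    using boundary_cover[OF M] by blast
  note * = I'[unfolded bump_chart_def]
  have "\<exists>O' r. boundary_retraction n M O' r \<and> boundary_points n M \<inter> (\<Union>i\<in>J. W i) \<subseteq> O'" if "finite J" "J \<subseteq> I" for J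
    using that
  proof induction
    case empty
    have "boundary_retraction n M {} (\<lambda>q. q)"
      unfolding boundary_retraction_def using smap_id[OF PM] by simp
    then show ?case by auto
  next
    case (insert i J)
    then obtain O' r where r: "boundary_retraction n M O' r" "boundary_points n M \<inter> (\<Union>i\<in>J. W i) \<subseteq> O'" by blast
    note i = *[of i]
    obtain O'' r' where "boundary_retraction n M O'' r'" "boundary_points n M \<inter> (O' \<union> W i) \<subseteq> O''"
      by (rule boundary_retraction_extend[OF SM n r(1), of "U i" "\<phi> i" "b i" "K i" "W i"]) (use i insert.prems in auto)
    then show ?case using r(2) by (intro exI[of _ O''] exI[of _ r']) auto
  qed
  from this[OF I order_refl] cover that show ?thesis by (metis Int_absorb2)
qed

section \<open>Existence of collars\<close>

lemma finite_INT_openin_Euclidean_space: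
  assumes "\<And>j. j < (k::nat) \<Longrightarrow> openin (Euclidean_space n) (W j)"
  shows "openin (Euclidean_space n) (ES n \<inter> (\<Inter>j\<in>{..<k}. W j))"
proof (cases "k = 0")
  case False
  then have "openin (Euclidean_space n) (\<Inter>j\<in>{..<k}. W j)"
    by (intro openin_INT2) (auto intro: assms)
  then show ?thesis by (intro openin_Int) simp_all
qed simp

lemma smap_chart_upd:
  assumes M: "premanifold n M" and U: "(U, \<phi>) \<in> atlas M" and n: "0 < n"
  shows "smap (Suc n) n (cylinder n M) (U \<times> UNIV) (euclidean_mfd n) (\<lambda>z. (\<phi> (fst z))(n - 1 := snd z))"
proof (rule smap_into_euclidean[OF premanifold_cylinder[OF M]])
  show "msmooth (Suc n) (cylinder n M) (U \<times> UNIV) (\<lambda>z. ((\<phi> (fst z))(n - 1 := snd z)) j)" if "j < n" for j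
  proof (cases "j = n - 1")
    case True
    then show ?thesis using msmooth_snd[OF M] by simp
  next
    case False
    have "msmooth (Suc n) (cylinder n M) (U \<times> UNIV) (\<lambda>z. \<phi> (fst z) j)"
      by (rule msmooth_compose[OF premanifold_cylinder[OF M] M smap_fst[OF M] msmooth_chart[OF M U that]]) auto
    then show ?thesis using False by simp
  qed
  show "(\<phi> (fst z))(n - 1 := snd z) \<in> ES n" if "z \<in> U \<times> UNIV" for z
    using chart_image[OF M U] that n by (auto simp: mem_ES image_subset_iff)
qed

text \<open>Near each boundary point, the pair of a retraction and a boundary defining function is
  invertible: in a chart, it extends to a map that fixes the boundary hyperplane pointwise.\<close>

lemma collar_local:
  assumes M: "compact_manifold n M" and n: "0 < n" and r: "boundary_retraction n M O' r"
    and \<rho>: "msmooth n M UNIV \<rho>" "\<And>q. q \<in> points M \<Longrightarrow> 0 \<le> \<rho> q"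
      "\<And>q. q \<in> boundary_points n M \<Longrightarrow> \<rho> q = 0"
    and p: "p \<in> boundary_points n M" "p \<in> O'"
    and U: "half_chart n M (U, \<phi>)" "openin (mtop M) W" "p \<in> W" "W \<subseteq> U"
      "\<And>q. q \<in> W \<Longrightarrow> \<phi> q (n - 1) \<le> \<rho> q"
  obtains P Q c where "openin (mtop M) P" "p \<in> P" "P \<subseteq> O'" "openin (mtop (cylinder n M)) Q"
    "(\<lambda>q. (r q, \<rho> q)) ` P = Q \<inter> (boundary_points n M \<times> {0..})"
    "\<And>q. q \<in> P \<Longrightarrow> c (r q, \<rho> q) = q"
    "smap (Suc n) n (cylinder n M) (Q \<inter> (boundary_points n M \<times> {0..})) M c"
proof -
  have SM: "smooth_manifold n M" using M by (simp add: compact_manifold_def)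
  note PM = smooth_manifold_imp_premanifold[OF SM]
  let ?B = "boundary_points n M"
  have r': "openin (mtop M) O'" "smap n n M O' M r" "\<And>q. q \<in> O' \<Longrightarrow> r q \<in> ?B"
    "\<And>q. q \<in> O' \<Longrightarrow> q \<in> ?B \<Longrightarrow> r q = q"
    using r by (auto simp: boundary_retraction_def)
  have OM: "O' \<subseteq> points M" using r'(1) openin_subset by blast
  have Ua: "(U, \<phi>) \<in> atlas M" using U by (simp add: half_chart_def)
  note cU = premanifold_chart[OF PM Ua]
  have inv: "inv_into U \<phi> (\<phi> q) = q" if "q \<in> U" for q using that cU(5) by simp
  have bd: "q \<in> ?B \<longleftrightarrow> \<phi> q (n - 1) = 0" if "q \<in> U" for q
    by (rule half_chart_image_boundary[OF SM n U(1) that])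
  define D where "D = {q \<in> O' \<inter> W. r q \<in> U}"
  have DU: "D \<subseteq> U" "D \<subseteq> O'" using U(4) by (auto simp: D_def)
  have Do: "openin (mtop M) D"
  proof -
    have "openin (subtopology (mtop M) O') {q \<in> topspace (subtopology (mtop M) O'). r q \<in> U}"
      by (rule openin_continuous_map_preimage[OF smap_continuous[OF r'(2)] cU(1)])
    moreover have "{q \<in> topspace (subtopology (mtop M) O'). r q \<in> U} = {q \<in> O'. r q \<in> U}" using OM by auto
    ultimately have "openin (mtop M) {q \<in> O'. r q \<in> U}" using r'(1) openin_trans_full by metis
    moreover have "D = {q \<in> O'. r q \<in> U} \<inter> W" by (auto simp: D_def)
    ultimately show ?thesis using U(2) by auto
  qed
  have pD: "p \<in> D" using p U r'(4)[OF p(2,1)] by (auto simp: D_def)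
  define A where "A = \<phi> ` D"
  obtain T1 where T1: "open T1" "\<phi> ` U = {x \<in> ES n. 0 \<le> x (n - 1)} \<inter> T1"
    using U openin_half_space by (auto simp: half_chart_def)
  obtain T2 where T2: "open T2" "\<phi> ` (U \<inter> D) = \<phi> ` U \<inter> T2"
    by (rule chart_image_Int_open[OF PM Ua Do])
  define T where "T = T1 \<inter> T2"
  have A: "open T" "A = {x \<in> ES n. 0 \<le> x (n - 1)} \<inter> T"
    using T1 T2 DU by (auto simp: T_def A_def Int_absorb1)
  have AU: "A \<subseteq> \<phi> ` U" using DU by (auto simp: A_def)
  let ?g = "inv_into U \<phi>"
  have gA: "?g y \<in> D" "\<phi> (?g y) = y" if "y \<in> A" for y using that DU inv by (auto simp: A_def)
  \<comment> \<open>The pair of \<open>r\<close> and \<open>\<rho>\<close> read in the chart, with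
    \<open>\<rho>\<close> in place of the last coordinate, which is 0 for boundary points.\<close>
  define \<kappa> where "\<kappa> y j = (if j = n - 1 then \<rho> (?g y) else \<phi> (r (?g y)) j)" for y j
  have sg: "smap n n (euclidean_mfd n) A M ?g" by (rule smap_subset[OF smap_chart_inverse[OF PM Ua] AU])
  have AE: "A \<subseteq> ES n" using A(2) by auto
  have \<kappa>: "smooth_on n A (\<lambda>y. \<kappa> y j)" if j: "j < n" for j
  proof (cases "j = n - 1")
    case True
    have "msmooth n (euclidean_mfd n) A (\<lambda>y. \<rho> (?g y))"
      by (rule msmooth_compose[OF premanifold_euclidean PM sg \<rho>(1)]) simp
    then show ?thesis using AE True by (simp add: msmooth_euclidean \<kappa>_def)
  next
    case False
    have "msmooth n M D (\<lambda>q. \<phi> (r q) j)"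
      by (rule msmooth_subset[OF smap_msmooth[OF r'(2) Ua j]]) (auto simp: D_def)
    then have "msmooth n (euclidean_mfd n) A (\<lambda>y. \<phi> (r (?g y)) j)"
      by (rule msmooth_compose[OF premanifold_euclidean PM sg]) (rule gA)
    then show ?thesis using AE False by (simp add: msmooth_euclidean \<kappa>_def)
  qed
  define y0 where "y0 = \<phi> p"
  have y0: "y0 \<in> A" "y0 (n - 1) = 0" using pD bd[of p] p(1) DU by (auto simp: A_def y0_def)
  \<comment> \<open>\<open>\<kappa>\<close> lives on a half space only. Local extensions of its
    components provide a map on a full cube around \<open>y0\<close>, to which the inversion lemma
    applies.\<close>
  have "\<exists>V F. y0 \<in> V \<and> smooth_on_open n V F \<and> (\<forall>y\<in>V \<inter> A. F y = \<kappa> y j)" if "j < n" for j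
    using \<kappa>[OF that] y0(1) unfolding smooth_on_def by blast
  then obtain V F where VF: "\<And>j. j < n \<Longrightarrow> y0 \<in> V j" "\<And>j. j < n \<Longrightarrow> smooth_on_open n (V j) (F j)"
    "\<And>j y. j < n \<Longrightarrow> y \<in> V j \<Longrightarrow> y \<in> A \<Longrightarrow> F j y = \<kappa> y j" by (metis IntI)
  define V0 where "V0 = (ES n \<inter> (\<Inter>j\<in>{..<n}. V j)) \<inter> (ES n \<inter> T)"
  have "openin (Euclidean_space n) V0"
    unfolding V0_def
  proof (rule openin_Int)
    show "openin (Euclidean_space n) (ES n \<inter> (\<Inter>j\<in>{..<n}. V j))"
      by (rule finite_INT_openin_Euclidean_space) (rule smooth_on_open_imp_openin[OF VF(2)])
    show "openin (Euclidean_space n) (ES n \<inter> T)"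
      unfolding openin_Euclidean_space using A(1) by (intro exI[of _ T]) simp
  qed
  moreover have "y0 \<in> V0" using y0 A(2) VF(1) by (auto simp: V0_def)
  ultimately obtain e where e: "e > 0" "cube n y0 e \<subseteq> V0" by (rule openin_Euclidean_space_cube)
  let ?H = "{x. 0 \<le> x (n - 1)} :: (nat \<Rightarrow> real) set"
  define C where "C = cube n y0 e"
  have C: "openin (Euclidean_space n) C" "y0 \<in> C" "C \<subseteq> V0" "C \<subseteq> ES n" "C \<inter> ?H \<subseteq> A"
    using e y0 AE A(2) openin_cube[of n y0 e] by (auto simp: C_def V0_def cube_def)
  define F' where "F' y = (\<lambda>j. if j < n then F j y else 0)" for y
  have F'sm: "smooth_on_open n C (\<lambda>y. F' y j)" if "j < n" for j
    using smooth_on_open_subset[OF VF(2)[OF that] C(1)] C(3) that by (auto simp: F'_def V0_def)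
  have F'\<kappa>: "F' y j = \<kappa> y j" if "y \<in> C \<inter> ?H" "j < n" for y j
  proof -
    have "y \<in> V j" "y \<in> A" using that C(3,5) by (auto simp: V0_def)
    then show ?thesis using VF(3)[OF that(2)] that(2) by (simp add: F'_def)
  qed
  have F'fix: "F' y = y" if y: "y \<in> C" "y (n - 1) = 0" for y
  proof (rule ES_eqI[of _ n])
    show "F' y \<in> ES n" "y \<in> ES n" using y C(4) by (auto simp: F'_def mem_ES)
    fix j assume j: "j < n"
    have yA: "y \<in> A" using y C(5) by auto
    then have gB: "?g y \<in> ?B" "?g y \<in> O'" using gA[OF yA] DU y(2) bd[of "?g y"] by auto
    have "F' y j = \<kappa> y j" using F'\<kappa>[of y j] y j by auto
    also have "\<dots> = y j" using r'(4)[OF gB(2,1)] \<rho>(3)[OF gB(1)] gA[OF yA] y(2) by (simp add: \<kappa>_def)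
    finally show "F' y j = y j" .
  qed
  have y0C: "y0(n - 1 := t) \<in> C \<inter> ?H" if "0 \<le> t" "t < e" for t
    using that e y0 n C(2) by (auto simp: C_def cube_def mem_ES)
  have \<rho>_ge: "t \<le> F' (y0(n - 1 := t)) (n - 1)" if "0 \<le> t" "t < e" for t
  proof -
    have yA: "y0(n - 1 := t) \<in> A" using y0C[OF that] C(5) by auto
    have "t = \<phi> (?g (y0(n - 1 := t))) (n - 1)" using gA[OF yA] by simp
    also have "\<dots> \<le> \<rho> (?g (y0(n - 1 := t)))" using gA(1)[OF yA] by (intro U(5)) (auto simp: D_def)
    also have "\<dots> = F' (y0(n - 1 := t)) (n - 1)" using F'\<kappa>[OF y0C[OF that], of "n - 1"] n by (simp add: \<kappa>_def)
    finally show ?thesis .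
  qed
  let ?d = "partial (n - 1) (\<lambda>y. F' y (n - 1))"
  \<comment> \<open>Going inwards from \<open>y0\<close> by \<open>t\<close>, the last component is
    at least \<open>t\<close>, with equality at 0. A derivative below 1 would make the difference
    decrease to the right of 0.\<close>
  have d1: "?d y0 \<ge> 1"
  proof (rule ccontr)
    assume "\<not> ?d y0 \<ge> 1"
    have "((\<lambda>t. F' (y0(n - 1 := t)) (n - 1) - t) has_real_derivative ?d y0 - 1) (at 0)"
      using smooth_on_open_imp_DERIV[OF F'sm, of "n - 1" "n - 1" y0] n y0(2) C(2)
      by (auto intro!: derivative_eq_intros)
    then obtain \<delta> where \<delta>: "\<delta> > 0"
      "\<And>h. 0 < h \<Longrightarrow> h < \<delta> \<Longrightarrow> F' (y0(n - 1 := 0 + h)) (n - 1) - (0 + h) < F' (y0(n - 1 := 0)) (n - 1) - 0"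
      using DERIV_neg_dec_right[of "\<lambda>t. F' (y0(n - 1 := t)) (n - 1) - t" "?d y0 - 1" 0] \<open>\<not> ?d y0 \<ge> 1\<close> by auto
    have y00: "y0(n - 1 := 0) = y0" using y0(2) by auto
    define h where "h = min (\<delta> / 2) (e / 2)"
    have "0 < h" "h < \<delta>" "h < e" using \<delta>(1) e(1) by (auto simp: h_def)
    then show False using \<delta>(2)[of h] \<rho>_ge[of h] F'fix[OF C(2) y0(2)] y0(2) unfolding y00 by auto
  qed
  obtain W' G where W': "y0 \<in> W'" "W' \<subseteq> C" "smooth_inverse_on n W' F' G"
  proof -
    have "F' ` C \<subseteq> ES n" by (auto simp: F'_def mem_ES)
    moreover have "?d y0 \<noteq> 0" using d1 by linarith
    ultimately show ?thesis
      using smooth_inverse_fixing_hyperplane[OF n F'sm _ C(2) F'fix y0(2)] that by blast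
  qed
  have W'o: "openin (Euclidean_space n) W'" using W'(3) by (simp add: smooth_inverse_on_def)
  obtain e1 where e1: "e1 > 0" "\<And>z. z \<in> C \<Longrightarrow> z \<in> cube n y0 e1 \<Longrightarrow> \<bar>?d z - ?d y0\<bar> < 1"
    using continuous_on_cubeD[OF C(4) smooth_on_open_imp_continuous[OF smooth_on_open_imp_partial[OF F'sm]] C(2), of "n - 1" "n - 1" 1] n
    by auto
  obtain e2 where e2: "e2 > 0" "cube n y0 e2 \<subseteq> W'" using openin_Euclidean_space_cube[OF W'o W'(1)] by blast
  define C' where "C' = cube n y0 (min e1 e2)"
  have C': "openin (Euclidean_space n) C'" "y0 \<in> C'" "C' \<subseteq> W'" "C' \<subseteq> C"
    using e1(1) e2 y0 AE W'(2) cube_mono[of "min e1 e2" e2 n y0]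
    by (auto simp: C'_def openin_cube intro!: in_cube_self)
  have d_pos: "?d y > 0" if "y \<in> C'" for y
    using e1(2)[of y] that C'(4) d1 cube_mono[of "min e1 e2" e1 n y0] by (force simp: C'_def)
  have inv': "smooth_inverse_on n C' F' G" by (rule smooth_inverse_on_subset[OF W'(3) C'(1,3)])
  have FC'o: "openin (Euclidean_space n) (F' ` C')" and GF: "\<And>y. y \<in> C' \<Longrightarrow> G (F' y) = y"
    and Gsm: "\<And>j. j < n \<Longrightarrow> smooth_on_open n (F' ` C') (\<lambda>y. G y j)"
    using inv' by (auto simp: smooth_inverse_on_def)
  \<comment> \<open>The extension also inverts points below the hyperplane, where it has nothing to
    do with the manifold. A positive derivative makes the last component increase along vertical
    segments; it is 0 on the hyperplane, so a preimage of a point of the upper half space belongs to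
    the upper half space.\<close>
  have upper: "y \<in> ?H" if y: "y \<in> C'" "F' y \<in> ?H" for y
  proof (rule ccontr)
    assume "y \<notin> ?H"
    then have neg: "y (n - 1) < 0" by simp
    have yt: "y(n - 1 := t) \<in> C'" if "y (n - 1) \<le> t" "t \<le> 0" for t
    proof -
      have "\<bar>y (n - 1) - y0 (n - 1)\<bar> < min e1 e2" using y(1) n unfolding C'_def cube_def by simp
      then have "\<bar>y (n - 1)\<bar> < min e1 e2" using y0(2) by simp
      then have "\<bar>t\<bar> < min e1 e2" using that by linarith
      then show ?thesis using y(1) n y0(2) by (auto simp: C'_def cube_def mem_ES)
    qed
    have "((\<lambda>s. F' (y(n - 1 := s)) (n - 1)) has_real_derivative ?d (y(n - 1 := t))) (at t)"
      if "y (n - 1) \<le> t" "t \<le> 0" for t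
      using DERIV_smooth_curve[OF F'sm, of "n - 1" "n - 1" y t] yt[OF that] C'(4) n by auto
    then have "F' (y(n - 1 := y (n - 1))) (n - 1) < F' (y(n - 1 := 0)) (n - 1)"
      using DERIV_pos_imp_increasing[OF neg, of "\<lambda>s. F' (y(n - 1 := s)) (n - 1)"] d_pos yt by blast
    moreover have "F' (y(n - 1 := 0)) = y(n - 1 := 0)"
      by (rule F'fix) (use yt[of 0] neg C'(4) in auto)
    ultimately show False using y(2) by simp
  qed
  define P where "P = {q \<in> U. \<phi> q \<in> C'}"
  have Po: "openin (mtop M) P"
  proof -
    have "continuous_map (subtopology (mtop M) U) (Euclidean_space n) \<phi>"
      using smap_continuous[OF smap_chart[OF PM Ua]] by simp
    from openin_continuous_map_preimage[OF this C'(1)]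
    have "openin (subtopology (mtop M) U) {q \<in> topspace (subtopology (mtop M) U). \<phi> q \<in> C'}" .
    moreover have "{q \<in> topspace (subtopology (mtop M) U). \<phi> q \<in> C'} = P"
      using cU(4) by (auto simp: P_def)
    ultimately show ?thesis using cU(1) openin_trans_full by metis
  qed
  have \<phi>H: "\<phi> q \<in> ?H" if "q \<in> U" for q using T1(2) that by blast
  have PD: "P \<subseteq> D"
  proof
    fix q assume q: "q \<in> P"
    then have "\<phi> q \<in> A" using \<phi>H C'(4) C(5) by (auto simp: P_def)
    then show "q \<in> D" using gA(1)[of "\<phi> q"] inv q by (auto simp: P_def)
  qed
  have key: "(\<phi> (r q))(n - 1 := \<rho> q) = F' (\<phi> q)" if q: "q \<in> P" for q
  proof (rule ES_eqI[of _ n])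
    have rU: "r q \<in> U" "q \<in> U" using q PD by (auto simp: D_def P_def)
    show "(\<phi> (r q))(n - 1 := \<rho> q) \<in> ES n" using cU(2) rU n by (auto simp: mem_ES image_subset_iff)
    show "F' (\<phi> q) \<in> ES n" by (simp add: F'_def mem_ES)
    show "((\<phi> (r q))(n - 1 := \<rho> q)) j = F' (\<phi> q) j" if "j < n" for j
      using F'\<kappa>[of "\<phi> q" j] that q \<phi>H[OF rU(2)] C'(4) inv[OF rU(2)] by (auto simp: P_def \<kappa>_def)
  qed
  let ?u = "\<lambda>z. (\<phi> (fst z))(n - 1 := snd z)"
  define c where "c z = ?g (G (?u z))" for z
  define Q where "Q = {z \<in> U \<times> UNIV. ?u z \<in> F' ` C'}"
  note su = smap_chart_upd[OF PM Ua n]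
  have Qo: "openin (mtop (cylinder n M)) Q"
  proof -
    have oU: "openin (mtop (cylinder n M)) (U \<times> UNIV)" using cU(1) by (simp add: openin_prod_Times_iff)
    have "continuous_map (subtopology (mtop (cylinder n M)) (U \<times> UNIV)) (Euclidean_space n) ?u"
      using smap_continuous[OF su] by simp
    from openin_continuous_map_preimage[OF this FC'o]
    have "openin (subtopology (mtop (cylinder n M)) (U \<times> UNIV))
      {z \<in> topspace (subtopology (mtop (cylinder n M)) (U \<times> UNIV)). ?u z \<in> F' ` C'}" .
    moreover have "{z \<in> topspace (subtopology (mtop (cylinder n M)) (U \<times> UNIV)). ?u z \<in> F' ` C'} = Q"
      using cU(4) by (auto simp: Q_def)
    ultimately show ?thesis using oU openin_trans_full by metis
  qed
  have GQ: "\<exists>y\<in>C' \<inter> ?H. ?u z = F' y \<and> G (?u z) = y" if z: "z \<in> Q" "snd z \<ge> 0" for z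
  proof -
    obtain y where y: "y \<in> C'" "?u z = F' y" using z(1) by (auto simp: Q_def)
    have "F' y \<in> ?H" unfolding y(2)[symmetric] using z(2) by simp
    then show ?thesis using y upper GF by auto
  qed
  have im: "(\<lambda>q. (r q, \<rho> q)) ` P = Q \<inter> (?B \<times> {0..})"
  proof (intro equalityI subsetI)
    fix z assume "z \<in> (\<lambda>q. (r q, \<rho> q)) ` P"
    then obtain q where q: "q \<in> P" "z = (r q, \<rho> q)" by blast
    then have "q \<in> D" "\<phi> q \<in> C'" using PD by (auto simp: P_def)
    then show "z \<in> Q \<inter> (?B \<times> {0..})"
      using key[OF q(1)] r'(3) \<rho>(2) OM q(2) by (auto simp: Q_def D_def)
  next
    fix z assume z: "z \<in> Q \<inter> (?B \<times> {0..})"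
    obtain y where y: "y \<in> C'" "y \<in> ?H" "?u z = F' y" using GQ[of z] z by auto
    have yA: "y \<in> A" using y C'(4) C(5) by auto
    let ?q = "?g y"
    have q: "?q \<in> P" using gA[OF yA] DU y by (auto simp: P_def)
    have eq: "(\<phi> (r ?q))(n - 1 := \<rho> ?q) = ?u z" using key[OF q] gA[OF yA] y(3) by simp
    have zU: "fst z \<in> U" "fst z \<in> ?B" using z by (auto simp: Q_def)
    have rU: "r ?q \<in> U" "r ?q \<in> ?B" using gA[OF yA] r'(3) by (auto simp: D_def)
    \<comment> \<open>The update overwrites the last coordinate, but that coordinate is 0 for both
      points, since both are boundary points.\<close>
    have "\<phi> (r ?q) = \<phi> (fst z)"
    proof
      fix i show "\<phi> (r ?q) i = \<phi> (fst z) i"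
        using fun_cong[OF eq, of i] bd[OF zU(1)] bd[OF rU(1)] zU rU by (cases "i = n - 1") auto
    qed
    then have "r ?q = fst z" using zU rU cU(5) by (auto dest: inj_onD)
    moreover have "\<rho> ?q = snd z" using fun_cong[OF eq, of "n - 1"] by simp
    ultimately show "z \<in> (\<lambda>q. (r q, \<rho> q)) ` P" using q by (intro image_eqI[of _ _ ?q]) (auto simp: prod_eq_iff)
  qed
  have cP: "c (r q, \<rho> q) = q" if "q \<in> P" for q
    using key[OF that] GF[of "\<phi> q"] inv[of q] that by (simp add: c_def P_def)
  have "smap (Suc n) n (cylinder n M) (Q \<inter> (?B \<times> {0..})) M c"
    unfolding c_def
  proof (rule smap_compose[OF premanifold_cylinder[OF PM] premanifold_euclidean _ smap_chart_inverse[OF PM Ua]])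
    have sG: "smap n n (euclidean_mfd n) (F' ` C') (euclidean_mfd n) G"
    proof (rule smap_into_euclidean[OF premanifold_euclidean])
      show "msmooth n (euclidean_mfd n) (F' ` C') (\<lambda>p. G p j)" if "j < n" for j
        using smooth_on_openI[OF Gsm[OF that]] openin_subset[OF FC'o] by (simp add: msmooth_euclidean)
      show "G y \<in> ES n" if "y \<in> F' ` C'" for y using that GF C'(4) C(4) by auto
    qed
    show "smap (Suc n) n (cylinder n M) (Q \<inter> (?B \<times> {0..})) (euclidean_mfd n) (\<lambda>z. G (?u z))"
      by (rule smap_compose[OF premanifold_cylinder[OF PM] premanifold_euclidean smap_subset[OF su] sG])
         (auto simp: Q_def)
    show "G (?u z) \<in> \<phi> ` U" if z: "z \<in> Q \<inter> (?B \<times> {0..})" for z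
    proof -
      have "z \<in> Q" "0 \<le> snd z" using z by auto
      then obtain y where "y \<in> C' \<inter> ?H" "G (?u z) = y" using GQ by blast
      then show ?thesis using C'(4) C(5) AU by blast
    qed
  qed
  then show ?thesis
    using that[OF Po _ _ Qo im cP] PD DU pD C'(2) by (auto simp: P_def y0_def)
qed

text \<open>The collar is a pair of mutually inverse smooth maps. The source is a subset of the
  cylinder over \<open>M\<close> itself, so the boundary enters as a subset and not through
  \<open>boundary_mfd\<close>.\<close>

definition collar :: "nat \<Rightarrow> 'a mfd \<Rightarrow> real \<Rightarrow> 'a set \<Rightarrow> ('a \<Rightarrow> 'a) \<Rightarrow> ('a \<Rightarrow> real) \<Rightarrow> ('a \<times> real \<Rightarrow> 'a) \<Rightarrow> bool" where
  "collar n M e O' r \<rho> c \<longleftrightarrow>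
     openin (mtop M) O' \<and> smap n n M O' M r \<and> msmooth n M O' \<rho> \<and>
     smap (Suc n) n (cylinder n M) (boundary_points n M \<times> {0..<e}) M c \<and>
     (\<forall>q\<in>O'. r q \<in> boundary_points n M \<and> 0 \<le> \<rho> q \<and> \<rho> q < e \<and> c (r q, \<rho> q) = q) \<and>
     (\<forall>x\<in>boundary_points n M. \<forall>t\<in>{0..<e}. c (x, t) \<in> O' \<and> r (c (x, t)) = x \<and> \<rho> (c (x, t)) = t) \<and>
     (\<forall>x\<in>boundary_points n M. c (x, 0) = x)"

text \<open>The local inverses of \<open>collar_local\<close> have to be joined into one.
  Compactness is used twice, through Wallace's theorem: on the square of the boundary, to make
  \<open>K\<close> injective near the boundary, and on the product of the boundary with 0, to obtain
  one length \<open>e\<close> for all boundary points.\<close>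

lemma collar_exists_small:
  assumes M: "compact_manifold n M" and n: "0 < n"
  obtains e O' r \<rho> c where "e > 0" "collar n M e O' r \<rho> c"
proof -
  have SM: "smooth_manifold n M" and CM: "compact_space (mtop M)" and HM: "Hausdorff_space (mtop M)"
    using M by (simp_all add: compact_manifold_def smooth_manifold_def)
  note PM = smooth_manifold_imp_premanifold[OF SM]
  let ?B = "boundary_points n M"
  obtain O0 r where r: "boundary_retraction n M O0 r" "?B \<subseteq> O0" by (rule boundary_retraction_exists[OF M n])
  have r': "openin (mtop M) O0" "smap n n M O0 M r" "\<And>q. q \<in> O0 \<Longrightarrow> r q \<in> ?B"
    "\<And>q. q \<in> ?B \<Longrightarrow> r q = q"
    using r by (auto simp: boundary_retraction_def)
  have OM: "O0 \<subseteq> points M" using r'(1) openin_subset by blast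
  obtain \<rho> where \<rho>: "msmooth n M UNIV \<rho>" "\<And>q. q \<in> points M \<Longrightarrow> 0 \<le> \<rho> q"
    "\<And>q. q \<in> ?B \<Longrightarrow> \<rho> q = 0"
    "\<And>p. p \<in> ?B \<Longrightarrow> \<exists>U \<phi> W. half_chart n M (U, \<phi>) \<and> openin (mtop M) W \<and> p \<in> W \<and> W \<subseteq> U \<and>
       (\<forall>q\<in>W. \<phi> q (n - 1) \<le> \<rho> q)"
    by (rule boundary_defining_function[OF M n]) blast
  define K where "K q = (r q, \<rho> q)" for q
  let ?N = "?B \<times> {0..}"
  define inverse_near where "inverse_near p P Q c \<longleftrightarrow> openin (mtop M) P \<and> p \<in> P \<and> P \<subseteq> O0 \<and>
      openin (mtop (cylinder n M)) Q \<and> K ` P = Q \<inter> ?N \<and> (\<forall>q\<in>P. c (K q) = q) \<and>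
      smap (Suc n) n (cylinder n M) (Q \<inter> ?N) M c" for p P Q c
  have "\<exists>P Q c. inverse_near p P Q c" if p: "p \<in> ?B" for p
  proof -
    obtain U \<phi> W where U: "half_chart n M (U, \<phi>)" "openin (mtop M) W" "p \<in> W" "W \<subseteq> U"
      "\<And>q. q \<in> W \<Longrightarrow> \<phi> q (n - 1) \<le> \<rho> q" using \<rho>(4)[OF p] by blast
    have pO: "p \<in> O0" using p r(2) by blast
    obtain P Q c where *: "openin (mtop M) P" "p \<in> P" "P \<subseteq> O0" "openin (mtop (cylinder n M)) Q"
      "(\<lambda>q. (r q, \<rho> q)) ` P = Q \<inter> ?N" "\<And>q. q \<in> P \<Longrightarrow> c (r q, \<rho> q) = q"
      "smap (Suc n) n (cylinder n M) (Q \<inter> ?N) M c"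
      using collar_local[OF M n r(1) \<rho>(1-3) p pO U] by blast
    show ?thesis
      by (intro exI[of _ P] exI[of _ Q] exI[of _ c]) (use * in \<open>simp add: inverse_near_def K_def\<close>)
  qed
  then obtain P Q c0 where "\<And>p. p \<in> ?B \<Longrightarrow> inverse_near p (P p) (Q p) (c0 p)"
    by metis
  then have P: "\<And>p. p \<in> ?B \<Longrightarrow> openin (mtop M) (P p)" "\<And>p. p \<in> ?B \<Longrightarrow> p \<in> P p" "\<And>p. p \<in> ?B \<Longrightarrow> P p \<subseteq> O0"
    "\<And>p. p \<in> ?B \<Longrightarrow> openin (mtop (cylinder n M)) (Q p)" "\<And>p. p \<in> ?B \<Longrightarrow> K ` P p = Q p \<inter> ?N"
    "\<And>p q. p \<in> ?B \<Longrightarrow> q \<in> P p \<Longrightarrow> c0 p (K q) = q" "\<And>p. p \<in> ?B \<Longrightarrow> smap (Suc n) n (cylinder n M) (Q p \<inter> ?N) M (c0 p)"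
    by (simp_all add: inverse_near_def)
  have preimage: "\<exists>S. openin (mtop (cylinder n M)) S \<and> (\<forall>z\<in>Q p \<inter> ?N. z \<in> S \<longleftrightarrow> c0 p z \<in> V)"
    if p: "p \<in> ?B" and V: "openin (mtop M) V" for p V
  proof -
    have "openin (subtopology (mtop (cylinder n M)) (Q p \<inter> ?N))
        {z \<in> topspace (subtopology (mtop (cylinder n M)) (Q p \<inter> ?N)). c0 p z \<in> V}"
      by (rule openin_continuous_map_preimage[OF smap_continuous[OF P(7)[OF p]] V])
    then obtain S where S: "openin (mtop (cylinder n M)) S"
      "{z \<in> topspace (subtopology (mtop (cylinder n M)) (Q p \<inter> ?N)). c0 p z \<in> V} = S \<inter> (Q p \<inter> ?N)"
      unfolding openin_subtopology by blast
    have "z \<in> topspace (mtop (cylinder n M))" if "z \<in> Q p" for z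
      using openin_subset[OF P(4)[OF p]] that by blast
    then have "z \<in> S \<longleftrightarrow> c0 p z \<in> V" if "z \<in> Q p \<inter> ?N" for z
      using S(2) that by auto
    then show ?thesis using S(1) by blast
  qed
  have KQ: "\<exists>q\<in>P p. z = K q \<and> c0 p z = q" if "p \<in> ?B" "z \<in> Q p \<inter> ?N" for p z
    using P(5)[OF that(1)] P(6)[OF that(1)] that(2) by (metis imageE)
  have cB: "compactin (mtop M) ?B"
    using closedin_compact_space[OF CM closedin_boundary_points[OF SM]] .
  \<comment> \<open>Products of neighbourhoods within which \<open>K\<close> distinguishes points.
    Around a diagonal point the local inverse provides one; around two different boundary points,
    \<open>r\<close> pulls back disjoint neighbourhoods. Hence the open set \<open>\<Omega>\<close>
    contains the square of the boundary.\<close>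
  define good where "good A A' \<longleftrightarrow> openin (mtop M) A \<and> openin (mtop M) A' \<and> (\<forall>a\<in>A. \<forall>a'\<in>A'. K a = K a' \<longrightarrow> a = a')" for A A'
  define \<Omega> where "\<Omega> = \<Union> {A \<times> A' | A A'. good A A'}"
  have "openin (prod_topology (mtop M) (mtop M)) \<Omega>"
    unfolding \<Omega>_def by (intro openin_Union) (auto simp: good_def openin_prod_Times_iff)
  moreover have "?B \<times> ?B \<subseteq> \<Omega>"
  proof clarify
    fix a b assume ab: "a \<in> ?B" "b \<in> ?B"
    have "\<exists>A A'. good A A' \<and> a \<in> A \<and> b \<in> A'"
    proof (cases "a = b")
      case True
      then show ?thesis
        using P(1,2)[OF ab(1)] P(6)[OF ab(1)] by (intro exI[of _ "P a"]) (auto simp: good_def, metis)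
    next
      case False
      have "a \<in> points M" "b \<in> points M" using ab boundary_points_subset[OF SM] by auto
      then obtain A B where AB: "openin (mtop M) A" "openin (mtop M) B" "a \<in> A" "b \<in> B" "disjnt A B"
        using HM False unfolding Hausdorff_space_def by blast
      have o: "openin (mtop M) {q \<in> O0. r q \<in> V}" if "openin (mtop M) V" for V
      proof -
        have "openin (subtopology (mtop M) O0) {q \<in> topspace (subtopology (mtop M) O0). r q \<in> V}"
          by (rule openin_continuous_map_preimage[OF smap_continuous[OF r'(2)] that])
        moreover have "{q \<in> topspace (subtopology (mtop M) O0). r q \<in> V} = {q \<in> O0. r q \<in> V}" using OM by auto
        ultimately show ?thesis using r'(1) openin_trans_full by metis
      qed
      have "good {q \<in> O0. r q \<in> A} {q \<in> O0. r q \<in> B}"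
        unfolding good_def using o[OF AB(1)] o[OF AB(2)] AB(5) by (auto simp: K_def disjnt_iff)
      moreover have "a \<in> {q \<in> O0. r q \<in> A}" "b \<in> {q \<in> O0. r q \<in> B}" using r(2) r'(4) ab AB by auto
      ultimately show ?thesis by blast
    qed
    then show "(a, b) \<in> \<Omega>" unfolding \<Omega>_def by blast
  qed
  ultimately obtain U V where UV: "openin (mtop M) U" "openin (mtop M) V" "?B \<subseteq> U" "?B \<subseteq> V" "U \<times> V \<subseteq> \<Omega>"
    using Wallace_theorem_prod_topology[OF cB cB] by metis
  define O1 where "O1 = U \<inter> V \<inter> (\<Union>p\<in>?B. P p)"
  have O1: "openin (mtop M) O1" "?B \<subseteq> O1" "O1 \<subseteq> O0"
    unfolding O1_def using UV P(1-3) by (auto intro!: openin_Int openin_Union dest: subsetD[OF P(3)])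
  have inj: "inj_on K O1"
  proof (rule inj_onI)
    fix a b assume ab: "a \<in> O1" "b \<in> O1" "K a = K b"
    then have "(a, b) \<in> \<Omega>" using UV(5) by (auto simp: O1_def)
    then show "a = b" using ab(3) by (auto simp: \<Omega>_def good_def)
  qed
  obtain S where S: "\<And>p. p \<in> ?B \<Longrightarrow> openin (mtop (cylinder n M)) (S p)"
    "\<And>p z. p \<in> ?B \<Longrightarrow> z \<in> Q p \<inter> ?N \<Longrightarrow> z \<in> S p \<longleftrightarrow> c0 p z \<in> O1"
    using preimage[OF _ O1(1)] by metis
  define Q1 where "Q1 = (\<Union>p\<in>?B. S p \<inter> Q p)"
  have Q1: "openin (prod_topology (mtop M) euclideanreal) Q1"
    unfolding Q1_def using S(1) P(4) by (intro openin_Union) auto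
  have KO1: "z \<in> K ` O1" if z: "z \<in> Q1" "z \<in> ?N" for z
  proof -
    from z(1) obtain p where p: "p \<in> ?B" "z \<in> S p" "z \<in> Q p" unfolding Q1_def by blast
    then obtain q where "q \<in> P p" "z = K q" "c0 p z = q" using KQ[of p z] z(2) by blast
    then show ?thesis using S(2)[of p z] p z(2) by auto
  qed
  \<comment> \<open>\<open>Q1\<close> is open and its part with nonnegative parameter lies in the
    image of \<open>K\<close> on \<open>O1\<close>. A product neighbourhood inside \<open>Q1\<close>
    therefore yields a collar of uniform length.\<close>
  have "?B \<times> {0} \<subseteq> Q1"
  proof clarify
    fix x assume x: "x \<in> ?B"
    have Kx: "K x = (x, 0)" using r'(4)[OF x] \<rho>(3)[OF x] by (simp add: K_def)
    then have "(x, 0) \<in> Q x \<inter> ?N" using P(2,5)[OF x] by (metis imageI)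
    moreover have "c0 x (x, 0) = x" using P(6)[OF x P(2)[OF x]] Kx by simp
    ultimately show "(x, 0) \<in> Q1" using S(2)[OF x, of "(x, 0)"] x O1(2) by (auto simp: Q1_def)
  qed
  moreover have "compactin euclideanreal {0}" by simp
  ultimately obtain U' V' where UV': "openin (mtop M) U'" "openin euclideanreal V'" "?B \<subseteq> U'" "{0} \<subseteq> V'" "U' \<times> V' \<subseteq> Q1"
    using Wallace_theorem_prod_topology[OF cB _ Q1] by metis
  then obtain e where e: "e > 0" "ball 0 e \<subseteq> V'" by (auto simp: open_contains_ball)
  define O2 where "O2 = {q \<in> O1. \<rho> q < e}"
  have O2: "openin (mtop M) O2" "O2 \<subseteq> O1"
  proof -
    have "openin (subtopology (mtop M) O1) {q \<in> topspace (subtopology (mtop M) O1). \<rho> q \<in> {..<e}}"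
      by (rule openin_continuous_map_preimage[OF msmooth_continuous[OF PM msmooth_subset[OF \<rho>(1)]]]) auto
    moreover have "{q \<in> topspace (subtopology (mtop M) O1). \<rho> q \<in> {..<e}} = O2"
      using openin_subset[OF O1(1)] by (auto simp: O2_def)
    ultimately show "openin (mtop M) O2" using O1(1) openin_trans_full by metis
  qed (auto simp: O2_def)
  have inj2: "inj_on K O2" using inj O2(2) inj_on_subset by blast
  have onto: "z \<in> K ` O2" if z: "z \<in> ?B \<times> {0..<e}" for z
  proof -
    have "snd z \<in> ball 0 e" "fst z \<in> U'" using z UV'(3) by auto
    then have "z \<in> Q1" using UV'(5) e(2) by (auto simp: subset_iff) (metis mem_Sigma_iff prod.collapse)
    then obtain q where "q \<in> O1" "z = K q" using KO1[of z] z by auto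
    then show ?thesis using z by (auto simp: O2_def K_def)
  qed
  define c where "c = inv_into O2 K"
  have cK: "c (K q) = q" if "q \<in> O2" for q using inj2 that by (simp add: c_def)
  have Kc: "c z \<in> O2 \<and> K (c z) = z" if "z \<in> ?B \<times> {0..<e}" for z
    using onto[OF that] by (simp add: c_def inv_into_into f_inv_into_f)
  have csm: "smap (Suc n) n (cylinder n M) (?B \<times> {0..<e}) M c"
  proof (rule smap_local[OF premanifold_cylinder[OF PM]])
    fix z assume z: "z \<in> ?B \<times> {0..<e}"
    then obtain p where p: "p \<in> ?B" "c z \<in> P p" using Kc[OF z] O2(2) by (auto simp: O1_def)
    \<comment> \<open>\<open>S\<close> singles out the arguments that the local inverse sends into
      \<open>O2\<close>, where \<open>K\<close> is injective. There it agrees with the global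
      inverse, which inherits its smoothness.\<close>
    obtain S where S: "openin (mtop (cylinder n M)) S" "\<And>w. w \<in> Q p \<inter> ?N \<Longrightarrow> w \<in> S \<longleftrightarrow> c0 p w \<in> O2"
      using preimage[OF p(1) O2(1)] by metis
    have zN: "z \<in> Q p \<inter> ?N" using P(5)[OF p(1)] Kc[OF z] p(2) by (metis imageI)
    have "c0 p z = c z" using P(6)[OF p] Kc[OF z] by simp
    then have zS: "z \<in> S \<inter> Q p" using S(2)[OF zN] Kc[OF z] zN by simp
    have "smap (Suc n) n (cylinder n M) (?B \<times> {0..<e} \<inter> (S \<inter> Q p)) M c"
    proof (rule smap_cong[OF premanifold_cylinder[OF PM] smap_subset[OF P(7)[OF p(1)]]])
      show "?B \<times> {0..<e} \<inter> (S \<inter> Q p) \<subseteq> Q p \<inter> ?N" by auto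
      fix w assume w: "w \<in> ?B \<times> {0..<e} \<inter> (S \<inter> Q p)"
      then have wN: "w \<in> Q p \<inter> ?N" by auto
      then have "c0 p w \<in> O2" using S(2)[OF wN] w by blast
      moreover obtain q where "w = K q" "c0 p w = q" using KQ[OF p(1) wN] by blast
      ultimately show "c0 p w = c w" using cK by simp
    qed
    then show "\<exists>W. openin (mtop (cylinder n M)) W \<and> z \<in> W \<and> smap (Suc n) n (cylinder n M) (?B \<times> {0..<e} \<inter> W) M c"
      using zS S(1) P(4)[OF p(1)] openin_Int by blast
  qed
  have "collar n M e O2 r \<rho> c"
    unfolding collar_def
  proof (intro conjI ballI csm O2(1))
    show "smap n n M O2 M r" by (rule smap_subset[OF r'(2)]) (use O2(2) O1(3) in blast)
    show "msmooth n M O2 \<rho>" by (rule msmooth_subset[OF \<rho>(1)]) simp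
    fix q assume q: "q \<in> O2"
    then show "r q \<in> ?B" "0 \<le> \<rho> q" "\<rho> q < e" "c (r q, \<rho> q) = q"
      using r'(3) \<rho>(2) O2(2) O1(3) OM cK[OF q] by (auto simp: K_def O2_def)
  next
    fix x t assume "x \<in> ?B" "t \<in> {0..<e}"
    then show "c (x, t) \<in> O2" "r (c (x, t)) = x" "\<rho> (c (x, t)) = t"
      using Kc[of "(x, t)"] by (simp_all add: K_def)
  next
    fix x assume x: "x \<in> ?B"
    have "x \<in> O2" using x O1(2) \<rho>(3) e(1) by (auto simp: O2_def)
    then show "c (x, 0) = x" using cK[of x] r'(4)[OF x] \<rho>(3)[OF x] by (simp add: K_def)
  qed
  then show ?thesis using that e(1) by blast
qed

text \<open>Rescaling the parameter gives a collar of any prescribed length, in particular one that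
  leaves room on both sides of the parameter 1.\<close>

lemma collar_exists:
  assumes M: "compact_manifold n M" and n: "0 < n" and "0 < d"
  obtains O' r \<rho> c where "collar n M d O' r \<rho> c"
proof -
  have PM: "premanifold n M"
    using M by (simp add: compact_manifold_def smooth_manifold_imp_premanifold)
  let ?B = "boundary_points n M"
  obtain e O' r \<rho> c where e: "e > 0" and *: "collar n M e O' r \<rho> c" by (rule collar_exists_small[OF M n])
  define a where "a = e / d"
  have a: "a > 0" using e \<open>0 < d\<close> by (simp add: a_def)
  have scale: "a * t \<in> {0..<e} \<longleftrightarrow> t \<in> {0..<d}" for t
    using e \<open>0 < d\<close> by (auto simp: a_def field_simps zero_le_mult_iff)
  note C = *[unfolded collar_def]
  have "smap (Suc n) (Suc n) (cylinder n M) (?B \<times> {0..<d}) (cylinder n M) (\<lambda>z. (fst z, a * snd z))"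
    by (intro smap_Pair[OF premanifold_cylinder[OF PM] PM smap_fst[OF PM]]
         msmooth_mult[OF premanifold_cylinder[OF PM]] msmooth_const[OF premanifold_cylinder[OF PM]] msmooth_snd[OF PM])
  then have "smap (Suc n) n (cylinder n M) (?B \<times> {0..<d}) M (\<lambda>z. c (fst z, a * snd z))"
  proof (rule smap_compose[OF premanifold_cylinder[OF PM] premanifold_cylinder[OF PM]])
    show "smap (Suc n) n (cylinder n M) (?B \<times> {0..<e}) M c" using C by blast
    show "(fst z, a * snd z) \<in> ?B \<times> {0..<e}" if "z \<in> ?B \<times> {0..<d}" for z
      using that scale[of "snd z"] by auto
  qed
  moreover have "msmooth n M O' (\<lambda>q. inverse a * \<rho> q)"
    using C by (intro msmooth_mult[OF PM] msmooth_const[OF PM]) auto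
  moreover have "inverse a * \<rho> q < d \<and> 0 \<le> inverse a * \<rho> q" if "q \<in> O'" for q
  proof -
    have "a * (inverse a * \<rho> q) = \<rho> q" using a by simp
    moreover have "\<rho> q \<in> {0..<e}" using C that by simp
    ultimately have "a * (inverse a * \<rho> q) \<in> {0..<e}" by (simp only:)
    then show ?thesis unfolding scale by simp
  qed
  moreover have "c (x, a * t) \<in> O' \<and> r (c (x, a * t)) = x \<and> inverse a * \<rho> (c (x, a * t)) = t"
    if "x \<in> ?B" "t \<in> {0..<d}" for x t
    using scale[of t] C that a by simp
  moreover have "c (r q, a * (inverse a * \<rho> q)) = q" if "q \<in> O'" for q
  proof -
    have "a * (inverse a * \<rho> q) = \<rho> q" using a by simp
    then show ?thesis using C that by (simp only:)
  qed
  ultimately have "collar n M d O' r (\<lambda>q. inverse a * \<rho> q) (\<lambda>z. c (fst z, a * snd z))"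
    unfolding collar_def using C a by simp
  then show ?thesis using that by blast
qed

section \<open>Gluing manifolds\<close>

text \<open>Pieces are glued by injections into a common type: two points are identified when their
  images coincide, which replaces a quotient by an equivalence relation. \<open>chart_open\<close>
  makes the result free of boundary. The Hausdorff property does not follow from these assumptions
  and is supplied in each application.\<close>

locale gluing =
  fixes n :: nat and I :: "'i set" and M :: "'i \<Rightarrow> 'b mfd" and N :: "'i \<Rightarrow> 'b set" and \<psi> :: "'i \<Rightarrow> 'b \<Rightarrow> 'c"
  assumes premanifold: "i \<in> I \<Longrightarrow> premanifold n (M i)"
    and N_open: "i \<in> I \<Longrightarrow> openin (mtop (M i)) (N i)"
    and \<psi>_inj: "i \<in> I \<Longrightarrow> inj_on (\<psi> i) (N i)"
    and chart_open: "i \<in> I \<Longrightarrow> (U, \<phi>) \<in> atlas (M i) \<Longrightarrow> openin (Euclidean_space n) (\<phi> ` (U \<inter> N i))"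
    and overlap_open: "i \<in> I \<Longrightarrow> j \<in> I \<Longrightarrow> openin (mtop (M i)) {q \<in> N i. \<psi> i q \<in> \<psi> j ` N j}"
    and overlap_smooth: "i \<in> I \<Longrightarrow> j \<in> I \<Longrightarrow>
      smap n n (M i) {q \<in> N i. \<psi> i q \<in> \<psi> j ` N j} (M j) (\<lambda>q. inv_into (N j) (\<psi> j) (\<psi> i q))"
begin

abbreviation inv_\<psi> :: "'i \<Rightarrow> 'c \<Rightarrow> 'b" where
  "inv_\<psi> i \<equiv> inv_into (N i) (\<psi> i)"

definition glued :: "'c mfd" where
  "glued = \<lparr>mtop = topology (\<lambda>W. W \<subseteq> (\<Union>i\<in>I. \<psi> i ` N i) \<and> (\<forall>i\<in>I. openin (mtop (M i)) {q \<in> N i. \<psi> i q \<in> W})),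
     atlas = (\<Union>i\<in>I. (\<lambda>(U, \<phi>). (\<psi> i ` (U \<inter> N i), \<lambda>x. \<phi> (inv_\<psi> i x))) ` atlas (M i))\<rparr>"

lemma inv_\<psi> [simp]: "i \<in> I \<Longrightarrow> q \<in> N i \<Longrightarrow> inv_\<psi> i (\<psi> i q) = q"
  by (simp add: \<psi>_inj)

lemma openin_glued:
  "openin (mtop glued) W \<longleftrightarrow> W \<subseteq> (\<Union>i\<in>I. \<psi> i ` N i) \<and> (\<forall>i\<in>I. openin (mtop (M i)) {q \<in> N i. \<psi> i q \<in> W})"
proof -
  have 1: "{q \<in> N i. \<psi> i q \<in> S \<inter> T} = {q \<in> N i. \<psi> i q \<in> S} \<inter> {q \<in> N i. \<psi> i q \<in> T}" for i S T by auto
  have 2: "{q \<in> N i. \<psi> i q \<in> \<Union>\<K>} = (\<Union>K\<in>\<K>. {q \<in> N i. \<psi> i q \<in> K})" for i \<K> by auto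
  have "istopology (\<lambda>W. W \<subseteq> (\<Union>i\<in>I. \<psi> i ` N i) \<and> (\<forall>i\<in>I. openin (mtop (M i)) {q \<in> N i. \<psi> i q \<in> W}))"
    unfolding istopology_def 1 2 by blast
  then show ?thesis by (simp add: glued_def)
qed

text \<open>In another piece, the preimage of the image of \<open>A\<close> is the preimage of
  \<open>A\<close> under the transition map, which is continuous on an open domain.\<close>

lemma openin_glued_image:
  assumes i: "i \<in> I" and A: "openin (mtop (M i)) A" "A \<subseteq> N i"
  shows "openin (mtop glued) (\<psi> i ` A)"
  unfolding openin_glued
proof (intro conjI ballI)
  show "\<psi> i ` A \<subseteq> (\<Union>i\<in>I. \<psi> i ` N i)" using i A(2) by blast
  fix j assume j: "j \<in> I"
  let ?D = "{q \<in> N j. \<psi> j q \<in> \<psi> i ` N i}"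
  have D: "?D \<subseteq> points (M j)" using openin_subset[OF overlap_open[OF j i]] .
  have "openin (subtopology (mtop (M j)) ?D) {q \<in> topspace (subtopology (mtop (M j)) ?D). inv_\<psi> i (\<psi> j q) \<in> A}"
    by (rule openin_continuous_map_preimage[OF smap_continuous[OF overlap_smooth[OF j i]] A(1)])
  moreover have "{q \<in> topspace (subtopology (mtop (M j)) ?D). inv_\<psi> i (\<psi> j q) \<in> A} = {q \<in> N j. \<psi> j q \<in> \<psi> i ` A}"
    using D A(2) i by (auto simp: image_iff)
  ultimately show "openin (mtop (M j)) {q \<in> N j. \<psi> j q \<in> \<psi> i ` A}"
    using overlap_open[OF j i] openin_trans_full by metis
qed

lemma points_glued: "points glued = (\<Union>i\<in>I. \<psi> i ` N i)"
proof
  show "points glued \<subseteq> (\<Union>i\<in>I. \<psi> i ` N i)" using openin_glued by blast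
  show "(\<Union>i\<in>I. \<psi> i ` N i) \<subseteq> points glued"
    using openin_glued_image[OF _ N_open order_refl] openin_subset by blast
qed

lemma \<psi>_continuous: "i \<in> I \<Longrightarrow> continuous_map (subtopology (mtop (M i)) (N i)) (mtop glued) (\<psi> i)"
  unfolding continuous_map_def
proof (intro conjI allI impI)
  assume i: "i \<in> I"
  show "\<psi> i \<in> topspace (subtopology (mtop (M i)) (N i)) \<rightarrow> points glued" using i by (auto simp: points_glued)
  fix W assume "openin (mtop glued) W"
  then have "openin (mtop (M i)) {q \<in> N i. \<psi> i q \<in> W}" using i by (simp add: openin_glued)
  moreover have "{q \<in> topspace (subtopology (mtop (M i)) (N i)). \<psi> i q \<in> W} = {q \<in> N i. \<psi> i q \<in> W}"
    using openin_subset[OF N_open[OF i]] by auto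
  ultimately show "openin (subtopology (mtop (M i)) (N i)) {q \<in> topspace (subtopology (mtop (M i)) (N i)). \<psi> i q \<in> W}"
    by (auto simp: openin_open_subtopology[OF N_open[OF i]])
qed

lemma inv_\<psi>_continuous:
  assumes i: "i \<in> I"
  shows "continuous_map (subtopology (mtop glued) (\<psi> i ` N i)) (subtopology (mtop (M i)) (N i)) (inv_\<psi> i)"
  unfolding continuous_map_def
proof (intro conjI allI impI)
  have NM: "N i \<subseteq> points (M i)" by (rule openin_subset[OF N_open[OF i]])
  show "inv_\<psi> i \<in> topspace (subtopology (mtop glued) (\<psi> i ` N i)) \<rightarrow> topspace (subtopology (mtop (M i)) (N i))"
    using i NM by auto
  fix A assume "openin (subtopology (mtop (M i)) (N i)) A"
  then have A: "openin (mtop (M i)) A" "A \<subseteq> N i" using openin_open_subtopology[OF N_open[OF i]] by blast+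
  have "{x \<in> topspace (subtopology (mtop glued) (\<psi> i ` N i)). inv_\<psi> i x \<in> A} = \<psi> i ` A"
    using i A(2) by (auto simp: points_glued)
  moreover have "openin (subtopology (mtop glued) (\<psi> i ` N i)) (\<psi> i ` A)"
    using openin_glued_image[OF i A] A(2) by (metis image_mono openin_subset_topspace_eq openin_subtopology_Int2 Int_absorb1)
  ultimately show "openin (subtopology (mtop glued) (\<psi> i ` N i)) {x \<in> topspace (subtopology (mtop glued) (\<psi> i ` N i)). inv_\<psi> i x \<in> A}"
    by simp
qed

lemma atlas_gluedE:
  assumes "(W, \<chi>') \<in> atlas glued"
  obtains i U \<phi> where "i \<in> I" "(U, \<phi>) \<in> atlas (M i)" "W = \<psi> i ` (U \<inter> N i)" "\<chi>' = (\<lambda>x. \<phi> (inv_\<psi> i x))"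
  using assms by (auto simp: glued_def)

lemma glued_chart:
  assumes i: "i \<in> I" and U: "(U, \<phi>) \<in> atlas (M i)"
  shows "openin (mtop glued) (\<psi> i ` (U \<inter> N i))"
    and "(\<lambda>x. \<phi> (inv_\<psi> i x)) ` \<psi> i ` (U \<inter> N i) = \<phi> ` (U \<inter> N i)"
    and "homeomorphic_map (subtopology (mtop glued) (\<psi> i ` (U \<inter> N i))) (top_of_set (\<phi> ` (U \<inter> N i))) (\<lambda>x. \<phi> (inv_\<psi> i x))"
    and "inj_on (\<lambda>x. \<phi> (inv_\<psi> i x)) (\<psi> i ` (U \<inter> N i))"
    and "\<And>q. q \<in> U \<inter> N i \<Longrightarrow> inv_into (\<psi> i ` (U \<inter> N i)) (\<lambda>x. \<phi> (inv_\<psi> i x)) (\<phi> q) = \<psi> i q"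
proof -
  note cU = premanifold_chart[OF premanifold[OF i] U]
  have inv: "inv_into U \<phi> (\<phi> q) = q" if "q \<in> U" for q using that cU(5) by simp
  show "openin (mtop glued) (\<psi> i ` (U \<inter> N i))"
    by (rule openin_glued_image[OF i]) (use cU(1) N_open[OF i] in auto)
  show im: "(\<lambda>x. \<phi> (inv_\<psi> i x)) ` \<psi> i ` (U \<inter> N i) = \<phi> ` (U \<inter> N i)"
    using i by (force simp: image_iff)
  have "homeomorphic_maps (subtopology (mtop glued) (\<psi> i ` (U \<inter> N i))) (top_of_set (\<phi> ` (U \<inter> N i)))
      (\<lambda>x. \<phi> (inv_\<psi> i x)) (\<lambda>y. \<psi> i (inv_into U \<phi> y))"
    unfolding homeomorphic_maps_def
  proof (intro conjI ballI)
    have 1: "continuous_map (subtopology (mtop glued) (\<psi> i ` (U \<inter> N i))) (subtopology (mtop (M i)) (N i)) (inv_\<psi> i)"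
      by (rule continuous_map_from_subtopology_mono[OF inv_\<psi>_continuous[OF i]]) blast
    have "continuous_map (subtopology (mtop glued) (\<psi> i ` (U \<inter> N i))) (subtopology (mtop (M i)) U) (inv_\<psi> i)"
      using 1 i by (auto simp: continuous_map_in_subtopology)
    from continuous_map_compose[OF this chart_continuous[OF premanifold[OF i] U]]
    show "continuous_map (subtopology (mtop glued) (\<psi> i ` (U \<inter> N i))) (top_of_set (\<phi> ` (U \<inter> N i))) (\<lambda>x. \<phi> (inv_\<psi> i x))"
      using i by (auto simp: continuous_map_in_subtopology o_def)
    have "continuous_map (top_of_set (\<phi> ` (U \<inter> N i))) (mtop (M i)) (inv_into U \<phi>)"
      using continuous_map_from_subtopology_mono[OF chart_inverse_continuous[OF premanifold[OF i] U], of "\<phi> ` (U \<inter> N i)"]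
      by (simp add: subtopology_subtopology Int_absorb1 image_mono)
    then have "continuous_map (top_of_set (\<phi> ` (U \<inter> N i))) (subtopology (mtop (M i)) (N i)) (inv_into U \<phi>)"
      using inv by (auto simp: continuous_map_in_subtopology)
    from continuous_map_compose[OF this \<psi>_continuous[OF i]]
    show "continuous_map (top_of_set (\<phi> ` (U \<inter> N i))) (subtopology (mtop glued) (\<psi> i ` (U \<inter> N i))) (\<lambda>y. \<psi> i (inv_into U \<phi> y))"
      using inv by (auto simp: continuous_map_in_subtopology o_def)
  qed (use inv i in auto)
  then show hom: "homeomorphic_map (subtopology (mtop glued) (\<psi> i ` (U \<inter> N i))) (top_of_set (\<phi> ` (U \<inter> N i))) (\<lambda>x. \<phi> (inv_\<psi> i x))"
    using homeomorphic_map_maps by blast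
  show inj: "inj_on (\<lambda>x. \<phi> (inv_\<psi> i x)) (\<psi> i ` (U \<inter> N i))"
    by (rule inj_on_inverseI[of _ "\<lambda>y. \<psi> i (inv_into U \<phi> y)"]) (use inv i in auto)
  fix q assume q: "q \<in> U \<inter> N i"
  then have "inv_into (\<psi> i ` (U \<inter> N i)) (\<lambda>x. \<phi> (inv_\<psi> i x)) (\<phi> (inv_\<psi> i (\<psi> i q))) = \<psi> i q"
    using inj by (intro inv_into_f_f[where f = "\<lambda>x. \<phi> (inv_\<psi> i x)"]) auto
  then show "inv_into (\<psi> i ` (U \<inter> N i)) (\<lambda>x. \<phi> (inv_\<psi> i x)) (\<phi> q) = \<psi> i q"
    using q i by simp
qed

lemma premanifold_glued: "premanifold n glued"
  unfolding premanifold_def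
proof (intro conjI)
  show "\<forall>(W, \<chi>')\<in>atlas glued. openin (mtop glued) W \<and> \<chi>' ` W \<subseteq> ES n \<and>
      homeomorphic_map (subtopology (mtop glued) W) (top_of_set (\<chi>' ` W)) \<chi>'"
  proof clarify
    fix W \<chi>' assume "(W, \<chi>') \<in> atlas glued"
    then obtain i U \<phi> where i: "i \<in> I" and U: "(U, \<phi>) \<in> atlas (M i)" "W = \<psi> i ` (U \<inter> N i)" "\<chi>' = (\<lambda>x. \<phi> (inv_\<psi> i x))"
      by (rule atlas_gluedE)
    have im: "\<chi>' ` W = \<phi> ` (U \<inter> N i)" unfolding U(2,3) by (rule glued_chart(2)[OF i U(1)])
    have "\<phi> ` (U \<inter> N i) \<subseteq> ES n" using chart_image[OF premanifold[OF i] U(1)] by blast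
    then show "openin (mtop glued) W \<and> \<chi>' ` W \<subseteq> ES n \<and> homeomorphic_map (subtopology (mtop glued) W) (top_of_set (\<chi>' ` W)) \<chi>'"
      using glued_chart(1,3)[OF i U(1)] unfolding im by (simp add: U(2,3))
  qed
  have "\<Union> (fst ` atlas glued) = (\<Union>i\<in>I. \<Union>(U, \<phi>)\<in>atlas (M i). \<psi> i ` (U \<inter> N i))"
    by (force simp: glued_def)
  also have "\<dots> = (\<Union>i\<in>I. \<psi> i ` N i)"
  proof (intro equalityI subsetI)
    fix x assume "x \<in> (\<Union>i\<in>I. \<psi> i ` N i)"
    then obtain i q where i: "i \<in> I" "q \<in> N i" "x = \<psi> i q" by blast
    then have "q \<in> points (M i)" using openin_subset[OF N_open] by blast
    then obtain U \<phi> where "(U, \<phi>) \<in> atlas (M i)" "q \<in> U" by (rule premanifold_cover[OF premanifold[OF i(1)]])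
    then show "x \<in> (\<Union>i\<in>I. \<Union>(U, \<phi>)\<in>atlas (M i). \<psi> i ` (U \<inter> N i))" using i by fastforce
  qed auto
  finally show "\<Union> (fst ` atlas glued) = points glued" by (simp add: points_glued)
  show "\<forall>c\<in>atlas glued. \<forall>d\<in>atlas glued. smooth_transition n c d"
  proof (intro ballI)
    fix c d assume c: "c \<in> atlas glued" and d: "d \<in> atlas glued"
    obtain i U \<phi> where i: "i \<in> I" and U: "(U, \<phi>) \<in> atlas (M i)" "c = (\<psi> i ` (U \<inter> N i), \<lambda>x. \<phi> (inv_\<psi> i x))"
      using atlas_gluedE[of "fst c" "snd c"] c by (metis prod.collapse)
    obtain j V \<theta> where j: "j \<in> I" and V: "(V, \<theta>) \<in> atlas (M j)" "d = (\<psi> j ` (V \<inter> N j), \<lambda>x. \<theta> (inv_\<psi> j x))"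
      using atlas_gluedE[of "fst d" "snd d"] d by (metis prod.collapse)
    let ?D = "{q \<in> N i. \<psi> i q \<in> \<psi> j ` N j}"
    have "smooth_on n ((\<lambda>x. \<phi> (inv_\<psi> i x)) ` (\<psi> i ` (U \<inter> N i) \<inter> \<psi> j ` (V \<inter> N j)))
        (\<lambda>y. \<theta> (inv_\<psi> j (inv_into (\<psi> i ` (U \<inter> N i)) (\<lambda>x. \<phi> (inv_\<psi> i x)) y)) k)" if k: "k < n" for k
    proof -
      have "msmooth n (M i) {q \<in> ?D. inv_\<psi> j (\<psi> i q) \<in> V} (\<lambda>q. \<theta> (inv_\<psi> j (\<psi> i q)) k)"
        by (rule smap_msmooth[OF overlap_smooth[OF i j] V(1) k])
      then have sm: "smooth_on n (\<phi> ` (U \<inter> {q \<in> ?D. inv_\<psi> j (\<psi> i q) \<in> V})) (\<lambda>y. \<theta> (inv_\<psi> j (\<psi> i (inv_into U \<phi> y))) k)"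
        using U(1) by (auto simp: msmooth_def o_def)
      have im: "(\<lambda>x. \<phi> (inv_\<psi> i x)) ` (\<psi> i ` (U \<inter> N i) \<inter> \<psi> j ` (V \<inter> N j)) = \<phi> ` (U \<inter> {q \<in> ?D. inv_\<psi> j (\<psi> i q) \<in> V})"
      proof (intro equalityI subsetI)
        fix y assume "y \<in> (\<lambda>x. \<phi> (inv_\<psi> i x)) ` (\<psi> i ` (U \<inter> N i) \<inter> \<psi> j ` (V \<inter> N j))"
        then obtain q q' where q: "q \<in> U \<inter> N i" "q' \<in> V \<inter> N j" "\<psi> i q = \<psi> j q'" "y = \<phi> (inv_\<psi> i (\<psi> i q))" by auto
        have "y = \<phi> q" using q(1,4) i by simp
        moreover have "inv_\<psi> j (\<psi> i q) = q'" unfolding q(3) using q(2) j by simp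
        ultimately show "y \<in> \<phi> ` (U \<inter> {q \<in> ?D. inv_\<psi> j (\<psi> i q) \<in> V})" using q by auto
      next
        fix y assume "y \<in> \<phi> ` (U \<inter> {q \<in> ?D. inv_\<psi> j (\<psi> i q) \<in> V})"
        then obtain q q' where q: "q \<in> U" "q \<in> N i" "q' \<in> N j" "\<psi> i q = \<psi> j q'" "inv_\<psi> j (\<psi> i q) \<in> V" "y = \<phi> q" by auto
        then have "q' \<in> V" using j by simp
        have "\<psi> i q \<in> \<psi> i ` (U \<inter> N i)" using q(1,2) by blast
        moreover have "\<psi> i q \<in> \<psi> j ` (V \<inter> N j)" unfolding q(4) using q(3) \<open>q' \<in> V\<close> by blast
        ultimately have "\<psi> i q \<in> \<psi> i ` (U \<inter> N i) \<inter> \<psi> j ` (V \<inter> N j)" by blast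
        moreover have "y = \<phi> (inv_\<psi> i (\<psi> i q))" unfolding inv_\<psi>[OF i q(2)] by (rule q(6))
        ultimately show "y \<in> (\<lambda>x. \<phi> (inv_\<psi> i x)) ` (\<psi> i ` (U \<inter> N i) \<inter> \<psi> j ` (V \<inter> N j))" by blast
      qed
      have inv: "inv_into (\<psi> i ` (U \<inter> N i)) (\<lambda>x. \<phi> (inv_\<psi> i x)) y = \<psi> i (inv_into U \<phi> y)" if "y \<in> \<phi> ` (U \<inter> N i)" for y
        using that glued_chart(5)[OF i U(1)] chart_inj[OF premanifold[OF i] U(1)] by auto
      show ?thesis
        unfolding im
      proof (rule smooth_on_cong[OF sm])
        fix y assume "y \<in> \<phi> ` (U \<inter> {q \<in> ?D. inv_\<psi> j (\<psi> i q) \<in> V})"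
        then have "y \<in> \<phi> ` (U \<inter> N i)" by blast
        then show "\<theta> (inv_\<psi> j (\<psi> i (inv_into U \<phi> y))) k =
            \<theta> (inv_\<psi> j (inv_into (\<psi> i ` (U \<inter> N i)) (\<lambda>x. \<phi> (inv_\<psi> i x)) y)) k" by (simp add: inv)
      qed
    qed
    then show "smooth_transition n c d"
      unfolding U(2) V(2) smooth_transition_def smooth_map_on_def by (simp add: o_def)
  qed
qed

lemma glued_chart_open: "(W, \<chi>') \<in> atlas glued \<Longrightarrow> openin (Euclidean_space n) (\<chi>' ` W)"
  by (elim atlas_gluedE) (simp only: glued_chart(2) chart_open)

lemma msmooth_glued:
  assumes "\<And>i. i \<in> I \<Longrightarrow> msmooth n (M i) {q \<in> N i. \<psi> i q \<in> S} (\<lambda>q. f (\<psi> i q))"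
  shows "msmooth n glued S f"
  unfolding msmooth_def
proof clarify
  fix W \<chi>' assume "(W, \<chi>') \<in> atlas glued"
  then obtain i U \<phi> where i: "i \<in> I" and U: "(U, \<phi>) \<in> atlas (M i)" "W = \<psi> i ` (U \<inter> N i)" "\<chi>' = (\<lambda>x. \<phi> (inv_\<psi> i x))"
    by (rule atlas_gluedE)
  have sm: "smooth_on n (\<phi> ` (U \<inter> {q \<in> N i. \<psi> i q \<in> S})) (\<lambda>y. f (\<psi> i (inv_into U \<phi> y)))"
    using assms[OF i] U(1) by (auto simp: msmooth_def o_def)
  have im: "\<chi>' ` (W \<inter> S) = \<phi> ` (U \<inter> {q \<in> N i. \<psi> i q \<in> S})"
    unfolding U(2,3) using i by (force simp: image_iff)
  have inv: "inv_into W \<chi>' y = \<psi> i (inv_into U \<phi> y)" if "y \<in> \<phi> ` (U \<inter> N i)" for y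
    using that glued_chart(5)[OF i U(1)] chart_inj[OF premanifold[OF i] U(1)] unfolding U(2,3) by auto
  show "smooth_on n (\<chi>' ` (W \<inter> S)) (f \<circ> inv_into W \<chi>')"
    unfolding im
  proof (rule smooth_on_cong[OF sm])
    fix y assume "y \<in> \<phi> ` (U \<inter> {q \<in> N i. \<psi> i q \<in> S})"
    then have "y \<in> \<phi> ` (U \<inter> N i)" by blast
    then show "f (\<psi> i (inv_into U \<phi> y)) = (f \<circ> inv_into W \<chi>') y" by (simp add: inv)
  qed
qed

lemma smap_\<psi>: 
  assumes i: "i \<in> I" shows "smap n n (M i) (N i) glued (\<psi> i)"
  unfolding smap_def
proof (intro conjI \<psi>_continuous[OF i], clarify)
  fix W \<chi>' k assume W: "(W, \<chi>') \<in> atlas glued" and k: "k < n"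
  obtain j V \<theta> where j: "j \<in> I" and V: "(V, \<theta>) \<in> atlas (M j)" "W = \<psi> j ` (V \<inter> N j)" "\<chi>' = (\<lambda>x. \<theta> (inv_\<psi> j x))"
    using W by (rule atlas_gluedE)
  show "msmooth n (M i) {q \<in> N i. \<psi> i q \<in> W} (\<lambda>q. \<chi>' (\<psi> i q) k)"
    unfolding V(3)
    by (rule msmooth_subset[OF smap_msmooth[OF overlap_smooth[OF i j] V(1) k]]) (use j V(2) in auto)
qed

lemma smap_inv_\<psi>:
  assumes i: "i \<in> I" shows "smap n n glued (\<psi> i ` N i) (M i) (inv_\<psi> i)"
  unfolding smap_def
proof (intro conjI)
  show "continuous_map (subtopology (mtop glued) (\<psi> i ` N i)) (mtop (M i)) (inv_\<psi> i)"
    using inv_\<psi>_continuous[OF i] by (simp add: continuous_map_in_subtopology)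
  show "\<forall>(V, \<theta>)\<in>atlas (M i). \<forall>k<n. msmooth n glued {x \<in> \<psi> i ` N i. inv_\<psi> i x \<in> V} (\<lambda>x. \<theta> (inv_\<psi> i x) k)"
  proof clarify
    fix V \<theta> k assume V: "(V, \<theta>) \<in> atlas (M i)" and k: "k < n"
    show "msmooth n glued {x \<in> \<psi> i ` N i. inv_\<psi> i x \<in> V} (\<lambda>x. \<theta> (inv_\<psi> i x) k)"
    proof (rule msmooth_glued)
      fix j assume j: "j \<in> I"
      show "msmooth n (M j) {q \<in> N j. \<psi> j q \<in> {x \<in> \<psi> i ` N i. inv_\<psi> i x \<in> V}} (\<lambda>q. \<theta> (inv_\<psi> i (\<psi> j q)) k)"
        by (rule msmooth_subset[OF smap_msmooth[OF overlap_smooth[OF j i] V k]]) auto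
    qed
  qed
qed

lemma second_countable_glued:
  assumes fin: "finite I" and sc: "\<And>i. i \<in> I \<Longrightarrow> second_countable (mtop (M i))"
  shows "second_countable (mtop glued)"
proof -
  have "\<exists>\<B>. countable \<B> \<and> (\<forall>V\<in>\<B>. openin (mtop (M i)) V) \<and>
      (\<forall>U x. openin (mtop (M i)) U \<and> x \<in> U \<longrightarrow> (\<exists>V\<in>\<B>. x \<in> V \<and> V \<subseteq> U))" if "i \<in> I" for i
    using sc[OF that] unfolding second_countable_def by blast
  then obtain \<B> where \<B>: "\<And>i. i \<in> I \<Longrightarrow> countable (\<B> i)" "\<And>i V. i \<in> I \<Longrightarrow> V \<in> \<B> i \<Longrightarrow> openin (mtop (M i)) V"
    "\<And>i U x. i \<in> I \<Longrightarrow> openin (mtop (M i)) U \<Longrightarrow> x \<in> U \<Longrightarrow> \<exists>V\<in>\<B> i. x \<in> V \<and> V \<subseteq> U" by metis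
  let ?C = "\<Union>i\<in>I. (\<lambda>V. \<psi> i ` (V \<inter> N i)) ` \<B> i"
  have "countable ?C" using fin \<B>(1) by (intro countable_UN countable_image) (auto intro: countable_finite)
  moreover have "openin (mtop glued) W" if "W \<in> ?C" for W
    using that \<B>(2) N_open by (auto intro!: openin_glued_image)
  moreover have "\<exists>V\<in>?C. x \<in> V \<and> V \<subseteq> U" if U: "openin (mtop glued) U" "x \<in> U" for U x
  proof -
    have "x \<in> points glued" using U openin_subset by blast
    then obtain i q where i: "i \<in> I" "q \<in> N i" "x = \<psi> i q" by (auto simp: points_glued)
    have "openin (mtop (M i)) {q \<in> N i. \<psi> i q \<in> U}" using U(1) i(1) by (simp add: openin_glued)
    then obtain V where V: "V \<in> \<B> i" "q \<in> V" "V \<subseteq> {q \<in> N i. \<psi> i q \<in> U}"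
      using \<B>(3)[OF i(1), of "{q \<in> N i. \<psi> i q \<in> U}" q] i U(2) by auto
    then show ?thesis using i by (intro bexI[of _ "\<psi> i ` (V \<inter> N i)"]) auto
  qed
  ultimately show ?thesis unfolding second_countable_def by (intro exI[of _ ?C] conjI ballI allI impI) auto
qed

lemma smooth_manifold_glued:
  assumes "finite I" "\<And>i. i \<in> I \<Longrightarrow> second_countable (mtop (M i))" "Hausdorff_space (mtop glued)"
  shows "smooth_manifold n glued" "boundary_points n glued = {}"
proof -
  have "is_chart n (mtop glued) c" if "c \<in> atlas glued" for c
  proof -
    obtain W \<chi>' where c: "c = (W, \<chi>')" by fastforce
    note * = premanifold_chart[OF premanifold_glued that[unfolded c]] glued_chart_open[OF that[unfolded c]]
    then show ?thesis by (simp add: c is_chart_def subtopology_Euclidean_space)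
  qed
  then show "smooth_manifold n glued"
    unfolding smooth_manifold_def
    using assms second_countable_glued premanifold_glued by (auto simp: premanifold_def)
  \<comment> \<open>A chart image open in Euclidean space may also be open in the half space, so the
    kind of chart alone does not decide. However, an open image that meets the hyperplane also has
    points below it.\<close>
  have False if *: "(W, \<chi>') \<in> atlas glued" "p \<in> W" "openin (half_space n) (\<chi>' ` W)" "\<chi>' p (n - 1) = 0" "0 < n" for W \<chi>' p
  proof -
    obtain e where e: "e > 0" "cube n (\<chi>' p) e \<subseteq> \<chi>' ` W"
      using openin_Euclidean_space_cube[OF glued_chart_open[OF *(1)]] *(2) by blast
    have "(\<chi>' p)(n - 1 := - e / 2) \<in> cube n (\<chi>' p) e"
      using e(1) that(2,4,5) chart_image[OF premanifold_glued that(1)] by (auto simp: cube_def mem_ES image_subset_iff)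
    then have "(\<chi>' p)(n - 1 := - e / 2) \<in> topspace (half_space n)"
      using e(2) openin_subset[OF that(3)] by blast
    then show False using e(1) by (simp add: topspace_half_space)
  qed
  then show "boundary_points n glued = {}" unfolding boundary_points_def by blast
qed

end

section \<open>Collars along the edges at a vertex\<close>

text \<open>A point of the collar \<open>C\<close> has three coordinates: the edge
  \<open>E q\<close>, a point \<open>X q\<close> of the manifold of this edge, and the depth
  \<open>\<rho> q\<close>. \<open>T e\<close> is the inverse on the part belonging to
  \<open>e\<close>. Depth 0 is the boundary and the length is 2, so that depth 1, where the gluing
  will stop, is interior to the collar.\<close>

definition edge_collars :: "nat \<Rightarrow> 'b mfd \<Rightarrow> 'e set \<Rightarrow> ('e \<Rightarrow> 'a mfd) \<Rightarrow> 'b set \<Rightarrow> ('b \<Rightarrow> 'e) \<Rightarrow> ('b \<Rightarrow> 'a)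
    \<Rightarrow> ('b \<Rightarrow> real) \<Rightarrow> ('e \<Rightarrow> 'a \<times> real \<Rightarrow> 'b) \<Rightarrow> bool" where
  "edge_collars m N I \<Phi> C E X \<rho> T \<longleftrightarrow>
     openin (mtop N) C \<and> msmooth m N C \<rho> \<and> boundary_points m N = {q \<in> C. \<rho> q = 0} \<and>
     (\<forall>e\<in>I. openin (mtop N) {q \<in> C. E q = e} \<and> smap m (m - 1) N {q \<in> C. E q = e} (\<Phi> e) X \<and>
        smap m m (cylinder (m - 1) (\<Phi> e)) (points (\<Phi> e) \<times> {0..<2}) N (T e) \<and>
        (\<forall>x\<in>points (\<Phi> e). \<forall>t\<in>{0..<2}.
           T e (x, t) \<in> C \<and> E (T e (x, t)) = e \<and> X (T e (x, t)) = x \<and> \<rho> (T e (x, t)) = t)) \<and>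
     (\<forall>q\<in>C. E q \<in> I \<and> X q \<in> points (\<Phi> (E q)) \<and> 0 \<le> \<rho> q \<and> \<rho> q < 2 \<and> T (E q) (X q, \<rho> q) = q)"

text \<open>The collar is composed with the diffeomorphism between the boundary and the disjoint
  union. The work is a change of dimension: charts of the boundary are restricted charts of
  \<open>N\<close>, whose last coordinate vanishes there, so that \<open>smooth_on_dim\<close>
  converts between dimensions \<open>m - 1\<close> and \<open>m\<close>.\<close>

lemma edge_collars_exist:
  fixes N :: "'b mfd" and \<Phi> :: "'e \<Rightarrow> 'a mfd"
  assumes m: "2 \<le> m" and N: "compact_manifold m N" and \<Phi>: "\<And>e. e \<in> I \<Longrightarrow> premanifold (m - 1) (\<Phi> e)"
    and D: "diffeomorphic (m - 1) (boundary_mfd m N) (disjoint_union_mfd \<Phi> I)"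
  shows "\<exists>C E X \<rho> T. edge_collars m N I \<Phi> C E X \<rho> T"
proof -
  let ?B = "boundary_points m N"
  have SN: "smooth_manifold m N" using N by (simp add: compact_manifold_def)
  note PN = smooth_manifold_imp_premanifold[OF SN]
  have m0: "0 < m" "m - 1 \<le> m" using m by auto
  obtain C r \<rho> c where "collar m N 2 C r \<rho> c" by (rule collar_exists[OF N m0(1) zero_less_numeral[of "num.Bit0 num.One"]])
  note col = this[unfolded collar_def]
  have colB: "c (x, t) \<in> C \<and> r (c (x, t)) = x \<and> \<rho> (c (x, t)) = t"
    if "x \<in> boundary_points m N" "t \<in> {0..<2}" for x t using col that by blast
  obtain g g' where hom: "homeomorphic_maps (mtop (boundary_mfd m N)) (mtop (disjoint_union_mfd \<Phi> I)) g g'"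
    and g: "smooth_map (m - 1) (m - 1) (boundary_mfd m N) (disjoint_union_mfd \<Phi> I) g"
    and g': "smooth_map (m - 1) (m - 1) (disjoint_union_mfd \<Phi> I) (boundary_mfd m N) g'"
    using D unfolding diffeomorphic_def by blast
  let ?S = "sum_topology (\<lambda>i. mtop (\<Phi> i)) I"
  have BN: "?B \<subseteq> points N" by (rule boundary_points_subset[OF SN])
  have gc: "continuous_map (subtopology (mtop N) ?B) ?S g" "continuous_map ?S (subtopology (mtop N) ?B) g'"
    and gg': "\<And>q. q \<in> ?B \<Longrightarrow> g' (g q) = q" "\<And>e x. e \<in> I \<Longrightarrow> x \<in> points (\<Phi> e) \<Longrightarrow> g (g' (e, x)) = (e, x)"
    using hom BN by (auto simp: homeomorphic_maps_def boundary_mfd_def disjoint_union_mfd_def topspace_sum_topology)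
  have gI: "fst (g q) \<in> I" "snd (g q) \<in> points (\<Phi> (fst (g q)))" if "q \<in> ?B" for q
  proof -
    have "g q \<in> topspace ?S" using gc(1) that BN by (auto simp: continuous_map_def)
    then show "fst (g q) \<in> I" "snd (g q) \<in> points (\<Phi> (fst (g q)))" by (auto simp: topspace_sum_topology)
  qed
  have g'B: "g' (e, x) \<in> ?B" if "e \<in> I" "x \<in> points (\<Phi> e)" for e x
    using gc(2) that by (auto simp: continuous_map_def topspace_sum_topology Pi_iff)
  have open_piece: "openin ?S ({e} \<times> V)" if "e \<in> I" "openin (mtop (\<Phi> e)) V" for e V
  proof -
    have "{x. (i, x) \<in> {e} \<times> V} = (if i = e then V else {})" for i by auto
    then show ?thesis using that openin_subset[OF that(2)] by (auto simp: openin_sum_topology topspace_sum_topology)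
  qed
  have \<phi>E: "\<phi> ` (U \<inter> ?B) \<subseteq> ES (m - 1)" if U: "(U, \<phi>) \<in> atlas N" for U \<phi>
  proof clarify
    fix q assume q: "q \<in> U" "q \<in> ?B"
    have "\<phi> q \<in> ES m" "\<phi> q (m - 1) = 0"
      using chart_image[OF PN U] q boundary_point_chart(2)[OF SN q(2) U q(1)] by auto
    then show "\<phi> q \<in> ES (m - 1)"
      unfolding mem_ES by (metis One_nat_def Suc_pred le_antisym m0(1) not_less_eq_eq)
  qed
  have sg: "smap m (m - 1) N {q \<in> ?B. fst (g q) = e} (\<Phi> e) (\<lambda>q. snd (g q))" if e: "e \<in> I" for e
    unfolding smap_def
  proof (intro conjI)
    let ?A = "{q \<in> ?B. fst (g q) = e}"
    show "continuous_map (subtopology (mtop N) ?A) (mtop (\<Phi> e)) (\<lambda>q. snd (g q))"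
      unfolding continuous_map_def
    proof (intro conjI allI impI)
      show "(\<lambda>q. snd (g q)) \<in> topspace (subtopology (mtop N) ?A) \<rightarrow> points (\<Phi> e)" using gI by auto
      fix V assume V: "openin (mtop (\<Phi> e)) V"
      have "openin (subtopology (mtop N) ?B) {q \<in> topspace (subtopology (mtop N) ?B). g q \<in> {e} \<times> V}"
        by (rule openin_continuous_map_preimage[OF gc(1) open_piece[OF e V]])
      then obtain W where W: "openin (mtop N) W" "{q \<in> topspace (subtopology (mtop N) ?B). g q \<in> {e} \<times> V} = W \<inter> ?B"
        by (auto simp: openin_subtopology)
      have "g q \<in> {e} \<times> V \<longleftrightarrow> q \<in> W" if "q \<in> ?B" for q using W(2) that BN by auto
      then have "{q \<in> topspace (subtopology (mtop N) ?A). snd (g q) \<in> V} = W \<inter> ?A"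
        using BN by (auto simp: mem_Times_iff)
      then show "openin (subtopology (mtop N) ?A) {q \<in> topspace (subtopology (mtop N) ?A). snd (g q) \<in> V}"
        using W(1) by (auto simp: openin_subtopology)
    qed
    show "\<forall>(V, \<theta>)\<in>atlas (\<Phi> e). \<forall>j<m - 1. msmooth m N {q \<in> ?A. snd (g q) \<in> V} (\<lambda>q. \<theta> (snd (g q)) j)"
    proof clarify
      fix V \<theta> j assume V: "(V, \<theta>) \<in> atlas (\<Phi> e)" and j: "j < m - 1"
      have V': "({e} \<times> V, \<theta> \<circ> snd) \<in> atlas (disjoint_union_mfd \<Phi> I)"
        using V e by (force simp: disjoint_union_mfd_def)
      show "msmooth m N {q \<in> ?A. snd (g q) \<in> V} (\<lambda>q. \<theta> (snd (g q)) j)"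
        unfolding msmooth_def
      proof clarify
        fix U \<phi> assume U: "(U, \<phi>) \<in> atlas N"
        note inj = chart_inj[OF PN U]
        have U': "(U \<inter> ?B, \<phi>) \<in> atlas (boundary_mfd m N)"
          using U by (force simp: boundary_mfd_def)
        have "smooth_map_on (m - 1) (m - 1) (\<phi> ` {p \<in> U \<inter> ?B. g p \<in> {e} \<times> V}) ((\<theta> \<circ> snd) \<circ> g \<circ> inv_into (U \<inter> ?B) \<phi>)"
          using g[unfolded smooth_map_def] U' V' by fast
        then have "smooth_on (m - 1) (\<phi> ` {p \<in> U \<inter> ?B. g p \<in> {e} \<times> V}) (\<lambda>y. \<theta> (snd (g (inv_into (U \<inter> ?B) \<phi> y))) j)"
          using j by (simp add: smooth_map_on_def)
        moreover have "\<phi> ` {p \<in> U \<inter> ?B. g p \<in> {e} \<times> V} \<subseteq> ES (m - 1)" using \<phi>E[OF U] by blast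
        ultimately have 1: "smooth_on m (\<phi> ` {p \<in> U \<inter> ?B. g p \<in> {e} \<times> V}) (\<lambda>y. \<theta> (snd (g (inv_into (U \<inter> ?B) \<phi> y))) j)"
          using smooth_on_dim[OF m0(2)] by blast
        have im: "U \<inter> {q \<in> ?A. snd (g q) \<in> V} = {p \<in> U \<inter> ?B. g p \<in> {e} \<times> V}"
          by (auto simp: mem_Times_iff)
        show "smooth_on m (\<phi> ` (U \<inter> {q \<in> ?A. snd (g q) \<in> V})) ((\<lambda>q. \<theta> (snd (g q)) j) \<circ> inv_into U \<phi>)"
          unfolding im
        proof (rule smooth_on_cong[OF 1])
          fix y assume "y \<in> \<phi> ` {p \<in> U \<inter> ?B. g p \<in> {e} \<times> V}"
          then obtain p where "p \<in> U \<inter> ?B" "y = \<phi> p" by blast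
          then have "inv_into (U \<inter> ?B) \<phi> y = inv_into U \<phi> y" using inj by (simp add: inj_on_Int)
          then show "\<theta> (snd (g (inv_into (U \<inter> ?B) \<phi> y))) j = ((\<lambda>q. \<theta> (snd (g q)) j) \<circ> inv_into U \<phi>) y" by simp
        qed
      qed
    qed
  qed
  have sg': "smap (m - 1) m (\<Phi> e) (points (\<Phi> e)) N (\<lambda>x. g' (e, x))" if e: "e \<in> I" for e
    unfolding smap_def
  proof (intro conjI)
    have "continuous_map (mtop (\<Phi> e)) ?S (\<lambda>x. (e, x))" by (rule continuous_map_component_injection[OF e])
    from continuous_map_compose[OF this gc(2)]
    show "continuous_map (subtopology (mtop (\<Phi> e)) (points (\<Phi> e))) (mtop N) (\<lambda>x. g' (e, x))"
      by (simp add: continuous_map_in_subtopology o_def)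
    show "\<forall>(U, \<phi>)\<in>atlas N. \<forall>j<m. msmooth (m - 1) (\<Phi> e) {x \<in> points (\<Phi> e). g' (e, x) \<in> U} (\<lambda>x. \<phi> (g' (e, x)) j)"
    proof clarify
      fix U \<phi> j assume U: "(U, \<phi>) \<in> atlas N" and j: "j < m"
      show "msmooth (m - 1) (\<Phi> e) {x \<in> points (\<Phi> e). g' (e, x) \<in> U} (\<lambda>x. \<phi> (g' (e, x)) j)"
      \<comment> \<open>The smoothness of \<open>g'\<close> covers the first \<open>m - 1\<close>
        chart coordinates; the last one is constantly 0 at boundary points.\<close>
      proof (cases "j = m - 1")
        case True
        show ?thesis
        proof (rule msmooth_cong[OF \<Phi>[OF e] msmooth_const[OF \<Phi>[OF e]]])
          fix x assume "x \<in> {x \<in> points (\<Phi> e). g' (e, x) \<in> U}"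
          then show "0 = \<phi> (g' (e, x)) j"
            using boundary_point_chart(2)[OF SN g'B[OF e] U] True by simp
        qed
      next
        case False
        then have j': "j < m - 1" using j by simp
        show ?thesis
          unfolding msmooth_def
        proof clarify
          fix V \<theta> assume V: "(V, \<theta>) \<in> atlas (\<Phi> e)"
          note cV = premanifold_chart[OF \<Phi>[OF e] V]
          have V': "({e} \<times> V, \<theta> \<circ> snd) \<in> atlas (disjoint_union_mfd \<Phi> I)"
            using V e by (force simp: disjoint_union_mfd_def)
          have U': "(U \<inter> ?B, \<phi>) \<in> atlas (boundary_mfd m N)"
            using U by (force simp: boundary_mfd_def)
          have "smooth_map_on (m - 1) (m - 1) ((\<theta> \<circ> snd) ` {p \<in> {e} \<times> V. g' p \<in> U \<inter> ?B}) (\<phi> \<circ> g' \<circ> inv_into ({e} \<times> V) (\<theta> \<circ> snd))"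
            using g'[unfolded smooth_map_def] U' V' by fast
          then have 1: "smooth_on (m - 1) ((\<theta> \<circ> snd) ` {p \<in> {e} \<times> V. g' p \<in> U \<inter> ?B})
              (\<lambda>y. \<phi> (g' (inv_into ({e} \<times> V) (\<theta> \<circ> snd) y)) j)"
            using j' by (simp add: smooth_map_on_def)
          have im: "(\<theta> \<circ> snd) ` {p \<in> {e} \<times> V. g' p \<in> U \<inter> ?B} = \<theta> ` (V \<inter> {x \<in> points (\<Phi> e). g' (e, x) \<in> U})"
            using g'B[OF e] cV(4) by (force simp: image_iff)
          have inj: "inj_on (\<theta> \<circ> snd) ({e} \<times> V)" using cV(5) by (auto simp: inj_on_def)
          show "smooth_on (m - 1) (\<theta> ` (V \<inter> {x \<in> points (\<Phi> e). g' (e, x) \<in> U})) ((\<lambda>x. \<phi> (g' (e, x)) j) \<circ> inv_into V \<theta>)"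
          proof (rule smooth_on_cong[OF 1[unfolded im]])
            fix y assume "y \<in> \<theta> ` (V \<inter> {x \<in> points (\<Phi> e). g' (e, x) \<in> U})"
            then obtain x where x: "x \<in> V" "y = \<theta> x" by blast
            have "inv_into ({e} \<times> V) (\<theta> \<circ> snd) ((\<theta> \<circ> snd) (e, x)) = (e, x)"
              by (rule inv_into_f_f[OF inj]) (use x in auto)
            then show "\<phi> (g' (inv_into ({e} \<times> V) (\<theta> \<circ> snd) y)) j = ((\<lambda>x. \<phi> (g' (e, x)) j) \<circ> inv_into V \<theta>) y"
              using x cV(5) by simp
          qed
        qed
      qed
    qed
  qed
  define E where "E q = fst (g (r q))" for q
  define X where "X q = snd (g (r q))" for q
  define T where "T e z = c (g' (e, fst z), snd z)" for e z
  have rc: "continuous_map (subtopology (mtop N) C) (subtopology (mtop N) ?B) r"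
    using smap_continuous[of m m N C N r] col by (auto simp: continuous_map_in_subtopology)
  have "edge_collars m N I \<Phi> C E X \<rho> T"
    unfolding edge_collars_def
  proof (intro conjI ballI)
    show "openin (mtop N) C" "msmooth m N C \<rho>" using col by blast+
    show "?B = {q \<in> C. \<rho> q = 0}"
    proof (intro equalityI subsetI)
      fix q assume q: "q \<in> ?B"
      have "c (q, 0) \<in> C \<and> \<rho> (c (q, 0)) = 0" "c (q, 0) = q" using colB[OF q, of 0] col q by simp_all
      then show "q \<in> {q \<in> C. \<rho> q = 0}" by simp
    next
      fix q assume q: "q \<in> {q \<in> C. \<rho> q = 0}"
      then have "c (r q, 0) = q" "r q \<in> ?B" using col by force+
      moreover from this have "c (r q, 0) = r q" using col by blast
      ultimately show "q \<in> ?B" by simp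
    qed
  next
    fix e assume e: "e \<in> I"
    show "openin (mtop N) {q \<in> C. E q = e}"
    proof -
      have "continuous_map (subtopology (mtop N) C) ?S (g \<circ> r)" by (rule continuous_map_compose[OF rc gc(1)])
      from openin_continuous_map_preimage[OF this open_piece[OF e openin_topspace]]
      have "openin (subtopology (mtop N) C) {q \<in> topspace (subtopology (mtop N) C). (g \<circ> r) q \<in> {e} \<times> points (\<Phi> e)}" .
      moreover have "{q \<in> topspace (subtopology (mtop N) C). (g \<circ> r) q \<in> {e} \<times> points (\<Phi> e)} = {q \<in> C. E q = e}"
      proof -
        have "C \<subseteq> points N" using col openin_subset by blast
        moreover have "r q \<in> ?B" if "q \<in> C" for q using col that by blast
        ultimately show ?thesis using gI by (fastforce simp: E_def mem_Times_iff)
      qed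
      moreover have "openin (mtop N) C" using col by blast
      ultimately show ?thesis using openin_trans_full by metis
    qed
    show "smap m (m - 1) N {q \<in> C. E q = e} (\<Phi> e) X"
      unfolding X_def
    proof (rule smap_compose[OF PN PN _ sg[OF e]])
      show "smap m m N {q \<in> C. E q = e} N r" by (rule smap_subset[of m m N C]) (use col in auto)
      show "r q \<in> {q \<in> ?B. fst (g q) = e}" if "q \<in> {q \<in> C. E q = e}" for q
        using that col by (auto simp: E_def)
    qed
    have Sm: "Suc (m - 1) = m" using m0 by simp
    note Pc = premanifold_cylinder[OF \<Phi>[OF e], unfolded Sm]
    show "smap m m (cylinder (m - 1) (\<Phi> e)) (points (\<Phi> e) \<times> {0..<2}) N (T e)"
      unfolding T_def
    proof (rule smap_compose[OF Pc premanifold_cylinder[OF PN]])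
      show "smap m (Suc m) (cylinder (m - 1) (\<Phi> e)) (points (\<Phi> e) \<times> {0..<2}) (cylinder m N) (\<lambda>z. (g' (e, fst z), snd z))"
      proof (rule smap_Pair[OF Pc PN])
        show "smap m m (cylinder (m - 1) (\<Phi> e)) (points (\<Phi> e) \<times> {0..<2}) N (\<lambda>z. g' (e, fst z))"
          by (rule smap_compose[OF Pc \<Phi>[OF e] smap_fst[OF \<Phi>[OF e], unfolded Sm] sg'[OF e]]) auto
        show "msmooth m (cylinder (m - 1) (\<Phi> e)) (points (\<Phi> e) \<times> {0..<2}) snd"
          by (rule msmooth_snd[OF \<Phi>[OF e], unfolded Sm])
      qed
      show "smap (Suc m) m (cylinder m N) (?B \<times> {0..<2}) N c" using col by blast
      show "(g' (e, fst z), snd z) \<in> ?B \<times> {0..<2}" if "z \<in> points (\<Phi> e) \<times> {0..<2}" for z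
        using that g'B[OF e] by auto
    qed
    fix x t assume x: "x \<in> points (\<Phi> e)" and t: "t \<in> {0..<2::real}"
    have "c (g' (e, x), t) \<in> C \<and> r (c (g' (e, x), t)) = g' (e, x) \<and> \<rho> (c (g' (e, x), t)) = t"
      by (rule colB[OF g'B[OF e x] t])
    then show "T e (x, t) \<in> C" "E (T e (x, t)) = e" "X (T e (x, t)) = x" "\<rho> (T e (x, t)) = t"
      using gg'(2)[OF e x] by (simp_all add: T_def E_def X_def)
  next
    fix q assume "q \<in> C"
    then have q: "r q \<in> ?B" "0 \<le> \<rho> q" "\<rho> q < 2" "c (r q, \<rho> q) = q" using col by blast+
    show "E q \<in> I" "X q \<in> points (\<Phi> (E q))" using gI[OF q(1)] by (simp_all add: E_def X_def)
    show "0 \<le> \<rho> q" "\<rho> q < 2" by fact+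
    show "T (E q) (X q, \<rho> q) = q" using gg'(1)[OF q(1)] q(4) by (simp add: T_def E_def X_def)
  qed
  then show ?thesis by blast
qed

section \<open>Finite graphs\<close>

text \<open>The closed cell is compact, hence closed, and is the closure of the open cell. The pair
  of ends is therefore the closure minus the open cell and does not depend on the characteristic
  map.\<close>

lemma characteristic_mapD:
  assumes G: "finite_graph G" and e: "e \<in> edges G" and \<gamma>: "characteristic_map G e \<gamma>"
  shows "\<gamma> ` {0<..<1} = e" "inj_on \<gamma> {0<..<1}" "\<gamma> ` {0..1} = insert (\<gamma> 0) (insert (\<gamma> 1) e)"
    "\<gamma> 0 \<in> verts G" "\<gamma> 1 \<in> verts G" "\<gamma> 0 \<notin> e" "\<gamma> 1 \<notin> e" "e \<subseteq> topspace (gtop G)"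
    "closedin (gtop G) (\<gamma> ` {0..1})" "{\<gamma> 0, \<gamma> 1} = gtop G closure_of e - e"
proof -
  have eG: "e \<subseteq> topspace (gtop G) - verts G" using G e unfolding finite_graph_def by blast
  then show "e \<subseteq> topspace (gtop G)" by blast
  have cont: "continuous_map (top_of_set {0..1}) (gtop G) \<gamma>"
    and hom: "homeomorphic_map (top_of_set {0<..<1}) (subtopology (gtop G) e) \<gamma>"
    using \<gamma> by (auto simp: characteristic_map_def)
  show im: "\<gamma> ` {0<..<1} = e"
    using homeomorphic_imp_surjective_map[OF hom] eG by auto
  show "inj_on \<gamma> {0<..<1}" using homeomorphic_imp_injective_map[OF hom] by simp
  have "{0..1} = insert 0 (insert 1 {0<..<1::real})" by auto
  then show full: "\<gamma> ` {0..1} = insert (\<gamma> 0) (insert (\<gamma> 1) e)" using im by (metis image_insert)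
  show v: "\<gamma> 0 \<in> verts G" "\<gamma> 1 \<in> verts G" using \<gamma> by (auto simp: characteristic_map_def)
  then show n: "\<gamma> 0 \<notin> e" "\<gamma> 1 \<notin> e" using eG by auto
  have "compactin (gtop G) (\<gamma> ` {0..1})"
    by (rule image_compactin[OF _ cont]) (simp add: compactin_subtopology)
  then show closed: "closedin (gtop G) (\<gamma> ` {0..1})"
    using G compactin_imp_closedin by (auto simp: finite_graph_def)
  have "gtop G closure_of e = \<gamma> ` {0..1}"
  proof
    show "gtop G closure_of e \<subseteq> \<gamma> ` {0..1}"
      using closure_of_minimal[OF _ closed, of e] full by blast
    have "\<gamma> ` (top_of_set {0..1} closure_of {0<..<1}) \<subseteq> gtop G closure_of (\<gamma> ` {0<..<1})"
      by (rule continuous_map_image_closure_subset[OF cont])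
    moreover have "top_of_set {0..1} closure_of {0<..<1} = {0..1::real}"
      by (simp add: closure_of_subtopology closure_greaterThanLessThan Int_absorb1 greaterThanLessThan_subseteq_atLeastAtMost_iff)
    ultimately show "\<gamma> ` {0..1} \<subseteq> gtop G closure_of e" by (simp add: im)
  qed
  then show "{\<gamma> 0, \<gamma> 1} = gtop G closure_of e - e" using full n by auto
qed

lemma characteristic_map_reverse:
  assumes "characteristic_map G e \<gamma>" shows "characteristic_map G e (\<lambda>t. \<gamma> (1 - t))"
proof -
  have 1: "continuous_map (top_of_set {0..1}) (top_of_set {0..1}) (\<lambda>t. 1 - t :: real)"
    by (auto intro!: continuous_intros simp: continuous_map_in_subtopology)
  have "homeomorphic_maps (top_of_set {0<..<1}) (top_of_set {0<..<1}) (\<lambda>t. 1 - t :: real) (\<lambda>t. 1 - t)"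
    by (auto intro!: continuous_intros simp: homeomorphic_maps_def continuous_map_in_subtopology)
  then have 2: "homeomorphic_map (top_of_set {0<..<1}) (top_of_set {0<..<1}) (\<lambda>t. 1 - t :: real)"
    using homeomorphic_map_maps by blast
  show ?thesis
    using assms continuous_map_compose[OF 1, of "gtop G" \<gamma>] homeomorphic_map_compose[OF 2, of "subtopology (gtop G) e" \<gamma>]
    by (auto simp: characteristic_map_def o_def)
qed

lemma edges_disjoint:
  assumes "finite_graph G" "e \<in> edges G" "e' \<in> edges G" "e \<noteq> e'" shows "e \<inter> e' = {}"
proof -
  have "pairwise disjnt (edges G)" using assms(1) by (simp add: finite_graph_def)
  then show ?thesis using assms(2-4) by (simp add: pairwise_def disjnt_def)
qed

text \<open>The complement is the finite union of the set of vertices and of the closed cells of the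
  other edges, all of them closed.\<close>

lemma graph_edge_open:
  assumes G: "finite_graph G" and e: "e \<in> edges G"
  shows "openin (gtop G) e"
proof -
  have "\<exists>\<gamma>. characteristic_map G e' \<gamma>" if "e' \<in> edges G" for e' using G that by (auto simp: finite_graph_def)
  then obtain \<gamma> where \<gamma>: "\<And>e'. e' \<in> edges G \<Longrightarrow> characteristic_map G e' (\<gamma> e')" by metis
  let ?R = "verts G \<union> (\<Union>e'\<in>edges G - {e}. \<gamma> e' ` {0..1})"
  have "closedin (gtop G) (verts G)"
    using G by (intro closedin_Hausdorff_finite) (auto simp: finite_graph_def)
  moreover have "closedin (gtop G) (\<Union>e'\<in>edges G - {e}. \<gamma> e' ` {0..1})"
    using G characteristic_mapD(9)[OF G _ \<gamma>] by (intro closedin_Union) (auto simp: finite_graph_def)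
  ultimately have "closedin (gtop G) ?R" by (rule closedin_Un)
  moreover have "topspace (gtop G) - ?R = e"
  proof -
    have dis: "e' \<inter> e = {}" if "e' \<in> edges G - {e}" for e'
      using edges_disjoint[OF G _ e] that by blast
    have un: "\<Union> (edges G) = topspace (gtop G) - verts G" using G by (simp add: finite_graph_def)
    have sub: "e' \<subseteq> \<gamma> e' ` {0..1}" "\<gamma> e' ` {0..1} \<subseteq> e' \<union> verts G" if "e' \<in> edges G" for e'
      unfolding characteristic_mapD(3)[OF G that \<gamma>[OF that]]
      using characteristic_mapD(4,5)[OF G that \<gamma>[OF that]] by blast+
    show ?thesis
    proof (intro equalityI subsetI)
      fix x assume x: "x \<in> topspace (gtop G) - ?R"
      then have "x \<in> \<Union> (edges G)" unfolding un by simp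
      then obtain e' where e': "e' \<in> edges G" "x \<in> e'" by blast
      then have "x \<in> \<gamma> e' ` {0..1}" using sub(1)[OF e'(1)] by blast
      then have "e' = e" using x e'(1) by blast
      then show "x \<in> e" using e' by simp
    next
      fix x assume x: "x \<in> e"
      have "e \<subseteq> topspace (gtop G) - verts G" using un e by blast
      then have xv: "x \<in> topspace (gtop G)" "x \<notin> verts G" using x by auto
      have "x \<notin> \<gamma> e' ` {0..1}" if e': "e' \<in> edges G - {e}" for e'
      proof -
        have "x \<notin> e'" using dis[OF e'] x by blast
        then show ?thesis using sub(2)[of e'] e' xv(2) by blast
      qed
      then show "x \<in> topspace (gtop G) - ?R" using xv by simp
    qed
  qed
  ultimately show ?thesis by (metis closedin_def)
qed

text \<open>The edges are nonempty, connected, open and pairwise disjoint, and they cover the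
  complement of the vertices. The edges of a Reeb graph are defined as such components, which makes
  the comparison of both graphs topological.\<close>

lemma edge_components:
  assumes G: "finite_graph G"
  shows "connected_components_of (subtopology (gtop G) (topspace (gtop G) - verts G)) = edges G"
proof -
  let ?X = "subtopology (gtop G) (topspace (gtop G) - verts G)"
  have top: "topspace ?X = \<Union> (edges G)" using G by (auto simp: finite_graph_def)
  have conn: "connectedin ?X e" and ne: "e \<noteq> {}" and op: "openin ?X e" if e: "e \<in> edges G" for e
  proof -
    obtain \<gamma> where \<gamma>: "characteristic_map G e \<gamma>" using G e by (auto simp: finite_graph_def)
    note c = characteristic_mapD[OF G e \<gamma>]
    have "connected_space (subtopology (gtop G) e)"
      using \<gamma> homeomorphic_map_connectedness[of "top_of_set {0<..<1}" "subtopology (gtop G) e" \<gamma> "{0<..<1}"] c(1)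
      by (auto simp: characteristic_map_def connectedin_def subtopology_subtopology)
    then have "connectedin (gtop G) e" using c(8) by (simp add: connectedin_def)
    then show "connectedin ?X e" using e top by (auto simp: connectedin_subtopology)
    show "e \<noteq> {}" using c(1) by (auto simp: greaterThanLessThan_empty_iff)
    show "openin ?X e" using graph_edge_open[OF G e] e top
      by (metis G Int_absorb1 Union_upper finite_graph_def openin_subtopology_Int2)
  qed
  have "connected_component_of_set ?X x = e" if e: "e \<in> edges G" and x: "x \<in> e" for e x
  proof
    show "e \<subseteq> connected_component_of_set ?X x"
      using connected_component_of_maximal[OF conn[OF e] x] .
    let ?C = "connected_component_of_set ?X x"
    have C: "connectedin ?X ?C" by (rule connectedin_connected_component_of)
    have xC: "x \<in> ?C" using e x top by (auto simp: connected_component_of_refl)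
    have "openin ?X (\<Union> (edges G - {e}))" using op by (intro openin_Union) auto
    moreover have Csub: "?C \<subseteq> e \<union> \<Union> (edges G - {e})" using connectedin_subset_topspace[OF C] top by auto
    moreover have "e \<inter> e' = {}" if "e' \<in> edges G - {e}" for e'
      using edges_disjoint[OF G e] that by blast
    then have "e \<inter> \<Union> (edges G - {e}) = {}" by blast
    ultimately have "?C \<inter> \<Union> (edges G - {e}) = {}"
      using C op[OF e] xC x unfolding connectedin by blast
    then show "?C \<subseteq> e" using Csub by blast
  qed
  then show ?thesis
    unfolding connected_components_of_def top
  proof (intro equalityI subsetI)
    fix C assume "C \<in> connected_component_of_set ?X ` \<Union> (edges G)"
    then obtain x e where "e \<in> edges G" "x \<in> e" "C = connected_component_of_set ?X x" by blast
    then show "C \<in> edges G" using \<open>\<And>x e. e \<in> edges G \<Longrightarrow> x \<in> e \<Longrightarrow> connected_component_of_set ?X x = e\<close> by simp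
  next
    fix e assume e: "e \<in> edges G"
    then obtain x where x: "x \<in> e" using ne by blast
    then have "e = connected_component_of_set ?X x"
      using \<open>\<And>x e. e \<in> edges G \<Longrightarrow> x \<in> e \<Longrightarrow> connected_component_of_set ?X x = e\<close> e by simp
    then show "e \<in> connected_component_of_set ?X ` \<Union> (edges G)" using e x by blast
  qed
qed

text \<open>A regular neighborhood may be described by any characteristic map, whereas the tubes use
  a fixed one. In the parameter of \<open>\<gamma>\<close>, the arc of \<open>\<gamma>'\<close>
  becomes a compact connected subset of [0, 1] that contains 0 and a positive number but not 1, and
  thus an interval from 0 to some \<open>u < 1\<close>.\<close>

lemma initial_arc:
  assumes G: "finite_graph G" and e: "e \<in> edges G"
    and \<gamma>: "characteristic_map G e \<gamma>" and \<gamma>': "characteristic_map G e \<gamma>'"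
    and ne: "\<gamma> 0 \<noteq> \<gamma> 1" and eq: "\<gamma>' 0 = \<gamma> 0" and s: "0 < s" "s < 1"
  obtains u where "0 < u" "u < 1" "\<gamma>' ` {0..s} = \<gamma> ` {0..u}"
proof -
  note c = characteristic_mapD[OF G e \<gamma>] and c' = characteristic_mapD[OF G e \<gamma>']
  have ends: "\<gamma>' 1 = \<gamma> 1"
    using c(10) c'(10) ne eq by (metis doubleton_eq_iff insert_absorb2 singleton_insert_inj_eq')
  have inj01: "inj_on \<delta> {0..1}" if d: "inj_on \<delta> {0<..<1}" "\<delta> ` {0<..<1} = e" "\<delta> 0 \<notin> e" "\<delta> 1 \<notin> e" "\<delta> 0 \<noteq> \<delta> 1" for \<delta> :: "real \<Rightarrow> 'a"
  proof (rule inj_onI)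
    have *: "\<delta> t \<in> e" if "0 < t" "t < 1" for t using d(2) that by auto
    fix x y :: real assume xy: "x \<in> {0..1}" "y \<in> {0..1}" "\<delta> x = \<delta> y"
    consider "x = 0" | "x = 1" | "0 < x" "x < 1" using xy(1) by fastforce
    then show "x = y"
    proof cases
      case 3
      then have "y \<noteq> 0" "y \<noteq> 1" using *[of x] d(3,4) xy(3) by metis+
      then have "0 < y" "y < 1" using xy(2) by auto
      then show ?thesis using 3 d(1) xy(3) by (auto dest: inj_onD)
    qed (use *[of y] d xy in \<open>auto simp: le_less\<close>)
  qed
  have inj: "inj_on \<gamma> {0..1}" "inj_on \<gamma>' {0..1}"
    using inj01[of \<gamma>] inj01[of \<gamma>'] c c' ne eq ends by simp_all
  have im: "\<gamma>' ` {0..1} = \<gamma> ` {0..1}" using c(3) c'(3) eq ends by simp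
  have cont: "continuous_map (top_of_set {0..1}) (gtop G) \<gamma>" "continuous_map (top_of_set {0..1}) (gtop G) \<gamma>'"
    using \<gamma> \<gamma>' by (auto simp: characteristic_map_def)
  have HG: "Hausdorff_space (gtop G)" using G by (simp add: finite_graph_def)
  \<comment> \<open>The distinct ends make \<open>\<gamma>\<close> injective on the whole closed
    interval, and a continuous injection of a compact space into a Hausdorff space is an
    embedding.\<close>
  have "embedding_map (top_of_set {0..1}) (gtop G) \<gamma>"
    by (rule continuous_imp_embedding_map[OF cont(1) _ HG]) (use inj in \<open>auto simp: compact_space_subtopology\<close>)
  then have "homeomorphic_map (top_of_set {0..1}) (subtopology (gtop G) (\<gamma> ` {0..1})) \<gamma>"
    by (simp add: embedding_map_def)
  then obtain \<delta> where \<delta>: "homeomorphic_maps (top_of_set {0..1}) (subtopology (gtop G) (\<gamma> ` {0..1})) \<gamma> \<delta>"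
    using homeomorphic_map_maps by blast
  have \<delta>1: "\<delta> (\<gamma> t) = t" if "t \<in> {0..1}" for t using \<delta> that by (auto simp: homeomorphic_maps_def)
  have \<delta>2: "\<gamma> (\<delta> x) = x \<and> \<delta> x \<in> {0..1}" if "x \<in> \<gamma> ` {0..1}" for x using that \<delta>1 by auto
  have "continuous_map (top_of_set {0..1}) (top_of_set {0..1}) (\<delta> \<circ> \<gamma>')"
  proof (rule continuous_map_compose)
    show "continuous_map (top_of_set {0..1}) (subtopology (gtop G) (\<gamma> ` {0..1})) \<gamma>'"
      using cont(2) im by (auto simp: continuous_map_in_subtopology)
    show "continuous_map (subtopology (gtop G) (\<gamma> ` {0..1})) (top_of_set {0..1}) \<delta>"
      using \<delta> by (simp add: homeomorphic_maps_def)
  qed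
  then have \<sigma>: "continuous_on {0..1} (\<lambda>t. \<delta> (\<gamma>' t))" by (simp add: o_def)
  let ?S = "(\<lambda>t. \<delta> (\<gamma>' t)) ` {0..s}"
  have sub: "{0..s} \<subseteq> {0..1}" using s by auto
  have "compact ?S" "connected ?S"
    using continuous_on_subset[OF \<sigma> sub] by (auto intro: compact_continuous_image connected_continuous_image)
  then obtain a b where ab: "?S = {a..b}" using connected_compact_interval_1 by blast
  have S01: "?S \<subseteq> {0..1}" using im \<delta>2 sub by blast
  have 0: "0 \<in> ?S" using \<delta>1[of 0] eq s by (intro image_eqI[of _ _ 0]) auto
  then have "a = 0" using ab S01 by (metis atLeastAtMost_iff atLeastatMost_subset_iff order_antisym order_trans)
  have fact_s: "\<delta> (\<gamma>' s) \<in> ?S" using s by auto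
  have "\<delta> (\<gamma>' s) \<noteq> 0"
  proof
    assume "\<delta> (\<gamma>' s) = 0"
    moreover have "\<gamma>' s \<in> \<gamma>' ` {0..1}" using s by (intro imageI) simp
    ultimately have "\<gamma>' s = \<gamma> 0" using \<delta>2[of "\<gamma>' s"] im by auto
    then show False using inj_onD[OF inj(2), of s 0] eq s by simp
  qed
  then have "0 < b" using fact_s ab \<open>a = 0\<close> by auto
  have "b \<noteq> 1"
  proof
    assume "b = 1"
    then have "1 \<in> ?S" using ab \<open>0 < b\<close> \<open>a = 0\<close> by auto
    then obtain t where t: "t \<in> {0..s}" "\<delta> (\<gamma>' t) = 1" by auto
    moreover have "\<gamma>' t \<in> \<gamma>' ` {0..1}" using t(1) sub by (intro imageI) blast
    ultimately have "\<gamma>' t = \<gamma>' 1" using \<delta>2[of "\<gamma>' t"] im ends by auto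
    then show False using inj_onD[OF inj(2), of t 1] t s by simp
  qed
  moreover have "b \<le> 1" using S01 ab \<open>0 < b\<close> \<open>a = 0\<close> by auto
  ultimately have "b < 1" by simp
  have "\<gamma> ` ?S = (\<lambda>t. \<gamma>' t) ` {0..s}"
    unfolding image_image
  proof (rule image_cong[OF refl])
    fix t assume "t \<in> {0..s}"
    then have "\<gamma>' t \<in> \<gamma>' ` {0..1}" using sub by (intro imageI) blast
    then show "\<gamma> (\<delta> (\<gamma>' t)) = \<gamma>' t" using \<delta>2 im by simp
  qed
  then show ?thesis using that[OF \<open>0 < b\<close> \<open>b < 1\<close>] ab \<open>a = 0\<close> by simp
qed

section \<open>Auxiliary smooth functions\<close>

text \<open>Near each point of an open set, a local extension is the function itself, so that all
  its iterated partial derivatives are those of the function.\<close>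

lemma smooth_on_open_iff:
  assumes A: "openin (Euclidean_space n) A" and F: "smooth_on n A F"
  shows "smooth_on_open n A F"
  unfolding smooth_on_open_def
proof (intro conjI A allI impI ballI)
  have loc: "\<exists>W F'. x \<in> W \<and> W \<subseteq> A \<and> smooth_on_open n W F' \<and> (\<forall>y\<in>W. F' y = F y)" if xA: "x \<in> A" for x
  proof -
    obtain W F' where W: "x \<in> W" "smooth_on_open n W F'" "\<forall>y\<in>W \<inter> A. F' y = F y"
      using F xA unfolding smooth_on_def by blast
    have "openin (Euclidean_space n) (W \<inter> A)" using A smooth_on_open_imp_openin[OF W(2)] by blast
    then have "smooth_on_open n (W \<inter> A) F'" by (rule smooth_on_open_subset[OF W(2)]) blast
    then show ?thesis using W xA by (intro exI[of _ "W \<inter> A"] exI[of _ F']) auto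
  qed
  fix "is" assume iss: "set is \<subseteq> {..<n}"
  show "continuous_map (subtopology (Euclidean_space n) A) euclideanreal (partials is F)"
  proof (rule continuous_map_local)
    fix x assume "x \<in> topspace (subtopology (Euclidean_space n) A)"
    then have "x \<in> A" by simp
    then obtain W F' where W: "x \<in> W" "W \<subseteq> A" "smooth_on_open n W F'" "\<forall>y\<in>W. F' y = F y" using loc by blast
    note Wo = smooth_on_open_imp_openin[OF W(3)]
    have "continuous_map (subtopology (Euclidean_space n) W) euclideanreal (partials is F')"
      using W(3) iss by (simp add: smooth_on_open_def)
    then have "continuous_map (subtopology (Euclidean_space n) W) euclideanreal (partials is F)"
    proof (rule continuous_map_eq)
      fix y assume "y \<in> topspace (subtopology (Euclidean_space n) W)"
      then have "y \<in> W" by simp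
      then show "partials is F' y = partials is F y"
        by (rule partials_cong[OF Wo _ iss, rotated]) (use W(4) in blast)
    qed
    then show "\<exists>W. openin (subtopology (Euclidean_space n) A) W \<and> x \<in> W \<and>
        continuous_map (subtopology (subtopology (Euclidean_space n) A) W) euclideanreal (partials is F)"
      using W(1,2) Wo
      by (intro exI[of _ W]) (auto simp: subtopology_subtopology Int_absorb1 openin_open_subtopology[OF A])
  qed
  fix i x assume i: "i < n" and x: "x \<in> A"
  obtain W F' where W: "x \<in> W" "W \<subseteq> A" "smooth_on_open n W F'" "\<forall>y\<in>W. F' y = F y" using loc[OF x] by blast
  note Wo = smooth_on_open_imp_openin[OF W(3)]
  have "(\<lambda>t. partials is F' (x(i := t))) differentiable at (x i)"
    using W(1,3) iss i by (simp add: smooth_on_open_def)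
  then obtain d where d: "((\<lambda>t. partials is F' (x(i := t))) has_real_derivative d) (at (x i))"
    using real_differentiable_def by blast
  have eq: "partials is F y = partials is F' y" if "y \<in> W" for y
    by (rule partials_cong[OF Wo _ iss that]) (use W(4) in simp)
  have ev: "\<forall>\<^sub>F t in nhds (x i). partials is F (x(i := t)) = partials is F' (x(i := t))"
    by (rule eventually_mono[OF eventually_upd_in[OF Wo W(1) i] eq])
  have "((\<lambda>t. partials is F (x(i := t))) has_real_derivative d) (at (x i))"
    unfolding DERIV_cong_ev[OF refl ev refl] by (rule d)
  then show "(\<lambda>t. partials is F (x(i := t))) differentiable at (x i)"
    using real_differentiable_def by blast
qed

text \<open>Turns smoothness along the lines of a cylinder into differentiability in the ordinary
  sense, by varying the last coordinate of a chart. It serves to differentiate the coordinates of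
  curves in tubes.\<close>

lemma msmooth_curve:
  assumes N: "premanifold k N" and x: "x \<in> points N" and D: "open D" "u \<in> D"
    and F: "msmooth (Suc k) (cylinder k N) ({x} \<times> D) F"
  shows "\<exists>d. ((\<lambda>s. F (x, s)) has_real_derivative d) (at u)"
proof -
  obtain V \<theta> where V: "(V, \<theta>) \<in> atlas N" "x \<in> V" by (rule premanifold_cover[OF N x])
  let ?c = "\<lambda>z. (\<theta> (fst z))(k := snd z)"
  note c = cylinder_chart[OF V(1), of k]
  have inv: "inv_into (V \<times> UNIV) ?c ((\<theta> x)(k := s)) = (x, s)" for s
    using inv_into_f_f[OF chart_inj[OF premanifold_cylinder[OF N] c], of "(x, s)"] V(2) by simp
  let ?y = "(\<theta> x)(k := u)"
  have "smooth_on (Suc k) (?c ` (V \<times> UNIV \<inter> {x} \<times> D)) (F \<circ> inv_into (V \<times> UNIV) ?c)"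
    using F c by (auto simp: msmooth_def)
  moreover have "?y \<in> ?c ` (V \<times> UNIV \<inter> {x} \<times> D)"
    using V(2) D(2) by (intro image_eqI[of _ _ "(x, u)"]) auto
  ultimately obtain W F' where W: "?y \<in> W" "smooth_on_open (Suc k) W F'"
    "\<forall>y\<in>W \<inter> ?c ` (V \<times> UNIV \<inter> {x} \<times> D). F' y = (F \<circ> inv_into (V \<times> UNIV) ?c) y"
    unfolding smooth_on_def by blast
  have "((\<lambda>s. F' (?y(k := s))) has_real_derivative partial k F' ?y) (at (?y k))"
    by (rule smooth_on_open_imp_DERIV[OF W(2) _ W(1)]) simp
  then have der: "((\<lambda>s. F' ((\<theta> x)(k := s))) has_real_derivative partial k F' ?y) (at u)" by simp
  have "\<forall>\<^sub>F s in nhds u. (\<theta> x)(k := s) \<in> W"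
    using eventually_upd_in[OF smooth_on_open_imp_openin[OF W(2)] W(1), of k] by simp
  moreover have "\<forall>\<^sub>F s in nhds u. s \<in> D" using D by (rule eventually_nhds_in_open)
  ultimately have ev: "\<forall>\<^sub>F s in nhds u. F (x, s) = F' ((\<theta> x)(k := s))"
  proof eventually_elim
    case (elim s)
    have "(\<theta> x)(k := s) \<in> ?c ` (V \<times> UNIV \<inter> {x} \<times> D)"
      using V(2) elim(2) by (intro image_eqI[of _ _ "(x, s)"]) auto
    then show ?case using W(3) elim(1) inv[of s] by auto
  qed
  show ?thesis unfolding DERIV_cong_ev[OF refl ev refl] using der by blast
qed

lemma mono_step: "mono step"
proof (rule monoI)
  fix s t :: real assume "s \<le> t"
  consider "t \<le> 0" | "1 \<le> s" | "s \<le> 0" "0 < t" | "0 < s" "1 \<le> t" | "0 < s" "t < 1" using \<open>s \<le> t\<close> by linarith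
  then show "step s \<le> step t"
  proof cases
    case 5
    then show ?thesis using step_strict_mono[of s t] \<open>s \<le> t\<close> by (cases "s = t") auto
  qed (use \<open>s \<le> t\<close> step_0 step_1 step_nonneg step_le_1 in auto)
qed

lemma DERIV_step_nonneg: "\<exists>d\<ge>0. (step has_real_derivative d) (at t)"
proof -
  obtain d where d: "(step has_real_derivative d) (at t)"
    using smooth_real_step unfolding smooth_real_def by blast
  have "d \<ge> 0"
    by (rule mono_on_imp_deriv_nonneg[of UNIV step d t]) (use mono_step d in auto)
  with d show ?thesis by blast
qed

text \<open>The map \<open>\<sigma>\<close> sends \<open>u\<close> to \<open>u - s\<close> plus
  \<open>s\<close> times a step that rises between \<open>s\<close> and 1. Hence it is a translation
  below \<open>s\<close> and the identity from 1 on. The step is nondecreasing, so the derivative of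
  \<open>\<sigma>\<close> is at least 1; the inverse is smooth by
  \<open>smooth_inverse_coordinate\<close> in dimension 1.\<close>

lemma slide:
  assumes s: "0 < s" "s < (1::real)"
  obtains \<sigma> \<tau> where "smooth_real \<sigma> UNIV" "smooth_real \<tau> UNIV" "\<And>u. \<tau> (\<sigma> u) = u" "\<And>u. \<sigma> (\<tau> u) = u"
    "strict_mono \<sigma>" "\<sigma> s = 0" "\<And>u. 1 \<le> u \<Longrightarrow> \<sigma> u = u"
proof -
  define \<sigma> where "\<sigma> u = u + s * step ((u + - s) * inverse (1 - s)) + - s" for u
  have o: "openin (Euclidean_space 1) (ES 1)" by simp
  have 1: "smooth_on_open 1 (ES 1) (\<lambda>y. (y 0 + - s) * inverse (1 - s))"
    by (intro smooth_on_open_add smooth_on_open_mult smooth_on_open_const smooth_on_open_coord o)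
  have "smooth_on_open 1 (ES 1) (\<lambda>y. step ((y 0 + - s) * inverse (1 - s)))"
    by (rule smooth_real_compose[OF smooth_real_step 1]) simp
  then have \<sigma>1: "smooth_on_open 1 (ES 1) (\<lambda>y. \<sigma> (y 0))"
    unfolding \<sigma>_def by (intro smooth_on_open_add smooth_on_open_mult smooth_on_open_const smooth_on_open_coord o)
  then have sm: "smooth_real \<sigma> UNIV" by (rule smooth_on_open_real)
  have mono: "strict_mono \<sigma>"
  proof (rule strict_monoI)
    fix u v :: real assume "u < v"
    then have "(u + - s) * inverse (1 - s) \<le> (v + - s) * inverse (1 - s)"
      using s by (intro mult_right_mono) auto
    then have "s * step ((u + - s) * inverse (1 - s)) \<le> s * step ((v + - s) * inverse (1 - s))"
      using s monoD[OF mono_step] by (intro mult_left_mono) auto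
    then show "\<sigma> u < \<sigma> v" using \<open>u < v\<close> by (simp add: \<sigma>_def)
  qed
  have s0: "\<sigma> s = 0" by (simp add: \<sigma>_def step_0)
  have up: "\<sigma> u = u" if "1 \<le> u" for u
  proof -
    have "1 \<le> (u + - s) * inverse (1 - s)" using s that by (simp add: field_simps)
    then show ?thesis by (simp add: \<sigma>_def step_1)
  qed
  have low: "\<sigma> u = u - s" if "u \<le> s" for u
  proof -
    have "(u + - s) * inverse (1 - s) \<le> 0" using s that by (simp add: mult_nonpos_nonneg)
    then show ?thesis by (simp add: \<sigma>_def step_0)
  qed
  have cont: "continuous_on UNIV \<sigma>"
    using sm unfolding smooth_real_def by (metis DERIV_isCont UNIV_I continuous_at_imp_continuous_on)
  have "surj \<sigma>"
    unfolding surj_def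
  proof
    fix y :: real
    \<comment> \<open>On the left \<open>\<sigma>\<close> is the translation and on the right the
      identity, so its values at these two points enclose \<open>y\<close>.\<close>
    let ?a = "min y 0" and ?b = "max y 1"
    have "\<sigma> ?a \<le> y" using low[of ?a] s by auto
    moreover have "y \<le> \<sigma> ?b" using up[of ?b] by auto
    ultimately have "\<exists>u\<ge>?a. u \<le> ?b \<and> \<sigma> u = y"
      using continuous_on_subset[OF cont] by (intro IVT') auto
    then show "\<exists>u. y = \<sigma> u" by blast
  qed
  define \<tau> where "\<tau> = inv_into UNIV \<sigma>"
  have inj: "inj \<sigma>" using mono by (rule strict_mono_imp_inj_on)
  have \<tau>\<sigma>: "\<tau> (\<sigma> u) = u" for u using inj by (simp add: \<tau>_def)
  have \<sigma>\<tau>: "\<sigma> (\<tau> u) = u" for u using \<open>surj \<sigma>\<close> by (simp add: \<tau>_def surj_f_inv_f)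
  have nz: "partial 0 (\<lambda>y. \<sigma> (y 0)) x \<noteq> 0" if "x \<in> ES 1" for x
  proof -
    obtain d where d: "d \<ge> 0" "(step has_real_derivative d) (at ((x 0 + - s) * inverse (1 - s)))"
      using DERIV_step_nonneg by blast
    have "((\<lambda>u. (u + - s) * inverse (1 - s)) has_real_derivative inverse (1 - s)) (at (x 0))"
      by (auto intro!: derivative_eq_intros)
    from DERIV_chain2[OF d(2) this]
    have "(\<sigma> has_real_derivative 1 + s * (d * inverse (1 - s))) (at (x 0))"
      unfolding \<sigma>_def by (auto intro!: derivative_eq_intros)
    then have "partial 0 (\<lambda>y. \<sigma> (y 0)) x = 1 + s * (d * inverse (1 - s))"
      by (simp add: partial_def DERIV_imp_deriv)
    moreover have "0 \<le> s * (d * inverse (1 - s))" using s d(1) by simp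
    ultimately show ?thesis by linarith
  qed
  have "(\<lambda>x. x(0 := \<sigma> (x 0))) ` ES 1 = ES 1"
  proof (intro equalityI subsetI)
    fix y assume "y \<in> ES 1"
    then show "y \<in> (\<lambda>x. x(0 := \<sigma> (x 0))) ` ES 1"
      using \<sigma>\<tau> by (intro image_eqI[of _ _ "y(0 := \<tau> (y 0))"]) (auto simp: mem_ES)
  qed (auto simp: mem_ES)
  then have "smooth_on_open 1 (ES 1) (\<lambda>y. (y(0 := \<tau> (y 0))) 0)"
    using smooth_inverse_coordinate(2)[OF \<sigma>1 zero_less_one _ nz refl smooth_on_open_coord[OF o], of "\<lambda>y. y(0 := \<tau> (y 0))" 0]
    by (simp add: \<tau>\<sigma>)
  then have "smooth_real \<tau> UNIV" by (intro smooth_on_open_real) simp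
  then show ?thesis using that sm \<tau>\<sigma> \<sigma>\<tau> mono s0 up by blast
qed

section \<open>Reeb spaces from maps with connected fibres\<close>

text \<open>A connected part of a level has a connected image under \<open>p\<close>; this image is
  finite in a Hausdorff space, hence discrete and at most a point. Together with the connectedness
  of the fibres, this makes the fibres the components of the levels. As a continuous surjection from
  a compact to a Hausdorff space, \<open>p\<close> is a quotient map, and \<open>Y\<close> and the
  Reeb space are quotients of \<open>X\<close> by the same partition.\<close>

lemma reeb_space_eq_fibres:
  assumes X: "compact_space X" and Y: "Hausdorff_space Y" and p: "continuous_map X Y p" "p ` topspace X = topspace Y"
    and f: "\<And>x y. x \<in> topspace X \<Longrightarrow> y \<in> topspace X \<Longrightarrow> p x = p y \<Longrightarrow> f x = f y"
    and fin: "\<And>c. finite (p ` {x \<in> topspace X. f x = c})"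
    and conn: "\<And>y. y \<in> topspace Y \<Longrightarrow> connectedin X {x \<in> topspace X. p x = y}"
  shows "x \<in> topspace X \<Longrightarrow> reeb_map X f x = {y \<in> topspace X. p y = p x}"
    and "homeomorphic_map Y (reeb_space X f) (\<lambda>g. {x \<in> topspace X. p x = g})"
proof -
  let ?h = "\<lambda>g. {x \<in> topspace X. p x = g}"
  show reeb: "reeb_map X f x = ?h (p x)" if x: "x \<in> topspace X" for x
  proof (intro equalityI subsetI)
    fix y assume "y \<in> reeb_map X f x"
    then have y: "y \<in> topspace X" "connected_component_of (subtopology X {z \<in> topspace X. f z = f x}) x y"
      by (auto simp: reeb_map_def reeb_related_def)
    then obtain S where S: "connectedin (subtopology X {z \<in> topspace X. f z = f x}) S" "x \<in> S" "y \<in> S"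
      by (auto simp: connected_component_of_def)
    then have "connectedin X S" "S \<subseteq> {z \<in> topspace X. f z = f x}" by (auto simp: connectedin_subtopology)
    then have pS: "connectedin Y (p ` S)" "finite (p ` S)"
      using connectedin_continuous_map_image[OF p(1)] fin[of "f x"] by (auto intro: finite_subset[OF image_mono])
    have "t1_space (subtopology Y (p ` S))" using Y by (simp add: Hausdorff_imp_t1_space Hausdorff_space_subtopology)
    moreover have top: "topspace (subtopology Y (p ` S)) = p ` S"
      using connectedin_subset_topspace[OF pS(1)] by auto
    ultimately have "subtopology Y (p ` S) = discrete_topology (p ` S)"
      using finite_t1_space_imp_discrete_topology pS(2) by blast
    moreover have "connected_space (subtopology Y (p ` S))" using pS(1) by (simp add: connectedin_def)
    ultimately have "\<exists>a. p ` S \<subseteq> {a}" by (simp add: connected_space_discrete_topology)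
    then have "p x = p y" using S(2,3) by auto
    then show "y \<in> ?h (p x)" using y(1) by simp
  next
    fix y assume y: "y \<in> ?h (p x)"
    have "p x \<in> topspace Y" using p(2) x by blast
    moreover have "?h (p x) \<subseteq> {z \<in> topspace X. f z = f x}" using x f by blast
    ultimately have "connectedin (subtopology X {z \<in> topspace X. f z = f x}) (?h (p x))"
      using conn by (simp add: connectedin_subtopology)
    then have "connected_component_of (subtopology X {z \<in> topspace X. f z = f x}) x y"
      unfolding connected_component_of_def using x y by (intro exI[of _ "?h (p x)"]) simp
    moreover have "f x = f y" by (rule f) (use x y in auto)
    ultimately show "y \<in> reeb_map X f x" using x y by (simp add: reeb_map_def reeb_related_def)
  qed
  have quot: "quotient_map X Y p"
    by (rule continuous_closed_imp_quotient_map[OF p(1) continuous_imp_closed_map_gen[OF X Hausdorff_imp_kc_space[OF Y] p(1)] p(2)])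
  have hp: "(?h \<circ> p) x = reeb_map X f x" if "x \<in> topspace X" for x using reeb[OF that] by simp
  have q: "quotient_map X (reeb_space X f) (?h \<circ> p)"
    using quotient_map_eq[OF quotient_map_quotient_topology[of X "reeb_map X f"], of "?h \<circ> p"] hp
    by (simp add: reeb_space_def)
  then have "continuous_map Y (reeb_space X f) ?h"
    using continuous_compose_quotient_map[OF quot quotient_imp_continuous_map[OF q]] by blast
  then have qh: "quotient_map Y (reeb_space X f) ?h"
    by (rule quotient_map_from_composition[OF p(1) _ q])
  have inj: "inj_on ?h (topspace Y)"
  proof (rule inj_onI)
    fix a b assume ab: "a \<in> topspace Y" "b \<in> topspace Y" "?h a = ?h b"
    then have "a \<in> p ` topspace X" using p(2) by simp
    then obtain x where "x \<in> topspace X" "p x = a" by blast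
    then have "x \<in> ?h a" by simp
    then have "x \<in> ?h b" using ab(3) by simp
    then show "a = b" using \<open>p x = a\<close> by simp
  qed
  show "homeomorphic_map Y (reeb_space X f) ?h"
    using qh inj by (simp add: homeomorphic_map_def)
qed

lemma (in gluing) continuous_map_glued:
  assumes "\<And>i. i \<in> I \<Longrightarrow> continuous_map (subtopology (mtop (M i)) (N i)) Y (\<lambda>q. f (\<psi> i q))"
  shows "continuous_map (mtop glued) Y f"
  unfolding continuous_map_def
proof (intro conjI allI impI)
  have sub: "N i \<subseteq> points (M i)" if "i \<in> I" for i using N_open[OF that] openin_subset by blast
  show "f \<in> points glued \<rightarrow> topspace Y"
    using assms sub by (fastforce simp: points_glued continuous_map_def Pi_iff)
  fix V assume V: "openin Y V"
  show "openin (mtop glued) {x \<in> points glued. f x \<in> V}"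
    unfolding openin_glued
  proof (intro conjI ballI)
    fix i assume i: "i \<in> I"
    have "openin (subtopology (mtop (M i)) (N i)) {q \<in> topspace (subtopology (mtop (M i)) (N i)). f (\<psi> i q) \<in> V}"
      by (rule openin_continuous_map_preimage[OF assms[OF i] V])
    moreover have "{q \<in> topspace (subtopology (mtop (M i)) (N i)). f (\<psi> i q) \<in> V} = {q \<in> N i. \<psi> i q \<in> {x \<in> points glued. f x \<in> V}}"
      using sub[OF i] i by (auto simp: points_glued)
    ultimately show "openin (mtop (M i)) {q \<in> N i. \<psi> i q \<in> {x \<in> points glued. f x \<in> V}}"
      using N_open[OF i] openin_trans_full by metis
  qed (auto simp: points_glued)
qed

text \<open>A point of a second countable Hausdorff space is encoded by the set of the basic open sets
  that contain it.\<close>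

lemma second_countable_encoding:
  assumes "Hausdorff_space X" "second_countable X"
  shows "\<exists>b :: 'a \<Rightarrow> nat \<Rightarrow> real. inj_on b (topspace X)"
proof -
  obtain \<B> where \<B>: "countable \<B>" "\<And>U x. openin X U \<Longrightarrow> x \<in> U \<Longrightarrow> \<exists>V\<in>\<B>. x \<in> V \<and> V \<subseteq> U"
    using assms(2) unfolding second_countable_def by metis
  define b where "b x i = (if x \<in> from_nat_into \<B> i then 1 else 0 :: real)" for x i
  have "inj_on b (topspace X)"
  proof (rule inj_onI, rule ccontr)
    fix x y assume xy: "x \<in> topspace X" "y \<in> topspace X" "b x = b y" "x \<noteq> y"
    obtain U V where U: "openin X U" "x \<in> U" "y \<notin> U"
      using assms(1) xy unfolding Hausdorff_space_def disjnt_iff by metis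
    then obtain W where W: "W \<in> \<B>" "x \<in> W" "W \<subseteq> U" using \<B>(2) by blast
    then obtain i where "from_nat_into \<B> i = W" using from_nat_into_surj[OF \<B>(1)] by blast
    then show False using fun_cong[OF xy(3), of i] W U(3) by (auto simp: b_def split: if_splits)
  qed
  then show ?thesis by blast
qed

section \<open>The realizing manifold\<close>

text \<open>A point of the model is a point of some \<open>\<Gamma> v\<close>, or it lies on the tube of an edge \<open>e\<close>, where it is
  given by a point of \<open>\<Phi> e\<close> and the parameter of its image on \<open>e\<close>.\<close>

definition model_points ::
    "'g graph \<Rightarrow> ('g set \<Rightarrow> 'a mfd) \<Rightarrow> ('g \<Rightarrow> 'b mfd) \<Rightarrow> ('g \<times> 'b + 'g set \<times> 'a \<times> real) set" where
  "model_points G \<Phi> \<Gamma> = Inl ` (SIGMA v:verts G. points (\<Gamma> v)) \<union> Inr ` (SIGMA e:edges G. points (\<Phi> e) \<times> UNIV)"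

text \<open>The locale fixes the choices of the construction. The injection \<open>enc\<close> moves
  the model, whose type mentions the types of the graph and of both kinds of manifolds, into the
  type in which the realizing manifold is to live.\<close>

locale realization =
  fixes m :: nat and G :: "'g graph" and \<Phi> :: "'g set \<Rightarrow> 'a mfd" and \<Gamma> :: "'g \<Rightarrow> 'b mfd"
    and \<gamma> :: "'g set \<Rightarrow> real \<Rightarrow> 'g"
    and C :: "'g \<Rightarrow> 'b set" and E :: "'g \<Rightarrow> 'b \<Rightarrow> 'g set" and X :: "'g \<Rightarrow> 'b \<Rightarrow> 'a" and \<rho> :: "'g \<Rightarrow> 'b \<Rightarrow> real"
    and T :: "'g \<Rightarrow> 'g set \<Rightarrow> 'a \<times> real \<Rightarrow> 'b"
    and a :: "'g \<Rightarrow> real" and enc :: "'g \<times> 'b + 'g set \<times> 'a \<times> real \<Rightarrow> 'c"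
  assumes m: "2 \<le> m" and dec: "decorated_graph m G \<Phi> \<Gamma>"
    and \<gamma>: "e \<in> edges G \<Longrightarrow> characteristic_map G e (\<gamma> e)"
    and col: "v \<in> verts G \<Longrightarrow> edge_collars m (\<Gamma> v) (incident_edges G v) \<Phi> (C v) (E v) (X v) (\<rho> v) (T v)"
    and a_inj: "inj_on a (verts G)"
    and enc_inj: "inj_on enc (model_points G \<Phi> \<Gamma>)"
begin

abbreviation inc :: "'g \<Rightarrow> 'g set set" where "inc v \<equiv> incident_edges G v"

lemma Sm: "Suc (m - 1) = m" using m by simp

lemma fin_G: "finite_graph G" using dec by (simp add: decorated_graph_def)

lemma ends_neq: "e \<in> edges G \<Longrightarrow> \<gamma> e 0 \<noteq> \<gamma> e 1"
  using dec \<gamma> by (simp add: decorated_graph_def loopless_def)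

lemma ends_verts: "e \<in> edges G \<Longrightarrow> \<gamma> e 0 \<in> verts G" "e \<in> edges G \<Longrightarrow> \<gamma> e 1 \<in> verts G"
  using characteristic_mapD(4,5)[OF fin_G _ \<gamma>] by auto

lemma inc_iff: "e \<in> inc v \<longleftrightarrow> e \<in> edges G \<and> (v = \<gamma> e 0 \<or> v = \<gamma> e 1)"
proof
  assume "e \<in> inc v"
  then obtain \<gamma>' where e: "e \<in> edges G" and \<gamma>': "characteristic_map G e \<gamma>'" "\<gamma>' 0 = v \<or> \<gamma>' 1 = v"
    by (auto simp: incident_edges_def)
  have "{\<gamma>' 0, \<gamma>' 1} = {\<gamma> e 0, \<gamma> e 1}"
    using characteristic_mapD(10)[OF fin_G e \<gamma>'(1)] characteristic_mapD(10)[OF fin_G e \<gamma>[OF e]] by simp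
  then show "e \<in> edges G \<and> (v = \<gamma> e 0 \<or> v = \<gamma> e 1)" using e \<gamma>'(2) by blast
next
  assume "e \<in> edges G \<and> (v = \<gamma> e 0 \<or> v = \<gamma> e 1)"
  then show "e \<in> inc v" using \<gamma>[of e] unfolding incident_edges_def by blast
qed

lemma inc_edges: "e \<in> inc v \<Longrightarrow> e \<in> edges G" by (simp add: inc_iff)

lemma finite_inc: "finite (inc v)"
proof (rule finite_subset)
  show "inc v \<subseteq> edges G" using inc_edges by blast
  show "finite (edges G)" using fin_G by (simp add: finite_graph_def)
qed

lemma \<Gamma>:
  assumes "v \<in> verts G"
  shows \<Gamma>_smooth: "smooth_manifold m (\<Gamma> v)" and \<Gamma>_compact: "compact_space (mtop (\<Gamma> v))"
    and \<Gamma>_Hausdorff: "Hausdorff_space (mtop (\<Gamma> v))" and \<Gamma>_second: "second_countable (mtop (\<Gamma> v))"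
    and \<Gamma>_connected: "connected_space (mtop (\<Gamma> v))" and \<Gamma>_ne: "points (\<Gamma> v) \<noteq> {}"
    and \<Gamma>_pre: "premanifold m (\<Gamma> v)"
proof -
  have "compact_manifold m (\<Gamma> v) \<and> connected_manifold (\<Gamma> v)"
    using assms dec by (simp add: decorated_graph_def)
  then show *: "smooth_manifold m (\<Gamma> v)" "compact_space (mtop (\<Gamma> v))" "Hausdorff_space (mtop (\<Gamma> v))"
    "second_countable (mtop (\<Gamma> v))" "connected_space (mtop (\<Gamma> v))" "points (\<Gamma> v) \<noteq> {}"
    by (simp_all add: compact_manifold_def connected_manifold_def smooth_manifold_def)
  show "premanifold m (\<Gamma> v)" by (rule smooth_manifold_imp_premanifold[OF *(1)])
qed

lemma \<Phi>:
  assumes "e \<in> edges G"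
  shows \<Phi>_compact: "compact_space (mtop (\<Phi> e))" and \<Phi>_connected: "connected_space (mtop (\<Phi> e))"
    and \<Phi>_ne: "points (\<Phi> e) \<noteq> {}" and \<Phi>_pre: "premanifold (m - 1) (\<Phi> e)"
    and \<Phi>_smooth: "smooth_manifold (m - 1) (\<Phi> e)" and \<Phi>_boundary: "boundary_points (m - 1) (\<Phi> e) = {}"
proof -
  have "closed_manifold (m - 1) (\<Phi> e) \<and> connected_manifold (\<Phi> e)"
    using assms dec by (simp add: decorated_graph_def)
  then show *: "smooth_manifold (m - 1) (\<Phi> e)" "compact_space (mtop (\<Phi> e))" "connected_space (mtop (\<Phi> e))" "points (\<Phi> e) \<noteq> {}"
    "boundary_points (m - 1) (\<Phi> e) = {}"
    by (simp_all add: closed_manifold_def compact_manifold_def connected_manifold_def)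
  show "premanifold (m - 1) (\<Phi> e)" by (rule smooth_manifold_imp_premanifold[OF *(1)])
qed

lemma C_open: "v \<in> verts G \<Longrightarrow> openin (mtop (\<Gamma> v)) (C v)"
  and \<rho>_smooth: "v \<in> verts G \<Longrightarrow> msmooth m (\<Gamma> v) (C v) (\<rho> v)"
  and boundary_eq: "v \<in> verts G \<Longrightarrow> boundary_points m (\<Gamma> v) = {q \<in> C v. \<rho> v q = 0}"
  using col[of v] by (simp_all add: edge_collars_def)

lemma E_open: "v \<in> verts G \<Longrightarrow> e \<in> inc v \<Longrightarrow> openin (mtop (\<Gamma> v)) {q \<in> C v. E v q = e}"
  and X_smooth: "v \<in> verts G \<Longrightarrow> e \<in> inc v \<Longrightarrow> smap m (m - 1) (\<Gamma> v) {q \<in> C v. E v q = e} (\<Phi> e) (X v)"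
  and T_smooth: "v \<in> verts G \<Longrightarrow> e \<in> inc v \<Longrightarrow>
      smap m m (cylinder (m - 1) (\<Phi> e)) (points (\<Phi> e) \<times> {0..<2}) (\<Gamma> v) (T v e)"
  and T_facts: "v \<in> verts G \<Longrightarrow> e \<in> inc v \<Longrightarrow> x \<in> points (\<Phi> e) \<Longrightarrow> 0 \<le> u \<Longrightarrow> u < 2 \<Longrightarrow>
      T v e (x, u) \<in> C v \<and> E v (T v e (x, u)) = e \<and> X v (T v e (x, u)) = x \<and> \<rho> v (T v e (x, u)) = u"
  using col[of v] by (simp_all add: edge_collars_def)

lemma C_facts:
  assumes "v \<in> verts G" "q \<in> C v"
  shows "E v q \<in> inc v" "E v q \<in> edges G" "X v q \<in> points (\<Phi> (E v q))" "0 \<le> \<rho> v q" "\<rho> v q < 2"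
    "T v (E v q) (X v q, \<rho> v q) = q" "q \<in> points (\<Gamma> v)"
proof -
  have "\<forall>q\<in>C v. E v q \<in> inc v \<and> X v q \<in> points (\<Phi> (E v q)) \<and> 0 \<le> \<rho> v q \<and> \<rho> v q < 2 \<and> T v (E v q) (X v q, \<rho> v q) = q"
    using col[OF assms(1)] unfolding edge_collars_def by (elim conjE)
  then show *: "E v q \<in> inc v" "X v q \<in> points (\<Phi> (E v q))" "0 \<le> \<rho> v q" "\<rho> v q < 2"
    "T v (E v q) (X v q, \<rho> v q) = q" using assms(2) by simp_all
  show "E v q \<in> edges G" using inc_edges[OF *(1)] .
  show "q \<in> points (\<Gamma> v)" using openin_subset[OF C_open[OF assms(1)]] assms(2) by blast
qed

lemma \<rho>_preimage_open:
  assumes v: "v \<in> verts G" and U: "open U"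
  shows "openin (mtop (\<Gamma> v)) {q \<in> C v. \<rho> v q \<in> U}"
proof -
  have "openin (subtopology (mtop (\<Gamma> v)) (C v)) {q \<in> topspace (subtopology (mtop (\<Gamma> v)) (C v)). \<rho> v q \<in> U}"
    by (rule openin_continuous_map_preimage[OF msmooth_continuous[OF \<Gamma>_pre[OF v] \<rho>_smooth[OF v]]]) (use U in simp)
  moreover have "{q \<in> topspace (subtopology (mtop (\<Gamma> v)) (C v)). \<rho> v q \<in> U} = {q \<in> C v. \<rho> v q \<in> U}"
    using openin_subset[OF C_open[OF v]] by auto
  ultimately show ?thesis using C_open[OF v] openin_trans_full by metis
qed

lemma T_continuous:
  assumes "v \<in> verts G" "e \<in> inc v"
  shows "continuous_map (subtopology (prod_topology (mtop (\<Phi> e)) euclideanreal) (points (\<Phi> e) \<times> {0..<2})) (mtop (\<Gamma> v)) (T v e)"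
  using smap_continuous[OF T_smooth[OF assms]] by simp

text \<open>The set is a finite union of images of the compact products of
  \<open>points (\<Phi> e)\<close> with \<open>{0..s}\<close>, which lie in the domain of
  \<open>T v e\<close> as \<open>s < 2\<close>. The case \<open>s = 1\<close> makes the part beyond
  depth 1 open.\<close>

lemma collar_closed:
  assumes v: "v \<in> verts G" and s: "0 \<le> s" "s < 2"
  shows "closedin (mtop (\<Gamma> v)) {q \<in> C v. \<rho> v q \<le> s}"
proof -
  have "{q \<in> C v. \<rho> v q \<le> s} = (\<Union>e\<in>inc v. T v e ` (points (\<Phi> e) \<times> {0..s}))"
  proof (intro equalityI subsetI)
    fix q assume q: "q \<in> {q \<in> C v. \<rho> v q \<le> s}"
    then have c: "q \<in> C v" by simp
    note f = C_facts[OF v c]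
    have "q \<in> T v (E v q) ` (points (\<Phi> (E v q)) \<times> {0..s})"
      by (rule image_eqI[of _ "T v (E v q)" "(X v q, \<rho> v q)"]) (use f q in auto)
    then show "q \<in> (\<Union>e\<in>inc v. T v e ` (points (\<Phi> e) \<times> {0..s}))" using f(1) by blast
  next
    fix q assume "q \<in> (\<Union>e\<in>inc v. T v e ` (points (\<Phi> e) \<times> {0..s}))"
    then obtain e x u where "e \<in> inc v" "x \<in> points (\<Phi> e)" "0 \<le> u" "u \<le> s" "q = T v e (x, u)" by auto
    then show "q \<in> {q \<in> C v. \<rho> v q \<le> s}" using T_facts[OF v, of e x u] s by simp
  qed
  moreover have "closedin (mtop (\<Gamma> v)) (T v e ` (points (\<Phi> e) \<times> {0..s}))" if e: "e \<in> inc v" for e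
  proof (rule compactin_imp_closedin[OF \<Gamma>_Hausdorff[OF v]], rule image_compactin[OF _ T_continuous[OF v e]])
    have "compactin (mtop (\<Phi> e)) (points (\<Phi> e))" using \<Phi>_compact[OF inc_edges[OF e]] by (simp add: compact_space_def)
    then have "compactin (prod_topology (mtop (\<Phi> e)) euclideanreal) (points (\<Phi> e) \<times> {0..s})"
      by (simp add: compactin_Times)
    then show "compactin (subtopology (prod_topology (mtop (\<Phi> e)) euclideanreal) (points (\<Phi> e) \<times> {0..<2})) (points (\<Phi> e) \<times> {0..s})"
      using s by (auto simp: compactin_subtopology)
  qed
  ultimately show ?thesis using finite_inc by (auto intro!: closedin_Union)
qed

text \<open>A collar coordinate \<open>u\<close> at the vertex \<open>v\<close> corresponds to the parameter \<open>par v e u\<close> of the edge \<open>e\<close>;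
  the core of \<open>\<Gamma> v\<close> begins at \<open>u = 1\<close>.\<close>

definition par :: "'g \<Rightarrow> 'g set \<Rightarrow> real \<Rightarrow> real" where
  "par v e u = (if v = \<gamma> e 0 then 1 - u else u)"

lemma par_par [simp]: "par v e (par v e u) = u" by (simp add: par_def)

lemma par_01: "0 < par v e u \<and> par v e u < 1 \<longleftrightarrow> 0 < u \<and> u < 1" by (auto simp: par_def)

lemma par_eq [simp]: "par v e u = par v e u' \<longleftrightarrow> u = u'" by (simp add: par_def)

lemma \<gamma>_par_1: "e \<in> inc v \<Longrightarrow> \<gamma> e (par v e 1) = v"
  by (auto simp: par_def inc_iff)

text \<open>The two ends of an edge see complementary depths, so one parameter of the edge has depth
  \<open>u\<close> from one end and \<open>1 - u\<close> from the other. That the incident vertices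
  are exactly two different ones is where the absence of loops enters.\<close>

lemma par_other: "e \<in> inc v \<Longrightarrow> e \<in> inc w \<Longrightarrow> v \<noteq> w \<Longrightarrow> par w e (1 - u) = par v e u"
  using ends_neq[of e] by (auto simp: par_def inc_iff)

section \<open>The gluing data\<close>

definition N :: "'g \<Rightarrow> 'b set" where "N v = points (\<Gamma> v) - boundary_points m (\<Gamma> v)"

definition core :: "'g \<Rightarrow> 'b set" where "core v = {q \<in> points (\<Gamma> v). q \<in> C v \<longrightarrow> 1 \<le> \<rho> v q}"

text \<open>Below depth 1 a point is recorded by its edge coordinates, without its vertex. Points of
  the two collars of an edge thus receive the same value exactly when they are to be identified, and
  all other points remain apart.\<close>

definition Pt :: "'g \<Rightarrow> 'b \<Rightarrow> 'g \<times> 'b + 'g set \<times> 'a \<times> real" where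
  "Pt v q = (if q \<in> C v \<and> \<rho> v q < 1 then Inr (E v q, X v q, par v (E v q) (\<rho> v q)) else Inl (v, q))"

definition \<psi> :: "'g \<Rightarrow> 'b \<Rightarrow> 'c" where "\<psi> v q = enc (Pt v q)"

lemma N_iff: "v \<in> verts G \<Longrightarrow> q \<in> N v \<longleftrightarrow> q \<in> points (\<Gamma> v) \<and> (q \<in> C v \<longrightarrow> 0 < \<rho> v q)"
  using boundary_eq[of v] C_facts(4)[of v q] by (auto simp: N_def less_le)

lemma core_subset: "v \<in> verts G \<Longrightarrow> core v \<subseteq> N v"
  using N_iff by (auto simp: core_def)

lemma Pt_core: "q \<in> core v \<Longrightarrow> Pt v q = Inl (v, q)" by (auto simp: Pt_def core_def)

lemma not_core: "q \<in> points (\<Gamma> v) \<Longrightarrow> q \<notin> core v \<longleftrightarrow> q \<in> C v \<and> \<rho> v q < 1"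
  by (auto simp: core_def)

lemma Pt_model:
  assumes "v \<in> verts G" "q \<in> N v" shows "Pt v q \<in> model_points G \<Phi> \<Gamma>"
  using assms C_facts[OF assms(1), of q] by (auto simp: Pt_def model_points_def N_def)

lemma tube_point:
  assumes v: "v \<in> verts G" "e \<in> inc v" and x: "x \<in> points (\<Phi> e)" and u: "0 < u" "u < 1"
  shows "T v e (x, u) \<in> N v" "T v e (x, u) \<in> C v" "Pt v (T v e (x, u)) = Inr (e, x, par v e u)"
proof -
  have *: "T v e (x, u) \<in> C v \<and> E v (T v e (x, u)) = e \<and> X v (T v e (x, u)) = x \<and> \<rho> v (T v e (x, u)) = u"
    by (rule T_facts[OF v x]) (use u in auto)
  then show "T v e (x, u) \<in> N v" "T v e (x, u) \<in> C v" "Pt v (T v e (x, u)) = Inr (e, x, par v e u)"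
    using N_iff[OF v(1)] C_facts(7)[OF v(1)] u by (auto simp: Pt_def)
qed

lemma Pt_inj:
  assumes v: "v \<in> verts G" and q: "q \<in> N v" "q' \<in> N v" and eq: "Pt v q = Pt v q'"
  shows "q = q'"
proof (cases "q \<in> C v \<and> \<rho> v q < 1")
  case True
  then have q': "q' \<in> C v \<and> \<rho> v q' < 1" using eq by (auto simp: Pt_def split: if_splits)
  then have "E v q = E v q'" "X v q = X v q'" "\<rho> v q = \<rho> v q'" using True eq by (auto simp: Pt_def)
  then show ?thesis using C_facts(6)[OF v, of q] C_facts(6)[OF v, of q'] True q' by metis
next
  case False
  then show ?thesis using eq by (auto simp: Pt_def split: if_splits)
qed

lemma enc_eq:
  assumes "v \<in> verts G" "q \<in> N v" "w \<in> verts G" "q' \<in> N w" "\<psi> v q = \<psi> w q'"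
  shows "Pt v q = Pt w q'"
  using inj_onD[OF enc_inj] Pt_model assms by (auto simp: \<psi>_def)

lemma \<psi>_inj': "v \<in> verts G \<Longrightarrow> inj_on (\<psi> v) (N v)"
  by (rule inj_onI) (use enc_eq Pt_inj in blast)

text \<open>Values under \<open>Inl\<close> carry their vertex, so points over different vertices
  can only be identified in a tube. There the transition keeps the point of \<open>\<Phi> e\<close>
  and reverses the depth.\<close>

lemma overlap:
  assumes vw: "v \<in> verts G" "w \<in> verts G" "v \<noteq> w" and q: "q \<in> N v"
  shows "\<psi> v q \<in> \<psi> w ` N w \<longleftrightarrow> q \<in> C v \<and> \<rho> v q < 1 \<and> E v q \<in> inc w"
    and "\<psi> v q \<in> \<psi> w ` N w \<Longrightarrow> inv_into (N w) (\<psi> w) (\<psi> v q) = T w (E v q) (X v q, 1 - \<rho> v q)"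
proof -
  have bwd: "T w (E v q) (X v q, 1 - \<rho> v q) \<in> N w" "\<psi> w (T w (E v q) (X v q, 1 - \<rho> v q)) = \<psi> v q"
    if qC: "q \<in> C v" "\<rho> v q < 1" "E v q \<in> inc w"
  proof -
    note f = C_facts[OF vw(1) qC(1)]
    have pos: "0 < \<rho> v q" using N_iff[OF vw(1)] q qC by blast
    note t = tube_point[OF vw(2) qC(3) f(3), of "1 - \<rho> v q"]
    show "T w (E v q) (X v q, 1 - \<rho> v q) \<in> N w" using t(1) pos qC by simp
    have "Pt w (T w (E v q) (X v q, 1 - \<rho> v q)) = Pt v q"
      using t(3) pos qC par_other[OF f(1) qC(3) vw(3)] by (simp add: Pt_def)
    then show "\<psi> w (T w (E v q) (X v q, 1 - \<rho> v q)) = \<psi> v q" by (simp add: \<psi>_def)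
  qed
  have fwd: "q \<in> C v \<and> \<rho> v q < 1 \<and> E v q \<in> inc w" if "\<psi> v q \<in> \<psi> w ` N w"
  proof -
    obtain q' where q': "q' \<in> N w" "\<psi> v q = \<psi> w q'" using \<open>\<psi> v q \<in> \<psi> w ` N w\<close> by blast
    have eq: "Pt v q = Pt w q'" by (rule enc_eq[OF vw(1) q vw(2) q'])
    then have *: "q \<in> C v \<and> \<rho> v q < 1" "q' \<in> C w \<and> \<rho> w q' < 1"
      using vw(3) by (auto simp: Pt_def split: if_splits)
    then have "E v q = E w q'" using eq by (simp add: Pt_def)
    then show ?thesis using * C_facts(1)[OF vw(2), of q'] by simp
  qed
  show "\<psi> v q \<in> \<psi> w ` N w \<longleftrightarrow> q \<in> C v \<and> \<rho> v q < 1 \<and> E v q \<in> inc w"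
  proof
    assume "q \<in> C v \<and> \<rho> v q < 1 \<and> E v q \<in> inc w"
    then show "\<psi> v q \<in> \<psi> w ` N w" using bwd by (metis imageI)
  qed (rule fwd)
  assume "\<psi> v q \<in> \<psi> w ` N w"
  then have "q \<in> C v" "\<rho> v q < 1" "E v q \<in> inc w" using fwd by auto
  from bwd[OF this] show "inv_into (N w) (\<psi> w) (\<psi> v q) = T w (E v q) (X v q, 1 - \<rho> v q)"
    using inv_into_f_f[OF \<psi>_inj'[OF vw(2)]] by metis
qed

lemma N_open': "v \<in> verts G \<Longrightarrow> openin (mtop (\<Gamma> v)) (N v)"
  unfolding N_def by (intro openin_diff openin_topspace closedin_boundary_points \<Gamma>_smooth)

sublocale gluing m "verts G" \<Gamma> N \<psi>
proof
  fix v assume v: "v \<in> verts G"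
  show "premanifold m (\<Gamma> v)" "openin (mtop (\<Gamma> v)) (N v)" "inj_on (\<psi> v) (N v)"
    by (rule \<Gamma>_pre[OF v], rule N_open'[OF v], rule \<psi>_inj'[OF v])
  fix U \<phi> assume U: "(U, \<phi>) \<in> atlas (\<Gamma> v)"
  note SM = \<Gamma>_smooth[OF v]
  note cU = premanifold_chart[OF \<Gamma>_pre[OF v] U]
  show "openin (Euclidean_space m) (\<phi> ` (U \<inter> N v))"
  proof (cases "openin (half_space m) (\<phi> ` U)")
    case True
    obtain S where S: "open S" "\<phi> ` U = {x \<in> ES m. 0 \<le> x (m - 1)} \<inter> S" using True openin_half_space by blast
    have bd: "q \<in> boundary_points m (\<Gamma> v) \<longleftrightarrow> \<phi> q (m - 1) = 0" if "q \<in> U" for q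
      using half_chart_image_boundary[OF SM _ _ that, of \<phi>] m U True by (simp add: half_chart_def)
    \<comment> \<open>Removing the boundary cuts the hyperplane off the chart image and leaves a set
      that is open in the full space.\<close>
    have "\<phi> ` (U \<inter> N v) = ES m \<inter> (S \<inter> {x. 0 < x (m - 1)})"
    proof (intro equalityI subsetI)
      fix y assume "y \<in> \<phi> ` (U \<inter> N v)"
      then obtain q where q: "q \<in> U" "q \<in> N v" "y = \<phi> q" by blast
      have "y \<in> {x \<in> ES m. 0 \<le> x (m - 1)} \<inter> S" using S(2) q by blast
      moreover have "y (m - 1) \<noteq> 0" using bd[OF q(1)] q by (simp add: N_def)
      ultimately show "y \<in> ES m \<inter> (S \<inter> {x. 0 < x (m - 1)})" by auto
    next
      fix y assume y: "y \<in> ES m \<inter> (S \<inter> {x. 0 < x (m - 1)})"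
      then have "y \<in> \<phi> ` U" unfolding S(2) by auto
      then obtain q where q: "q \<in> U" "y = \<phi> q" by blast
      then have "q \<notin> boundary_points m (\<Gamma> v)" using bd[OF q(1)] y by auto
      then show "y \<in> \<phi> ` (U \<inter> N v)" using q cU(4) by (auto simp: N_def)
    qed
    moreover have "open (S \<inter> {x. 0 < x (m - 1)})"
      using S(1) by (intro open_Int open_Collect_less continuous_on_coord continuous_intros)
    ultimately show ?thesis unfolding openin_Euclidean_space by blast
  next
    case False
    then have "U \<inter> N v = U" using boundary_point_chart(1)[OF SM _ U] cU(4) by (auto simp: N_def)
    then show ?thesis using smooth_manifold_chart_image[OF SM U] False by simp
  qed
next
  fix v w assume v: "v \<in> verts G" and w: "w \<in> verts G"
  let ?D = "{q \<in> N v. \<psi> v q \<in> \<psi> w ` N w}"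
  show D: "openin (mtop (\<Gamma> v)) ?D"
  proof (cases "v = w")
    case True
    then have "?D = N v" by auto
    then show ?thesis using N_open'[OF v] by simp
  next
    case False
    have "?D = N v \<inter> (\<Union>e\<in>inc v \<inter> inc w. {q \<in> C v. E v q = e}) \<inter> {q \<in> C v. \<rho> v q \<in> {..<1}}"
      using overlap(1)[OF v w False] C_facts(1)[OF v] by auto
    moreover have "openin (mtop (\<Gamma> v)) \<dots>"
      by (intro openin_Int N_open'[OF v] openin_Union \<rho>_preimage_open[OF v]) (use E_open[OF v] in auto)
    ultimately show ?thesis by simp
  qed
  show "smap m m (\<Gamma> v) ?D (\<Gamma> w) (\<lambda>q. inv_into (N w) (\<psi> w) (\<psi> v q))"
  proof (cases "v = w")
    case True
    have "smap m m (\<Gamma> v) ?D (\<Gamma> v) (\<lambda>q. inv_into (N v) (\<psi> v) (\<psi> v q))"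
      by (rule smap_cong[OF \<Gamma>_pre[OF v] smap_id[OF \<Gamma>_pre[OF v]]])
         (use True \<psi>_inj'[OF v] openin_subset[OF N_open'[OF v]] in auto)
    then show ?thesis using True by simp
  next
    case False
    show ?thesis
    proof (rule smap_local[OF \<Gamma>_pre[OF v]])
      fix p assume p: "p \<in> ?D"
      \<comment> \<open>The edge of a collar point is locally constant, so that near
        \<open>p\<close> the transition is a single composite through the cylinder over
        \<open>\<Phi> e\<close>.\<close>
      define e where "e = E v p"
      have e: "p \<in> C v" "e \<in> inc v" "e \<in> inc w"
        using overlap(1)[OF v w False, of p] p C_facts(1)[OF v] by (auto simp: e_def)
      let ?W = "{q \<in> C v. E v q = e}"
      note Pc = premanifold_cylinder[OF \<Phi>_pre[OF inc_edges[OF e(2)]], unfolded Sm]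
      have sub: "?D \<inter> ?W \<subseteq> ?W" "?D \<inter> ?W \<subseteq> C v" by auto
      have "smap m (Suc (m - 1)) (\<Gamma> v) (?D \<inter> ?W) (cylinder (m - 1) (\<Phi> e)) (\<lambda>q. (X v q, 1 + (- 1) * \<rho> v q))"
        by (intro smap_Pair[OF \<Gamma>_pre[OF v] \<Phi>_pre[OF inc_edges[OF e(2)]]] smap_subset[OF X_smooth[OF v e(2)] sub(1)]
             msmooth_add[OF \<Gamma>_pre[OF v]] msmooth_mult[OF \<Gamma>_pre[OF v]] msmooth_const[OF \<Gamma>_pre[OF v]]
             msmooth_subset[OF \<rho>_smooth[OF v] sub(2)])
      then have 1: "smap m m (\<Gamma> v) (?D \<inter> ?W) (cylinder (m - 1) (\<Phi> e)) (\<lambda>q. (X v q, 1 + (- 1) * \<rho> v q))"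
        unfolding Sm .
      have "smap m m (\<Gamma> v) (?D \<inter> ?W) (\<Gamma> w) (\<lambda>q. T w e (X v q, 1 + (- 1) * \<rho> v q))"
      proof (rule smap_compose[OF \<Gamma>_pre[OF v] Pc 1 T_smooth[OF w e(3)]])
        fix q assume q: "q \<in> ?D \<inter> ?W"
        then have "q \<in> C v" "\<rho> v q < 1" using overlap(1)[OF v w False, of q] by auto
        then show "(X v q, 1 + (- 1) * \<rho> v q) \<in> points (\<Phi> e) \<times> {0..<2}"
          using C_facts[OF v, of q] q by auto
      qed
      then have "smap m m (\<Gamma> v) (?D \<inter> ?W) (\<Gamma> w) (\<lambda>q. inv_into (N w) (\<psi> w) (\<psi> v q))"
        by (rule smap_cong[OF \<Gamma>_pre[OF v]]) (use overlap(2)[OF v w False] in auto)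
      then show "\<exists>W. openin (mtop (\<Gamma> v)) W \<and> p \<in> W \<and> smap m m (\<Gamma> v) (?D \<inter> W) (\<Gamma> w) (\<lambda>q. inv_into (N w) (\<psi> w) (\<psi> v q))"
        using E_open[OF v e(2)] e(1) by (intro exI[of _ ?W]) (simp add: e_def)
    qed
  qed
qed

lemma N_eq: "v \<in> verts G \<Longrightarrow> q \<in> N v \<Longrightarrow> q \<in> core v \<or> (q \<in> C v \<and> 0 < \<rho> v q \<and> \<rho> v q < 1)"
  using N_iff[of v q] by (auto simp: core_def)

section \<open>The projection to the graph and the height\<close>

definition decode :: "'c \<Rightarrow> 'g \<times> 'b + 'g set \<times> 'a \<times> real" where
  "decode = inv_into (model_points G \<Phi> \<Gamma>) enc"

lemma decode_\<psi>: "v \<in> verts G \<Longrightarrow> q \<in> N v \<Longrightarrow> decode (\<psi> v q) = Pt v q"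
  using inv_into_f_f[OF enc_inj Pt_model] by (simp add: decode_def \<psi>_def)

definition proj :: "'c \<Rightarrow> 'g" where
  "proj x = (case decode x of Inl (v, q) \<Rightarrow> v | Inr (e, y, t) \<Rightarrow> \<gamma> e t)"

definition height :: "'c \<Rightarrow> real" where
  "height x = (case decode x of Inl (v, q) \<Rightarrow> a v
     | Inr (e, y, t) \<Rightarrow> a (\<gamma> e 0) + (a (\<gamma> e 1) + - a (\<gamma> e 0)) * step t)"

lemma proj_core: "v \<in> verts G \<Longrightarrow> q \<in> core v \<Longrightarrow> proj (\<psi> v q) = v"
  and height_core: "v \<in> verts G \<Longrightarrow> q \<in> core v \<Longrightarrow> height (\<psi> v q) = a v"
  using decode_\<psi>[of v q] core_subset[of v] Pt_core[of q v] by (auto simp: proj_def height_def)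

lemma proj_tube: "v \<in> verts G \<Longrightarrow> q \<in> N v \<Longrightarrow> q \<in> C v \<Longrightarrow> \<rho> v q < 1 \<Longrightarrow> proj (\<psi> v q) = \<gamma> (E v q) (par v (E v q) (\<rho> v q))"
  using decode_\<psi>[of v q] by (simp add: proj_def Pt_def)

text \<open>On a collar, the height is given by one formula also beyond \<open>\<rho> = 1\<close>, since \<open>step\<close> is
  constant there.\<close>

lemma height_collar:
  assumes v: "v \<in> verts G" and q: "q \<in> N v" "q \<in> C v" and e: "E v q = e"
  shows "height (\<psi> v q) = a (\<gamma> e 0) + (a (\<gamma> e 1) + - a (\<gamma> e 0)) * step (par v e (\<rho> v q))"
proof (cases "\<rho> v q < 1")
  case True
  then show ?thesis using decode_\<psi>[OF v q(1)] q(2) e by (simp add: height_def Pt_def)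
next
  case False
  then have "q \<in> core v" using C_facts(7)[OF v q(2)] by (simp add: core_def)
  moreover have "e \<in> inc v" using C_facts(1)[OF v q(2)] e by simp
  then consider "v = \<gamma> e 0" | "v = \<gamma> e 1" "v \<noteq> \<gamma> e 0" by (auto simp: inc_iff)
  then have "a v = a (\<gamma> e 0) + (a (\<gamma> e 1) + - a (\<gamma> e 0)) * step (par v e (\<rho> v q))"
    by cases (use False in \<open>auto simp: par_def step_0 step_1\<close>)
  ultimately show ?thesis using height_core[OF v] by simp
qed

text \<open>Beyond depth 1 the projection stays at the vertex, which truncation by
  \<open>min\<close> expresses. The kink at depth 1 is harmless, since the projection only has to be
  continuous.\<close>

lemma proj_collar:
  assumes v: "v \<in> verts G" and q: "q \<in> N v" "q \<in> C v" and e: "E v q = e"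
  shows "proj (\<psi> v q) = \<gamma> e (par v e (min 1 (\<rho> v q)))"
proof (cases "\<rho> v q < 1")
  case True
  then show ?thesis using proj_tube[OF v q] e by simp
next
  case False
  then have "q \<in> core v" using C_facts(7)[OF v q(2)] by (simp add: core_def)
  then show ?thesis using proj_core[OF v] False \<gamma>_par_1[of e v] C_facts(1)[OF v q(2)] e by simp
qed

text \<open>The core need not be open, but this part of it is, and together with the open collar it
  covers \<open>\<Gamma> v\<close>. Local statements therefore split into a case where projection
  and height are constant and a case with collar coordinates.\<close>

definition inner_core :: "'g \<Rightarrow> 'b set" where
  "inner_core v = points (\<Gamma> v) - {q \<in> C v. \<rho> v q \<le> 1}"

lemma inner_core_open: "v \<in> verts G \<Longrightarrow> openin (mtop (\<Gamma> v)) (inner_core v)"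
  unfolding inner_core_def by (intro openin_diff openin_topspace collar_closed) auto

lemma inner_core_subset: "inner_core v \<subseteq> core v"
  by (auto simp: inner_core_def core_def)

lemma inner_core_or_collar: "q \<in> points (\<Gamma> v) \<Longrightarrow> q \<in> inner_core v \<or> q \<in> C v"
  by (auto simp: inner_core_def)

lemma proj_continuous: "continuous_map (mtop glued) (gtop G) proj"
proof (rule continuous_map_glued)
  fix v assume v: "v \<in> verts G"
  note NM = openin_subset[OF N_open'[OF v]]
  show "continuous_map (subtopology (mtop (\<Gamma> v)) (N v)) (gtop G) (\<lambda>q. proj (\<psi> v q))"
  proof (rule continuous_map_local)
    fix q assume "q \<in> topspace (subtopology (mtop (\<Gamma> v)) (N v))"
    then have q: "q \<in> N v" "q \<in> points (\<Gamma> v)" by auto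
    have ex: "\<exists>W. openin (subtopology (mtop (\<Gamma> v)) (N v)) W \<and> q \<in> W \<and>
        continuous_map (subtopology (subtopology (mtop (\<Gamma> v)) (N v)) W) (gtop G) (\<lambda>q. proj (\<psi> v q))"
      if W: "openin (mtop (\<Gamma> v)) W" "q \<in> W" "continuous_map (subtopology (mtop (\<Gamma> v)) (N v \<inter> W)) (gtop G) (\<lambda>q. proj (\<psi> v q))" for W
      by (rule exI[of _ "N v \<inter> W"]) (use W q in \<open>simp add: openin_subtopology_Int2 subtopology_subtopology\<close>)
    show "\<exists>W. openin (subtopology (mtop (\<Gamma> v)) (N v)) W \<and> q \<in> W \<and>
        continuous_map (subtopology (subtopology (mtop (\<Gamma> v)) (N v)) W) (gtop G) (\<lambda>q. proj (\<psi> v q))"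
    proof (cases "q \<in> inner_core v")
      case True
      have vG: "v \<in> topspace (gtop G)" using fin_G v by (auto simp: finite_graph_def)
      have "continuous_map (subtopology (mtop (\<Gamma> v)) (N v \<inter> inner_core v)) (gtop G) (\<lambda>q. v)" using vG by simp
      then have "continuous_map (subtopology (mtop (\<Gamma> v)) (N v \<inter> inner_core v)) (gtop G) (\<lambda>q. proj (\<psi> v q))"
        by (rule continuous_map_eq) (use proj_core[OF v] subsetD[OF inner_core_subset] in force)
      then show ?thesis by (rule ex[OF inner_core_open[OF v] True])
    next
      case False
      then have qC: "q \<in> C v" using inner_core_or_collar q(2) by blast
      define e where "e = E v q"
      have e: "e \<in> inc v" using C_facts(1)[OF v qC] by (simp add: e_def)
      let ?W = "{q \<in> C v. E v q = e}"
      let ?Z = "subtopology (mtop (\<Gamma> v)) (N v \<inter> ?W)"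
      have 1: "continuous_map ?Z euclideanreal (\<rho> v)"
        by (rule continuous_map_from_subtopology_mono[OF msmooth_continuous[OF \<Gamma>_pre[OF v] \<rho>_smooth[OF v]]]) blast
      have "continuous_map ?Z euclideanreal (\<lambda>q. par v e (min 1 (\<rho> v q)))"
        unfolding par_def using 1 by (cases "v = \<gamma> e 0") (auto intro!: continuous_intros)
      moreover have "par v e (min 1 (\<rho> v q)) \<in> {0..1}" if "q \<in> ?W" for q
        using C_facts(4)[OF v, of q] that by (auto simp: par_def)
      ultimately have 2: "continuous_map ?Z (top_of_set {0..1}) (\<lambda>q. par v e (min 1 (\<rho> v q)))"
        by (auto simp: continuous_map_in_subtopology)
      have "continuous_map (top_of_set {0..1}) (gtop G) (\<gamma> e)"
        using \<gamma>[OF inc_edges[OF e]] by (simp add: characteristic_map_def)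
      from continuous_map_compose[OF 2 this]
      have "continuous_map ?Z (gtop G) (\<lambda>q. proj (\<psi> v q))"
        by (rule continuous_map_eq) (use proj_collar[OF v] in auto)
      moreover have "q \<in> ?W" using qC e_def by simp
      ultimately show ?thesis using ex[OF E_open[OF v e]] by blast
    qed
  qed
qed

lemma height_smooth: "msmooth m glued UNIV height"
proof (rule msmooth_glued)
  fix v assume v: "v \<in> verts G"
  note PM = \<Gamma>_pre[OF v]
  have eq: "{q \<in> N v. \<psi> v q \<in> UNIV} = N v" by simp
  show "msmooth m (\<Gamma> v) {q \<in> N v. \<psi> v q \<in> UNIV} (\<lambda>q. height (\<psi> v q))"
    unfolding eq
  proof (rule msmooth_local[OF PM])
    fix q assume q: "q \<in> N v" "q \<in> points (\<Gamma> v)"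
    show "\<exists>W. openin (mtop (\<Gamma> v)) W \<and> q \<in> W \<and> msmooth m (\<Gamma> v) (N v \<inter> W) (\<lambda>q. height (\<psi> v q))"
    proof (cases "q \<in> inner_core v")
      case True
      have "msmooth m (\<Gamma> v) (N v \<inter> inner_core v) (\<lambda>q. height (\<psi> v q))"
        by (rule msmooth_cong[OF PM msmooth_const[OF PM, of _ "a v"]]) (use height_core[OF v] subsetD[OF inner_core_subset] in force)
      then show ?thesis using inner_core_open[OF v] True by blast
    next
      case False
      then have qC: "q \<in> C v" using inner_core_or_collar q(2) by blast
      define e where "e = E v q"
      have e: "e \<in> inc v" using C_facts(1)[OF v qC] by (simp add: e_def)
      let ?W = "{q \<in> C v. E v q = e}"
      have \<rho>: "msmooth m (\<Gamma> v) (N v \<inter> ?W) (\<rho> v)" by (rule msmooth_subset[OF \<rho>_smooth[OF v]]) blast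
      have "msmooth m (\<Gamma> v) (N v \<inter> ?W) (\<lambda>q. par v e (\<rho> v q))"
      proof (cases "v = \<gamma> e 0")
        case True
        have "msmooth m (\<Gamma> v) (N v \<inter> ?W) (\<lambda>q. 1 + (- 1) * \<rho> v q)"
          by (intro msmooth_add[OF PM] msmooth_mult[OF PM] msmooth_const[OF PM] \<rho>)
        then show ?thesis using True by (simp add: par_def)
      qed (simp add: par_def \<rho>)
      from msmooth_real[OF PM smooth_real_step this]
      have "msmooth m (\<Gamma> v) (N v \<inter> ?W) (\<lambda>q. a (\<gamma> e 0) + (a (\<gamma> e 1) + - a (\<gamma> e 0)) * step (par v e (\<rho> v q)))"
        by (intro msmooth_add[OF PM] msmooth_mult[OF PM] msmooth_const[OF PM])
      then have "msmooth m (\<Gamma> v) (N v \<inter> ?W) (\<lambda>q. height (\<psi> v q))"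
        by (rule msmooth_cong[OF PM]) (use height_collar[OF v] in auto)
      then show ?thesis using E_open[OF v e] qC e_def by (intro exI[of _ ?W]) simp
    qed
  qed
qed

lemma tube_eq:
  assumes "v \<in> verts G" "e \<in> inc v" "x \<in> points (\<Phi> e)" "0 < u" "u < 1"
  shows "\<psi> v (T v e (x, u)) = enc (Inr (e, x, par v e u))"
  using tube_point(3)[OF assms] by (simp add: \<psi>_def)

lemma tube_at:
  assumes v: "v \<in> verts G" and e: "e \<in> inc v" and x: "x \<in> points (\<Phi> e)" and t: "0 < t" "t < 1"
  shows "enc (Inr (e, x, t)) = \<psi> v (T v e (x, par v e t))" "T v e (x, par v e t) \<in> N v"
  using tube_eq[OF v e x, of "par v e t"] tube_point(1)[OF v e x, of "par v e t"] par_01[of v e t] t by auto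

lemma inc_end: "e \<in> edges G \<Longrightarrow> e \<in> inc (\<gamma> e 0)" "e \<in> edges G \<Longrightarrow> e \<in> inc (\<gamma> e 1)"
  by (auto simp: inc_iff)

section \<open>Fibres of the projection\<close>

lemma glued_pointE:
  assumes "x \<in> points glued"
  obtains (core) v q where "v \<in> verts G" "q \<in> core v" "x = \<psi> v q"
  | (tube) e y t where "e \<in> edges G" "y \<in> points (\<Phi> e)" "0 < t" "t < 1" "x = enc (Inr (e, y, t))"
proof -
  obtain v q where v: "v \<in> verts G" and q: "q \<in> N v" "x = \<psi> v q" using assms by (auto simp: points_glued)
  show thesis
  proof (cases "q \<in> core v")
    case True
    then show ?thesis using core v q by blast
  next
    case False
    then have c: "q \<in> C v" "0 < \<rho> v q" "\<rho> v q < 1" using N_eq[OF v q(1)] by auto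
    note f = C_facts[OF v c(1)]
    show ?thesis
    proof (rule tube)
      show "E v q \<in> edges G" by (rule inc_edges[OF f(1)])
      show "X v q \<in> points (\<Phi> (E v q))" by (rule f(3))
      show "x = enc (Inr (E v q, X v q, par v (E v q) (\<rho> v q)))"
        using q c by (simp add: \<psi>_def Pt_def)
      show "0 < par v (E v q) (\<rho> v q)" "par v (E v q) (\<rho> v q) < 1" using par_01[of v "E v q" "\<rho> v q"] c by auto
    qed
  qed
qed

lemma core_glued: "v \<in> verts G \<Longrightarrow> q \<in> core v \<Longrightarrow> \<psi> v q \<in> points glued"
  using core_subset by (auto simp: points_glued)

lemma tube_glued:
  assumes "e \<in> edges G" "y \<in> points (\<Phi> e)" "0 < t" "t < 1"
  shows "enc (Inr (e, y, t)) \<in> points glued" "proj (enc (Inr (e, y, t))) = \<gamma> e t"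
    "height (enc (Inr (e, y, t))) = a (\<gamma> e 0) + (a (\<gamma> e 1) + - a (\<gamma> e 0)) * step t"
proof -
  note i = tube_at[OF ends_verts(1)[OF assms(1)] inc_end(1)[OF assms(1)] assms(2-4)]
  show "enc (Inr (e, y, t)) \<in> points glued" using i ends_verts(1)[OF assms(1)] by (auto simp: points_glued)
  have "Inr (e, y, t) \<in> model_points G \<Phi> \<Gamma>" using assms by (auto simp: model_points_def)
  then have "decode (enc (Inr (e, y, t))) = Inr (e, y, t)" using inv_into_f_f[OF enc_inj] by (simp add: decode_def)
  then show "proj (enc (Inr (e, y, t))) = \<gamma> e t"
    "height (enc (Inr (e, y, t))) = a (\<gamma> e 0) + (a (\<gamma> e 1) + - a (\<gamma> e 0)) * step t"
    by (auto simp: proj_def height_def)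
qed

lemma \<gamma>_in_edge: "e \<in> edges G \<Longrightarrow> 0 < t \<Longrightarrow> t < 1 \<Longrightarrow> \<gamma> e t \<in> e"
  using characteristic_mapD(1)[OF fin_G _ \<gamma>] by fastforce

lemma edge_not_vert: "e \<in> edges G \<Longrightarrow> g \<in> e \<Longrightarrow> g \<notin> verts G"
  and verts_in_top: "verts G \<subseteq> topspace (gtop G)"
  using fin_G by (auto simp: finite_graph_def)

lemma \<gamma>_tube_inj:
  assumes "e \<in> edges G" "0 < t" "t < 1" "e' \<in> edges G" "0 < t'" "t' < 1" "\<gamma> e t = \<gamma> e' t'"
  shows "e = e'" "t = t'"
proof -
  show ee: "e = e'"
    using \<gamma>_in_edge[OF assms(1-3)] \<gamma>_in_edge[OF assms(4-6)] edges_disjoint[OF fin_G assms(1,4)] assms(7) by auto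
  show "t = t'" using inj_onD[OF characteristic_mapD(2)[OF fin_G assms(1) \<gamma>[OF assms(1)]], of t t'] assms ee by simp
qed

lemma graph_pointE:
  assumes "g \<in> topspace (gtop G)"
  obtains (vert) "g \<in> verts G" | (edge) e t where "e \<in> edges G" "0 < t" "t < 1" "g = \<gamma> e t"
proof (cases "g \<in> verts G")
  case False
  then obtain e where e: "e \<in> edges G" "g \<in> e" using assms fin_G unfolding finite_graph_def by blast
  then obtain t where "t \<in> {0<..<1}" "g = \<gamma> e t" using characteristic_mapD(1)[OF fin_G e(1) \<gamma>[OF e(1)]] by blast
  then show ?thesis using edge[of e t] e(1) by simp
qed (rule vert)

lemma fibre_vertex:
  assumes v: "v \<in> verts G"
  shows "{x \<in> points glued. proj x = v} = \<psi> v ` core v"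
proof (intro equalityI subsetI)
  fix x assume "x \<in> {x \<in> points glued. proj x = v}"
  then have x: "x \<in> points glued" "proj x = v" by auto
  from x(1) show "x \<in> \<psi> v ` core v"
  proof (cases rule: glued_pointE)
    case (core w q)
    then show ?thesis using proj_core[OF core(1,2)] x(2) by simp
  next
    case (tube e y t)
    then show ?thesis using tube_glued(2)[OF tube(1-4)] \<gamma>_in_edge[OF tube(1,3,4)] edge_not_vert[OF tube(1)] x(2) v by simp
  qed
next
  fix x assume "x \<in> \<psi> v ` core v"
  then show "x \<in> {x \<in> points glued. proj x = v}" using core_glued[OF v] proj_core[OF v] by blast
qed

lemma fibre_edge:
  assumes e: "e \<in> edges G" and t: "0 < t" "t < 1"
  shows "{x \<in> points glued. proj x = \<gamma> e t} = (\<lambda>y. enc (Inr (e, y, t))) ` points (\<Phi> e)"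
proof (intro equalityI subsetI)
  fix x assume "x \<in> {x \<in> points glued. proj x = \<gamma> e t}"
  then have x: "x \<in> points glued" "proj x = \<gamma> e t" by auto
  from x(1) show "x \<in> (\<lambda>y. enc (Inr (e, y, t))) ` points (\<Phi> e)"
  proof (cases rule: glued_pointE)
    case (core w q)
    then show ?thesis using proj_core[OF core(1,2)] x(2) edge_not_vert[OF e \<gamma>_in_edge[OF e t]] by simp
  next
    case (tube e' y t')
    then have "\<gamma> e t = \<gamma> e' t'" using tube_glued(2)[OF tube(1-4)] x(2) by simp
    then have "e = e'" "t = t'" using \<gamma>_tube_inj[OF e t tube(1,3,4)] by auto
    then show ?thesis using tube by simp
  qed
next
  fix x assume "x \<in> (\<lambda>y. enc (Inr (e, y, t))) ` points (\<Phi> e)"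
  then show "x \<in> {x \<in> points glued. proj x = \<gamma> e t}" using tube_glued(1,2)[OF e _ t] by blast
qed

lemma proj_in_G:
  assumes "x \<in> points glued" shows "proj x \<in> topspace (gtop G)"
  using continuous_map_image_subset_topspace[OF proj_continuous] assms by blast

section \<open>The glued space as a closed manifold\<close>

lemma same_fibre_chart:
  assumes x: "x \<in> points glued" and y: "y \<in> points glued" "proj x = proj y"
  shows "\<exists>v\<in>verts G. x \<in> \<psi> v ` N v \<and> y \<in> \<psi> v ` N v"
using proj_in_G[OF x]
proof (cases rule: graph_pointE)
  case vert
  have "x \<in> \<psi> (proj x) ` core (proj x)" "y \<in> \<psi> (proj x) ` core (proj x)"
    using fibre_vertex[OF vert] x y by auto
  then show ?thesis using vert core_subset[OF vert] by blast
next
  case (edge e t)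
  have m: "x \<in> (\<lambda>y. enc (Inr (e, y, t))) ` points (\<Phi> e)" "y \<in> (\<lambda>y. enc (Inr (e, y, t))) ` points (\<Phi> e)"
    using fibre_edge[OF edge(1-3)] x y edge(4) by auto
  have "enc (Inr (e, z, t)) \<in> \<psi> (\<gamma> e 0) ` N (\<gamma> e 0)" if "z \<in> points (\<Phi> e)" for z
    using tube_at[OF ends_verts(1)[OF edge(1)] inc_end(1)[OF edge(1)] that edge(2,3)] by simp
  then show ?thesis using ends_verts(1)[OF edge(1)] m by blast
qed

text \<open>Points with different projections are separated by preimages of open sets of the
  Hausdorff space \<open>gtop G\<close>. Points of one fibre lie in a common piece, which is
  Hausdorff and open in the glued space.\<close>

lemma Hausdorff_glued: "Hausdorff_space (mtop glued)"
  unfolding Hausdorff_space_def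
proof (intro allI impI)
  fix x y assume xy: "x \<in> points glued \<and> y \<in> points glued \<and> x \<noteq> y"
  show "\<exists>U V. openin (mtop glued) U \<and> openin (mtop glued) V \<and> x \<in> U \<and> y \<in> V \<and> disjnt U V"
  proof (cases "proj x = proj y")
    case False
    have "Hausdorff_space (gtop G)" using fin_G by (simp add: finite_graph_def)
    then obtain U V where UV: "openin (gtop G) U" "openin (gtop G) V" "proj x \<in> U" "proj y \<in> V" "disjnt U V"
      using proj_in_G xy False unfolding Hausdorff_space_def by meson
    have o: "openin (mtop glued) {z \<in> points glued. proj z \<in> U}" "openin (mtop glued) {z \<in> points glued. proj z \<in> V}"
      using openin_continuous_map_preimage[OF proj_continuous] UV by auto
    have "x \<in> {z \<in> points glued. proj z \<in> U}" "y \<in> {z \<in> points glued. proj z \<in> V}" using xy UV(3,4) by simp_all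
    moreover have "disjnt {z \<in> points glued. proj z \<in> U} {z \<in> points glued. proj z \<in> V}"
      using UV(5) by (simp add: disjnt_iff)
    ultimately show ?thesis using o by (intro exI conjI)
  next
    case True
    obtain v where v: "v \<in> verts G" "x \<in> \<psi> v ` N v" "y \<in> \<psi> v ` N v" using same_fibre_chart xy True by blast
    then obtain p q where pq: "p \<in> N v" "x = \<psi> v p" "q \<in> N v" "y = \<psi> v q" by blast
    have NM: "N v \<subseteq> points (\<Gamma> v)" by (rule openin_subset[OF N_open'[OF v(1)]])
    have "p \<in> points (\<Gamma> v)" "q \<in> points (\<Gamma> v)" "p \<noteq> q" using subsetD[OF NM] pq xy by auto
    then obtain U V where UV: "openin (mtop (\<Gamma> v)) U" "openin (mtop (\<Gamma> v)) V" "p \<in> U" "q \<in> V" "disjnt U V"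
      using \<Gamma>_Hausdorff[OF v(1)] unfolding Hausdorff_space_def by meson
    have o: "openin (mtop glued) (\<psi> v ` (U \<inter> N v))" "openin (mtop glued) (\<psi> v ` (V \<inter> N v))"
      using openin_glued_image[OF v(1)] N_open'[OF v(1)] UV(1,2) by auto
    have "disjnt (\<psi> v ` (U \<inter> N v)) (\<psi> v ` (V \<inter> N v))"
      using UV(5) inj_onD[OF \<psi>_inj'[OF v(1)]] unfolding disjnt_iff by blast
    moreover have "x \<in> \<psi> v ` (U \<inter> N v)" "y \<in> \<psi> v ` (V \<inter> N v)" using pq UV(3,4) by simp_all
    ultimately show ?thesis using o by (intro exI conjI)
  qed
qed

text \<open>The interiors of the pieces are not compact in general, but the parts of depth at least
  1/2 are closed in the compact manifolds. They cover because a tube point has depth at least 1/2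
  from one of its two ends.\<close>

lemma compact_glued: "compact_space (mtop glued)"
proof -
  define H where "H v = {q \<in> points (\<Gamma> v). q \<in> C v \<longrightarrow> 1 / 2 \<le> \<rho> v q}" for v
  have HN: "H v \<subseteq> N v" if v: "v \<in> verts G" for v
  proof
    fix q assume q: "q \<in> H v"
    have "0 < \<rho> v q" if "q \<in> C v"
      using q that by (simp add: H_def)
    then show "q \<in> N v" using q unfolding N_iff[OF v] by (simp add: H_def)
  qed
  have comp: "compactin (mtop glued) (\<psi> v ` H v)" if v: "v \<in> verts G" for v
  proof (rule image_compactin[OF _ \<psi>_continuous[OF v]])
    have "openin (mtop (\<Gamma> v)) {q \<in> C v. \<rho> v q \<in> {..<1 / 2}}" by (rule \<rho>_preimage_open[OF v]) simp
    then have "closedin (mtop (\<Gamma> v)) (points (\<Gamma> v) - {q \<in> C v. \<rho> v q \<in> {..<1 / 2}})" by blast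
    moreover have "points (\<Gamma> v) - {q \<in> C v. \<rho> v q \<in> {..<1 / 2}} = H v" by (auto simp: H_def)
    ultimately have "compactin (mtop (\<Gamma> v)) (H v)" using closedin_compact_space[OF \<Gamma>_compact[OF v]] by simp
    then show "compactin (subtopology (mtop (\<Gamma> v)) (N v)) (H v)" using HN[OF v] by (simp add: compactin_subtopology)
  qed
  have "points glued = (\<Union>v\<in>verts G. \<psi> v ` H v)"
  proof (intro equalityI subsetI)
    fix x assume "x \<in> points glued"
    then show "x \<in> (\<Union>v\<in>verts G. \<psi> v ` H v)"
    proof (cases rule: glued_pointE)
      case (core v q)
      then show ?thesis by (force simp: H_def core_def)
    next
      case (tube e y t)
      obtain v where v: "v \<in> verts G" "e \<in> inc v" "1 / 2 \<le> par v e t"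
      proof (cases "t \<le> 1 / 2")
        case True
        then show ?thesis using that[of "\<gamma> e 0"] ends_verts[OF tube(1)] inc_end[OF tube(1)] by (simp add: par_def)
      next
        case False
        then show ?thesis using that[of "\<gamma> e 1"] ends_verts[OF tube(1)] inc_end[OF tube(1)] ends_neq[OF tube(1)]
          by (auto simp: par_def)
      qed
      note p = tube_at[OF v(1,2) tube(2-4)]
      have "T v e (y, par v e t) \<in> H v"
        using p(2) T_facts[OF v(1,2) tube(2), of "par v e t"] v(3) par_01[of v e t] tube(3,4) by (auto simp: H_def N_def)
      then show ?thesis using p(1) tube(5) v(1) by blast
    qed
  next
    fix x assume "x \<in> (\<Union>v\<in>verts G. \<psi> v ` H v)"
    then show "x \<in> points glued" using HN by (auto simp: points_glued)
  qed
  moreover have "compactin (mtop glued) (\<Union>v\<in>verts G. \<psi> v ` H v)"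
    using comp fin_G by (intro compactin_Union) (auto simp: finite_graph_def)
  ultimately show ?thesis by (simp add: compact_space_def)
qed

lemma closed_manifold_glued: "closed_manifold m glued"
  using smooth_manifold_glued[OF _ \<Gamma>_second Hausdorff_glued] compact_glued fin_G
  by (simp add: closed_manifold_def compact_manifold_def finite_graph_def)

section \<open>Connected fibres\<close>

lemma inner_core_nonempty:
  assumes v: "v \<in> verts G" shows "inner_core v \<noteq> {}"
proof (cases "inc v = {}")
  case True
  then have "C v = {}" using C_facts(1)[OF v] by blast
  then show ?thesis using \<Gamma>_ne[OF v] by (simp add: inner_core_def)
next
  case False
  then obtain e where e: "e \<in> inc v" by blast
  then obtain x where x: "x \<in> points (\<Phi> e)" using \<Phi>_ne[OF inc_edges[OF e]] by blast
  \<comment> \<open>Any depth strictly between 1 and 2 would do.\<close>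
  have "T v e (x, 3 / 2) \<in> inner_core v"
    using T_facts[OF v e x, of "3 / 2"] C_facts(7)[OF v, of "T v e (x, 3 / 2)"] by (simp add: inner_core_def)
  then show ?thesis by blast
qed

text \<open>The core is a retract of the connected manifold \<open>\<Gamma> v\<close>: collar points
  of depth below 1 are pushed inwards to depth 1, everything else is fixed.\<close>

lemma core_connected:
  assumes v: "v \<in> verts G" shows "connectedin (mtop (\<Gamma> v)) (core v)"
proof -
  define r where "r q = (if q \<in> C v then T v (E v q) (X v q, max 1 (\<rho> v q)) else q)" for q
  have rC: "T v (E v q) (X v q, max 1 (\<rho> v q)) \<in> core v" if q: "q \<in> C v" for q
    using T_facts[OF v C_facts(1)[OF v q] C_facts(3)[OF v q], of "max 1 (\<rho> v q)"] C_facts(5)[OF v q]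
      C_facts(7)[OF v, of "T v (E v q) (X v q, max 1 (\<rho> v q))"] by (simp add: core_def)
  have r_core: "r q = q" if "q \<in> core v" for q
    using that C_facts(6)[OF v, of q] by (auto simp: r_def core_def max_def)
  have "r ` points (\<Gamma> v) = core v"
  proof (intro equalityI subsetI)
    fix q assume "q \<in> r ` points (\<Gamma> v)"
    then show "q \<in> core v" using rC by (auto simp: r_def core_def)
  next
    fix q assume "q \<in> core v"
    then show "q \<in> r ` points (\<Gamma> v)" using r_core[of q] by (force simp: core_def)
  qed
  moreover have "continuous_map (mtop (\<Gamma> v)) (mtop (\<Gamma> v)) r"
  proof (rule continuous_map_local)
    fix q assume q: "q \<in> points (\<Gamma> v)"
    show "\<exists>W. openin (mtop (\<Gamma> v)) W \<and> q \<in> W \<and> continuous_map (subtopology (mtop (\<Gamma> v)) W) (mtop (\<Gamma> v)) r"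
    proof (cases "q \<in> inner_core v")
      case True
      have "continuous_map (subtopology (mtop (\<Gamma> v)) (inner_core v)) (mtop (\<Gamma> v)) r"
        by (rule continuous_map_eq[of _ _ "\<lambda>q. q"]) (use r_core subsetD[OF inner_core_subset] in \<open>auto simp: continuous_map_from_subtopology\<close>)
      then show ?thesis using inner_core_open[OF v] True by blast
    next
      case False
      then have qC: "q \<in> C v" using inner_core_or_collar q by blast
      define e where "e = E v q"
      have e: "e \<in> inc v" using C_facts(1)[OF v qC] by (simp add: e_def)
      let ?W = "{q \<in> C v. E v q = e}"
      let ?Z = "subtopology (mtop (\<Gamma> v)) ?W"
      have 1: "continuous_map ?Z euclideanreal (\<rho> v)"
        by (rule continuous_map_from_subtopology_mono[OF msmooth_continuous[OF \<Gamma>_pre[OF v] \<rho>_smooth[OF v]]]) blast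
      have "continuous_map ?Z (prod_topology (mtop (\<Phi> e)) euclideanreal) (\<lambda>q. (X v q, max 1 (\<rho> v q)))"
        using smap_continuous[OF X_smooth[OF v e]] 1
        by (auto simp: continuous_map_pairwise o_def intro!: continuous_map_real_max)
      moreover have "(X v q, max 1 (\<rho> v q)) \<in> points (\<Phi> e) \<times> {0..<2}" if "q \<in> ?W" for q
        using C_facts(3,5)[OF v, of q] that by auto
      ultimately have "continuous_map ?Z (subtopology (prod_topology (mtop (\<Phi> e)) euclideanreal) (points (\<Phi> e) \<times> {0..<2}))
          (\<lambda>q. (X v q, max 1 (\<rho> v q)))"
        by (auto simp: continuous_map_in_subtopology)
      from continuous_map_compose[OF this T_continuous[OF v e]]
      have "continuous_map ?Z (mtop (\<Gamma> v)) r"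
        by (rule continuous_map_eq) (auto simp: r_def)
      then show ?thesis using E_open[OF v e] qC e_def by blast
    qed
  qed
  ultimately show ?thesis
    using connectedin_continuous_map_image[of "mtop (\<Gamma> v)" "mtop (\<Gamma> v)" r "points (\<Gamma> v)"] \<Gamma>_connected[OF v]
    by (simp add: connectedin_topspace)
qed

lemma tube_fibre_smap:
  assumes v: "v \<in> verts G" and e: "e \<in> inc v" and u: "0 < u" "u < 1"
  shows "smap (m - 1) m (\<Phi> e) (points (\<Phi> e)) glued (\<lambda>y. \<psi> v (T v e (y, u)))"
proof -
  note P\<Phi> = \<Phi>_pre[OF inc_edges[OF e]]
  note Pc = premanifold_cylinder[OF P\<Phi>, unfolded Sm]
  have "smap (m - 1) (Suc (m - 1)) (\<Phi> e) (points (\<Phi> e)) (cylinder (m - 1) (\<Phi> e)) (\<lambda>y. (y, u))"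
    by (intro smap_Pair[OF P\<Phi> P\<Phi>] smap_id P\<Phi> msmooth_const)
  then have 1: "smap (m - 1) m (\<Phi> e) (points (\<Phi> e)) (cylinder (m - 1) (\<Phi> e)) (\<lambda>y. (y, u))" unfolding Sm .
  have "smap (m - 1) m (\<Phi> e) (points (\<Phi> e)) (\<Gamma> v) (\<lambda>y. T v e (y, u))"
    by (rule smap_compose[OF P\<Phi> Pc 1 T_smooth[OF v e]]) (use u in auto)
  then show ?thesis
    by (rule smap_compose[OF P\<Phi> \<Gamma>_pre[OF v] _ smap_\<psi>[OF v]]) (rule tube_point(1)[OF v e _ u])
qed

lemma fibre_connected:
  assumes "g \<in> topspace (gtop G)"
  shows "connectedin (mtop glued) {x \<in> points glued. proj x = g}" "{x \<in> points glued. proj x = g} \<noteq> {}"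
proof -
  have "connectedin (mtop glued) {x \<in> points glued. proj x = g} \<and> {x \<in> points glued. proj x = g} \<noteq> {}"
    using assms
  proof (cases rule: graph_pointE)
    case vert
    have "connectedin (subtopology (mtop (\<Gamma> g)) (N g)) (core g)"
      using core_connected[OF vert] core_subset[OF vert] by (simp add: connectedin_subtopology)
    then have "connectedin (mtop glued) (\<psi> g ` core g)"
      by (rule connectedin_continuous_map_image[OF \<psi>_continuous[OF vert]])
    moreover have "core g \<noteq> {}" using inner_core_nonempty[OF vert] inner_core_subset by blast
    ultimately show ?thesis unfolding fibre_vertex[OF vert] by simp
  next
    case (edge e t)
    define v where "v = \<gamma> e 0"
    have v: "v \<in> verts G" "e \<in> inc v" using ends_verts(1) inc_end(1) edge(1) by (auto simp: v_def)
    have u: "0 < par v e t" "par v e t < 1" using par_01[of v e t] edge by auto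
    have "continuous_map (mtop (\<Phi> e)) (mtop glued) (\<lambda>y. \<psi> v (T v e (y, par v e t)))"
      using smap_continuous[OF tube_fibre_smap[OF v u]] by simp
    then have "connectedin (mtop glued) ((\<lambda>y. \<psi> v (T v e (y, par v e t))) ` points (\<Phi> e))"
      using connectedin_continuous_map_image[of "mtop (\<Phi> e)" "mtop glued" _ "points (\<Phi> e)"] \<Phi>_connected[OF edge(1)]
      by (simp add: connectedin_topspace)
    moreover have "(\<lambda>y. \<psi> v (T v e (y, par v e t))) ` points (\<Phi> e) = (\<lambda>y. enc (Inr (e, y, t))) ` points (\<Phi> e)"
      using tube_at(1)[OF v _ edge(2,3)] by (intro image_cong) auto
    ultimately show ?thesis unfolding edge(4) fibre_edge[OF edge(1-3)] using \<Phi>_ne[OF edge(1)] by simp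
  qed
  then show "connectedin (mtop glued) {x \<in> points glued. proj x = g}" "{x \<in> points glued. proj x = g} \<noteq> {}" by auto
qed

lemma height_factors:
  assumes x: "x \<in> points glued" and y: "y \<in> points glued" "proj x = proj y"
  shows "height x = height y"
using proj_in_G[OF x]
proof (cases rule: graph_pointE)
  case vert
  have "x \<in> \<psi> (proj x) ` core (proj x)" "y \<in> \<psi> (proj x) ` core (proj x)"
    using fibre_vertex[OF vert] x y by auto
  then show ?thesis using height_core[OF vert] by fastforce
next
  case (edge e t)
  have m: "x \<in> (\<lambda>y. enc (Inr (e, y, t))) ` points (\<Phi> e)" "y \<in> (\<lambda>y. enc (Inr (e, y, t))) ` points (\<Phi> e)"
    using fibre_edge[OF edge(1-3)] x y edge(4) by auto
  then show ?thesis using tube_glued(3)[OF edge(1) _ edge(2,3)] by auto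
qed

section \<open>Levels of the height and the Reeb space\<close>

lemma ends_height: "e \<in> edges G \<Longrightarrow> a (\<gamma> e 1) + - a (\<gamma> e 0) \<noteq> 0"
  using inj_onD[OF a_inj, of "\<gamma> e 0" "\<gamma> e 1"] ends_neq[of e] ends_verts[of e] by auto

text \<open>The ends of an edge have different heights and \<open>step\<close> is strictly
  increasing on [0, 1], so that a level meets the inside of each edge at most once. All remaining
  points project to one of the finitely many vertices.\<close>

lemma finite_level: "finite (proj ` {x \<in> points glued. height x = c})"
proof (rule finite_subset)
  let ?L = "\<lambda>e. {t. 0 < t \<and> t < 1 \<and> a (\<gamma> e 0) + (a (\<gamma> e 1) + - a (\<gamma> e 0)) * step t = c}"
  show "proj ` {x \<in> points glued. height x = c} \<subseteq> verts G \<union> (\<Union>e\<in>edges G. \<gamma> e ` ?L e)"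
  proof
    fix g assume "g \<in> proj ` {x \<in> points glued. height x = c}"
    then obtain x where x: "x \<in> points glued" "height x = c" "g = proj x" by blast
    from x(1) show "g \<in> verts G \<union> (\<Union>e\<in>edges G. \<gamma> e ` ?L e)"
    proof (cases rule: glued_pointE)
      case (core v q)
      then show ?thesis using proj_core[OF core(1,2)] x(3) by simp
    next
      case (tube e y t)
      then show ?thesis using tube_glued(2,3)[OF tube(1-4)] x by auto
    qed
  qed
  have "finite (?L e)" if e: "e \<in> edges G" for e
  proof (cases "?L e = {}")
    case False
    then obtain t where t: "t \<in> ?L e" by blast
    have "?L e \<subseteq> {t}"
    proof
      fix s assume s: "s \<in> ?L e"
      then have eq: "step s = step t" using t ends_height[OF e] by auto
      have "\<not> s < t" "\<not> t < s" using step_strict_mono[of s t] step_strict_mono[of t s] eq s t by auto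
      then show "s \<in> {t}" by simp
    qed
    then show ?thesis by (rule finite_subset) simp
  qed (simp only: finite.emptyI)
  then show "finite (verts G \<union> (\<Union>e\<in>edges G. \<gamma> e ` ?L e))" using fin_G by (simp add: finite_graph_def)
qed

definition fibre :: "'g \<Rightarrow> 'c set" where "fibre g = {x \<in> points glued. proj x = g}"

lemma proj_surj: "proj ` points glued = topspace (gtop G)"
proof (intro equalityI subsetI)
  fix g assume "g \<in> proj ` points glued"
  then show "g \<in> topspace (gtop G)" using proj_in_G by blast
next
  fix g assume "g \<in> topspace (gtop G)"
  then show "g \<in> proj ` points glued" using fibre_connected(2)[of g] by blast
qed

lemma reeb_map_height: "x \<in> points glued \<Longrightarrow> reeb_map (mtop glued) height x = fibre (proj x)"
  and fibre_homeomorphic: "homeomorphic_map (gtop G) (reeb_space (mtop glued) height) fibre"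
proof -
  have "Hausdorff_space (gtop G)" using fin_G by (simp add: finite_graph_def)
  note R = reeb_space_eq_fibres[OF compact_glued this proj_continuous proj_surj height_factors finite_level fibre_connected(1)]
  show "x \<in> points glued \<Longrightarrow> reeb_map (mtop glued) height x = fibre (proj x)" unfolding fibre_def by (rule R(1))
  show "homeomorphic_map (gtop G) (reeb_space (mtop glued) height) fibre" unfolding fibre_def[abs_def] by (rule R(2))
qed

lemma reeb_preimage_fibre: "reeb_preimage (mtop glued) height (fibre ` A) = {x \<in> points glued. proj x \<in> A}"
proof (intro equalityI subsetI)
  fix x assume "x \<in> reeb_preimage (mtop glued) height (fibre ` A)"
  then obtain g where x: "x \<in> points glued" and g: "g \<in> A" "fibre (proj x) = fibre g"
    using reeb_map_height by (auto simp: reeb_preimage_def)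
  have "x \<in> fibre (proj x)" using x by (simp add: fibre_def)
  then have "proj x = g" unfolding g(2) by (simp add: fibre_def)
  then show "x \<in> {x \<in> points glued. proj x \<in> A}" using x g by simp
next
  fix x assume "x \<in> {x \<in> points glued. proj x \<in> A}"
  then show "x \<in> reeb_preimage (mtop glued) height (fibre ` A)"
    using reeb_map_height[of x] by (simp add: reeb_preimage_def)
qed

section \<open>Critical points of the height\<close>

lemma tube_smap:
  assumes v: "v \<in> verts G" and e: "e \<in> inc v"
  shows "smap m m (cylinder (m - 1) (\<Phi> e)) (points (\<Phi> e) \<times> {0<..<1}) glued (\<lambda>z. \<psi> v (T v e z))"
proof -
  note Pc = premanifold_cylinder[OF \<Phi>_pre[OF inc_edges[OF e]], unfolded Sm]
  show ?thesis
  proof (rule smap_compose[OF Pc \<Gamma>_pre[OF v] smap_subset[OF T_smooth[OF v e]] smap_\<psi>[OF v]])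
    fix z assume "z \<in> points (\<Phi> e) \<times> {0<..<1::real}"
    then show "T v e z \<in> N v" using tube_point(1)[OF v e] by auto
  qed auto
qed

text \<open>Along the line of the tube through the point, the height has a nonzero derivative, a
  multiple of the derivative of \<open>step\<close> by the difference of the end heights. At a
  critical point, the chain rule in the chart would make this derivative 0.\<close>

lemma no_critical_tube:
  assumes e: "e \<in> edges G" and y: "y \<in> points (\<Phi> e)" and t: "0 < t" "t < 1"
  shows "\<not> critical_point m glued height (enc (Inr (e, y, t)))"
proof
  assume "critical_point m glued height (enc (Inr (e, y, t)))"
  then obtain U \<phi> where U: "(U, \<phi>) \<in> atlas glued" "enc (Inr (e, y, t)) \<in> U"
    and crit: "\<And>i. i < m \<Longrightarrow> partial i (height \<circ> inv_into U \<phi>) (\<phi> (enc (Inr (e, y, t)))) = 0"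
    by (auto simp: critical_point_def)
  define v where "v = \<gamma> e 0"
  have v: "v \<in> verts G" "e \<in> inc v" using ends_verts(1)[OF e] inc_end(1)[OF e] by (auto simp: v_def)
  define \<kappa> where "\<kappa> u = \<psi> v (T v e (y, u))" for u
  define u0 where "u0 = 1 - t"
  have x: "enc (Inr (e, y, t)) = \<kappa> u0" using tube_at(1)[OF v y t] by (simp add: \<kappa>_def u0_def par_def v_def)
  have u0: "0 < u0" "u0 < 1" using t by (auto simp: u0_def)
  note sm = tube_smap[OF v] and P\<Phi> = \<Phi>_pre[OF e]
  define D where "D = {u \<in> {0<..<1}. \<kappa> u \<in> U}"
  have cont: "continuous_map (top_of_set {0<..<1}) (mtop glued) \<kappa>"
  proof -
    have "continuous_map (top_of_set {0<..<1}) (subtopology (mtop (cylinder (m - 1) (\<Phi> e))) (points (\<Phi> e) \<times> {0<..<1})) (\<lambda>u. (y, u))"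
      using y by (auto simp: continuous_map_in_subtopology continuous_map_pairwise o_def)
    from continuous_map_compose[OF this smap_continuous[OF sm]] show ?thesis by (simp add: o_def \<kappa>_def[abs_def])
  qed
  have "openin (top_of_set {0<..<1}) {u \<in> topspace (top_of_set {0<..<1}). \<kappa> u \<in> U}"
    by (rule openin_continuous_map_preimage[OF cont chart_openin[OF premanifold_glued U(1)]])
  then have D: "open D" unfolding D_def by (simp add: openin_open_eq)
  have u0D: "u0 \<in> D" using U(2) u0 x by (simp add: D_def)
  have "\<exists>d. ((\<lambda>u. \<phi> (\<kappa> u) j) has_real_derivative d) (at u0)" if j: "j < m" for j
  proof -
    have "msmooth m (cylinder (m - 1) (\<Phi> e)) {z \<in> points (\<Phi> e) \<times> {0<..<1}. \<psi> v (T v e z) \<in> U} (\<lambda>z. \<phi> (\<psi> v (T v e z)) j)"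
      by (rule smap_msmooth[OF sm U(1) j])
    then have "msmooth m (cylinder (m - 1) (\<Phi> e)) ({y} \<times> D) (\<lambda>z. \<phi> (\<psi> v (T v e z)) j)"
      by (rule msmooth_subset) (use y in \<open>auto simp: D_def \<kappa>_def\<close>)
    from msmooth_curve[OF P\<Phi> y D u0D, unfolded Sm, OF this] show ?thesis by (simp add: \<kappa>_def)
  qed
  then obtain d where d: "\<And>j. j < m \<Longrightarrow> ((\<lambda>u. \<phi> (\<kappa> u) j) has_real_derivative d j) (at u0)" by metis
  let ?H = "height \<circ> inv_into U \<phi>"
  \<comment> \<open>Criticality concerns the partial derivatives of the chart representation itself.
    The chart image is open, so this representation, and not merely an extension of it, is
    differentiable.\<close>
  have "smooth_on m (\<phi> ` U) ?H" using height_smooth U(1) by (auto simp: msmooth_def)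
  then have H: "smooth_on_open m (\<phi> ` U) ?H" by (rule smooth_on_open_iff[OF glued_chart_open[OF U(1)]])
  have ev: "\<forall>\<^sub>F u in at u0. \<phi> (\<kappa> u) \<in> ES m"
  proof (rule eventually_mono[OF eventually_at_in_open'[OF D u0D]])
    fix u assume "u \<in> D"
    then show "\<phi> (\<kappa> u) \<in> ES m" using chart_image[OF premanifold_glued U(1)] by (auto simp: D_def)
  qed
  have "((\<lambda>u. ?H (\<phi> (\<kappa> u))) has_real_derivative (\<Sum>j<m. partial j ?H (\<phi> (\<kappa> u0)) * d j)) (at u0)"
    by (rule smooth_chain_curve[OF H _ d ev]) (use U(2) x in auto)
  then have 0: "((\<lambda>u. ?H (\<phi> (\<kappa> u))) has_real_derivative 0) (at u0)" using crit by (simp add: x)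
  obtain d' where d': "d' > 0" "(step has_real_derivative d') (at (1 - u0))"
    using DERIV_step[of "1 - u0"] u0 by auto
  let ?B = "a (\<gamma> e 1) + - a (\<gamma> e 0)"
  have "((\<lambda>u. step (1 - u)) has_real_derivative d' * (- 1)) (at u0)"
    by (rule DERIV_chain2[where g = "\<lambda>u. 1 - u", OF d'(2)]) (auto intro!: derivative_eq_intros)
  then have "((\<lambda>u. a (\<gamma> e 0) + ?B * step (1 - u)) has_real_derivative ?B * (d' * (- 1))) (at u0)"
    by (auto intro!: derivative_eq_intros)
  then have "((\<lambda>u. ?H (\<phi> (\<kappa> u))) has_real_derivative ?B * (d' * (- 1))) (at u0)"
  proof (rule has_field_derivative_transform_within_open[OF _ D u0D])
    fix u assume u: "u \<in> D"
    then have "?H (\<phi> (\<kappa> u)) = height (\<kappa> u)"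
      using inv_into_f_f[OF chart_inj[OF premanifold_glued U(1)]] by (simp add: D_def)
    also have "\<dots> = height (enc (Inr (e, y, par v e u)))" using tube_eq[OF v y] u by (simp add: \<kappa>_def D_def)
    also have "\<dots> = a (\<gamma> e 0) + ?B * step (1 - u)"
      using tube_glued(3)[OF e y, of "par v e u"] u by (simp add: D_def par_def v_def)
    finally show "a (\<gamma> e 0) + ?B * step (1 - u) = ?H (\<phi> (\<kappa> u))" by simp
  qed
  then have "?B * (d' * (- 1)) = 0" using 0 by (rule DERIV_unique)
  then show False using d'(1) ends_height[OF e] by simp
qed

text \<open>The height is constant on the nonempty open inner core. Every vertex of \<open>G\<close>
  thereby becomes a vertex of the Reeb graph, whatever its degree.\<close>

lemma critical_core:
  assumes v: "v \<in> verts G"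
  shows "\<exists>p\<in>fibre v. critical_point m glued height p"
proof -
  obtain q where q: "q \<in> inner_core v" using inner_core_nonempty[OF v] by blast
  have qc: "q \<in> core v" using q inner_core_subset by blast
  have IN: "inner_core v \<subseteq> N v" using inner_core_subset core_subset[OF v] by blast
  have pG: "\<psi> v q \<in> points glued" by (rule core_glued[OF v qc])
  obtain U \<phi> where U: "(U, \<phi>) \<in> atlas glued" "\<psi> v q \<in> U" by (rule premanifold_cover[OF premanifold_glued pG])
  let ?W = "\<psi> v ` inner_core v"
  obtain S where S: "open S" "\<phi> ` (U \<inter> ?W) = \<phi> ` U \<inter> S"
    by (rule chart_image_Int_open[OF premanifold_glued U(1) openin_glued_image[OF v inner_core_open[OF v] IN]])
  obtain S' where S': "open S'" "\<phi> ` U = ES m \<inter> S'" using glued_chart_open[OF U(1)] unfolding openin_Euclidean_space by blast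
  have o: "openin (Euclidean_space m) (\<phi> ` (U \<inter> ?W))"
    unfolding openin_Euclidean_space S(2) S'(2) using S(1) S'(1) by (intro exI[of _ "S' \<inter> S"]) auto
  have "partial i (height \<circ> inv_into U \<phi>) (\<phi> (\<psi> v q)) = 0" if i: "i < m" for i
  proof -
    have "partial i (height \<circ> inv_into U \<phi>) (\<phi> (\<psi> v q)) = partial i (\<lambda>_. a v) (\<phi> (\<psi> v q))"
    proof (rule partial_cong[OF o _ i])
      show "\<phi> (\<psi> v q) \<in> \<phi> ` (U \<inter> ?W)" using U(2) q by blast
      fix z assume "z \<in> \<phi> ` (U \<inter> ?W)"
      obtain p' where p': "\<psi> v p' \<in> U" "z = \<phi> (\<psi> v p')" "p' \<in> inner_core v" using \<open>z \<in> \<phi> ` (U \<inter> ?W)\<close> by blast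
      then show "(height \<circ> inv_into U \<phi>) z = a v"
        using inv_into_f_f[OF chart_inj[OF premanifold_glued U(1)]] height_core[OF v subsetD[OF inner_core_subset]] by simp
    qed
    then show ?thesis by (simp add: partial_def)
  qed
  then have "critical_point m glued height (\<psi> v q)" using U by (auto simp: critical_point_def)
  moreover have "\<psi> v q \<in> fibre v" using pG proj_core[OF v qc] by (simp add: fibre_def)
  ultimately show ?thesis by blast
qed

lemma critical_pointD:
  assumes "critical_point m glued height p"
  shows "p \<in> points glued" "proj p \<in> verts G" "height p = a (proj p)"
proof -
  show pG: "p \<in> points glued"
    using assms chart_subset[OF premanifold_glued] by (force simp: critical_point_def)
  have "proj p \<in> verts G \<and> height p = a (proj p)"
    using pG
  proof (cases rule: glued_pointE)
    case (core v q)
    then show ?thesis using proj_core height_core by simp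
  next
    case (tube e y t)
    then show ?thesis using no_critical_tube[OF tube(1-4)] assms by simp
  qed
  then show "proj p \<in> verts G" "height p = a (proj p)" by auto
qed

lemma finite_critical_values: "finite (critical_values m glued height)"
proof (rule finite_subset)
  show "critical_values m glued height \<subseteq> a ` verts G"
    using critical_pointD by (auto simp: critical_values_def)
qed (use fin_G in \<open>simp add: finite_graph_def\<close>)

lemma topspace_reeb: "topspace (reeb_space (mtop glued) height) = fibre ` topspace (gtop G)"
  using homeomorphic_imp_surjective_map[OF fibre_homeomorphic] by simp

lemma reeb_verts_eq: "reeb_verts m glued height = fibre ` verts G"
proof (intro equalityI subsetI)
  fix w assume "w \<in> reeb_verts m glued height"
  then obtain g p where g: "w = fibre g" "p \<in> fibre g" "critical_point m glued height p"
    by (auto simp: reeb_verts_def topspace_reeb)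
  then have "g = proj p" by (simp add: fibre_def)
  then show "w \<in> fibre ` verts G" using critical_pointD(2)[OF g(3)] g(1) by simp
next
  fix w assume "w \<in> fibre ` verts G"
  then obtain v where v: "v \<in> verts G" "w = fibre v" by blast
  then show "w \<in> reeb_verts m glued height"
    using critical_core[OF v(1)] verts_in_top by (auto simp: reeb_verts_def topspace_reeb)
qed

text \<open>The edges of both graphs are the components of the complement of the vertices, and a
  homeomorphism that matches the vertices matches these components.\<close>

lemma graph_isomorphism_fibre: "graph_isomorphism G (reeb_graph m glued height) fibre"
proof -
  let ?R = "reeb_space (mtop glued) height"
  have inj: "inj_on fibre (topspace (gtop G))" using homeomorphic_imp_injective_map[OF fibre_homeomorphic] .
  have top: "fibre ` (topspace (gtop G) - verts G) = topspace ?R - fibre ` verts G"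
    unfolding topspace_reeb by (rule inj_on_image_set_diff[OF inj]) (use verts_in_top in auto)
  have "homeomorphic_map (subtopology (gtop G) (topspace (gtop G) - verts G)) (subtopology ?R (topspace ?R - fibre ` verts G)) fibre"
    by (rule homeomorphic_map_subtopologies[OF fibre_homeomorphic]) (use top in \<open>auto simp: Int_absorb1\<close>)
  from homeomorphic_map_connected_components_of[OF this]
  have "connected_components_of (subtopology ?R (topspace ?R - fibre ` verts G)) = (`) fibre ` edges G"
    unfolding edge_components[OF fin_G] .
  then show ?thesis using fibre_homeomorphic by (simp add: graph_isomorphism_def reeb_graph_def reeb_verts_eq)
qed

section \<open>Slice charts and the preimages of edge points and of regular neighborhoods\<close>

lemma edge_pointE:
  assumes "e \<in> edges G" "g \<in> e"
  obtains t where "0 < t" "t < 1" "g = \<gamma> e t"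
proof -
  have "g \<in> \<gamma> e ` {0<..<1}" unfolding characteristic_mapD(1)[OF fin_G assms(1) \<gamma>[OF assms(1)]] by (rule assms(2))
  then show ?thesis using that by auto
qed

text \<open>A chart of \<open>\<Phi> e\<close> with the depth appended as last coordinate. The shift
  by \<open>c\<close> puts the points of depth \<open>c\<close> on the hyperplane, so that one chart
  exhibits both the fibre at depth \<open>c\<close> as a slice of dimension \<open>m - 1\<close> and
  the part of depth at least \<open>c\<close> as a half space.\<close>

lemma tube_chart:
  fixes c :: real
  assumes v: "v \<in> verts G" and e: "e \<in> inc v" and V: "(V, \<theta>) \<in> atlas (\<Phi> e)"
  defines "U \<equiv> (\<lambda>z. \<psi> v (T v e z)) ` (V \<times> {0<..<1})"
    and "\<chi>' \<equiv> \<lambda>x. (\<theta> (X v (inv_\<psi> v x)))(m - 1 := \<rho> v (inv_\<psi> v x) - c)"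
  shows "(U, \<chi>') \<in> maximal_atlas m glued" "openin (Euclidean_space m) (\<chi>' ` U)"
    and "\<And>y u. y \<in> V \<Longrightarrow> 0 < u \<Longrightarrow> u < 1 \<Longrightarrow> \<chi>' (\<psi> v (T v e (y, u))) = (\<theta> y)(m - 1 := u - c)"
proof -
  note e' = inc_edges[OF e]
  note P\<Phi> = \<Phi>_pre[OF e'] and P\<Gamma> = \<Gamma>_pre[OF v]
  note cV = premanifold_chart[OF P\<Phi> V]
  let ?A = "{q \<in> C v. E v q = e \<and> X v q \<in> V \<and> \<rho> v q \<in> {0<..<1}}"
  have val: "inv_\<psi> v (\<psi> v (T v e (y, u))) = T v e (y, u)" "X v (T v e (y, u)) = y" "\<rho> v (T v e (y, u)) = u"
    "T v e (y, u) \<in> ?A"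
    if "y \<in> V" "0 < u" "u < 1" for y u
  proof -
    have y: "y \<in> points (\<Phi> e)" using that(1) cV(4) by blast
    show "inv_\<psi> v (\<psi> v (T v e (y, u))) = T v e (y, u)" using tube_point(1)[OF v e y that(2,3)] v by simp
    show "X v (T v e (y, u)) = y" "\<rho> v (T v e (y, u)) = u" "T v e (y, u) \<in> ?A"
      using T_facts[OF v e y, of u] that by auto
  qed
  have UA: "U = \<psi> v ` ?A"
  proof (intro equalityI subsetI)
    fix x assume "x \<in> U"
    then show "x \<in> \<psi> v ` ?A" using val(4) by (auto simp: U_def)
  next
    fix x assume "x \<in> \<psi> v ` ?A"
    then obtain q where q: "q \<in> ?A" "x = \<psi> v q" by blast
    then have "x = \<psi> v (T v e (X v q, \<rho> v q))" using C_facts(6)[OF v, of q] by auto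
    then show "x \<in> U" using q(1) by (auto simp: U_def)
  qed
  have AN: "?A \<subseteq> N v"
  proof
    fix q assume "q \<in> ?A"
    then have "q \<in> C v" "0 < \<rho> v q" by auto
    then show "q \<in> N v" using C_facts(7)[OF v] unfolding N_iff[OF v] by simp
  qed
  have Ao: "openin (mtop (\<Gamma> v)) ?A"
  proof -
    have "openin (subtopology (mtop (\<Gamma> v)) {q \<in> C v. E v q = e})
        {q \<in> topspace (subtopology (mtop (\<Gamma> v)) {q \<in> C v. E v q = e}). X v q \<in> V}"
      by (rule openin_continuous_map_preimage[OF smap_continuous[OF X_smooth[OF v e]] cV(1)])
    then have "openin (mtop (\<Gamma> v)) {q \<in> topspace (subtopology (mtop (\<Gamma> v)) {q \<in> C v. E v q = e}). X v q \<in> V}"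
      using E_open[OF v e] openin_trans_full by blast
    moreover have "openin (mtop (\<Gamma> v)) {q \<in> C v. \<rho> v q \<in> {0<..<1}}" by (rule \<rho>_preimage_open[OF v]) simp
    ultimately have "openin (mtop (\<Gamma> v)) ({q \<in> topspace (subtopology (mtop (\<Gamma> v)) {q \<in> C v. E v q = e}). X v q \<in> V} \<inter>
        {q \<in> C v. \<rho> v q \<in> {0<..<1}})" by (rule openin_Int)
    moreover have "{q \<in> topspace (subtopology (mtop (\<Gamma> v)) {q \<in> C v. E v q = e}). X v q \<in> V} \<inter>
        {q \<in> C v. \<rho> v q \<in> {0<..<1}} = ?A" using C_facts(7)[OF v] by auto
    ultimately show ?thesis by simp
  qed
  have Uo: "openin (mtop glued) U" unfolding UA by (rule openin_glued_image[OF v Ao AN])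
  show chi: "\<chi>' (\<psi> v (T v e (y, u))) = (\<theta> y)(m - 1 := u - c)" if "y \<in> V" "0 < u" "u < 1" for y u
    unfolding \<chi>'_def val(1-3)[OF that] ..
  have \<theta>ES: "\<theta> y \<in> ES (m - 1)" if "y \<in> V" for y using cV(2) that by blast
  have \<theta>upd: "((\<theta> y)(m - 1 := w))(m - 1 := 0) = \<theta> y" if "y \<in> V" for y w
    using \<theta>ES[OF that] by (auto simp: mem_ES fun_eq_iff)
  have m1: "m - 1 < m" using m by simp
  obtain S where S: "open S" "\<theta> ` V = ES (m - 1) \<inter> S"
  proof -
    have "openin (Euclidean_space (m - 1)) (\<theta> ` V)"
    proof (cases "openin (half_space (m - 1)) (\<theta> ` V)")
      case True
      \<comment> \<open>\<open>\<Phi> e\<close> is closed, so a chart into the half space misses the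
        hyperplane and its image is open in the full space of dimension
        \<open>m - 1\<close>.\<close>
      have nb: "\<theta> y (m - 1 - 1) \<noteq> 0" if "y \<in> V" for y
        using boundary_pointI[OF _ V that True] m \<Phi>_boundary[OF e'] by auto
      obtain S where S: "open S" "\<theta> ` V = {x \<in> ES (m - 1). 0 \<le> x (m - 1 - 1)} \<inter> S"
        using True openin_half_space by blast
      have "\<theta> ` V = ES (m - 1) \<inter> (S \<inter> {x. 0 < x (m - 1 - 1)})"
      proof (intro equalityI subsetI)
        fix z assume z: "z \<in> \<theta> ` V"
        then have "z (m - 1 - 1) \<noteq> 0" using nb by blast
        then show "z \<in> ES (m - 1) \<inter> (S \<inter> {x. 0 < x (m - 1 - 1)})" using z unfolding S(2) by auto
      qed (use S(2) in auto)
      moreover have "open (S \<inter> {x. 0 < x (m - 1 - 1)})"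
        using S(1) by (intro open_Int open_Collect_less continuous_on_coord continuous_intros)
      ultimately show ?thesis unfolding openin_Euclidean_space by blast
    qed (use smooth_manifold_chart_image[OF \<Phi>_smooth[OF e'] V] in auto)
    then show ?thesis using that unfolding openin_Euclidean_space by blast
  qed
  have img: "\<chi>' ` U = ES m \<inter> ((\<lambda>z. z(m - 1 := 0)) -` S \<inter> {z. 0 < z (m - 1) + c} \<inter> {z. z (m - 1) + c < 1})"
  proof (intro equalityI subsetI)
    fix z assume "z \<in> \<chi>' ` U"
    then obtain y u where y: "y \<in> V" "0 < u" "u < 1" "z = (\<theta> y)(m - 1 := u - c)" using chi by (auto simp: U_def)
    have "z \<in> ES m" unfolding y(4) by (rule ES_upd[OF ES_mono[OF _ \<theta>ES[OF y(1)]] m1]) simp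
    moreover have "z(m - 1 := 0) \<in> S" using \<theta>upd[OF y(1)] S(2) y(1) unfolding y(4) by blast
    ultimately show "z \<in> ES m \<inter> ((\<lambda>z. z(m - 1 := 0)) -` S \<inter> {z. 0 < z (m - 1) + c} \<inter> {z. z (m - 1) + c < 1})"
      using y by simp
  next
    fix z assume z: "z \<in> ES m \<inter> ((\<lambda>z. z(m - 1 := 0)) -` S \<inter> {z. 0 < z (m - 1) + c} \<inter> {z. z (m - 1) + c < 1})"
    have "z(m - 1 := 0) \<in> ES (m - 1)"
      unfolding mem_ES
    proof (intro allI impI)
      fix i assume "i \<ge> m - 1"
      then have "i = m - 1 \<or> i \<ge> m" by linarith
      then show "(z(m - 1 := 0)) i = 0" using z by (auto simp: mem_ES)
    qed
    then have "z(m - 1 := 0) \<in> \<theta> ` V" unfolding S(2) using z by simp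
    then obtain y where y: "y \<in> V" "z(m - 1 := 0) = \<theta> y" by blast
    have "z = (\<theta> y)(m - 1 := (z (m - 1) + c) - c)" unfolding y(2)[symmetric] by simp
    then have "z = \<chi>' (\<psi> v (T v e (y, z (m - 1) + c)))" using chi[OF y(1), of "z (m - 1) + c"] z by simp
    then show "z \<in> \<chi>' ` U" using y(1) z by (auto simp: U_def)
  qed
  have proj_img: "z(m - 1 := 0) \<in> \<theta> ` V" "0 < z (m - 1) + c" "z (m - 1) + c < 1" if z: "z \<in> \<chi>' ` U" for z
  proof -
    obtain y u where y: "y \<in> V" "0 < u" "u < 1" "z = (\<theta> y)(m - 1 := u - c)" using chi z by (auto simp: U_def)
    show "z(m - 1 := 0) \<in> \<theta> ` V" unfolding y(4) \<theta>upd[OF y(1)] using y(1) by blast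
    show "0 < z (m - 1) + c" "z (m - 1) + c < 1" using y by auto
  qed
  show \<chi>o: "openin (Euclidean_space m) (\<chi>' ` U)"
  proof -
    have "continuous_on UNIV (\<lambda>z :: nat \<Rightarrow> real. z(m - 1 := 0))"
    proof (rule continuous_on_coordinatewise_then_product)
      show "continuous_on UNIV (\<lambda>z :: nat \<Rightarrow> real. (z(m - 1 := 0)) i)" for i
        by (cases "i = m - 1") (simp_all add: continuous_on_coord)
    qed
    then have "open ((\<lambda>z :: nat \<Rightarrow> real. z(m - 1 := 0)) -` S)" using S(1) by (rule open_vimage[rotated])
    then have "open ((\<lambda>z. z(m - 1 := 0)) -` S \<inter> {z. 0 < z (m - 1) + c} \<inter> {z. z (m - 1) + c < 1})"
      by (intro open_Int open_Collect_less continuous_on_add continuous_on_coord continuous_on_const)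
    then show ?thesis unfolding img openin_Euclidean_space by blast
  qed
  have invU: "smap m m glued U (\<Gamma> v) (inv_\<psi> v)"
    by (rule smap_subset[OF smap_inv_\<psi>[OF v]]) (use UA AN in blast)
  have invA: "inv_\<psi> v x \<in> ?A" if x: "x \<in> U" for x
  proof -
    obtain y u where "y \<in> V" "0 < u" "u < 1" "x = \<psi> v (T v e (y, u))" using x by (auto simp: U_def)
    then show ?thesis using val(1,4) by simp
  qed
  have sm: "smap m m glued U (euclidean_mfd m) \<chi>'"
  proof (rule smap_into_euclidean[OF premanifold_glued])
    fix j assume j: "j < m"
    show "msmooth m glued U (\<lambda>x. \<chi>' x j)"
    proof (cases "j = m - 1")
      case True
      have "msmooth m (\<Gamma> v) ?A (\<lambda>q. \<rho> v q + - c)"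
        by (intro msmooth_add[OF P\<Gamma>] msmooth_const[OF P\<Gamma>] msmooth_subset[OF \<rho>_smooth[OF v]]) auto
      from msmooth_compose[OF premanifold_glued P\<Gamma> invU this]
      have "msmooth m glued U (\<lambda>x. \<rho> v (inv_\<psi> v x) + - c)" using invA by blast
      then show ?thesis by (simp add: \<chi>'_def True)
    next
      case False
      then have "j < m - 1" using j by simp
      from smap_msmooth[OF X_smooth[OF v e] V this]
      have "msmooth m (\<Gamma> v) ?A (\<lambda>q. \<theta> (X v q) j)" by (rule msmooth_subset) auto
      from msmooth_compose[OF premanifold_glued P\<Gamma> invU this]
      have "msmooth m glued U (\<lambda>x. \<theta> (X v (inv_\<psi> v x)) j)" using invA by blast
      then show ?thesis using False by (simp add: \<chi>'_def)
    qed
  next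
    fix x assume "x \<in> U"
    then have "\<chi>' x \<in> \<chi>' ` U" by blast
    then show "\<chi>' x \<in> ES m" unfolding img by blast
  qed
  define g where "g z = \<psi> v (T v e (inv_into V \<theta> (z(m - 1 := 0)), z (m - 1) + c))" for z
  have EU: "\<chi>' ` U \<subseteq> ES m" unfolding img by blast
  have 1: "smap m (m - 1) (euclidean_mfd m) (\<chi>' ` U) (euclidean_mfd (m - 1)) (\<lambda>z. z(m - 1 := 0))"
  proof (rule smap_into_euclidean[OF premanifold_euclidean])
    fix j assume j: "j < m - 1"
    then show "msmooth m (euclidean_mfd m) (\<chi>' ` U) (\<lambda>z. (z(m - 1 := 0)) j)"
      using smooth_on_coord[OF EU, of j] msmooth_euclidean[OF EU] by simp
  next
    fix z assume "z \<in> \<chi>' ` U"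
    then show "z(m - 1 := 0) \<in> ES (m - 1)" using proj_img(1) cV(2) by blast
  qed
  have 2: "smap m (m - 1) (euclidean_mfd m) (\<chi>' ` U) (\<Phi> e) (\<lambda>z. inv_into V \<theta> (z(m - 1 := 0)))"
    by (rule smap_compose[OF premanifold_euclidean premanifold_euclidean 1 smap_chart_inverse[OF P\<Phi> V]]) (rule proj_img(1))
  have 3: "msmooth m (euclidean_mfd m) (\<chi>' ` U) (\<lambda>z. z (m - 1) + c)"
  proof (intro msmooth_add premanifold_euclidean msmooth_const)
    show "msmooth m (euclidean_mfd m) (\<chi>' ` U) (\<lambda>z. z (m - 1))"
      using smooth_on_coord[OF EU] msmooth_euclidean[OF EU] by blast
  qed
  have gs: "smap m m (euclidean_mfd m) (\<chi>' ` U) glued g"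
    unfolding g_def[abs_def]
  proof (rule smap_compose[OF premanifold_euclidean premanifold_cylinder[OF P\<Phi>, unfolded Sm]
        smap_Pair[OF premanifold_euclidean P\<Phi> 2 3, unfolded Sm] tube_smap[OF v e]])
    fix z assume "z \<in> \<chi>' ` U"
    then show "(inv_into V \<theta> (z(m - 1 := 0)), z (m - 1) + c) \<in> points (\<Phi> e) \<times> {0<..<1}"
      using proj_img[of z] cV(4) inv_into_into[of "z(m - 1 := 0)" \<theta> V] by auto
  qed
  show "(U, \<chi>') \<in> maximal_atlas m glued"
  proof (rule maximal_atlasI[OF premanifold_glued Uo \<chi>o sm gs])
    fix x assume "x \<in> U"
    then obtain y u where y: "y \<in> V" "0 < u" "u < 1" "x = \<psi> v (T v e (y, u))" by (auto simp: U_def)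
    show "g (\<chi>' x) = x"
      unfolding y(4) chi[OF y(1-3)] g_def \<theta>upd[OF y(1)] inv_into_f_f[OF cV(5) y(1)] by simp
  qed
qed

text \<open>The first alternative is the one for a point of an edge, the second the one for a
  regular neighborhood of a vertex. In both, \<open>S\<close> is described within the tube by the
  depth alone, which becomes a condition on the sign of the last coordinate.\<close>

lemma tube_slice_chart:
  fixes c :: real
  assumes v: "v \<in> verts G" and e: "e \<in> inc v" and y: "y \<in> points (\<Phi> e)" and c: "0 < c" "c < 1"
    and S: "(\<forall>z\<in>points (\<Phi> e). \<forall>u\<in>{0<..<1}. \<psi> v (T v e (z, u)) \<in> S \<longleftrightarrow> u = c) \<and> k = m - 1 \<or>
      (\<forall>z\<in>points (\<Phi> e). \<forall>u\<in>{0<..<1}. \<psi> v (T v e (z, u)) \<in> S \<longleftrightarrow> c \<le> u) \<and> k = m"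
  shows "\<psi> v (T v e (y, c)) \<in> \<Union> (fst ` slice_charts k m glued S)"
proof -
  obtain V \<theta> where V: "(V, \<theta>) \<in> atlas (\<Phi> e)" "y \<in> V" by (rule premanifold_cover[OF \<Phi>_pre[OF inc_edges[OF e]] y])
  note cV = premanifold_chart[OF \<Phi>_pre[OF inc_edges[OF e]] V(1)]
  let ?U = "(\<lambda>z. \<psi> v (T v e z)) ` (V \<times> {0<..<1})"
  let ?\<chi> = "\<lambda>x. (\<theta> (X v (inv_\<psi> v x)))(m - 1 := \<rho> v (inv_\<psi> v x) - c)"
  note t = tube_chart[OF v e V(1), where c = c]
  have slice: "?\<chi> ` (?U \<inter> S) = ?\<chi> ` ?U \<inter> Y"
    if *: "\<And>z u. z \<in> V \<Longrightarrow> 0 < u \<Longrightarrow> u < 1 \<Longrightarrow> \<psi> v (T v e (z, u)) \<in> S \<longleftrightarrow> (\<theta> z)(m - 1 := u - c) \<in> Y" for Y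
  proof -
    have "x \<in> S \<longleftrightarrow> ?\<chi> x \<in> Y" if x: "x \<in> ?U" for x
    proof -
      obtain z u where z: "z \<in> V" "0 < u" "u < 1" "x = \<psi> v (T v e (z, u))" using x by auto
      show ?thesis unfolding z(4) t(3)[OF z(1-3)] by (rule *[OF z(1-3)])
    qed
    then show ?thesis by blast
  qed
  have \<theta>ES: "\<theta> z \<in> ES (m - 1)" if "z \<in> V" for z using cV(2) that by blast
  have E1: "(\<theta> z)(m - 1 := u - c) \<in> ES (m - 1) \<longleftrightarrow> u = c" if "z \<in> V" for z u
    using \<theta>ES[OF that] by (auto simp: mem_ES)
  have E2: "(\<theta> z)(m - 1 := u - c) \<in> topspace (half_space m) \<longleftrightarrow> c \<le> u" if "z \<in> V" for z u
  proof -
    have "(\<theta> z)(m - 1 := u - c) \<in> ES m" by (rule ES_upd[OF ES_mono[OF _ \<theta>ES[OF that]]]) (use m in auto)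
    then show ?thesis by (simp add: topspace_half_space)
  qed
  have "?\<chi> ` (?U \<inter> S) = ?\<chi> ` ?U \<inter> ES k \<or> ?\<chi> ` (?U \<inter> S) = ?\<chi> ` ?U \<inter> topspace (half_space k)"
    using S
  proof
    assume A: "(\<forall>z\<in>points (\<Phi> e). \<forall>u\<in>{0<..<1}. \<psi> v (T v e (z, u)) \<in> S \<longleftrightarrow> u = c) \<and> k = m - 1"
    have "?\<chi> ` (?U \<inter> S) = ?\<chi> ` ?U \<inter> ES (m - 1)"
      by (rule slice, subst E1) (use A cV(4) in auto)
    then show ?thesis using A by simp
  next
    assume A: "(\<forall>z\<in>points (\<Phi> e). \<forall>u\<in>{0<..<1}. \<psi> v (T v e (z, u)) \<in> S \<longleftrightarrow> c \<le> u) \<and> k = m"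
    have "?\<chi> ` (?U \<inter> S) = ?\<chi> ` ?U \<inter> topspace (half_space m)"
      by (rule slice, subst E2) (use A cV(4) in auto)
    then show ?thesis using A by simp
  qed
  then have "(?U, ?\<chi>) \<in> slice_charts k m glued S" using t(1,2) by (simp add: slice_charts_def)
  then have "?U \<in> fst ` slice_charts k m glued S" by (rule image_eqI[rotated]) simp
  moreover have "\<psi> v (T v e (y, c)) \<in> ?U" using V(2) c by (intro imageI) simp
  ultimately show ?thesis by (rule UnionI)
qed

text \<open>At an interior point of \<open>S\<close>, a chart shrunk into \<open>S\<close> is a
  slice chart of full dimension, by the alternative without a half space.\<close>

lemma open_slice_chart:
  assumes W: "openin (mtop glued) W" "x \<in> W" "W \<subseteq> S"
  shows "x \<in> \<Union> (fst ` slice_charts m m glued S)"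
proof -
  have x: "x \<in> points glued" using openin_subset[OF W(1)] W(2) by blast
  obtain U \<phi> where U: "(U, \<phi>) \<in> atlas glued" "x \<in> U" by (rule premanifold_cover[OF premanifold_glued x])
  note cU = premanifold_chart[OF premanifold_glued U(1)]
  obtain S1 where S1: "open S1" "\<phi> ` (U \<inter> W) = \<phi> ` U \<inter> S1"
    by (rule chart_image_Int_open[OF premanifold_glued U(1) W(1)])
  obtain S' where S': "open S'" "\<phi> ` U = ES m \<inter> S'" using glued_chart_open[OF U(1)] unfolding openin_Euclidean_space by blast
  have o: "openin (Euclidean_space m) (\<phi> ` (U \<inter> W))"
    unfolding openin_Euclidean_space S1(2) S'(2) using S1(1) S'(1) by (intro exI[of _ "S' \<inter> S1"]) auto
  have max: "(U \<inter> W, \<phi>) \<in> maximal_atlas m glued"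
    by (rule maximal_atlasI[OF premanifold_glued openin_Int[OF cU(1) W(1)] o
          smap_subset[OF smap_chart[OF premanifold_glued U(1)]] smap_subset[OF smap_chart_inverse[OF premanifold_glued U(1)]]])
       (auto simp: inv_into_f_f[OF cU(5)])
  have "U \<inter> W \<inter> S = U \<inter> W" using W(3) by blast
  moreover have "\<phi> ` (U \<inter> W) \<inter> ES m = \<phi> ` (U \<inter> W)" using cU(2) by blast
  ultimately have "(U \<inter> W, \<phi>) \<in> slice_charts m m glued S" using max o by (simp add: slice_charts_def)
  then have "U \<inter> W \<in> fst ` slice_charts m m glued S" by (rule image_eqI[rotated]) simp
  then show ?thesis by (rule UnionI) (use U(2) W(2) in simp)
qed

lemma edge_preimage:
  assumes e: "e \<in> edges G" and g: "g \<in> e"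
  shows "submanifold_diffeomorphic (m - 1) m glued (reeb_preimage (mtop glued) height {fibre g}) (\<Phi> e)"
proof -
  note P\<Phi> = \<Phi>_pre[OF e]
  obtain t where t: "0 < t" "t < 1" "g = \<gamma> e t" by (rule edge_pointE[OF e g])
  define v where "v = \<gamma> e 0"
  have v: "v \<in> verts G" "e \<in> inc v" using ends_verts(1)[OF e] inc_end(1)[OF e] by (auto simp: v_def)
  define c where "c = par v e t"
  have c: "0 < c" "c < 1" using par_01[of v e t] t by (auto simp: c_def)
  define S where "S = reeb_preimage (mtop glued) height {fibre g}"
  have S: "S = {x \<in> points glued. proj x = \<gamma> e t}"
    using reeb_preimage_fibre[of "{g}"] t(3) by (auto simp: S_def)
  have S': "S = (\<lambda>y. \<psi> v (T v e (y, c))) ` points (\<Phi> e)"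
    unfolding S fibre_edge[OF e t(1,2)] by (rule image_cong[OF refl]) (use tube_at(1)[OF v _ t(1,2)] c_def in simp)
  have SN: "S \<subseteq> \<psi> v ` N v" unfolding S' using tube_point(1)[OF v _ c] by blast
  have val: "inv_\<psi> v (\<psi> v (T v e (y, c))) = T v e (y, c)" "X v (T v e (y, c)) = y" "T v e (y, c) \<in> {q \<in> C v. E v q = e}"
    if y: "y \<in> points (\<Phi> e)" for y
    using tube_point(1)[OF v y c] v T_facts[OF v y, of c] c by auto
  have mem: "\<psi> v (T v e (z, u)) \<in> S \<longleftrightarrow> u = c" if z: "z \<in> points (\<Phi> e)" "u \<in> {0<..<1}" for z u
  proof -
    have u: "0 < u" "u < 1" using z(2) by auto
    note p = par_01[of v e u]
    have x: "\<psi> v (T v e (z, u)) \<in> points glued" "proj (\<psi> v (T v e (z, u))) = \<gamma> e (par v e u)"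
      unfolding tube_eq[OF v z(1) u] using tube_glued[OF e z(1), of "par v e u"] p u by auto
    have "\<gamma> e (par v e u) = \<gamma> e t \<longleftrightarrow> par v e u = t"
      using \<gamma>_tube_inj(2)[OF e _ _ e t(1,2), of "par v e u"] p u by auto
    also have "\<dots> \<longleftrightarrow> u = c" by (auto simp: c_def)
    finally show ?thesis unfolding S using x by simp
  qed
  show ?thesis
    unfolding S_def[symmetric]
  proof (rule submanifold_diffeomorphicI[OF premanifold_glued P\<Phi>])
    show "m - 1 \<le> m" by simp
    show "S \<subseteq> points glued" unfolding S by blast
    show "S \<subseteq> \<Union> (fst ` slice_charts (m - 1) m glued S)"
    proof
      fix x assume "x \<in> S"
      then obtain y where y: "y \<in> points (\<Phi> e)" "x = \<psi> v (T v e (y, c))" unfolding S' by blast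
      show "x \<in> \<Union> (fst ` slice_charts (m - 1) m glued S)"
        unfolding y(2) by (rule tube_slice_chart[OF v y(1) c]) (use mem in blast)
    qed
    show "smap m (m - 1) glued S (\<Phi> e) (\<lambda>x. X v (inv_\<psi> v x))"
    proof (rule smap_compose[OF premanifold_glued \<Gamma>_pre[OF v(1)] smap_subset[OF smap_inv_\<psi>[OF v(1)] SN] X_smooth[OF v]])
      fix x assume "x \<in> S"
      then show "inv_\<psi> v x \<in> {q \<in> C v. E v q = e}" unfolding S' using val(1,3) by auto
    qed
    show "smap (m - 1) m (\<Phi> e) (points (\<Phi> e)) glued (\<lambda>y. \<psi> v (T v e (y, c)))" by (rule tube_fibre_smap[OF v c])
    show "(\<lambda>y. \<psi> v (T v e (y, c))) ` points (\<Phi> e) \<subseteq> S" unfolding S' by blast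
    show "\<psi> v (T v e (X v (inv_\<psi> v x), c)) = x" if x: "x \<in> S" for x
    proof -
      obtain y where y: "y \<in> points (\<Phi> e)" "x = \<psi> v (T v e (y, c))" using x unfolding S' by blast
      show ?thesis unfolding y(2) val(1,2)[OF y(1)] ..
    qed
    show "X v (inv_\<psi> v (\<psi> v (T v e (y, c)))) = y" if "y \<in> points (\<Phi> e)" for y
      unfolding val(1,2)[OF that] ..
  qed
qed

text \<open>Meant for functions that are the identity from 1 on. The map then is the identity on the
  inner core, so the two cases of the definition fit together smoothly at the inner end of the
  collar.\<close>

definition reparam :: "('g set \<Rightarrow> real \<Rightarrow> real) \<Rightarrow> 'g \<Rightarrow> 'b \<Rightarrow> 'b" where
  "reparam f v q = (if q \<in> C v then T v (E v q) (X v q, f (E v q) (\<rho> v q)) else q)"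

lemma reparam_collar:
  assumes v: "v \<in> verts G" and q: "q \<in> C v" "0 \<le> f (E v q) (\<rho> v q)" "f (E v q) (\<rho> v q) < 2"
  shows "reparam f v q \<in> C v" "E v (reparam f v q) = E v q" "X v (reparam f v q) = X v q"
    "\<rho> v (reparam f v q) = f (E v q) (\<rho> v q)"
  using T_facts[OF v C_facts(1,3)[OF v q(1)] q(2,3)] q(1) by (auto simp: reparam_def)

lemma reparam_comp:
  assumes v: "v \<in> verts G" and q: "q \<in> points (\<Gamma> v)"
    and f: "q \<in> C v \<Longrightarrow> 0 \<le> f (E v q) (\<rho> v q) \<and> f (E v q) (\<rho> v q) < 2 \<and> f' (E v q) (f (E v q) (\<rho> v q)) = \<rho> v q"
  shows "reparam f' v (reparam f v q) = q"
proof (cases "q \<in> C v")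
  case True
  then have f: "0 \<le> f (E v q) (\<rho> v q)" "f (E v q) (\<rho> v q) < 2" "f' (E v q) (f (E v q) (\<rho> v q)) = \<rho> v q" using f by auto
  note r = reparam_collar[where f = f, OF v True f(1,2)]
  have "reparam f' v (reparam f v q) = T v (E v (reparam f v q)) (X v (reparam f v q), f' (E v (reparam f v q)) (\<rho> v (reparam f v q)))"
    using r(1) by (simp add: reparam_def[of f'])
  also have "\<dots> = q" unfolding r(2-4) f(3) by (rule C_facts(6)[OF v True])
  finally show ?thesis .
qed (simp add: reparam_def)

lemma reparam_smap:
  assumes v: "v \<in> verts G" and f: "\<And>e. e \<in> inc v \<Longrightarrow> smooth_real (f e) UNIV" "\<And>e u. e \<in> inc v \<Longrightarrow> 1 \<le> u \<Longrightarrow> f e u = u"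
    and K: "\<And>q. q \<in> K \<Longrightarrow> q \<in> C v \<Longrightarrow> 0 \<le> f (E v q) (\<rho> v q) \<and> f (E v q) (\<rho> v q) < 2"
  shows "smap m m (\<Gamma> v) K (\<Gamma> v) (reparam f v)"
proof (rule smap_local[OF \<Gamma>_pre[OF v]])
  note P\<Gamma> = \<Gamma>_pre[OF v]
  fix q assume q: "q \<in> K" "q \<in> points (\<Gamma> v)"
  show "\<exists>W. openin (mtop (\<Gamma> v)) W \<and> q \<in> W \<and> smap m m (\<Gamma> v) (K \<inter> W) (\<Gamma> v) (reparam f v)"
  proof (cases "q \<in> inner_core v")
    case True
    have "smap m m (\<Gamma> v) (K \<inter> inner_core v) (\<Gamma> v) (reparam f v)"
    proof (rule smap_cong[OF P\<Gamma> smap_id[OF P\<Gamma>]])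
      fix p assume "p \<in> K \<inter> inner_core v"
      then have p: "p \<in> C v \<Longrightarrow> 1 \<le> \<rho> v p" by (auto simp: inner_core_def)
      show "p = reparam f v p"
      proof (cases "p \<in> C v")
        case True
        then show ?thesis using p f(2)[OF C_facts(1)[OF v True]] C_facts(6)[OF v True] by (simp add: reparam_def)
      qed (simp add: reparam_def)
    qed
    then show ?thesis using inner_core_open[OF v] True by blast
  next
    case False
    then have qC: "q \<in> C v" using inner_core_or_collar q(2) by blast
    define e where "e = E v q"
    have e: "e \<in> inc v" using C_facts(1)[OF v qC] by (simp add: e_def)
    note P\<Phi> = \<Phi>_pre[OF inc_edges[OF e]]
    let ?W = "{q \<in> C v. E v q = e}"
    have sub: "K \<inter> ?W \<subseteq> ?W" "K \<inter> ?W \<subseteq> C v" by auto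
    have 1: "smap m m (\<Gamma> v) (K \<inter> ?W) (cylinder (m - 1) (\<Phi> e)) (\<lambda>q. (X v q, f e (\<rho> v q)))"
      by (rule smap_Pair[OF P\<Gamma> P\<Phi> smap_subset[OF X_smooth[OF v e] sub(1)]
            msmooth_real[OF P\<Gamma> f(1)[OF e] msmooth_subset[OF \<rho>_smooth[OF v] sub(2)]], unfolded Sm])
    have "smap m m (\<Gamma> v) (K \<inter> ?W) (\<Gamma> v) (\<lambda>q. T v e (X v q, f e (\<rho> v q)))"
    proof (rule smap_compose[OF P\<Gamma> premanifold_cylinder[OF P\<Phi>, unfolded Sm] 1 T_smooth[OF v e]])
      fix p assume "p \<in> K \<inter> ?W"
      then show "(X v p, f e (\<rho> v p)) \<in> points (\<Phi> e) \<times> {0..<2}"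
        using K[of p] C_facts(3)[OF v, of p] by auto
    qed
    then have "smap m m (\<Gamma> v) (K \<inter> ?W) (\<Gamma> v) (reparam f v)"
      by (rule smap_cong[OF P\<Gamma>]) (simp add: reparam_def)
    then show ?thesis using E_open[OF v e] qC e_def by blast
  qed
qed

text \<open>On each incident edge the neighborhood is an initial arc, which by
  \<open>initial_arc\<close> ends at a single parameter of the fixed characteristic map. Depth at
  \<open>v\<close> decreases with the distance from \<open>v\<close> along the edge, so the arc
  corresponds to depths from some \<open>s e\<close> upwards. The vertex contributes the
  core.\<close>

lemma neighborhood_preimage:
  assumes v: "v \<in> verts G" and Nb: "regular_neighborhood G v Nb"
  shows "\<exists>s. (\<forall>e\<in>inc v. 0 < s e \<and> s e < 1) \<and>
    {x \<in> points glued. proj x \<in> Nb} = \<psi> v ` {q \<in> points (\<Gamma> v). q \<in> C v \<longrightarrow> s (E v q) \<le> \<rho> v q}"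
proof -
  have vN: "v \<in> Nb" "Nb \<subseteq> insert v (\<Union> (inc v))" using Nb by (auto simp: regular_neighborhood_def)
  have "\<exists>s. 0 < s \<and> s < 1 \<and> (\<forall>r. 0 < r \<and> r < 1 \<longrightarrow> (\<gamma> e (par v e r) \<in> Nb \<longleftrightarrow> s \<le> r))" if e: "e \<in> inc v" for e
  proof -
    note e' = inc_edges[OF e]
    \<comment> \<open>\<open>\<gamma> e\<close> oriented so as to start at \<open>v\<close>: its
      parameter \<open>t\<close> corresponds to depth \<open>1 - t\<close>. An arc up to
      \<open>u\<close> therefore gives the bound \<open>1 - u\<close> for the depth.\<close>
    define \<delta> where "\<delta> t = \<gamma> e (par v e (1 - t))" for t
    have \<delta>: "characteristic_map G e \<delta>"
      using \<gamma>[OF e'] characteristic_map_reverse[OF \<gamma>[OF e']] by (cases "v = \<gamma> e 0") (auto simp: \<delta>_def[abs_def] par_def)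
    note c = characteristic_mapD[OF fin_G e' \<delta>]
    have \<delta>0: "\<delta> 0 = v" using \<gamma>_par_1[OF e] by (simp add: \<delta>_def)
    have ne: "\<delta> 0 \<noteq> \<delta> 1" using dec \<delta> e' by (simp add: decorated_graph_def loopless_def)
    obtain \<gamma>' s' where \<gamma>': "characteristic_map G e \<gamma>'" "\<gamma>' 0 = v" "0 < s'" "s' < 1" "Nb \<inter> insert v e = \<gamma>' ` {0..s'}"
      using Nb e unfolding regular_neighborhood_def by meson
    obtain u where u: "0 < u" "u < 1" "\<gamma>' ` {0..s'} = \<delta> ` {0..u}"
      by (rule initial_arc[OF fin_G e' \<delta> \<gamma>'(1) ne _ \<gamma>'(3,4)]) (use \<gamma>'(2) \<delta>0 in auto)
    have "\<gamma> e (par v e r) \<in> Nb \<longleftrightarrow> 1 - u \<le> r" if r: "0 < r" "r < 1" for r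
    proof -
      have eq: "\<gamma> e (par v e r) = \<delta> (1 - r)" by (simp add: \<delta>_def)
      have in_e: "\<delta> (1 - r) \<in> e" using c(1) r by force
      have "\<delta> (1 - r) \<in> Nb \<longleftrightarrow> \<delta> (1 - r) \<in> \<delta> ` {0..u}" using in_e \<gamma>'(5) u(3) by blast
      also have "\<dots> \<longleftrightarrow> 1 - r \<le> u"
      proof
        assume "\<delta> (1 - r) \<in> \<delta> ` {0..u}"
        then obtain x where x: "0 \<le> x" "x \<le> u" "\<delta> (1 - r) = \<delta> x" by auto
        have "x \<noteq> 0" using x(3) in_e c(6) by metis
        then have "1 - r = x" using inj_onD[OF c(2) x(3)] x r u by simp
        then show "1 - r \<le> u" using x by simp
      qed (use r in auto)
      finally show ?thesis unfolding eq by linarith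
    qed
    then show ?thesis using u by (intro exI[of _ "1 - u"]) simp
  qed
  then obtain s where s: "\<And>e. e \<in> inc v \<Longrightarrow> 0 < s e \<and> s e < 1 \<and> (\<forall>r. 0 < r \<and> r < 1 \<longrightarrow> (\<gamma> e (par v e r) \<in> Nb \<longleftrightarrow> s e \<le> r))"
    by metis
  let ?K = "{q \<in> points (\<Gamma> v). q \<in> C v \<longrightarrow> s (E v q) \<le> \<rho> v q}"
  show ?thesis
  proof (intro exI[of _ s] conjI)
    show "\<forall>e\<in>inc v. 0 < s e \<and> s e < 1" using s by simp
    show "{x \<in> points glued. proj x \<in> Nb} = \<psi> v ` ?K"
    proof (intro equalityI subsetI)
      fix x assume "x \<in> {x \<in> points glued. proj x \<in> Nb}"
      then have x: "x \<in> points glued" "proj x \<in> Nb" by auto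
      show "x \<in> \<psi> v ` ?K"
      proof (cases "proj x = v")
        case True
        then have "x \<in> \<psi> v ` core v" using fibre_vertex[OF v] x(1) by blast
        then obtain q where q: "q \<in> core v" "x = \<psi> v q" by blast
        have "s (E v q) \<le> \<rho> v q" if "q \<in> C v"
          using s[OF C_facts(1)[OF v that]] q(1) that by (simp add: core_def)
        then have "q \<in> ?K" using q(1) by (simp add: core_def)
        then show ?thesis using q(2) by blast
      next
        case False
        then obtain e where e: "e \<in> inc v" "proj x \<in> e" using x(2) vN(2) by blast
        note e' = inc_edges[OF e(1)]
        obtain t where t: "0 < t" "t < 1" "proj x = \<gamma> e t" by (rule edge_pointE[OF e' e(2)])
        then obtain y where y: "y \<in> points (\<Phi> e)" "x = enc (Inr (e, y, t))" using fibre_edge[OF e' t(1,2)] x(1) by blast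
        define r where "r = par v e t"
        have r: "0 < r" "r < 1" "par v e r = t" using par_01[of v e t] t by (auto simp: r_def)
        have "\<gamma> e (par v e r) \<in> Nb \<longleftrightarrow> s e \<le> r" using s[OF e(1)] r(1,2) by blast
        then have "s e \<le> r" using r(3) x(2) t(3) by simp
        then have "T v e (y, r) \<in> ?K"
          using T_facts[OF v e(1) y(1), of r] C_facts(7)[OF v, of "T v e (y, r)"] r by simp
        then show ?thesis using tube_at(1)[OF v e(1) y(1) t(1,2)] y(2) r_def by blast
      qed
    next
      fix x assume "x \<in> \<psi> v ` ?K"
      then obtain q where q: "q \<in> points (\<Gamma> v)" "q \<in> C v \<Longrightarrow> s (E v q) \<le> \<rho> v q" "x = \<psi> v q" by blast
      show "x \<in> {x \<in> points glued. proj x \<in> Nb}"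
      proof (cases "q \<in> core v")
        case True
        then show ?thesis using core_glued[OF v True] proj_core[OF v True] vN(1) q(3) by simp
      next
        case False
        then have qC: "q \<in> C v" "\<rho> v q < 1" using not_core[OF q(1)] by auto
        note sq = s[OF C_facts(1)[OF v qC(1)]] and sr = q(2)[OF qC(1)]
        have pos: "0 < \<rho> v q" using sq sr by linarith
        then have qN: "q \<in> N v" using q(1) unfolding N_iff[OF v] by simp
        have "proj x \<in> Nb" unfolding q(3) proj_tube[OF v qN qC] using sq sr pos qC(2) by simp
        moreover have "x \<in> points glued" using qN v q(3) by (auto simp: points_glued)
        ultimately show ?thesis by simp
      qed
    qed
  qed
qed

text \<open>In \<open>\<Gamma> v\<close> the preimage becomes the set \<open>K\<close> of points
  with depth at least \<open>s e\<close> on each edge. The slides \<open>\<sigma> e\<close> move the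
  cut at depth \<open>s e\<close> to the boundary at depth 0 and fix all depths from 1 on;
  reparametrizing by them maps \<open>K\<close> to \<open>\<Gamma> v\<close>, and the maps
  \<open>\<tau> e\<close> give the inverse.\<close>

lemma vertex_preimage:
  assumes v: "v \<in> verts G" and Nb: "regular_neighborhood G v Nb"
  shows "submanifold_diffeomorphic m m glued (reeb_preimage (mtop glued) height (fibre ` Nb)) (\<Gamma> v)"
proof -
  note P\<Gamma> = \<Gamma>_pre[OF v]
  obtain s where s: "\<And>e. e \<in> inc v \<Longrightarrow> 0 < s e \<and> s e < 1"
    and im: "{x \<in> points glued. proj x \<in> Nb} = \<psi> v ` {q \<in> points (\<Gamma> v). q \<in> C v \<longrightarrow> s (E v q) \<le> \<rho> v q}"
    using neighborhood_preimage[OF v Nb] by blast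
  define K where "K = {q \<in> points (\<Gamma> v). q \<in> C v \<longrightarrow> s (E v q) \<le> \<rho> v q}"
  define S where "S = {x \<in> points glued. proj x \<in> Nb}"
  have SK: "S = \<psi> v ` K" unfolding S_def K_def by (rule im)
  have KN: "K \<subseteq> N v"
  proof
    fix q assume q: "q \<in> K"
    have "0 < \<rho> v q" if "q \<in> C v" using s[OF C_facts(1)[OF v that]] q that by (auto simp: K_def)
    then show "q \<in> N v" using q unfolding N_iff[OF v] by (simp add: K_def)
  qed
  have "\<exists>\<sigma> \<tau>. smooth_real \<sigma> UNIV \<and> smooth_real \<tau> UNIV \<and> (\<forall>u. \<tau> (\<sigma> u) = u) \<and> (\<forall>u. \<sigma> (\<tau> u) = u) \<and>
      strict_mono \<sigma> \<and> \<sigma> (s e) = 0 \<and> (\<forall>u\<ge>1. \<sigma> u = u)" if e: "e \<in> inc v" for e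
  proof -
    have "0 < s e" "s e < 1" using s[OF e] by auto
    then show ?thesis by (rule slide) (intro exI conjI allI impI)
  qed
  then obtain \<sigma> \<tau> where st: "\<And>e. e \<in> inc v \<Longrightarrow> smooth_real (\<sigma> e) UNIV \<and> smooth_real (\<tau> e) UNIV \<and>
      (\<forall>u. \<tau> e (\<sigma> e u) = u) \<and> (\<forall>u. \<sigma> e (\<tau> e u) = u) \<and> strict_mono (\<sigma> e) \<and> \<sigma> e (s e) = 0 \<and> (\<forall>u\<ge>1. \<sigma> e u = u)"
    by metis
  have \<sigma>: "smooth_real (\<sigma> e) UNIV" "\<tau> e (\<sigma> e u) = u" "1 \<le> u \<Longrightarrow> \<sigma> e u = u"
    and \<tau>: "smooth_real (\<tau> e) UNIV" "\<sigma> e (\<tau> e u) = u" "1 \<le> u \<Longrightarrow> \<tau> e u = u"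
    and mono: "\<sigma> e u \<le> \<sigma> e u' \<longleftrightarrow> u \<le> u'" "\<sigma> e (s e) = 0"
    if "e \<in> inc v" for e u u'
    using st[OF that] strict_mono_less_eq[of "\<sigma> e"] by (auto, metis)
  have \<sigma>_range: "0 \<le> \<sigma> e u \<and> \<sigma> e u < 2" if e: "e \<in> inc v" and u: "s e \<le> u" "u < 2" for e u
  proof (cases "1 \<le> u")
    case False
    then have "\<sigma> e u \<le> \<sigma> e 1" using mono(1)[OF e] by simp
    then show ?thesis using mono(1)[OF e, of "s e" u] mono(2)[OF e] u \<sigma>(3)[OF e, of 1] by simp
  qed (use \<sigma>(3)[OF e] u in simp)
  have \<tau>_range: "s e \<le> \<tau> e u \<and> \<tau> e u < 2" if e: "e \<in> inc v" and u: "0 \<le> u" "u < 2" for e u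
  proof -
    have "s e \<le> \<tau> e u" using mono(1)[OF e, of "s e" "\<tau> e u"] mono(2)[OF e] \<tau>(2)[OF e] u by simp
    moreover have "\<tau> e u < 2"
    proof (rule ccontr)
      assume "\<not> \<tau> e u < 2"
      then show False using \<sigma>(3)[OF e, of "\<tau> e u"] \<tau>(2)[OF e] u by simp
    qed
    ultimately show ?thesis by simp
  qed
  have K\<sigma>: "0 \<le> \<sigma> (E v q) (\<rho> v q) \<and> \<sigma> (E v q) (\<rho> v q) < 2" if "q \<in> K" "q \<in> C v" for q
    using \<sigma>_range[OF C_facts(1)[OF v that(2)]] C_facts(5)[OF v that(2)] that by (simp add: K_def)
  have K\<tau>: "s (E v q) \<le> \<tau> (E v q) (\<rho> v q) \<and> \<tau> (E v q) (\<rho> v q) < 2" if "q \<in> C v" for q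
    by (rule \<tau>_range[OF C_facts(1,4,5)[OF v that]])
  have K\<tau>0: "0 \<le> \<tau> (E v q) (\<rho> v q) \<and> \<tau> (E v q) (\<rho> v q) < 2" if "q \<in> C v" for q
    using K\<tau>[OF that] s[OF C_facts(1)[OF v that]] by simp
  have sm\<sigma>: "smap m m (\<Gamma> v) K (\<Gamma> v) (reparam \<sigma> v)" by (rule reparam_smap[OF v \<sigma>(1,3) K\<sigma>])
  have sm\<tau>: "smap m m (\<Gamma> v) (points (\<Gamma> v)) (\<Gamma> v) (reparam \<tau> v)" by (rule reparam_smap[OF v \<tau>(1,3) K\<tau>0])
  have \<tau>K: "reparam \<tau> v q \<in> K" if q: "q \<in> points (\<Gamma> v)" for q
  proof (cases "q \<in> C v")
    case True
    note r = reparam_collar[OF v True, of \<tau>]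
    show ?thesis using r K\<tau>0[OF True] K\<tau>[OF True] C_facts(7)[OF v, of "reparam \<tau> v q"] by (simp add: K_def)
  qed (use q in \<open>simp add: reparam_def K_def\<close>)
  have inv1: "reparam \<tau> v (reparam \<sigma> v q) = q" if "q \<in> K" for q
    by (rule reparam_comp[OF v]) (use that K\<sigma>[OF that] \<sigma>(2) C_facts(1)[OF v] in \<open>auto simp: K_def\<close>)
  have inv2: "reparam \<sigma> v (reparam \<tau> v q) = q" if "q \<in> points (\<Gamma> v)" for q
    by (rule reparam_comp[OF v that]) (use K\<tau>0 \<tau>(2) C_facts(1)[OF v] in auto)
  have pre: "reeb_preimage (mtop glued) height (fibre ` Nb) = S" unfolding reeb_preimage_fibre S_def ..
  show ?thesis
    unfolding pre
  proof (rule submanifold_diffeomorphicI[OF premanifold_glued P\<Gamma> order_refl])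
    show "S \<subseteq> points glued" unfolding S_def by blast
    show "S \<subseteq> \<Union> (fst ` slice_charts m m glued S)"
    proof
      fix x assume "x \<in> S"
      then obtain q where q: "q \<in> K" "x = \<psi> v q" unfolding SK by blast
      have interior: "x \<in> \<Union> (fst ` slice_charts m m glued S)"
        if A: "openin (mtop (\<Gamma> v)) A" "q \<in> A" "A \<subseteq> K" for A
      proof (rule open_slice_chart)
        show "openin (mtop glued) (\<psi> v ` A)" by (rule openin_glued_image[OF v A(1)]) (use A(3) KN in blast)
      qed (use A q SK in blast)+
      have qp: "q \<in> points (\<Gamma> v)" using q(1) by (simp add: K_def)
      \<comment> \<open>Only points at the cut depth are boundary points of the preimage and call
        for a half space chart. All others have a neighbourhood inside \<open>K\<close>.\<close>
      consider "q \<in> inner_core v" | "q \<in> C v" "s (E v q) < \<rho> v q" | "q \<in> C v" "\<rho> v q = s (E v q)"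
        using inner_core_or_collar[OF qp] q(1) by (force simp: K_def)
      then show "x \<in> \<Union> (fst ` slice_charts m m glued S)"
      proof cases
        case 1
        have "inner_core v \<subseteq> K"
        proof
          fix p assume p: "p \<in> inner_core v"
          have "s (E v p) \<le> \<rho> v p" if "p \<in> C v" using s[OF C_facts(1)[OF v that]] p that by (auto simp: inner_core_def)
          then show "p \<in> K" using p by (simp add: K_def inner_core_def)
        qed
        then show ?thesis by (rule interior[OF inner_core_open[OF v] 1])
      next
        case 2
        define e where "e = E v q"
        have e: "e \<in> inc v" using C_facts(1)[OF v 2(1)] by (simp add: e_def)
        have "openin (mtop (\<Gamma> v)) ({q \<in> C v. E v q = e} \<inter> {q \<in> C v. \<rho> v q \<in> {s e<..}})"
          by (intro openin_Int E_open[OF v e] \<rho>_preimage_open[OF v]) simp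
        then show ?thesis by (rule interior) (use 2 e_def C_facts(7)[OF v] in \<open>auto simp: K_def\<close>)
      next
        case 3
        define e where "e = E v q"
        have e: "e \<in> inc v" "X v q \<in> points (\<Phi> e)" using C_facts(1,3)[OF v 3(1)] by (auto simp: e_def)
        have xq: "x = \<psi> v (T v e (X v q, s e))" using C_facts(6)[OF v 3(1)] 3(2) q(2) by (simp add: e_def)
        have mem: "\<psi> v (T v e (z, u)) \<in> S \<longleftrightarrow> s e \<le> u" if z: "z \<in> points (\<Phi> e)" "u \<in> {0<..<1}" for z u
        proof -
          have u: "0 < u" "u < 1" using z(2) by auto
          have t: "T v e (z, u) \<in> C v \<and> E v (T v e (z, u)) = e \<and> \<rho> v (T v e (z, u)) = u"
            using T_facts[OF v e(1) z(1), of u] u by simp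
          \<comment> \<open>\<open>\<psi> v\<close> is injective on \<open>N v\<close>, so
            membership in the image of \<open>K\<close> can be tested in
            \<open>\<Gamma> v\<close>.\<close>
          have "\<psi> v (T v e (z, u)) \<in> S \<longleftrightarrow> T v e (z, u) \<in> K"
            unfolding SK by (rule inj_on_image_mem_iff[OF \<psi>_inj'[OF v] tube_point(1)[OF v e(1) z(1) u] KN])
          also have "\<dots> \<longleftrightarrow> s e \<le> u" using t C_facts(7)[OF v, of "T v e (z, u)"] by (simp add: K_def)
          finally show ?thesis .
        qed
        show ?thesis unfolding xq
          by (rule tube_slice_chart[OF v e]) (use s[OF e(1)] mem in blast)+
      qed
    qed
    show "smap m m glued S (\<Gamma> v) (\<lambda>x. reparam \<sigma> v (inv_\<psi> v x))"
    proof (rule smap_compose[OF premanifold_glued P\<Gamma> smap_subset[OF smap_inv_\<psi>[OF v]] sm\<sigma>])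
      show "S \<subseteq> \<psi> v ` N v" unfolding SK using KN by blast
      fix x assume "x \<in> S"
      then obtain q where q: "q \<in> K" "x = \<psi> v q" unfolding SK by blast
      then show "inv_\<psi> v x \<in> K" using inv_\<psi>[OF v subsetD[OF KN q(1)]] by simp
    qed
    show "smap m m (\<Gamma> v) (points (\<Gamma> v)) glued (\<lambda>q. \<psi> v (reparam \<tau> v q))"
      by (rule smap_compose[OF P\<Gamma> P\<Gamma> sm\<tau> smap_\<psi>[OF v]]) (use \<tau>K KN in blast)
    show "(\<lambda>q. \<psi> v (reparam \<tau> v q)) ` points (\<Gamma> v) \<subseteq> S" unfolding SK using \<tau>K by blast
    show "\<psi> v (reparam \<tau> v (reparam \<sigma> v (inv_\<psi> v x))) = x" if x: "x \<in> S" for x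
    proof -
      obtain q where q: "q \<in> K" "x = \<psi> v q" using x unfolding SK by blast
      show ?thesis unfolding q(2) inv_\<psi>[OF v subsetD[OF KN q(1)]] inv1[OF q(1)] ..
    qed
    show "reparam \<sigma> v (inv_\<psi> v (\<psi> v (reparam \<tau> v q))) = q" if q: "q \<in> points (\<Gamma> v)" for q
      unfolding inv_\<psi>[OF v subsetD[OF KN \<tau>K[OF q]]] by (rule inv2[OF q])
  qed
qed

end

lemma model_encoding:
  fixes \<Phi> :: "'g set \<Rightarrow> 'a mfd" and \<Gamma> :: "'g \<Rightarrow> 'b mfd"
  assumes dec: "decorated_graph m G \<Phi> \<Gamma>"
  shows "\<exists>enc :: 'g \<times> 'b + 'g set \<times> 'a \<times> real \<Rightarrow> nat \<Rightarrow> real. inj_on enc (model_points G \<Phi> \<Gamma>)"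
proof -
  have fin: "finite (verts G)" "finite (edges G)" using dec by (auto simp: decorated_graph_def finite_graph_def)
  obtain i :: "'g \<Rightarrow> nat" where i: "inj_on i (verts G)" using finite_imp_inj_to_nat_seg[OF fin(1)] by blast
  obtain j :: "'g set \<Rightarrow> nat" where j: "inj_on j (edges G)" using finite_imp_inj_to_nat_seg[OF fin(2)] by blast
  have "\<exists>b :: 'b \<Rightarrow> nat \<Rightarrow> real. inj_on b (points (\<Gamma> v))" if "v \<in> verts G" for v
    by (rule second_countable_encoding) (use dec that in \<open>auto simp: decorated_graph_def compact_manifold_def smooth_manifold_def\<close>)
  then obtain b :: "'g \<Rightarrow> 'b \<Rightarrow> nat \<Rightarrow> real" where b: "\<And>v. v \<in> verts G \<Longrightarrow> inj_on (b v) (points (\<Gamma> v))" by metis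
  have "\<exists>b :: 'a \<Rightarrow> nat \<Rightarrow> real. inj_on b (points (\<Phi> e))" if "e \<in> edges G" for e
    by (rule second_countable_encoding)
       (use dec that in \<open>auto simp: decorated_graph_def closed_manifold_def compact_manifold_def smooth_manifold_def\<close>)
  then obtain c :: "'g set \<Rightarrow> 'a \<Rightarrow> nat \<Rightarrow> real" where c: "\<And>e. e \<in> edges G \<Longrightarrow> inj_on (c e) (points (\<Phi> e))" by metis
  \<comment> \<open>A sequence starting with a tag for the two kinds of points, then the index of
    the vertex or edge, for tubes also the real parameter, and finally the code of the point in its
    manifold.\<close>
  define enc :: "'g \<times> 'b + 'g set \<times> 'a \<times> real \<Rightarrow> nat \<Rightarrow> real" where
    "enc z = (case z of
       Inl (v, q) \<Rightarrow> case_nat 0 (case_nat (real (i v)) (b v q))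
     | Inr (e, x, t) \<Rightarrow> case_nat 1 (case_nat (real (j e)) (case_nat t (c e x))))" for z
  have cn: "case_nat x f = case_nat y g \<longleftrightarrow> x = y \<and> f = g" for x y :: real and f g
  proof
    assume eq: "case_nat x f = case_nat y g"
    show "x = y \<and> f = g" using fun_cong[OF eq, of 0] fun_cong[OF eq, of "Suc _"] by auto
  qed simp
  have "inj_on enc (model_points G \<Phi> \<Gamma>)"
  proof (rule inj_onI)
    fix z z' assume z: "z \<in> model_points G \<Phi> \<Gamma>" "z' \<in> model_points G \<Phi> \<Gamma>" and eq: "enc z = enc z'"
    show "z = z'"
      using z eq unfolding model_points_def enc_def
      by (auto simp: cn inj_on_eq_iff[OF i] inj_on_eq_iff[OF j] inj_on_eq_iff[OF b] inj_on_eq_iff[OF c])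
  qed
  then show ?thesis by blast
qed

theorem theorem5p3:
  fixes m :: nat
    and G :: "'g graph"
    and \<Phi> :: "'g set \<Rightarrow> 'a mfd"
    and \<Gamma> :: "'g \<Rightarrow> 'b mfd"
  assumes "2 \<le> m"
    and "decorated_graph m G \<Phi> \<Gamma>"
  shows "reeb_realizable m G \<Phi> \<Gamma>"
proof -
  have fin: "finite_graph G" using assms(2) by (simp add: decorated_graph_def)
  have "\<exists>\<gamma>. characteristic_map G e \<gamma>" if "e \<in> edges G" for e using fin that by (simp add: finite_graph_def)
  then obtain \<gamma> where \<gamma>: "\<And>e. e \<in> edges G \<Longrightarrow> characteristic_map G e (\<gamma> e)" by metis
  have "\<exists>C E X \<rho> T. edge_collars m (\<Gamma> v) (incident_edges G v) \<Phi> C E X \<rho> T" if v: "v \<in> verts G" for v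
  proof (rule edge_collars_exist[OF assms(1)])
    show "compact_manifold m (\<Gamma> v)"
      "diffeomorphic (m - 1) (boundary_mfd m (\<Gamma> v)) (disjoint_union_mfd \<Phi> (incident_edges G v))"
      using assms(2) v by (simp_all add: decorated_graph_def)
    fix e assume "e \<in> incident_edges G v"
    then have "closed_manifold (m - 1) (\<Phi> e)" using assms(2) by (simp add: decorated_graph_def incident_edges_def)
    then show "premanifold (m - 1) (\<Phi> e)"
      by (intro smooth_manifold_imp_premanifold) (simp add: closed_manifold_def compact_manifold_def)
  qed
  then obtain C E X \<rho> T where col: "\<And>v. v \<in> verts G \<Longrightarrow> edge_collars m (\<Gamma> v) (incident_edges G v) \<Phi> (C v) (E v) (X v) (\<rho> v) (T v)"
    by metis
  obtain enc :: "'g \<times> 'b + 'g set \<times> 'a \<times> real \<Rightarrow> nat \<Rightarrow> real" where enc: "inj_on enc (model_points G \<Phi> \<Gamma>)"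
    using model_encoding[OF assms(2)] by blast
  have "finite (verts G)" using fin by (simp add: finite_graph_def)
  \<comment> \<open>An enumeration of the vertices supplies the distinct heights.\<close>
  then obtain i :: "'g \<Rightarrow> nat" where i: "inj_on i (verts G)" using finite_imp_inj_to_nat_seg by blast
  interpret realization m G \<Phi> \<Gamma> \<gamma> C E X \<rho> T "\<lambda>v. real (i v)" enc
  proof
    show "inj_on (\<lambda>v. real (i v)) (verts G)" using i by (simp add: inj_on_def)
  qed (use assms \<gamma> col enc in auto)
  have "smooth_function m glued height"
    using height_smooth by (simp add: smooth_function_def msmooth_def)
  then show ?thesis
    unfolding reeb_realizable_def
    using closed_manifold_glued finite_critical_values graph_isomorphism_fibre edge_preimage vertex_preimage
    by (intro exI[of _ glued] exI[of _ height] exI[of _ fibre] conjI ballI allI impI)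
qed

end
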